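(* Let $G=(V,E)$ be a directed multigraph with countable vertex set $V$ and countable edge set $E$, and let $(G,(J_v)_{v\in V},(O_v)_{v\in V},(T_e)_{e\in E})$ satisfy: (G.1) $G$ is strongly connected, i.e. there is a path between any two vertices. (G.2) Each $J_v$ is a nonempty closed subset of a Banach space $(Y_v,\|\cdot\|_v)$ and $\sup_{v}\mathrm{diam}\,J_v<+\infty$. (G.3) Each $O_v$ is an open convex subset of $Y_v$ and $J_v\subset O_v$. (G.4) Each $T_e$ is a $C^1$ map from $O_{t(e)}$ to $O_{i(e)}$ satisfying $T_eJ_{t(e)}\subset J_{i(e)}$. There exists $0<r<1$ such that the norm of the derivative satisfies $\|DT_e(x)\|\le r$ for any $e\in E$ and $x\in O_{t(e)}$. Moreover, there exist constants $c>0$ and $0<\beta\le1$ such that $\big|\|DT_e(x)\|-\|DT_e(y)\|\big|\le c\|DT_e(x)\|\,\|x-y\|_{t(e)}^\beta$ for any $x,y\in J_{t(e)}$ and $e\in E$. (G.5) $s_*:=\inf\{s\ge0:\sum_{e\in E}\sup_{x\in J_{t(e)}}\|DT_e(x)\|^s<\infty\}$ is a real number (the set is nonempty). Let $\varphi:X_M\to\mathbb{R}$, $\varphi(\omega)=\log\|DT_{\omega_0}(\pi\sigma\omega)\|$, and let $\theta=r^\beta$. Then for each $s>s_*$ the Ruelle operator $\mathcal{L}=\mathcal{L}_{s\varphi}$ of the potential $s\varphi$ acting on $F_b^1(X_M)$ has the spectral decomposition $$\mathcal{L}=\sum_{i=0}^{p-1}\lambda_i\mathcal{P}_i+\mathcal{R},$$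 where $p$ is the period of $M$, $\kappa=\exp(2\pi\sqrt{-1}/p)$, $\lambda=\exp(P(s\varphi))$ is the spectral radius of $\mathcal{L}$, each $\lambda_i=\lambda\kappa^i$ is a simple eigenvalue of $\mathcal{L}$, each $\mathcal{P}_i$ is a projection of the form $\mathcal{P}_i=h_i\otimes\nu_i$ with eigenfunction $h_i=\sum_{j=0}^{p-1}\kappa^{-ji}h\chi_{\Sigma_j}$ and eigenvector $\nu_i=\sum_{j=0}^{p-1}\kappa^{ji}\nu|_{\Sigma_j}$ (of $\mathcal{L}$ and $\mathcal{L}^*$ respectively, for $\lambda_i$), and the spectral radius of $\mathcal{R}$ is less than $\lambda$. Here $\nu$ is a Borel probability measure on $X_M$ with $\mathcal{L}^*\nu=\lambda\nu$ and $h\in F^1_b(X_M)$ is a nonnegative function with $\mathcal{L}h=\lambda h$ and $\nu(h)=1$.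
   Context: For an edge $e$, $i(e)$ is its initial vertex and $t(e)$ its terminal vertex. $M=(M(ee'))_{e,e'\in E}$ is the zero-one matrix with $M(ee')=1$ if $t(e)=i(e')$ and $M(ee')=0$ otherwise. $X_M=\{\omega\in\prod_{n\ge0}E: M(\omega_n\omega_{n+1})=1\ \forall n\ge0\}$ with shift $(\sigma\omega)_n=\omega_{n+1}$ and cylinders $[w]$. The coding map is given by $\{\pi\omega\}=\bigcap_{n\ge0}T_{\omega_0}\circ\cdots\circ T_{\omega_n}(J_{t(\omega_n)})\subset Y_{i(\omega_0)}$. It is understood that $\|DT_e(x)\|>0$ for $x\in J_{t(e)}$, so that $\varphi$ is real-valued. With $\theta\in(0,1)$ and $d_\theta(\omega,\upsilon)=\theta^{\min\{n:\omega_n\ne\upsilon_n\}}$ for $\omega\neq\upsilon$, put $\mathrm{var}_nf=\sup\{|f(\omega)-f(\upsilon)|:\omega_i=\upsilon_i,\ 0\le i\le n-1\}$ and $[f]_1=\sup_{n\ge1}\mathrm{var}_nf/\theta^n$; $F_b^1(X_M)$ is the Banach space of bounded continuous $f:X_M\to\mathbb{C}$ with $[f]_1<\infty$, normed by $\|f\|_\infty+[f]_1$. The Ruelle operator of a potential $\psi$ is $\mathcal{L}_\psi f(\omega)=\sum_{e\in E:t(e)=i(\omega_0)}e^{\psi(e\cdot\omega)}f(e\cdot\omega)$, where $e\cdot\omega=e\omega_0\omega_1\cdots$; $\mathcal{L}^*\nu=\lambda\nu$ means $\int\mathcal{L}f\,d\nu=\lambda\int f\,d\nu$ for bounded continuous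 $f$. The pressure is $P(\psi)=\lim_{n\to\infty}\frac1n\log\sum_{w\in E^n:[w]\ne\emptyset}\exp(\sup_{[w]}\sum_{i=0}^{n-1}\psi\circ\sigma^i)$. $M$ is irreducible under (G.1); its period $p$ is the gcd of the lengths $n\ge1$ of $M$-admissible loops from an edge to itself. There is a decomposition $E=E_0\cup\cdots\cup E_{p-1}$ into disjoint sets such that, with $\Sigma_i=\bigcup_{e\in E_i}[e]$, one has $\sigma(\Sigma_i)=\Sigma_{i+1\bmod p}$ and each $(\Sigma_i,\sigma^p)$ is topologically mixing. $\chi_{\Sigma_j}$ is the indicator of $\Sigma_j$, $\nu|_{\Sigma_j}$ the restriction of $\nu$, and $(h\otimes\nu)f=\nu(f)h$ with $\nu(f)=\int f\,d\nu$. *)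

theory Defs
  imports "HOL-Probability.Probability" "Graph_Theory.Digraph_Component"
begin

section \<open>Families of Banach spaces\<close>

text \<open>
  The spaces \<open>Y\<^sub>v\<close> vary with the vertex and carry unrelated norms. Each of them is given by a
  linear subspace \<open>V\<close> of one real vector space (no norm or topology on the latter is used)
  together with its own norm \<open>n\<close> on \<open>V\<close>. Every family of Banach spaces has this form, up to
  isometric isomorphism, inside its algebraic direct sum. Values of \<open>n\<close> outside \<open>V\<close> are irrelevant.
\<close>

text \<open>The value off \<open>V\<close> makes \<open>Metric_space V (norm_dist V n)\<close> hold, whose axioms of
  nonnegativity and symmetry range over the whole type.\<close>

definition norm_dist :: "'y::real_vector set \<Rightarrow> ('y \<Rightarrow> real) \<Rightarrow> 'y \<Rightarrow> 'y \<Rightarrow> real" where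
  "norm_dist V n x y = (if x \<in> V \<and> y \<in> V then n (x - y) else 0)"

definition norm_topology :: "'y::real_vector set \<Rightarrow> ('y \<Rightarrow> real) \<Rightarrow> 'y topology" where
  "norm_topology V n = Metric_space.mtopology V (norm_dist V n)"

definition is_norm_on :: "'y::real_vector set \<Rightarrow> ('y \<Rightarrow> real) \<Rightarrow> bool" where
  "is_norm_on V n \<longleftrightarrow>
     (\<forall>x\<in>V. 0 \<le> n x \<and> (n x = 0 \<longleftrightarrow> x = 0)) \<and>
     (\<forall>x\<in>V. \<forall>a. n (a *\<^sub>R x) = \<bar>a\<bar> * n x) \<and>
     (\<forall>x\<in>V. \<forall>y\<in>V. n (x + y) \<le> n x + n y)"

definition banach_space_on :: "'y::real_vector set \<Rightarrow> ('y \<Rightarrow> real) \<Rightarrow> bool" where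
  "banach_space_on V n \<longleftrightarrow>
     subspace V \<and> is_norm_on V n \<and> Metric_space.mcomplete V (norm_dist V n)"

definition bounded_linear_between ::
  "'y::real_vector set \<Rightarrow> ('y \<Rightarrow> real) \<Rightarrow> 'y set \<Rightarrow> ('y \<Rightarrow> real) \<Rightarrow> ('y \<Rightarrow> 'y) \<Rightarrow> bool" where
  "bounded_linear_between V n W m L \<longleftrightarrow>
     (\<forall>u\<in>V. L u \<in> W) \<and>
     (\<forall>u\<in>V. \<forall>v\<in>V. L (u + v) = L u + L v) \<and>
     (\<forall>u\<in>V. \<forall>a. L (a *\<^sub>R u) = a *\<^sub>R L u) \<and>
     (\<exists>K. \<forall>u\<in>V. m (L u) \<le> K * n u)"

definition op_norm ::
  "'y::real_vector set \<Rightarrow> ('y \<Rightarrow> real) \<Rightarrow> ('y \<Rightarrow> real) \<Rightarrow> ('y \<Rightarrow> 'y) \<Rightarrow> real" where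
  "op_norm V n m L = (SUP u\<in>{u \<in> V. n u \<le> 1}. m (L u))"

text \<open>\<open>L\<close> is a Frechet derivative at \<open>x\<close> of \<open>f : U \<rightarrow> W\<close>, where \<open>U \<subseteq> V\<close> is open.
  It is unique as a map on \<open>V\<close>.\<close>

definition has_frechet_derivative_in ::
  "'y::real_vector set \<Rightarrow> ('y \<Rightarrow> real) \<Rightarrow> 'y set \<Rightarrow> ('y \<Rightarrow> real) \<Rightarrow> 'y set \<Rightarrow>
   ('y \<Rightarrow> 'y) \<Rightarrow> ('y \<Rightarrow> 'y) \<Rightarrow> 'y \<Rightarrow> bool" where
  "has_frechet_derivative_in V n W m U f L x \<longleftrightarrow>
     bounded_linear_between V n W m L \<and>
     (\<forall>\<epsilon>>0. \<exists>\<delta>>0. \<forall>y\<in>U. n (y - x) < \<delta> \<longrightarrow>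
        m (f y - f x - L (y - x)) \<le> \<epsilon> * n (y - x))"

definition frechet_derivative_in ::
  "'y::real_vector set \<Rightarrow> ('y \<Rightarrow> real) \<Rightarrow> 'y set \<Rightarrow> ('y \<Rightarrow> real) \<Rightarrow> 'y set \<Rightarrow>
   ('y \<Rightarrow> 'y) \<Rightarrow> 'y \<Rightarrow> 'y \<Rightarrow> 'y" where
  "frechet_derivative_in V n W m U f x =
     (SOME L. has_frechet_derivative_in V n W m U f L x)"

definition C1_map_between ::
  "'y::real_vector set \<Rightarrow> ('y \<Rightarrow> real) \<Rightarrow> 'y set \<Rightarrow> ('y \<Rightarrow> real) \<Rightarrow> 'y set \<Rightarrow>
   ('y \<Rightarrow> 'y) \<Rightarrow> bool" where
  "C1_map_between V n W m U f \<longleftrightarrow>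
     (\<forall>x\<in>U. \<exists>L. has_frechet_derivative_in V n W m U f L x) \<and>
     (\<forall>x\<in>U. \<forall>\<epsilon>>0. \<exists>\<delta>>0. \<forall>y\<in>U. n (y - x) < \<delta> \<longrightarrow>
        op_norm V n m (\<lambda>u. frechet_derivative_in V n W m U f y u
                            - frechet_derivative_in V n W m U f x u) < \<epsilon>)"


section \<open>The Markov shift of edges\<close>

text \<open>For an edge \<open>e\<close>, \<open>i(e)\<close> is \<open>tail G e\<close> and \<open>t(e)\<close> is \<open>head G e\<close>.\<close>

definition incident :: "('v,'e) pre_digraph \<Rightarrow> 'e \<Rightarrow> 'e \<Rightarrow> bool" where
  "incident G e e' \<longleftrightarrow> head G e = tail G e'"

definition shift_space :: "('v,'e) pre_digraph \<Rightarrow> (nat \<Rightarrow> 'e) set" where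
  "shift_space G = {\<omega>. (\<forall>n. \<omega> n \<in> arcs G) \<and> (\<forall>n. incident G (\<omega> n) (\<omega> (Suc n)))}"

definition shift :: "(nat \<Rightarrow> 'e) \<Rightarrow> nat \<Rightarrow> 'e" where
  "shift \<omega> = (\<lambda>n. \<omega> (Suc n))"

definition prepend :: "'e \<Rightarrow> (nat \<Rightarrow> 'e) \<Rightarrow> nat \<Rightarrow> 'e" where
  "prepend e \<omega> = case_nat e \<omega>"

definition cylinder :: "('v,'e) pre_digraph \<Rightarrow> 'e list \<Rightarrow> (nat \<Rightarrow> 'e) set" where
  "cylinder G w = {\<omega> \<in> shift_space G. \<forall>i<length w. \<omega> i = w ! i}"

definition shift_dist :: "real \<Rightarrow> (nat \<Rightarrow> 'e) \<Rightarrow> (nat \<Rightarrow> 'e) \<Rightarrow> real" where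
  "shift_dist \<theta> \<omega> \<upsilon> = (if \<omega> = \<upsilon> then 0 else \<theta> ^ (LEAST n. \<omega> n \<noteq> \<upsilon> n))"

definition shift_topology :: "('v,'e) pre_digraph \<Rightarrow> real \<Rightarrow> (nat \<Rightarrow> 'e) topology" where
  "shift_topology G \<theta> = Metric_space.mtopology (shift_space G) (shift_dist \<theta>)"

definition shift_borel :: "('v,'e) pre_digraph \<Rightarrow> real \<Rightarrow> (nat \<Rightarrow> 'e) measure" where
  "shift_borel G \<theta> = sigma (shift_space G) {U. openin (shift_topology G \<theta>) U}"

definition admissible_loop :: "('v,'e) pre_digraph \<Rightarrow> nat \<Rightarrow> (nat \<Rightarrow> 'e) \<Rightarrow> bool" where
  "admissible_loop G n w \<longleftrightarrow>
     w n = w 0 \<and> (\<forall>k\<le>n. w k \<in> arcs G) \<and> (\<forall>k<n. incident G (w k) (w (Suc k)))"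

text \<open>For irreducible \<open>M\<close> the gcd does not depend on the base edge of the loops, so the loops at
  all edges may be taken together.\<close>

definition period :: "('v,'e) pre_digraph \<Rightarrow> nat" where
  "period G = Gcd {n. 1 \<le> n \<and> (\<exists>w. admissible_loop G n w)}"

definition topologically_mixing :: "'a topology \<Rightarrow> ('a \<Rightarrow> 'a) \<Rightarrow> bool" where
  "topologically_mixing X f \<longleftrightarrow>
     (\<forall>U V. openin X U \<and> openin X V \<and> U \<noteq> {} \<and> V \<noteq> {} \<longrightarrow>
        (\<exists>N. \<forall>n\<ge>N. (f ^^ n) ` U \<inter> V \<noteq> {}))"

definition edge_union :: "('v,'e) pre_digraph \<Rightarrow> 'e set \<Rightarrow> (nat \<Rightarrow> 'e) set" where
  "edge_union G A = (\<Union>e\<in>A. cylinder G [e])"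

definition cyclic_decomposition ::
  "('v,'e) pre_digraph \<Rightarrow> real \<Rightarrow> (nat \<Rightarrow> 'e set) \<Rightarrow> bool" where
  "cyclic_decomposition G \<theta> Es \<longleftrightarrow>
     (\<Union>i<period G. Es i) = arcs G \<and>
     disjoint_family_on Es {..<period G} \<and>
     (\<forall>i<period G. shift ` edge_union G (Es i) = edge_union G (Es (Suc i mod period G))) \<and>
     (\<forall>i<period G. topologically_mixing
        (subtopology (shift_topology G \<theta>) (edge_union G (Es i))) (shift ^^ period G))"


section \<open>Function spaces and thermodynamic formalism\<close>

text \<open>A function on the shift space is represented by its extension by zero.\<close>

definition bounded_continuous ::
  "('v,'e) pre_digraph \<Rightarrow> real \<Rightarrow> ((nat \<Rightarrow> 'e) \<Rightarrow> complex) set" where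
  "bounded_continuous G \<theta> =
     {f. (\<forall>\<omega>. \<omega> \<notin> shift_space G \<longrightarrow> f \<omega> = 0) \<and>
         continuous_map (shift_topology G \<theta>) euclidean f \<and>
         bounded (f ` shift_space G)}"

definition variation ::
  "('v,'e) pre_digraph \<Rightarrow> nat \<Rightarrow> ((nat \<Rightarrow> 'e) \<Rightarrow> complex) \<Rightarrow> real" where
  "variation G n f =
     Sup {cmod (f \<omega> - f \<upsilon>) | \<omega> \<upsilon>.
            \<omega> \<in> shift_space G \<and> \<upsilon> \<in> shift_space G \<and> (\<forall>i<n. \<omega> i = \<upsilon> i)}"

definition holder_seminorm ::
  "('v,'e) pre_digraph \<Rightarrow> real \<Rightarrow> ((nat \<Rightarrow> 'e) \<Rightarrow> complex) \<Rightarrow> real" where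
  "holder_seminorm G \<theta> f = (SUP n\<in>{1..}. variation G n f / \<theta> ^ n)"

definition holder_space ::
  "('v,'e) pre_digraph \<Rightarrow> real \<Rightarrow> ((nat \<Rightarrow> 'e) \<Rightarrow> complex) set" where
  "holder_space G \<theta> =
     {f \<in> bounded_continuous G \<theta>. bdd_above ((\<lambda>n. variation G n f / \<theta> ^ n) ` {1..})}"

definition holder_norm ::
  "('v,'e) pre_digraph \<Rightarrow> real \<Rightarrow> ((nat \<Rightarrow> 'e) \<Rightarrow> complex) \<Rightarrow> real" where
  "holder_norm G \<theta> f = (SUP \<omega>\<in>shift_space G. cmod (f \<omega>)) + holder_seminorm G \<theta> f"

definition ruelle_operator ::
  "('v,'e) pre_digraph \<Rightarrow> ((nat \<Rightarrow> 'e) \<Rightarrow> real) \<Rightarrow>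
   ((nat \<Rightarrow> 'e) \<Rightarrow> complex) \<Rightarrow> (nat \<Rightarrow> 'e) \<Rightarrow> complex" where
  "ruelle_operator G \<psi> f \<omega> =
     (if \<omega> \<in> shift_space G
      then \<Sum>\<^sub>\<infinity>e\<in>{e \<in> arcs G. head G e = tail G (\<omega> 0)}.
             of_real (exp (\<psi> (prepend e \<omega>))) * f (prepend e \<omega>)
      else 0)"

definition nonempty_words :: "('v,'e) pre_digraph \<Rightarrow> nat \<Rightarrow> 'e list set" where
  "nonempty_words G n = {w. set w \<subseteq> arcs G \<and> length w = n \<and> cylinder G w \<noteq> {}}"

definition word_weight ::
  "('v,'e) pre_digraph \<Rightarrow> ((nat \<Rightarrow> 'e) \<Rightarrow> real) \<Rightarrow> 'e list \<Rightarrow> real" where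
  "word_weight G \<psi> w =
     exp (SUP \<omega>\<in>cylinder G w. \<Sum>i<length w. \<psi> ((shift ^^ i) \<omega>))"

text \<open>The pressure is stated as a relation: the partition sums converge and the limit exists
  and equals the real number \<open>P\<close>.\<close>

definition has_pressure ::
  "('v,'e) pre_digraph \<Rightarrow> ((nat \<Rightarrow> 'e) \<Rightarrow> real) \<Rightarrow> real \<Rightarrow> bool" where
  "has_pressure G \<psi> P \<longleftrightarrow>
     (\<forall>n\<ge>1. word_weight G \<psi> summable_on nonempty_words G n) \<and>
     (\<lambda>n. 1 / real n * ln (\<Sum>\<^sub>\<infinity>w\<in>nonempty_words G n. word_weight G \<psi> w)) \<longlonglongrightarrow> P"


section \<open>Bounded operators on a space of functions\<close>

text \<open>\<open>F\<close> is a linear space of complex functions with norm \<open>N\<close>.\<close>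

definition bounded_operator ::
  "('a \<Rightarrow> complex) set \<Rightarrow> (('a \<Rightarrow> complex) \<Rightarrow> real) \<Rightarrow>
   (('a \<Rightarrow> complex) \<Rightarrow> 'a \<Rightarrow> complex) \<Rightarrow> bool" where
  "bounded_operator F N A \<longleftrightarrow>
     (\<forall>f\<in>F. A f \<in> F) \<and>
     (\<forall>f\<in>F. \<forall>g\<in>F. A (\<lambda>x. f x + g x) = (\<lambda>x. A f x + A g x)) \<and>
     (\<forall>f\<in>F. \<forall>a. A (\<lambda>x. a * f x) = (\<lambda>x. a * A f x)) \<and>
     (\<exists>K. \<forall>f\<in>F. N (A f) \<le> K * N f)"

definition operator_spectrum ::
  "('a \<Rightarrow> complex) set \<Rightarrow> (('a \<Rightarrow> complex) \<Rightarrow> real) \<Rightarrow>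
   (('a \<Rightarrow> complex) \<Rightarrow> 'a \<Rightarrow> complex) \<Rightarrow> complex set" where
  "operator_spectrum F N A =
     {z. \<not> (\<exists>B. bounded_operator F N B \<and>
              (\<forall>f\<in>F. B (\<lambda>x. z * f x - A f x) = f \<and>
                      (\<lambda>x. z * B f x - A (B f) x) = f))}"

definition operator_spectral_radius ::
  "('a \<Rightarrow> complex) set \<Rightarrow> (('a \<Rightarrow> complex) \<Rightarrow> real) \<Rightarrow>
   (('a \<Rightarrow> complex) \<Rightarrow> 'a \<Rightarrow> complex) \<Rightarrow> real" where
  "operator_spectral_radius F N A = Sup (cmod ` operator_spectrum F N A)"

definition eigenfunction ::
  "('a \<Rightarrow> complex) set \<Rightarrow> (('a \<Rightarrow> complex) \<Rightarrow> 'a \<Rightarrow> complex) \<Rightarrow>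
   complex \<Rightarrow> ('a \<Rightarrow> complex) \<Rightarrow> bool" where
  "eigenfunction F A z f \<longleftrightarrow> f \<in> F \<and> f \<noteq> (\<lambda>_. 0) \<and> A f = (\<lambda>x. z * f x)"

text \<open>Simplicity is algebraic: the generalized eigenspace is one-dimensional.\<close>

definition simple_eigenvalue ::
  "('a \<Rightarrow> complex) set \<Rightarrow> (('a \<Rightarrow> complex) \<Rightarrow> 'a \<Rightarrow> complex) \<Rightarrow> complex \<Rightarrow> bool" where
  "simple_eigenvalue F A z \<longleftrightarrow>
     (\<exists>g. eigenfunction F A z g \<and>
        {f \<in> F. \<exists>n. ((\<lambda>f x. A f x - z * f x) ^^ n) f = (\<lambda>_. 0)} = range (\<lambda>a x. a * g x))"

text \<open>An eigenvector of the dual operator, as a functional \<open>\<mu>\<close> on the test functions \<open>C\<close>.\<close>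

definition dual_eigenvector ::
  "('a \<Rightarrow> complex) set \<Rightarrow> (('a \<Rightarrow> complex) \<Rightarrow> 'a \<Rightarrow> complex) \<Rightarrow>
   complex \<Rightarrow> (('a \<Rightarrow> complex) \<Rightarrow> complex) \<Rightarrow> bool" where
  "dual_eigenvector C A z \<mu> \<longleftrightarrow>
     (\<exists>f\<in>C. \<mu> f \<noteq> 0) \<and> (\<forall>f\<in>C. \<mu> (A f) = z * \<mu> f)"

definition tensor_op ::
  "('a \<Rightarrow> complex) \<Rightarrow> (('a \<Rightarrow> complex) \<Rightarrow> complex) \<Rightarrow> ('a \<Rightarrow> complex) \<Rightarrow> 'a \<Rightarrow> complex"
  (infix \<open>\<otimes>\<^sub>o\<close> 70) where
  "(h \<otimes>\<^sub>o \<mu>) f = (\<lambda>x. \<mu> f * h x)"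

definition is_projection ::
  "('a \<Rightarrow> complex) set \<Rightarrow> (('a \<Rightarrow> complex) \<Rightarrow> real) \<Rightarrow>
   (('a \<Rightarrow> complex) \<Rightarrow> 'a \<Rightarrow> complex) \<Rightarrow> bool" where
  "is_projection F N A \<longleftrightarrow> bounded_operator F N A \<and> (\<forall>f\<in>F. A (A f) = A f)"

definition rotated_eigenfunction ::
  "nat \<Rightarrow> complex \<Rightarrow> (nat \<Rightarrow> 'a set) \<Rightarrow> ('a \<Rightarrow> complex) \<Rightarrow> nat \<Rightarrow> 'a \<Rightarrow> complex" where
  "rotated_eigenfunction p \<kappa> \<Sigma> h i =
     (\<lambda>\<omega>. \<Sum>j<p. inverse \<kappa> ^ (j * i) * h \<omega> * indicator (\<Sigma> j) \<omega>)"

text \<open>The complex measure \<open>\<Sum>\<^sub>j \<kappa>\<^bsup>ji\<^esup> \<nu>|\<Sigma>\<^sub>j\<close>, given by its integral.\<close>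

definition rotated_measure ::
  "nat \<Rightarrow> complex \<Rightarrow> (nat \<Rightarrow> 'a set) \<Rightarrow> 'a measure \<Rightarrow> nat \<Rightarrow> ('a \<Rightarrow> complex) \<Rightarrow> complex" where
  "rotated_measure p \<kappa> \<Sigma> \<nu> i f = (\<Sum>j<p. \<kappa> ^ (j * i) * (LINT \<omega>:\<Sigma> j|\<nu>. f \<omega>))"


section \<open>Graph directed systems\<close>

text \<open>\<open>(Ysp v, Ynorm v)\<close> is the Banach space \<open>Y\<^sub>v\<close>; \<open>Tmap e\<close> is relevant on \<open>Oset (head e)\<close> only.\<close>

record ('v, 'e, 'y) graph_system =
  graph :: "('v, 'e) pre_digraph"
  Ysp :: "'v \<Rightarrow> 'y set"
  Ynorm :: "'v \<Rightarrow> 'y \<Rightarrow> real"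
  Jset :: "'v \<Rightarrow> 'y set"
  Oset :: "'v \<Rightarrow> 'y set"
  Tmap :: "'e \<Rightarrow> 'y \<Rightarrow> 'y"

text \<open>The operator norm of the derivative of \<open>T\<^sub>e\<close> at \<open>x\<close>.\<close>

definition DTnorm :: "('v, 'e, 'y::real_vector) graph_system \<Rightarrow> 'e \<Rightarrow> 'y \<Rightarrow> real" where
  "DTnorm S e x =
     (let u = head (graph S) e; v = tail (graph S) e
      in op_norm (Ysp S u) (Ynorm S u) (Ynorm S v)
           (frechet_derivative_in (Ysp S u) (Ynorm S u) (Ysp S v) (Ynorm S v)
              (Oset S u) (Tmap S e) x))"

definition summable_exponents :: "('v, 'e, 'y::real_vector) graph_system \<Rightarrow> real set" where
  "summable_exponents S =
     {s. 0 \<le> s \<and>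
         (\<lambda>e. SUP x\<in>Jset S (head (graph S) e). DTnorm S e x powr s) summable_on arcs (graph S)}"

primrec T_along :: "('v, 'e, 'y) graph_system \<Rightarrow> (nat \<Rightarrow> 'e) \<Rightarrow> nat \<Rightarrow> 'y \<Rightarrow> 'y" where
  "T_along S \<omega> 0 = Tmap S (\<omega> 0)"
| "T_along S \<omega> (Suc n) = T_along S \<omega> n \<circ> Tmap S (\<omega> (Suc n))"

definition coding_map :: "('v, 'e, 'y) graph_system \<Rightarrow> (nat \<Rightarrow> 'e) \<Rightarrow> 'y" where
  "coding_map S \<omega> = the_elem (\<Inter>n. T_along S \<omega> n ` Jset S (head (graph S) (\<omega> n)))"

definition log_derivative :: "('v, 'e, 'y::real_vector) graph_system \<Rightarrow> (nat \<Rightarrow> 'e) \<Rightarrow> real" where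
  "log_derivative S \<omega> = ln (DTnorm S (\<omega> 0) (coding_map S (shift \<omega>)))"

end

theory Submission
  imports Defs "HOL-Complex_Analysis.Great_Picard"
begin

text \<open>
  The derivative bound makes every \<open>T\<^sub>e\<close> an \<open>r\<close>-contraction on the convex set \<open>O\<close> (mean value inequality),
  so the coding map is well defined, and the bounded distortion of \<open>\<parallel>DT\<^sub>e\<parallel>\<close> makes \<open>s \<phi>\<close> Lipschitz for
  \<open>d\<^sub>\<theta>\<close> with \<open>exp (s \<phi>)\<close> dominated by a summable function of the first letter.

  For such a potential, Perron--Frobenius theory is done by hand. Normalised truncated resolvents
  \<open>\<Sum>\<^sub>n x\<^sup>-\<^sup>n\<^sup>-\<^sup>1 L\<^sup>n 1\<close> with \<open>x\<close> decreasing to \<open>\<lambda> = inf \<parallel>L\<^sup>n 1\<parallel>\<^sup>1\<^sup>/\<^sup>n\<close> lie in a cone of functions of bounded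
  distortion; a pointwise limit is the eigenfunction \<open>h\<close>, and summability prevents it from vanishing.
  Evaluating the same resolvents at a point gives a tight family of functionals whose limit is the
  eigenmeasure \<open>\<nu>\<close>. After normalisation, a Lasota--Yorke inequality and mixing of \<open>\<sigma>\<^sup>p\<close> on each class show by
  compactness that \<open>L\<^sup>n\<close> decays exponentially on the functions with \<open>\<nu>\<close>-integral zero over every class.
  The classes are permuted cyclically by \<open>L\<close>, which yields the \<open>p\<close> peripheral eigenvalues; Neumann series
  control the rest of the spectrum.
\<close>

section \<open>The edge shift\<close>

text \<open>The alphabet may be infinite, so \<open>X\<close> need not be compact and neither
  uniform Ascoli nor a fixed point in the space of measures is at hand. The substitute is always the
  same: off a finite set of letters one application of the operator has weight at most a tail of the
  summable majorant \<open>B\<close>, and on finitely many cylinders pointwise convergence is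
  enough. Taking \<lambda> as an infimum gives growth at least \<lambda>^n at every n, so the
  resolvents blow up as x tends to \<lambda>, and dividing by their size makes the defect of
  invariance vanish. They are cut at an index where the growth is at most x^N, so the boundary term
  is bounded and no infinite series has to be summed. The rate of decay is not computed. The
  integral of |L^n f| cannot increase and becomes constant along a limit function, where positivity
  then forbids cancellation; compactness turns this into a uniform contraction. The argument needs
  the order, so it is made for real functions and carried over to real and imaginary parts.\<close>

definition agree :: "nat \<Rightarrow> (nat \<Rightarrow> 'e) \<Rightarrow> (nat \<Rightarrow> 'e) \<Rightarrow> bool" where
  "agree n \<omega> \<upsilon> \<longleftrightarrow> (\<forall>i<n. \<omega> i = \<upsilon> i)"

lemma agree_sym: "agree n \<omega> \<upsilon> \<Longrightarrow> agree n \<upsilon> \<omega>"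
  by (simp add: agree_def)

lemma agree_refl [simp]: "agree n \<omega> \<omega>"
  by (simp add: agree_def)

lemma agree_mono: "agree n \<omega> \<upsilon> \<Longrightarrow> m \<le> n \<Longrightarrow> agree m \<omega> \<upsilon>"
  by (simp add: agree_def)

lemma agree_prepend: "agree n \<omega> \<upsilon> \<Longrightarrow> agree (Suc n) (prepend e \<omega>) (prepend e \<upsilon>)"
  by (auto simp: agree_def prepend_def split: nat.splits)

lemma agree_shift: "agree (Suc n) \<omega> \<upsilon> \<Longrightarrow> agree n (shift \<omega>) (shift \<upsilon>)"
  by (auto simp: agree_def shift_def)

lemma shift_prepend [simp]: "shift (prepend e \<omega>) = \<omega>"
  by (simp add: shift_def prepend_def)

lemma prepend_0 [simp]: "prepend e \<omega> 0 = e"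
  by (simp add: prepend_def)

lemma prepend_Suc [simp]: "prepend e \<omega> (Suc n) = \<omega> n"
  by (simp add: prepend_def)

lemma prepend_shift: "prepend (\<omega> 0) (shift \<omega>) = \<omega>"
  by (rule ext) (auto simp: shift_def prepend_def split: nat.splits)

lemma funpow_shift: "(shift ^^ n) \<omega> = (\<lambda>i. \<omega> (i + n))"
  by (induction n) (auto simp: shift_def)

lemma shift_space_nth: "\<omega> \<in> shift_space G \<Longrightarrow> \<omega> n \<in> arcs G"
  by (simp add: shift_space_def)

lemma shift_in [simp]: "\<omega> \<in> shift_space G \<Longrightarrow> shift \<omega> \<in> shift_space G"
  by (simp add: shift_space_def shift_def)

lemma funpow_shift_in [simp]: "\<omega> \<in> shift_space G \<Longrightarrow> (shift ^^ n) \<omega> \<in> shift_space G"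
  by (induction n) auto

lemma shift_space_glue:
  assumes "\<omega> \<in> shift_space G" "\<upsilon> \<in> shift_space G" "\<omega> k = \<upsilon> k"
  shows "(\<lambda>i. if i < k then \<omega> i else \<upsilon> i) \<in> shift_space G"
proof -
  have "incident G (if n < k then \<omega> n else \<upsilon> n) (if Suc n < k then \<omega> (Suc n) else \<upsilon> (Suc n))" for n
  proof -
    consider "Suc n < k" | "Suc n = k" | "k \<le> n" by linarith
    then show ?thesis
    proof cases
      case 2
      then have "incident G (\<omega> n) (\<upsilon> k)" using assms(1) unfolding assms(3)[symmetric] by (auto simp: shift_space_def)
      then show ?thesis using 2 by auto
    qed (use assms in \<open>auto simp: shift_space_def\<close>)
  qed
  then show ?thesis using assms by (auto simp: shift_space_def)
qed

text \<open>The index set of the sum in the Ruelle operator. It depends on \<open>\<omega>\<close>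
  through the first letter only, so points that agree on one letter have sums over the same
  set.\<close>

definition preds :: "('v,'e) pre_digraph \<Rightarrow> (nat \<Rightarrow> 'e) \<Rightarrow> 'e set" where
  "preds G \<omega> = {e \<in> arcs G. head G e = tail G (\<omega> 0)}"

lemma preds_arcs: "e \<in> preds G \<omega> \<Longrightarrow> e \<in> arcs G"
  by (simp add: preds_def)

lemma preds_subset: "preds G \<omega> \<subseteq> arcs G"
  by (auto simp: preds_def)

lemma prepend_in [simp]: "\<omega> \<in> shift_space G \<Longrightarrow> e \<in> preds G \<omega> \<Longrightarrow> prepend e \<omega> \<in> shift_space G"
  by (auto simp: shift_space_def preds_def incident_def prepend_def split: nat.splits)

lemma nth_0_preds: "\<omega> \<in> shift_space G \<Longrightarrow> \<omega> 0 \<in> preds G (shift \<omega>)"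
  by (auto simp: shift_space_def preds_def incident_def shift_def)

lemma agree_preds: "agree n \<omega> \<upsilon> \<Longrightarrow> 1 \<le> n \<Longrightarrow> preds G \<omega> = preds G \<upsilon>"
  by (simp add: agree_def preds_def)

definition bounded_by :: "('v,'e) pre_digraph \<Rightarrow> ((nat \<Rightarrow> 'e) \<Rightarrow> 'b::real_normed_vector) \<Rightarrow> real \<Rightarrow> bool" where
  "bounded_by G f M \<longleftrightarrow> (\<forall>\<omega>\<in>shift_space G. norm (f \<omega>) \<le> M)"

text \<open>The restriction to n >= 1 matches the seminorm [f]_1: nothing relates the values of
  \<open>f\<close> on cylinders with different first letters. The bound is a parameter and not a
  supremum, so estimates compose without any discussion of whether suprema exist.\<close>

definition lipschitz_by ::
  "('v,'e) pre_digraph \<Rightarrow> real \<Rightarrow> ((nat \<Rightarrow> 'e) \<Rightarrow> 'b::real_normed_vector) \<Rightarrow> real \<Rightarrow> bool" where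
  "lipschitz_by G \<theta> f V \<longleftrightarrow> (\<forall>\<omega>\<in>shift_space G. \<forall>\<upsilon>\<in>shift_space G. \<forall>n\<ge>1.
     agree n \<omega> \<upsilon> \<longrightarrow> norm (f \<omega> - f \<upsilon>) \<le> V * \<theta> ^ n)"

lemma bounded_byD: "bounded_by G f M \<Longrightarrow> \<omega> \<in> shift_space G \<Longrightarrow> norm (f \<omega>) \<le> M"
  by (simp add: bounded_by_def)

lemma bounded_by_absD:
  fixes f :: "(nat \<Rightarrow> 'e) \<Rightarrow> real" shows "bounded_by G f M \<Longrightarrow> \<omega> \<in> shift_space G \<Longrightarrow> \<bar>f \<omega>\<bar> \<le> M"
  by (simp add: bounded_by_def)

lemma lipschitz_byI:
  "(\<And>\<omega> \<upsilon> n. \<omega> \<in> shift_space G \<Longrightarrow> \<upsilon> \<in> shift_space G \<Longrightarrow> 1 \<le> n \<Longrightarrow> agree n \<omega> \<upsilon> \<Longrightarrow>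
    norm (f \<omega> - f \<upsilon>) \<le> V * \<theta> ^ n) \<Longrightarrow> lipschitz_by G \<theta> f V"
  unfolding lipschitz_by_def by blast

lemma lipschitz_byD:
  "lipschitz_by G \<theta> f V \<Longrightarrow> \<omega> \<in> shift_space G \<Longrightarrow> \<upsilon> \<in> shift_space G \<Longrightarrow> 1 \<le> n \<Longrightarrow>
    agree n \<omega> \<upsilon> \<Longrightarrow> norm (f \<omega> - f \<upsilon>) \<le> V * \<theta> ^ n"
  unfolding lipschitz_by_def by blast

lemma bounded_by_mono: "bounded_by G f M \<Longrightarrow> M \<le> M' \<Longrightarrow> bounded_by G f M'"
  unfolding bounded_by_def by force

lemma lipschitz_by_add:
  assumes "lipschitz_by G \<theta> f V" "lipschitz_by G \<theta> g V'"
  shows "lipschitz_by G \<theta> (\<lambda>\<omega>. f \<omega> + g \<omega>) (V + V')"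
proof (rule lipschitz_byI)
  fix \<omega> \<upsilon> n assume "\<omega> \<in> shift_space G" "\<upsilon> \<in> shift_space G" "1 \<le> n" "agree n \<omega> \<upsilon>"
  note norm_triangle_mono[OF lipschitz_byD[OF assms(1) this] lipschitz_byD[OF assms(2) this]]
  then show "norm (f \<omega> + g \<omega> - (f \<upsilon> + g \<upsilon>)) \<le> (V + V') * \<theta> ^ n" by (simp add: algebra_simps)
qed

lemma lipschitz_by_scale:
  fixes f :: "_ \<Rightarrow> 'b::real_normed_field"
  assumes "lipschitz_by G \<theta> f V" shows "lipschitz_by G \<theta> (\<lambda>\<omega>. c * f \<omega>) (norm c * V)"
proof (rule lipschitz_byI)
  fix \<omega> \<upsilon> n assume "\<omega> \<in> shift_space G" "\<upsilon> \<in> shift_space G" "1 \<le> n" "agree n \<omega> \<upsilon>"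
  note mult_left_mono[OF lipschitz_byD[OF assms this] norm_ge_zero[of c]]
  then show "norm (c * f \<omega> - c * f \<upsilon>) \<le> norm c * V * \<theta> ^ n"
    by (simp add: right_diff_distrib[symmetric] norm_mult mult.assoc)
qed

locale edge_shift =
  fixes G :: "('v,'e) pre_digraph" and \<theta> :: real
  assumes wf: "wf_digraph G" and countable_arcs: "countable (arcs G)" and arcs_nonempty: "arcs G \<noteq> {}"
    and strong: "strongly_connected G" and \<theta>_pos: "0 < \<theta>" and \<theta>_less_1: "\<theta> < 1"
begin

abbreviation X :: "(nat \<Rightarrow> 'e) set" where "X \<equiv> shift_space G"

definition follows :: "('e \<times> 'e) set" where
  "follows = {(a, b). a \<in> arcs G \<and> b \<in> arcs G \<and> incident G a b}"

text \<open>Strong connectivity speaks of vertices, irreducibility of the edge matrix of chains of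
  edges: a vertex path from the head of \<open>e\<close> to the tail of \<open>e'\<close> is read as
  the edges to be placed between the two.\<close>

lemma follows_trancl_reachable:
  assumes "e \<in> arcs G" "head G e \<rightarrow>\<^sup>*\<^bsub>G\<^esub> v" "e' \<in> arcs G" "tail G e' = v"
  shows "(e, e') \<in> follows\<^sup>+"
  using assms(2-) unfolding reachable_def
proof (induction arbitrary: e' rule: rtrancl_on_induct)
  case base
  then show ?case using assms(1) by (auto simp: follows_def incident_def)
next
  case (step v w)
  then obtain a where a: "a \<in> arcs G" "tail G a = v" "head G a = w"
    by (auto simp: arcs_ends_def arc_to_ends_def)
  then show ?case using step.IH[OF a(1,2)] step.prems
    by (auto simp: follows_def incident_def intro: trancl_into_trancl)
qed

lemma arcs_connected: "e \<in> arcs G \<Longrightarrow> e' \<in> arcs G \<Longrightarrow> (e, e') \<in> follows\<^sup>+"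
  using strong wf follows_trancl_reachable[of e "tail G e'" e']
  by (simp add: strongly_connected_def wf_digraph.head_in_verts wf_digraph.tail_in_verts)

lemma periodic_point_exists:
  assumes "e \<in> arcs G"
  obtains \<omega> n where "\<omega> \<in> X" "\<omega> 0 = e" "n \<ge> 1" "\<And>i. \<omega> (i + n) = \<omega> i"
proof -
  obtain n where n: "n > 0" "(e, e) \<in> follows ^^ n"
    using arcs_connected[OF assms assms] by (meson trancl_power)
  then obtain f where f: "f 0 = e" "f n = e" "\<And>i. i < n \<Longrightarrow> (f i, f (Suc i)) \<in> follows"
    by (auto simp: relpow_fun_conv)
  \<comment> \<open>A loop of length \<open>n\<close> at \<open>e\<close> is repeated;
    \<open>f n = f 0\<close> makes the transition at every multiple of \<open>n\<close>
    admissible.\<close>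
  define \<omega> where "\<omega> i = f (i mod n)" for i
  have "(\<omega> i, \<omega> (Suc i)) \<in> follows" for i
    using f(3)[of "i mod n"] f(1,2) n by (auto simp: \<omega>_def mod_Suc)
  then have "\<omega> \<in> X" by (auto simp: shift_space_def follows_def)
  moreover have "\<omega> 0 = e" "\<And>i. \<omega> (i + n) = \<omega> i" using f by (auto simp: \<omega>_def)
  ultimately show ?thesis using that n by (metis One_nat_def Suc_leI)
qed

definition edge_point :: "'e \<Rightarrow> nat \<Rightarrow> 'e" where
  "edge_point e = (SOME \<omega>. \<omega> \<in> X \<and> \<omega> 0 = e)"

lemma edge_point: assumes "e \<in> arcs G" shows "edge_point e \<in> X" "edge_point e 0 = e"
proof -
  have "\<exists>\<omega>. \<omega> \<in> X \<and> \<omega> 0 = e" by (rule periodic_point_exists[OF assms]) blast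
  from someI_ex[OF this] show "edge_point e \<in> X" "edge_point e 0 = e" by (auto simp: edge_point_def)
qed

lemma X_nonempty: "X \<noteq> {}"
  using arcs_nonempty edge_point by blast

section \<open>Representatives of cylinders and pointwise compactness\<close>

definition word_point :: "'e list \<Rightarrow> nat \<Rightarrow> 'e" where
  "word_point w = (SOME \<omega>. \<omega> \<in> cylinder G w)"

text \<open>The representative depends on the first \<open>n\<close> letters only. As there are
  countably many words, all representatives together form a countable dense set.\<close>

definition rep :: "nat \<Rightarrow> (nat \<Rightarrow> 'e) \<Rightarrow> nat \<Rightarrow> 'e" where
  "rep n \<omega> = word_point (map \<omega> [0..<n])"

lemma word_point: "cylinder G w \<noteq> {} \<Longrightarrow> word_point w \<in> cylinder G w"
  using someI_ex[of "\<lambda>\<omega>. \<omega> \<in> cylinder G w"] by (auto simp: word_point_def)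

lemma rep: assumes "\<omega> \<in> X" shows "rep n \<omega> \<in> X" "agree n (rep n \<omega>) \<omega>"
proof -
  have "\<omega> \<in> cylinder G (map \<omega> [0..<n])" using assms by (auto simp: cylinder_def)
  then have "rep n \<omega> \<in> cylinder G (map \<omega> [0..<n])" unfolding rep_def using word_point by blast
  then show "rep n \<omega> \<in> X" "agree n (rep n \<omega>) \<omega>" by (auto simp: cylinder_def agree_def)
qed

lemma rep_cong: "agree n \<omega> \<upsilon> \<Longrightarrow> rep n \<omega> = rep n \<upsilon>"
  unfolding rep_def agree_def by (intro arg_cong[of _ _ word_point] map_cong) auto

lemma countable_words: "countable (lists (arcs G))"
  using countable_arcs by simp

lemma rep_range_countable: "countable {rep n \<omega> | n \<omega>. \<omega> \<in> X}"
proof (rule countable_subset)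
  show "{rep n \<omega> | n \<omega>. \<omega> \<in> X} \<subseteq> word_point ` lists (arcs G)"
    by (auto simp: rep_def intro!: imageI) (simp add: shift_space_nth)
qed (use countable_words in simp)

lemma \<theta>_pow_tendsto_0: "(\<lambda>n. \<theta> ^ n) \<longlonglongrightarrow> 0"
  using \<theta>_pos \<theta>_less_1 by (simp add: LIMSEQ_realpow_zero)

lemma \<theta>_pow_le_1: "\<theta> ^ n \<le> 1"
  using \<theta>_pos \<theta>_less_1 by (simp add: power_le_one)

lemma \<theta>_pow_pos [simp]: "0 < \<theta> ^ n"
  using \<theta>_pos by simp

text \<open>Only pointwise convergence can be expected without compactness. A diagonal subsequence
  converges on the countable set of representatives, and the common Lipschitz constant carries
  convergence to every point.\<close>

lemma ascoli:
  fixes f :: "nat \<Rightarrow> (nat \<Rightarrow> 'e) \<Rightarrow> real"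
  assumes M: "\<And>k. bounded_by G (f k) M" and V: "\<And>k. lipschitz_by G \<theta> (f k) V"
  obtains \<sigma> :: "nat \<Rightarrow> nat" and g where "strict_mono \<sigma>" "\<And>\<omega>. \<omega> \<in> X \<Longrightarrow> (\<lambda>k. f (\<sigma> k) \<omega>) \<longlonglongrightarrow> g \<omega>"
    "bounded_by G g M" "lipschitz_by G \<theta> g V"
proof -
  let ?D = "{rep n \<omega> | n \<omega>. \<omega> \<in> X}"
  have "norm (f k x) \<le> M" if "x \<in> ?D" for k x
    using that M rep(1) by (auto simp: bounded_by_def)
  then obtain \<sigma> :: "nat \<Rightarrow> nat" where \<sigma>: "strict_mono \<sigma>"
    and D: "\<And>x. x \<in> ?D \<Longrightarrow> \<exists>l. (\<lambda>k. f (\<sigma> k) x) \<longlonglongrightarrow> l"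
    by (rule function_convergent_subsequence[OF rep_range_countable, of f M]) blast+
  have cauchy: "Cauchy (\<lambda>k. f (\<sigma> k) \<omega>)" if "\<omega> \<in> X" for \<omega>
  proof (rule CauchyI)
    fix \<epsilon> :: real assume "\<epsilon> > 0"
    have "(\<lambda>n. \<bar>V\<bar> * \<theta> ^ n) \<longlonglongrightarrow> \<bar>V\<bar> * 0" by (intro tendsto_intros \<theta>_pow_tendsto_0)
    then have "eventually (\<lambda>n. \<bar>V\<bar> * \<theta> ^ n < \<epsilon> / 3) sequentially"
      using \<open>\<epsilon> > 0\<close> by (intro order_tendstoD(2)) auto
    then have "eventually (\<lambda>n. \<bar>V\<bar> * \<theta> ^ n < \<epsilon> / 3 \<and> n \<ge> 1) sequentially"
      using eventually_ge_at_top by (rule eventually_conj)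
    then obtain n where n: "\<bar>V\<bar> * \<theta> ^ n < \<epsilon> / 3" "n \<ge> 1"
      using eventually_happens' sequentially_bot by blast
    have "\<bar>f (\<sigma> k) \<omega> - f (\<sigma> k) (rep n \<omega>)\<bar> < \<epsilon> / 3" for k
    proof -
      have "\<bar>f (\<sigma> k) \<omega> - f (\<sigma> k) (rep n \<omega>)\<bar> \<le> V * \<theta> ^ n"
        using lipschitz_byD[OF V, of \<omega> "rep n \<omega>" n "\<sigma> k"] rep[OF that] n agree_sym[OF rep(2)[OF that]] that
        by simp
      also have "\<dots> \<le> \<bar>V\<bar> * \<theta> ^ n" by (simp add: mult_right_mono \<theta>_pos less_imp_le)
      finally show ?thesis using n by simp
    qed
    moreover have "convergent (\<lambda>k. f (\<sigma> k) (rep n \<omega>))"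
      using D[of "rep n \<omega>"] that by (auto simp: convergent_def)
    then obtain N where "\<And>k l. k \<ge> N \<Longrightarrow> l \<ge> N \<Longrightarrow>
        \<bar>f (\<sigma> k) (rep n \<omega>) - f (\<sigma> l) (rep n \<omega>)\<bar> < \<epsilon> / 3"
      using CauchyD[of "\<lambda>k. f (\<sigma> k) (rep n \<omega>)" "\<epsilon>/3"] \<open>\<epsilon> > 0\<close> by (auto simp: convergent_Cauchy)
    moreover have "\<bar>a - b\<bar> < \<epsilon>" if "\<bar>a - c\<bar> < \<epsilon> / 3" "\<bar>b - d\<bar> < \<epsilon> / 3" "\<bar>c - d\<bar> < \<epsilon> / 3"
      for a b c d :: real using that by linarith
    ultimately have "\<bar>f (\<sigma> k) \<omega> - f (\<sigma> l) \<omega>\<bar> < \<epsilon>" if "k \<ge> N" "l \<ge> N" for k l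
      using that by blast
    then show "\<exists>N. \<forall>m\<ge>N. \<forall>n\<ge>N. norm (f (\<sigma> m) \<omega> - f (\<sigma> n) \<omega>) < \<epsilon>" by auto
  qed
  define g where "g \<omega> = lim (\<lambda>k. f (\<sigma> k) \<omega>)" for \<omega>
  have lim: "(\<lambda>k. f (\<sigma> k) \<omega>) \<longlonglongrightarrow> g \<omega>" if "\<omega> \<in> X" for \<omega>
    using cauchy[OF that] by (simp add: Cauchy_convergent_iff convergent_LIMSEQ_iff g_def)
  have "bounded_by G g M" unfolding bounded_by_def
    using LIMSEQ_le_const2[OF tendsto_norm[OF lim]] M by (meson bounded_byD)
  moreover have "lipschitz_by G \<theta> g V"
  proof (rule lipschitz_byI)
    fix \<omega> \<upsilon> n assume *: "\<omega> \<in> X" "\<upsilon> \<in> X" "1 \<le> n" "agree n \<omega> \<upsilon>"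
    show "norm (g \<omega> - g \<upsilon>) \<le> V * \<theta> ^ n"
      by (rule LIMSEQ_le_const2[OF tendsto_norm[OF tendsto_diff[OF lim lim]]])
        (use * lipschitz_byD[OF V] in auto)
  qed
  ultimately show ?thesis using that \<sigma> lim by blast
qed

end

section \<open>The Ruelle operator on real functions\<close>

text \<open>\<open>B\<close> depends on the first letter only, which allows estimates at all points
  at once. For the geometric potential it is the supremum of the derivative norms raised to a
  smaller exponent.\<close>

locale potential = edge_shift G \<theta> for G :: "('v,'e) pre_digraph" and \<theta> :: real +
  fixes \<psi> :: "(nat \<Rightarrow> 'e) \<Rightarrow> real" and B :: "'e \<Rightarrow> real" and K :: real
  assumes K_nonneg: "0 \<le> K"
    and \<psi>_lip: "\<And>\<omega> \<upsilon> n. \<omega> \<in> shift_space G \<Longrightarrow> \<upsilon> \<in> shift_space G \<Longrightarrow> 1 \<le> n \<Longrightarrow> agree n \<omega> \<upsilon> \<Longrightarrow>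
      \<bar>\<psi> \<omega> - \<psi> \<upsilon>\<bar> \<le> K * \<theta> ^ n"
    and \<psi>_bound: "\<And>\<omega>. \<omega> \<in> shift_space G \<Longrightarrow> exp (\<psi> \<omega>) \<le> B (\<omega> 0)"
    and B_summable: "B summable_on arcs G"
begin

text \<open>The operator on real functions, where the order is available. The value 0 off
  \<open>X\<close> makes \<open>L f\<close> depend on \<open>f\<close> on \<open>X\<close> alone, so
  that \<open>L_cong\<close> yields equality of functions.\<close>

definition L :: "((nat \<Rightarrow> 'e) \<Rightarrow> real) \<Rightarrow> (nat \<Rightarrow> 'e) \<Rightarrow> real" where
  "L f \<omega> = (if \<omega> \<in> X then \<Sum>\<^sub>\<infinity>e\<in>preds G \<omega>. exp (\<psi> (prepend e \<omega>)) * f (prepend e \<omega>) else 0)"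

definition SB :: real where "SB = infsum B (arcs G)"

lemma B_pos: "e \<in> arcs G \<Longrightarrow> 0 < B e"
  using \<psi>_bound[of "edge_point e"] edge_point[of e] less_le_trans[OF exp_gt_zero] by simp

lemma B_nonneg: "e \<in> arcs G \<Longrightarrow> 0 \<le> B e"
  by (rule less_imp_le[OF B_pos])

lemma B_summable_subset: "A \<subseteq> arcs G \<Longrightarrow> B summable_on A"
  by (rule summable_on_subset_banach[OF B_summable])

lemma SB_pos: "0 < SB"
proof -
  obtain e where e: "e \<in> arcs G" using arcs_nonempty by auto
  have "sum B {e} \<le> SB" unfolding SB_def
    by (rule finite_sum_le_infsum) (use e B_summable B_nonneg in auto)
  then show ?thesis using B_pos[OF e] by simp
qed

lemma tail_small:
  assumes "\<epsilon> > 0"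
  obtains F where "finite F" "F \<subseteq> arcs G" "infsum B (arcs G - F) < \<epsilon>"
proof -
  obtain F where F: "finite F" "F \<subseteq> arcs G" "dist (sum B F) SB \<le> \<epsilon> / 2"
    using infsum_finite_approximation[of B "arcs G" "\<epsilon>/2"] B_summable assms unfolding SB_def by auto
  have "infsum B (arcs G - F) = SB - infsum B F" unfolding SB_def
    by (rule infsum_Diff) (use F B_summable in auto)
  moreover have "infsum B F = sum B F" "SB - sum B F \<le> \<epsilon> / 2"
    using F abs_ge_minus_self[of "sum B F - SB"] unfolding dist_real_def by (simp, linarith)
  ultimately have "infsum B (arcs G - F) < \<epsilon>" using assms by linarith
  then show ?thesis using that F by blast
qed

lemma tail_nonneg: "0 \<le> infsum B (arcs G - F)"
  by (rule infsum_nonneg) (use B_nonneg in auto)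

lemma term_bound:
  assumes "\<omega> \<in> X" "e \<in> preds G \<omega>" "bounded_by G f M"
  shows "\<bar>exp (\<psi> (prepend e \<omega>)) * f (prepend e \<omega>)\<bar> \<le> B e * \<bar>f (prepend e \<omega>)\<bar>"
    "\<bar>exp (\<psi> (prepend e \<omega>)) * f (prepend e \<omega>)\<bar> \<le> M * B e"
proof -
  have b: "exp (\<psi> (prepend e \<omega>)) \<le> B e" using \<psi>_bound[of "prepend e \<omega>"] assms by simp
  then show 1: "\<bar>exp (\<psi> (prepend e \<omega>)) * f (prepend e \<omega>)\<bar> \<le> B e * \<bar>f (prepend e \<omega>)\<bar>"
    by (simp add: abs_mult mult_right_mono)
  also have "\<dots> \<le> B e * M"
    by (rule mult_left_mono[OF bounded_by_absD[OF assms(3) prepend_in[OF assms(1,2)]] B_nonneg[OF preds_arcs[OF assms(2)]]])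
  finally show "\<bar>exp (\<psi> (prepend e \<omega>)) * f (prepend e \<omega>)\<bar> \<le> M * B e" by (simp add: mult.commute)
qed

lemma term_summable:
  assumes "\<omega> \<in> X" "bounded_by G f M"
  shows "(\<lambda>e. exp (\<psi> (prepend e \<omega>)) * f (prepend e \<omega>)) summable_on preds G \<omega>"
    "(\<lambda>e. \<bar>exp (\<psi> (prepend e \<omega>)) * f (prepend e \<omega>)\<bar>) summable_on preds G \<omega>"
proof -
  have "(\<lambda>e. M * B e) summable_on preds G \<omega>"
    by (rule summable_on_cmult_right[OF B_summable_subset[OF preds_subset]])
  then show "(\<lambda>e. \<bar>exp (\<psi> (prepend e \<omega>)) * f (prepend e \<omega>)\<bar>) summable_on preds G \<omega>"
    by (rule summable_on_comparison_test) (rule term_bound(2)[OF assms(1) _ assms(2)], assumption, rule abs_ge_zero)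
  then show "(\<lambda>e. exp (\<psi> (prepend e \<omega>)) * f (prepend e \<omega>)) summable_on preds G \<omega>"
    using abs_summable_summable[of "\<lambda>e. exp (\<psi> (prepend e \<omega>)) * f (prepend e \<omega>)" "preds G \<omega>"]
    unfolding real_norm_def by blast
qed

lemma L_has_sum:
  assumes "\<omega> \<in> X" "bounded_by G f M"
  shows "((\<lambda>e. exp (\<psi> (prepend e \<omega>)) * f (prepend e \<omega>)) has_sum L f \<omega>) (preds G \<omega>)"
  using term_summable(1)[OF assms] assms by (simp add: L_def)

lemma L_cong: "(\<And>\<omega>. \<omega> \<in> X \<Longrightarrow> f \<omega> = g \<omega>) \<Longrightarrow> L f = L g"
  by (rule ext) (auto simp: L_def intro!: infsum_cong)

lemma bounded_by_add:
  "bounded_by G f M \<Longrightarrow> bounded_by G g M' \<Longrightarrow> bounded_by G (\<lambda>\<omega>. f \<omega> + g \<omega>) (M + M')"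
  unfolding bounded_by_def by (meson norm_triangle_ineq add_mono order_trans)

lemma bounded_by_diff:
  "bounded_by G f M \<Longrightarrow> bounded_by G g M' \<Longrightarrow> bounded_by G (\<lambda>\<omega>. f \<omega> - g \<omega>) (M + M')"
  unfolding bounded_by_def by (meson norm_triangle_ineq4 add_mono order_trans)

lemma bounded_by_scale:
  fixes f :: "(nat \<Rightarrow> 'e) \<Rightarrow> real"
  shows "bounded_by G f M \<Longrightarrow> bounded_by G (\<lambda>\<omega>. c * f \<omega>) (\<bar>c\<bar> * M)"
  by (simp add: bounded_by_def abs_mult mult_left_mono)

lemma bounded_by_const: "bounded_by G (\<lambda>_. c::real) \<bar>c\<bar>"
  by (simp add: bounded_by_def)

lemma bounded_by_abs: "bounded_by G (f :: _ \<Rightarrow> real) M \<Longrightarrow> bounded_by G (\<lambda>\<omega>. \<bar>f \<omega>\<bar>) M"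
  by (simp add: bounded_by_def)

lemma L_add:
  assumes "bounded_by G f M" "bounded_by G g M'"
  shows "L (\<lambda>\<omega>. f \<omega> + g \<omega>) = (\<lambda>\<omega>. L f \<omega> + L g \<omega>)"
proof (rule ext)
  fix \<omega> show "L (\<lambda>\<omega>. f \<omega> + g \<omega>) \<omega> = L f \<omega> + L g \<omega>"
  proof (cases "\<omega> \<in> X")
    case True
    then show ?thesis
      using infsum_add[OF term_summable(1)[OF True assms(1)] term_summable(1)[OF True assms(2)]]
      by (simp add: L_def algebra_simps)
  qed (simp add: L_def)
qed

lemma L_scale: "L (\<lambda>\<omega>. c * f \<omega>) = (\<lambda>\<omega>. c * L f \<omega>)"
  by (rule ext) (simp add: L_def infsum_cmult_right'[symmetric] mult_ac)

lemma L_diff: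
  assumes "bounded_by G f M" "bounded_by G g M'"
  shows "L (\<lambda>\<omega>. f \<omega> - g \<omega>) = (\<lambda>\<omega>. L f \<omega> - L g \<omega>)"
  using L_add[OF assms(1) bounded_by_scale[OF assms(2), of "-1"]] L_scale[of "-1" g] by simp

text \<open>All preimages of a point have the same shift, so a factor that depends on the shift
  leaves the sum. This moves events at later coordinates to coordinate 0 and permutes the cyclic
  classes.\<close>

lemma L_pullback: "L (\<lambda>\<omega>. f \<omega> * u (shift \<omega>)) = (\<lambda>\<omega>. u \<omega> * L f \<omega>)"
  by (rule ext) (simp add: L_def infsum_cmult_right'[symmetric] mult_ac)

lemma L_mono:
  assumes "bounded_by G f M" "bounded_by G g M'" "\<And>\<omega>. \<omega> \<in> X \<Longrightarrow> f \<omega> \<le> g \<omega>"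
  shows "L f \<omega> \<le> L g \<omega>"
proof (cases "\<omega> \<in> X")
  case True
  then show ?thesis using term_summable(1)[OF True assms(1)] term_summable(1)[OF True assms(2)] assms(3)
    by (auto simp: L_def intro!: infsum_mono)
qed (simp add: L_def)

lemma L_nonneg: "(\<And>\<omega>. \<omega> \<in> X \<Longrightarrow> 0 \<le> f \<omega>) \<Longrightarrow> 0 \<le> L f \<omega>"
  by (auto simp: L_def intro!: infsum_nonneg)

lemma L_ge_term:
  assumes "bounded_by G f M" "\<And>\<omega>. \<omega> \<in> X \<Longrightarrow> 0 \<le> f \<omega>" "\<omega> \<in> X"
  shows "exp (\<psi> \<omega>) * f \<omega> \<le> L f (shift \<omega>)"
proof -
  have "sum (\<lambda>e. exp (\<psi> (prepend e (shift \<omega>))) * f (prepend e (shift \<omega>))) {\<omega> 0}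
      \<le> infsum (\<lambda>e. exp (\<psi> (prepend e (shift \<omega>))) * f (prepend e (shift \<omega>))) (preds G (shift \<omega>))"
    by (rule finite_sum_le_infsum) (use assms term_summable(1)[OF _ assms(1)] nth_0_preds in auto)
  then show ?thesis using assms by (simp add: L_def prepend_shift)
qed

text \<open>Finitely many letters are treated through the values of \<open>f\<close>, the others
  through its supremum and a tail of \<open>B\<close>. With \<open>F = {}\<close> this is the bound
  of \<open>L\<close> by \<open>SB\<close>; with a small tail it reduces limits to finitely many
  points.\<close>

lemma L_split_bound:
  assumes "\<omega> \<in> X" "finite F" "F \<subseteq> arcs G" "bounded_by G f M"
  shows "\<bar>L f \<omega>\<bar> \<le> (\<Sum>e\<in>F \<inter> preds G \<omega>. B e * \<bar>f (prepend e \<omega>)\<bar>) + M * infsum B (arcs G - F)"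
proof -
  let ?t = "\<lambda>e. \<bar>exp (\<psi> (prepend e \<omega>)) * f (prepend e \<omega>)\<bar>" and ?P = "preds G \<omega>"
  have M: "0 \<le> M" by (rule order_trans[OF abs_ge_zero bounded_by_absD[OF assms(4,1)]])
  note s = term_summable(2)[OF assms(1,4)]
  have "\<bar>L f \<omega>\<bar> \<le> infsum ?t ?P"
    using norm_infsum_bound[of "\<lambda>e. exp (\<psi> (prepend e \<omega>)) * f (prepend e \<omega>)" ?P] s assms(1)
    by (simp add: L_def)
  also have "infsum ?t ?P = infsum ?t (F \<inter> ?P) + infsum ?t (?P - F)"
  proof -
    have "infsum ?t ((F \<inter> ?P) \<union> (?P - F)) = infsum ?t (F \<inter> ?P) + infsum ?t (?P - F)"
      by (rule infsum_Un_disjoint) (use summable_on_subset_banach[OF s] assms(2) in auto)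
    moreover have "(F \<inter> ?P) \<union> (?P - F) = ?P" by auto
    ultimately show ?thesis by simp
  qed
  also have "infsum ?t (F \<inter> ?P) \<le> (\<Sum>e\<in>F \<inter> ?P. B e * \<bar>f (prepend e \<omega>)\<bar>)"
    using assms(2) term_bound(1)[OF assms(1) _ assms(4)] by (auto intro!: sum_mono)
  also have "infsum ?t (?P - F) \<le> infsum (\<lambda>e. M * B e) (arcs G - F)"
  proof (rule infsum_mono_neutral)
    show "?t summable_on ?P - F" by (rule summable_on_subset_banach[OF s]) auto
    show "(\<lambda>e. M * B e) summable_on arcs G - F"
      by (rule summable_on_cmult_right[OF B_summable_subset]) auto
    show "?t e \<le> M * B e" if "e \<in> (?P - F) \<inter> (arcs G - F)" for e
      by (rule term_bound(2)[OF assms(1) _ assms(4)]) (use that in auto)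
    show "0 \<le> M * B e" if "e \<in> (arcs G - F) - (?P - F)" for e
      using that M B_nonneg by auto
  qed (use preds_subset[of G \<omega>] in auto)
  also have "\<dots> = M * infsum B (arcs G - F)" by (simp add: infsum_cmult_right')
  finally show ?thesis by linarith
qed

lemma L_bound: assumes "bounded_by G f M" shows "bounded_by G (L f) (M * SB)"
  using L_split_bound[OF _ _ _ assms, of _ "{}"] by (auto simp: bounded_by_def SB_def)

text \<open>Dominated convergence for the series, with \<open>M * B e\<close> as the dominating
  terms.\<close>

lemma L_tendsto:
  assumes M: "\<And>k. bounded_by G (f k) M" and lim: "\<And>\<omega>. \<omega> \<in> X \<Longrightarrow> (\<lambda>k. f k \<omega>) \<longlonglongrightarrow> g \<omega>" and \<omega>: "\<omega> \<in> X"
  shows "(\<lambda>k. L (f k) \<omega>) \<longlonglongrightarrow> L g \<omega>"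
proof -
  have g: "bounded_by G g M" unfolding bounded_by_def
    using LIMSEQ_le_const2[OF tendsto_norm[OF lim]] M by (meson bounded_byD)
  define d where "d k \<omega> = f k \<omega> - g \<omega>" for k \<omega>
  have d: "bounded_by G (d k) (M + M)" for k unfolding d_def by (rule bounded_by_diff[OF M g])
  have M0: "0 \<le> M" by (rule order_trans[OF abs_ge_zero bounded_by_absD[OF g \<omega>]])
  have "(\<lambda>k. L (d k) \<omega>) \<longlonglongrightarrow> 0"
  proof (rule LIMSEQ_I)
    fix \<epsilon> :: real assume "\<epsilon> > 0"
    then obtain F where F: "finite F" "F \<subseteq> arcs G" "infsum B (arcs G - F) < \<epsilon> / (4 * (M + 1))"
      using tail_small[of "\<epsilon> / (4 * (M + 1))"] M0 by auto
    have "(\<lambda>k. \<Sum>e\<in>F \<inter> preds G \<omega>. B e * \<bar>d k (prepend e \<omega>)\<bar>) \<longlonglongrightarrow> (\<Sum>e\<in>F \<inter> preds G \<omega>. B e * \<bar>0\<bar>)"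
      using \<omega> unfolding d_def by (intro tendsto_intros LIM_zero lim) auto
    then have "eventually (\<lambda>k. (\<Sum>e\<in>F \<inter> preds G \<omega>. B e * \<bar>d k (prepend e \<omega>)\<bar>) < \<epsilon> / 2) sequentially"
      using \<open>\<epsilon> > 0\<close> by (intro order_tendstoD(2)) auto
    then obtain N where N: "\<And>k. k \<ge> N \<Longrightarrow> (\<Sum>e\<in>F \<inter> preds G \<omega>. B e * \<bar>d k (prepend e \<omega>)\<bar>) < \<epsilon> / 2"
      by (auto simp: eventually_sequentially)
    have "(M + M) * infsum B (arcs G - F) \<le> (M + M) * (\<epsilon> / (4 * (M + 1)))"
      using F M0 by (intro mult_left_mono) auto
    also have "\<dots> \<le> \<epsilon> / 2" using M0 \<open>\<epsilon> > 0\<close> by (simp add: field_simps)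
    finally have "\<bar>L (d k) \<omega>\<bar> < \<epsilon>" if "k \<ge> N" for k
      using L_split_bound[OF \<omega> F(1,2) d, of k] N[OF that] by linarith
    then show "\<exists>N. \<forall>k\<ge>N. norm (L (d k) \<omega> - 0) < \<epsilon>" by auto
  qed
  moreover have "L (d k) \<omega> = L (f k) \<omega> - L g \<omega>" for k
    using fun_cong[OF L_diff[OF M g]] unfolding d_def .
  ultimately show ?thesis by (simp add: LIM_zero_iff)
qed

section \<open>The cone of functions of bounded distortion\<close>

definition cone :: "((nat \<Rightarrow> 'e) \<Rightarrow> real) \<Rightarrow> bool" where
  "cone f \<longleftrightarrow> (\<forall>\<omega>\<in>X. 0 \<le> f \<omega>) \<and> (\<forall>\<omega>\<in>X. \<forall>\<upsilon>\<in>X. \<forall>n\<ge>1. agree n \<omega> \<upsilon> \<longrightarrow>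
     f \<omega> \<le> exp (K * \<theta> / (1 - \<theta>) * \<theta> ^ n) * f \<upsilon>)"

lemma cone_nonneg: "cone f \<Longrightarrow> \<omega> \<in> X \<Longrightarrow> 0 \<le> f \<omega>"
  by (simp add: cone_def)

lemma coneD: "cone f \<Longrightarrow> \<omega> \<in> X \<Longrightarrow> \<upsilon> \<in> X \<Longrightarrow> 1 \<le> n \<Longrightarrow> agree n \<omega> \<upsilon> \<Longrightarrow>
    f \<omega> \<le> exp (K * \<theta> / (1 - \<theta>) * \<theta> ^ n) * f \<upsilon>"
  by (simp add: cone_def)

definition D :: real where "D = exp (K * \<theta> / (1 - \<theta>))"

lemma exponent_nonneg: "0 \<le> K * \<theta> / (1 - \<theta>)"
  using K_nonneg \<theta>_pos \<theta>_less_1 by simp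

lemma D_ge_1: "1 \<le> D"
  using exponent_nonneg by (simp add: D_def)

lemma cone_D: assumes "cone f" "\<omega> \<in> X" "\<upsilon> \<in> X" "\<omega> 0 = \<upsilon> 0" shows "f \<omega> \<le> D * f \<upsilon>"
proof -
  have "K * \<theta> / (1 - \<theta>) * \<theta> ^ 1 \<le> K * \<theta> / (1 - \<theta>) * 1"
    using exponent_nonneg \<theta>_pow_le_1[of 1] by (intro mult_left_mono) auto
  then have "exp (K * \<theta> / (1 - \<theta>) * \<theta> ^ 1) * f \<upsilon> \<le> D * f \<upsilon>"
    using cone_nonneg[OF assms(1,3)] by (intro mult_right_mono) (auto simp: D_def)
  then show ?thesis using coneD[OF assms(1-3), of 1] assms(4) by (auto simp: agree_def)
qed

lemma cone_const: "0 \<le> c \<Longrightarrow> cone (\<lambda>_. c)"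
  using mult_nonneg_nonneg[OF exponent_nonneg less_imp_le[OF \<theta>_pow_pos]] by (simp add: cone_def mult_le_cancel_right1)

lemma cone_add:
  assumes "cone f" "cone g" shows "cone (\<lambda>\<omega>. f \<omega> + g \<omega>)"
  unfolding cone_def
proof (intro conjI ballI allI impI)
  fix \<omega> \<upsilon> n assume *: "\<omega> \<in> X" "\<upsilon> \<in> X" "1 \<le> n" "agree n \<omega> \<upsilon>"
  show "f \<omega> + g \<omega> \<le> exp (K * \<theta> / (1 - \<theta>) * \<theta> ^ n) * (f \<upsilon> + g \<upsilon>)"
    unfolding distrib_left by (rule add_mono[OF coneD[OF assms(1) *] coneD[OF assms(2) *]])
qed (use assms cone_nonneg in auto)

lemma cone_scale:
  assumes "cone f" "0 \<le> c" shows "cone (\<lambda>\<omega>. c * f \<omega>)"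
  unfolding cone_def
proof (intro conjI ballI allI impI)
  fix \<omega> \<upsilon> n assume *: "\<omega> \<in> X" "\<upsilon> \<in> X" "1 \<le> n" "agree n \<omega> \<upsilon>"
  show "c * f \<omega> \<le> exp (K * \<theta> / (1 - \<theta>) * \<theta> ^ n) * (c * f \<upsilon>)"
    using mult_left_mono[OF coneD[OF assms(1) *] assms(2)] by (simp add: mult.left_commute)
qed (use assms cone_nonneg in auto)

text \<open>Put a = K \<theta> / (1 - \<theta>). Prepending a letter turns agreement n into n + 1,
  so the weight adds K \<theta>^(n+1) and the function a \<theta>^(n+1) to the exponent. The number
  a solves K \<theta> + a \<theta> = a, which makes the cone invariant.\<close>

lemma cone_L:
  assumes f: "cone f" "bounded_by G f M" shows "cone (L f)"
  unfolding cone_def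
proof (intro conjI ballI allI impI)
  fix \<omega> \<upsilon> n assume *: "\<omega> \<in> X" "\<upsilon> \<in> X" "1 \<le> n" "agree n \<omega> \<upsilon>"
  let ?c = "exp (K * \<theta> / (1 - \<theta>) * \<theta> ^ n)"
  have "exp (\<psi> (prepend e \<omega>)) * f (prepend e \<omega>) \<le> ?c * (exp (\<psi> (prepend e \<upsilon>)) * f (prepend e \<upsilon>))"
    if e: "e \<in> preds G \<omega>" for e
  proof -
    have e': "e \<in> preds G \<upsilon>" using e agree_preds[OF *(4,3), of G] by simp
    have X: "prepend e \<omega> \<in> X" "prepend e \<upsilon> \<in> X" using * e e' by auto
    have a: "agree (Suc n) (prepend e \<omega>) (prepend e \<upsilon>)" by (rule agree_prepend[OF *(4)])
    have 1: "exp (\<psi> (prepend e \<omega>)) \<le> exp (K * \<theta> ^ Suc n) * exp (\<psi> (prepend e \<upsilon>))"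
      unfolding exp_add[symmetric] using \<psi>_lip[OF X _ a] by (simp add: abs_le_iff algebra_simps)
    have 2: "f (prepend e \<omega>) \<le> exp (K * \<theta> / (1 - \<theta>) * \<theta> ^ Suc n) * f (prepend e \<upsilon>)"
      by (rule coneD[OF f(1) X _ a]) simp
    have "exp (\<psi> (prepend e \<omega>)) * f (prepend e \<omega>)
        \<le> (exp (K * \<theta> ^ Suc n) * exp (\<psi> (prepend e \<upsilon>))) * (exp (K * \<theta> / (1 - \<theta>) * \<theta> ^ Suc n) * f (prepend e \<upsilon>))"
      by (rule mult_mono[OF 1 2]) (use cone_nonneg[OF f(1)] X in auto)
    also have "\<dots> = exp (K * \<theta> ^ Suc n + K * \<theta> / (1 - \<theta>) * \<theta> ^ Suc n) * (exp (\<psi> (prepend e \<upsilon>)) * f (prepend e \<upsilon>))"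
      by (simp add: exp_add)
    also have "K * \<theta> ^ Suc n + K * \<theta> / (1 - \<theta>) * \<theta> ^ Suc n = K * \<theta> / (1 - \<theta>) * \<theta> ^ n"
      using \<theta>_less_1 by (simp add: field_simps)
    finally show ?thesis .
  qed
  then have "(\<Sum>\<^sub>\<infinity>e\<in>preds G \<omega>. exp (\<psi> (prepend e \<omega>)) * f (prepend e \<omega>))
      \<le> (\<Sum>\<^sub>\<infinity>e\<in>preds G \<omega>. ?c * (exp (\<psi> (prepend e \<upsilon>)) * f (prepend e \<upsilon>)))"
    using term_summable(1)[OF *(1) f(2)] term_summable(1)[OF *(2) f(2)] agree_preds[OF *(4,3), of G]
    by (intro infsum_mono summable_on_cmult_right) auto
  then show "L f \<omega> \<le> ?c * L f \<upsilon>"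
    using * agree_preds[OF *(4,3), of G] by (simp add: L_def infsum_cmult_right')
qed (use L_nonneg cone_nonneg[OF f(1)] in auto)

end

section \<open>Iterates of the Ruelle operator\<close>

lemma abs_exp_minus_one_le:
  fixes z :: real assumes "\<bar>z\<bar> \<le> c" "c \<le> K" shows "\<bar>exp z - 1\<bar> \<le> c * exp K"
proof -
  have "(1 - z) * exp z \<le> exp (- z) * exp z"
    using exp_ge_add_one_self[of "- z"] by (intro mult_right_mono) auto
  then have "exp z - 1 \<le> z * exp z" by (simp add: exp_minus algebra_simps)
  also have "\<dots> \<le> \<bar>z\<bar> * exp K" using assms by (intro mult_mono) auto
  finally have "exp z - 1 \<le> \<bar>z\<bar> * exp K" .
  moreover have "\<bar>z\<bar> * 1 \<le> \<bar>z\<bar> * exp K" using assms by (intro mult_left_mono) auto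
  ultimately have "\<bar>exp z - 1\<bar> \<le> \<bar>z\<bar> * exp K" using exp_ge_add_one_self[of z] unfolding abs_le_iff by linarith
  also have "\<dots> \<le> c * exp K" using assms by (intro mult_right_mono) auto
  finally show ?thesis .
qed

context potential
begin

text \<open>Boundedness with the bound hidden, so that the side conditions of linearity are
  discharged by rewriting without naming constants.\<close>

definition bd :: "((nat \<Rightarrow> 'e) \<Rightarrow> real) \<Rightarrow> bool" where
  "bd f \<longleftrightarrow> (\<exists>M. bounded_by G f M)"

lemma bdI: "bounded_by G f M \<Longrightarrow> bd f"
  by (auto simp: bd_def)

lemma bd_intros [intro, simp]:
  "bd (\<lambda>_. c)"
  "bd f \<Longrightarrow> bd (\<lambda>\<omega>. c * f \<omega>)"
  "bd f \<Longrightarrow> bd g \<Longrightarrow> bd (\<lambda>\<omega>. f \<omega> + g \<omega>)"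
  "bd f \<Longrightarrow> bd g \<Longrightarrow> bd (\<lambda>\<omega>. f \<omega> - g \<omega>)"
  "bd f \<Longrightarrow> bd (\<lambda>\<omega>. \<bar>f \<omega>\<bar>)"
  "bd f \<Longrightarrow> bd (L f)"
  unfolding bd_def
  by ((rule exI, rule bounded_by_const),
      (erule exE, rule exI, erule bounded_by_scale),
      (elim exE, rule exI, erule (1) bounded_by_add),
      (elim exE, rule exI, erule (1) bounded_by_diff),
      (erule exE, rule exI, erule bounded_by_abs),
      (erule exE, rule exI, erule L_bound))

lemma bd_Lpow [simp]: "bd f \<Longrightarrow> bd ((L ^^ n) f)"
  by (induction n) auto

lemma L_add': "bd f \<Longrightarrow> bd g \<Longrightarrow> L (\<lambda>\<omega>. f \<omega> + g \<omega>) = (\<lambda>\<omega>. L f \<omega> + L g \<omega>)"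
  unfolding bd_def using L_add by blast

lemma L_diff': "bd f \<Longrightarrow> bd g \<Longrightarrow> L (\<lambda>\<omega>. f \<omega> - g \<omega>) = (\<lambda>\<omega>. L f \<omega> - L g \<omega>)"
  unfolding bd_def using L_diff by blast

lemma L_mono': "bd f \<Longrightarrow> bd g \<Longrightarrow> (\<And>\<omega>. \<omega> \<in> X \<Longrightarrow> f \<omega> \<le> g \<omega>) \<Longrightarrow> L f \<omega> \<le> L g \<omega>"
  unfolding bd_def using L_mono by blast

lemma Lpow_Suc: "(L ^^ Suc n) f = (L ^^ n) (L f)"
  by (simp only: funpow_Suc_right comp_apply)

lemma Lpow_add_exp: "(L ^^ (m + n)) f = (L ^^ m) ((L ^^ n) f)"
  by (simp only: funpow_add comp_apply)

lemma Lpow_cong: "(\<And>\<omega>. \<omega> \<in> X \<Longrightarrow> f \<omega> = g \<omega>) \<Longrightarrow> \<omega> \<in> X \<Longrightarrow> (L ^^ n) f \<omega> = (L ^^ n) g \<omega>"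
  using L_cong[of f g] by (cases n) (simp_all add: Lpow_Suc del: funpow.simps(2))

lemma Lpow_add: "bd f \<Longrightarrow> bd g \<Longrightarrow> (L ^^ n) (\<lambda>\<omega>. f \<omega> + g \<omega>) = (\<lambda>\<omega>. (L ^^ n) f \<omega> + (L ^^ n) g \<omega>)"
  by (induction n) (simp_all add: L_add')

lemma Lpow_diff: "bd f \<Longrightarrow> bd g \<Longrightarrow> (L ^^ n) (\<lambda>\<omega>. f \<omega> - g \<omega>) = (\<lambda>\<omega>. (L ^^ n) f \<omega> - (L ^^ n) g \<omega>)"
  by (induction n) (simp_all add: L_diff')

lemma Lpow_scale: "(L ^^ n) (\<lambda>\<omega>. c * f \<omega>) = (\<lambda>\<omega>. c * (L ^^ n) f \<omega>)"
  by (induction n) (simp_all add: L_scale)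

lemma Lpow_mono:
  assumes "bd f" "bd g" "\<And>\<omega>. \<omega> \<in> X \<Longrightarrow> f \<omega> \<le> g \<omega>" "\<omega> \<in> X"
  shows "(L ^^ n) f \<omega> \<le> (L ^^ n) g \<omega>"
  using assms(4)
proof (induction n arbitrary: \<omega>)
  case (Suc n)
  then show ?case using assms(1,2) by (auto intro: L_mono')
qed (use assms in auto)

lemma Lpow_nonneg: "(\<And>\<omega>. \<omega> \<in> X \<Longrightarrow> 0 \<le> f \<omega>) \<Longrightarrow> \<omega> \<in> X \<Longrightarrow> 0 \<le> (L ^^ n) f \<omega>"
  by (induction n arbitrary: \<omega>) (auto intro: L_nonneg)

lemma Lpow_abs_le: assumes "bd f" "\<omega> \<in> X" shows "\<bar>(L ^^ n) f \<omega>\<bar> \<le> (L ^^ n) (\<lambda>\<omega>. \<bar>f \<omega>\<bar>) \<omega>"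
proof -
  have "(L ^^ n) f \<omega> \<le> (L ^^ n) (\<lambda>\<omega>. \<bar>f \<omega>\<bar>) \<omega>" by (rule Lpow_mono) (use assms in auto)
  moreover have "(L ^^ n) (\<lambda>\<omega>. -1 * f \<omega>) \<omega> \<le> (L ^^ n) (\<lambda>\<omega>. \<bar>f \<omega>\<bar>) \<omega>"
    by (rule Lpow_mono) (use assms bd_intros(2)[of f "-1"] in auto)
  ultimately show ?thesis unfolding Lpow_scale by simp
qed

lemma Lpow_pullback: "(L ^^ n) (\<lambda>\<omega>. f \<omega> * u ((shift ^^ n) \<omega>)) = (\<lambda>\<omega>. u \<omega> * (L ^^ n) f \<omega>)"
proof (induction n arbitrary: f u)
  case (Suc n)
  have "(L ^^ Suc n) (\<lambda>\<omega>. f \<omega> * u ((shift ^^ Suc n) \<omega>)) = (L ^^ n) (\<lambda>\<omega>. L f \<omega> * u ((shift ^^ n) \<omega>))"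
    unfolding Lpow_Suc using L_pullback[of f "\<lambda>\<omega>. u ((shift ^^ n) \<omega>)"]
    by (simp add: funpow_Suc_right mult.commute del: funpow.simps)
  then show ?case using Suc by (simp add: Lpow_Suc del: funpow.simps)
qed (simp add: mult.commute)

text \<open>At \<open>(shift ^^ n) \<omega>\<close> the iterate is a sum of nonnegative terms over
  the preimages of order \<open>n\<close>, and \<open>\<omega>\<close> is one of them.\<close>

lemma Lpow_ge_term:
  assumes "bd f" "\<And>\<omega>. \<omega> \<in> X \<Longrightarrow> 0 \<le> f \<omega>" "\<omega> \<in> X"
  shows "exp (\<Sum>i<n. \<psi> ((shift ^^ i) \<omega>)) * f \<omega> \<le> (L ^^ n) f ((shift ^^ n) \<omega>)"
proof (induction n)
  case (Suc n)
  have b: "bd ((L ^^ n) f)" using assms by simp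
  then obtain M where M: "bounded_by G ((L ^^ n) f) M" by (auto simp: bd_def)
  have "exp (\<Sum>i<Suc n. \<psi> ((shift ^^ i) \<omega>)) * f \<omega>
      = exp (\<psi> ((shift ^^ n) \<omega>)) * (exp (\<Sum>i<n. \<psi> ((shift ^^ i) \<omega>)) * f \<omega>)" by (simp add: exp_add)
  also have "\<dots> \<le> exp (\<psi> ((shift ^^ n) \<omega>)) * (L ^^ n) f ((shift ^^ n) \<omega>)"
    using Suc by (intro mult_left_mono) auto
  also have "\<dots> \<le> L ((L ^^ n) f) (shift ((shift ^^ n) \<omega>))"
    by (rule L_ge_term[OF M Lpow_nonneg[OF assms(2)]]) (use assms in auto)
  finally show ?case by simp
qed simp

lemma cone_Lpow: "cone f \<Longrightarrow> bd f \<Longrightarrow> cone ((L ^^ n) f)"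
proof (induction n)
  case (Suc n)
  then show ?case using cone_L[of "(L ^^ n) f"] bd_Lpow[of f n] unfolding bd_def by auto
qed auto

text \<open>Since \<open>L\<close> is positive, this is the norm of the n-th iterate on bounded
  functions (\<open>Lpow_bound\<close>).\<close>

definition growth :: "nat \<Rightarrow> real" where
  "growth n = (SUP \<omega>\<in>X. (L ^^ n) (\<lambda>_. 1) \<omega>)"

lemma Lpow_one_le: "\<omega> \<in> X \<Longrightarrow> (L ^^ n) (\<lambda>_. 1) \<omega> \<le> growth n"
proof -
  have "bd ((L ^^ n) (\<lambda>_. 1))" by simp
  then obtain M where "bounded_by G ((L ^^ n) (\<lambda>_. 1)) M" by (auto simp: bd_def)
  then have "bdd_above ((L ^^ n) (\<lambda>_. 1) ` X)"
    by (auto simp: bounded_by_def intro!: bdd_aboveI[of _ M])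
  then show "\<omega> \<in> X \<Longrightarrow> (L ^^ n) (\<lambda>_. 1) \<omega> \<le> growth n"
    unfolding growth_def by (rule cSUP_upper[rotated])
qed

lemma growth_le: "(\<And>\<omega>. \<omega> \<in> X \<Longrightarrow> (L ^^ n) (\<lambda>_. 1) \<omega> \<le> c) \<Longrightarrow> growth n \<le> c"
  unfolding growth_def by (rule cSUP_least[OF X_nonempty])

lemma Lpow_one_nonneg: "\<omega> \<in> X \<Longrightarrow> 0 \<le> (L ^^ n) (\<lambda>_. 1) \<omega>"
  by (rule Lpow_nonneg) auto

lemma growth_nonneg: "0 \<le> growth n"
  using X_nonempty Lpow_one_nonneg Lpow_one_le by (meson ex_in_conv order_trans)

lemma Lpow_const: "(L ^^ n) (\<lambda>_. c) = (\<lambda>\<omega>. c * (L ^^ n) (\<lambda>_. 1) \<omega>)"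
  using Lpow_scale[of n c "\<lambda>_. 1"] by simp

lemma Lpow_le_one:
  assumes "bounded_by G f M" "\<omega> \<in> X" shows "\<bar>(L ^^ n) f \<omega>\<bar> \<le> M * (L ^^ n) (\<lambda>_. 1) \<omega>"
proof -
  have "\<bar>(L ^^ n) f \<omega>\<bar> \<le> (L ^^ n) (\<lambda>\<omega>. \<bar>f \<omega>\<bar>) \<omega>" by (rule Lpow_abs_le[OF bdI[OF assms(1)] assms(2)])
  also have "\<dots> \<le> (L ^^ n) (\<lambda>_. M) \<omega>"
    by (rule Lpow_mono) (use assms bdI in \<open>auto simp: bounded_by_absD\<close>)
  finally show ?thesis by (subst (asm) Lpow_const)
qed

lemma bounded_by_nonneg: "bounded_by G f M \<Longrightarrow> 0 \<le> M"
  using X_nonempty by (meson bounded_by_def ex_in_conv norm_ge_zero order_trans)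

lemma Lpow_bound:
  assumes "bounded_by G f M" shows "bounded_by G ((L ^^ n) f) (M * growth n)"
  unfolding bounded_by_def
proof
  fix \<omega> assume \<omega>: "\<omega> \<in> X"
  have "\<bar>(L ^^ n) f \<omega>\<bar> \<le> M * (L ^^ n) (\<lambda>_. 1) \<omega>" by (rule Lpow_le_one[OF assms \<omega>])
  also have "\<dots> \<le> M * growth n" by (rule mult_left_mono[OF Lpow_one_le[OF \<omega>] bounded_by_nonneg[OF assms]])
  finally show "norm ((L ^^ n) f \<omega>) \<le> M * growth n" by simp
qed

lemma growth_submult: "growth (m + n) \<le> growth m * growth n"
proof (rule growth_le)
  fix \<omega> assume \<omega>: "\<omega> \<in> X"
  have b: "bounded_by G ((L ^^ n) (\<lambda>_. 1)) (1 * growth n)" by (rule Lpow_bound) (simp add: bounded_by_def)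
  have "(L ^^ (m + n)) (\<lambda>_. 1) \<omega> \<le> \<bar>(L ^^ m) ((L ^^ n) (\<lambda>_. 1)) \<omega>\<bar>" by (simp add: Lpow_add_exp)
  also have "\<dots> \<le> growth n * growth m" using bounded_by_absD[OF Lpow_bound[OF b] \<omega>] by simp
  finally show "(L ^^ (m + n)) (\<lambda>_. 1) \<omega> \<le> growth m * growth n" by (simp add: mult.commute)
qed

lemma growth_0 [simp]: "growth 0 = 1"
  using X_nonempty by (simp add: growth_def)

text \<open>Along a periodic orbit the potential is bounded below.\<close>

lemma growth_lower: "\<exists>\<mu>>0. \<forall>n. \<mu> ^ n \<le> growth n"
proof -
  obtain e where "e \<in> arcs G" using arcs_nonempty by auto
  then obtain \<omega> p where \<omega>: "\<omega> \<in> X" "p \<ge> 1" "\<And>i. \<omega> (i + p) = \<omega> i" by (rule periodic_point_exists) blast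
  have per: "(shift ^^ (i mod p)) \<omega> = (shift ^^ i) \<omega>" for i
  proof (induction i rule: less_induct)
    case (less i)
    show ?case
    proof (cases "i < p")
      case False
      have "\<omega> (j + (i - p)) = \<omega> (j + i)" for j using \<omega>(3)[of "j + (i - p)"] False by simp
      then have "(shift ^^ (i - p)) \<omega> = (shift ^^ i) \<omega>" by (simp add: funpow_shift)
      then show ?thesis using less[of "i - p"] False \<omega>(2) by (simp add: mod_if)
    qed simp
  qed
  define m where "m = Min ((\<lambda>i. \<psi> ((shift ^^ i) \<omega>)) ` {..<p})"
  have m: "m \<le> \<psi> ((shift ^^ i) \<omega>)" for i
  proof -
    have "m \<le> \<psi> ((shift ^^ (i mod p)) \<omega>)" unfolding m_def using \<omega>(2) by (intro Min_le) auto
    then show ?thesis by (simp only: per)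
  qed
  have "exp m ^ n \<le> growth n" for n
  proof -
    have "exp m ^ n = exp (\<Sum>i<n. m)" by (simp add: exp_of_nat_mult[symmetric])
    also have "\<dots> \<le> exp (\<Sum>i<n. \<psi> ((shift ^^ i) \<omega>)) * 1" using m by (auto intro: sum_mono simp del: sum_constant)
    also have "\<dots> \<le> (L ^^ n) (\<lambda>_. 1) ((shift ^^ n) \<omega>)" by (rule Lpow_ge_term) (use \<omega> in auto)
    also have "\<dots> \<le> growth n" by (rule Lpow_one_le) (use \<omega> in simp)
    finally show ?thesis .
  qed
  then show ?thesis using exp_gt_zero by blast
qed

text \<open>The bounds \<open>v\<close> and \<open>u\<close> are functions in the cone instead of
  constants. The result is then again \<theta>^n times a function at \<open>\<omega>\<close>, and
  iteration yields the factor \<open>(L ^^ m) (\<lambda>_. 1) \<omega>\<close> whatever the growth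
  of the iterates is.\<close>

lemma lasota_yorke_step:
  assumes u: "cone u" "bd u" and v: "cone v" "bd v"
    and fv: "\<And>\<omega>. \<omega> \<in> X \<Longrightarrow> \<bar>f \<omega>\<bar> \<le> v \<omega>"
    and fu: "\<And>\<omega> \<upsilon> n. \<omega> \<in> X \<Longrightarrow> \<upsilon> \<in> X \<Longrightarrow> 1 \<le> n \<Longrightarrow> agree n \<omega> \<upsilon> \<Longrightarrow> \<bar>f \<omega> - f \<upsilon>\<bar> \<le> \<theta> ^ n * u \<omega>"
    and *: "\<omega> \<in> X" "\<upsilon> \<in> X" "1 \<le> n" "agree n \<omega> \<upsilon>"
  shows "\<bar>L f \<omega> - L f \<upsilon>\<bar> \<le> \<theta> ^ n * (\<theta> * (L u \<omega> + K * exp K * D * L v \<omega>))"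
proof -
  let ?K = "K * exp K * D" and ?t = "\<lambda>\<omega> e. exp (\<psi> (prepend e \<omega>)) * f (prepend e \<omega>)"
  obtain M where M: "bounded_by G v M" using v by (auto simp: bd_def)
  then have f: "bounded_by G f M" using fv unfolding bounded_by_def by fastforce
  have P: "preds G \<upsilon> = preds G \<omega>" using agree_preds[OF *(4,3), of G] by simp
  have b: "bd (\<lambda>\<omega>. u \<omega> + ?K * v \<omega>)" using u v by simp
  then obtain M' where M': "bounded_by G (\<lambda>\<omega>. u \<omega> + ?K * v \<omega>) M'" by (auto simp: bd_def)
  have "((\<lambda>e. ?t \<omega> e - ?t \<upsilon> e) has_sum (L f \<omega> - L f \<upsilon>)) (preds G \<omega>)"
    using has_sum_add[OF L_has_sum[OF *(1) f] has_sum_cmult_right[OF L_has_sum[OF *(2) f, unfolded P], of "-1"]]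
    by simp
  note diff = this
  have "((\<lambda>e. \<theta> ^ Suc n * (exp (\<psi> (prepend e \<omega>)) * (u (prepend e \<omega>) + ?K * v (prepend e \<omega>)))) has_sum
      \<theta> ^ Suc n * L (\<lambda>\<omega>. u \<omega> + ?K * v \<omega>) \<omega>) (preds G \<omega>)"
    by (rule has_sum_cmult_right[OF L_has_sum[OF *(1) M']])
  note bound = this
  have le: "norm (?t \<omega> e - ?t \<upsilon> e)
      \<le> \<theta> ^ Suc n * (exp (\<psi> (prepend e \<omega>)) * (u (prepend e \<omega>) + ?K * v (prepend e \<omega>)))"
    if e: "e \<in> preds G \<omega>" for e
  proof -
    let ?x = "prepend e \<omega>" and ?y = "prepend e \<upsilon>"
    have X: "?x \<in> X" "?y \<in> X" using * e P by simp_all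
    have a: "agree (Suc n) ?x ?y" by (rule agree_prepend[OF *(4)])
    have d: "\<bar>\<psi> ?y - \<psi> ?x\<bar> \<le> K * \<theta> ^ Suc n"
      using \<psi>_lip[OF X _ a] by (simp add: abs_minus_commute)
    have "\<bar>exp (\<psi> ?y - \<psi> ?x) - 1\<bar> \<le> K * \<theta> ^ Suc n * exp K"
      by (rule abs_exp_minus_one_le[OF d]) (use K_nonneg \<theta>_pow_le_1[of "Suc n"] mult_left_mono[of "\<theta> ^ Suc n" 1 K] in linarith)
    then have e1: "\<bar>exp (\<psi> ?x) - exp (\<psi> ?y)\<bar> \<le> exp (\<psi> ?x) * (K * \<theta> ^ Suc n * exp K)"
    proof -
      assume *: "\<bar>exp (\<psi> ?y - \<psi> ?x) - 1\<bar> \<le> K * \<theta> ^ Suc n * exp K"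
      have "exp (\<psi> ?x) - exp (\<psi> ?y) = exp (\<psi> ?x) * - (exp (\<psi> ?y - \<psi> ?x) - 1)"
        by (simp add: exp_diff algebra_simps)
      then have "\<bar>exp (\<psi> ?x) - exp (\<psi> ?y)\<bar> = exp (\<psi> ?x) * \<bar>exp (\<psi> ?y - \<psi> ?x) - 1\<bar>"
        by (simp only: abs_mult abs_minus_cancel abs_exp_cancel)
      then show ?thesis using mult_left_mono[OF *, of "exp (\<psi> ?x)"] by simp
    qed
    \<comment> \<open>Distortion moves the majorant from \<open>?y\<close> to \<open>?x\<close>, so
      that the sum over the letters becomes an application of \<open>L\<close> at
      \<open>\<omega>\<close> alone.\<close>
    have fy: "\<bar>f ?y\<bar> \<le> D * v ?x" using fv[OF X(2)] cone_D[OF v(1) X(2,1)] by simp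
    have "\<bar>?t \<omega> e - ?t \<upsilon> e\<bar> = \<bar>exp (\<psi> ?x) * (f ?x - f ?y) + (exp (\<psi> ?x) - exp (\<psi> ?y)) * f ?y\<bar>"
      by (simp add: algebra_simps)
    also have "\<dots> \<le> exp (\<psi> ?x) * \<bar>f ?x - f ?y\<bar> + \<bar>exp (\<psi> ?x) - exp (\<psi> ?y)\<bar> * \<bar>f ?y\<bar>"
      by (rule order_trans[OF abs_triangle_ineq]) (simp add: abs_mult)
    also have "\<dots> \<le> exp (\<psi> ?x) * (\<theta> ^ Suc n * u ?x) + (exp (\<psi> ?x) * (K * \<theta> ^ Suc n * exp K)) * (D * v ?x)"
      using fu[OF X _ a] e1 fy by (intro add_mono mult_mono mult_left_mono) (auto intro!: mult_nonneg_nonneg K_nonneg \<theta>_pos less_imp_le)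
    also have "\<dots> = \<theta> ^ Suc n * (exp (\<psi> ?x) * (u ?x + ?K * v ?x))"
      by (simp add: algebra_simps)
    finally show ?thesis by simp
  qed
  have "\<bar>L f \<omega> - L f \<upsilon>\<bar> \<le> \<theta> ^ Suc n * L (\<lambda>\<omega>. u \<omega> + ?K * v \<omega>) \<omega>"
    using has_sum_mono[OF diff bound] has_sum_mono[OF has_sum_cmult_right[OF diff, of "-1"] bound] le
    by (simp add: abs_le_iff)
  also have "L (\<lambda>\<omega>. u \<omega> + ?K * v \<omega>) \<omega> = L u \<omega> + ?K * L v \<omega>"
    using u v by (simp add: L_add' L_scale)
  finally show ?thesis by (simp add: mult_ac)
qed

text \<open>The solution of \<theta> * C_LY + \<theta> * (K * exp K * D) = C_LY, so that the
  supremum part of the inequality reproduces itself in each step.\<close>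

definition C_LY :: real where "C_LY = K * exp K * D * \<theta> / (1 - \<theta>)"

lemma C_LY_nonneg: "0 \<le> C_LY"
  unfolding C_LY_def using K_nonneg D_ge_1 \<theta>_pos \<theta>_less_1 by simp

lemma lasota_yorke:
  assumes f: "bounded_by G f M" "lipschitz_by G \<theta> f V" and V: "0 \<le> V"
    and *: "\<omega> \<in> X" "\<upsilon> \<in> X" "1 \<le> n" "agree n \<omega> \<upsilon>"
  shows "\<bar>(L ^^ m) f \<omega> - (L ^^ m) f \<upsilon>\<bar> \<le> \<theta> ^ n * ((\<theta> ^ m * V + C_LY * M) * (L ^^ m) (\<lambda>_. 1) \<omega>)"
  using *
proof (induction m arbitrary: \<omega> \<upsilon> n)
  case 0
  have "V * \<theta> ^ n \<le> \<theta> ^ n * (V + C_LY * M)"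
    using C_LY_nonneg bounded_by_nonneg[OF f(1)] \<theta>_pos by (simp add: algebra_simps)
  then show ?case using order_trans[OF lipschitz_byD[OF f(2) 0]] by simp
next
  case (Suc m)
  have M: "0 \<le> M" by (rule bounded_by_nonneg[OF f(1)])
  let ?c = "\<theta> ^ m * V + C_LY * M"
  have c: "0 \<le> ?c" using V M C_LY_nonneg \<theta>_pos by simp
  let ?one = "(L ^^ m) (\<lambda>_. 1)"
  have one: "cone ?one" "bd ?one" using cone_Lpow[OF cone_const] by auto
  have "\<bar>L ((L ^^ m) f) \<omega> - L ((L ^^ m) f) \<upsilon>\<bar>
      \<le> \<theta> ^ n * (\<theta> * (L (\<lambda>\<omega>. ?c * ?one \<omega>) \<omega> + K * exp K * D * L (\<lambda>\<omega>. M * ?one \<omega>) \<omega>))"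
    by (rule lasota_yorke_step[OF _ _ _ _ _ _ Suc.prems])
      (use one c M Suc.IH Lpow_le_one[OF f(1)] cone_scale in auto)
  also have "\<dots> = \<theta> ^ n * ((\<theta> * ?c + \<theta> * (K * exp K * D) * M) * L ?one \<omega>)"
    unfolding L_scale by (simp only: ring_distribs mult_ac)
  also have "\<theta> * ?c + \<theta> * (K * exp K * D) * M = \<theta> ^ Suc m * V + C_LY * M"
  proof -
    have "\<theta> * C_LY + \<theta> * (K * exp K * D) = C_LY"
      using \<theta>_less_1 by (simp add: C_LY_def field_simps)
    then have "\<theta> * C_LY * M + \<theta> * (K * exp K * D) * M = C_LY * M" by (simp add: distrib_right[symmetric])
    then show ?thesis by (simp add: algebra_simps)
  qed
  finally show ?case by simp
qed

lemma Lpow_lipschitz: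
  assumes "bounded_by G f M" "lipschitz_by G \<theta> f V" "0 \<le> V"
  shows "lipschitz_by G \<theta> ((L ^^ m) f) ((\<theta> ^ m * V + C_LY * M) * growth m)"
proof (rule lipschitz_byI)
  fix \<omega> \<upsilon> n assume *: "\<omega> \<in> X" "\<upsilon> \<in> X" "1 \<le> n" "agree n \<omega> \<upsilon>"
  have "\<bar>(L ^^ m) f \<omega> - (L ^^ m) f \<upsilon>\<bar> \<le> \<theta> ^ n * ((\<theta> ^ m * V + C_LY * M) * (L ^^ m) (\<lambda>_. 1) \<omega>)"
    by (rule lasota_yorke[OF assms *])
  also have "\<dots> \<le> \<theta> ^ n * ((\<theta> ^ m * V + C_LY * M) * growth m)"
    using Lpow_one_le[OF *(1), of m] assms(3) bounded_by_nonneg[OF assms(1)] C_LY_nonneg \<theta>_pos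
    by (intro mult_left_mono) auto
  finally show "norm ((L ^^ m) f \<omega> - (L ^^ m) f \<upsilon>) \<le> (\<theta> ^ m * V + C_LY * M) * growth m * \<theta> ^ n"
    by (simp add: mult_ac)
qed

end

section \<open>The leading eigenvalue and its eigenfunction\<close>

lemma has_sum_sum_index:
  fixes f :: "'i \<Rightarrow> 'a \<Rightarrow> 'b :: topological_comm_monoid_add"
  assumes "finite I" "\<And>i. i \<in> I \<Longrightarrow> (f i has_sum s i) A"
  shows "((\<lambda>x. \<Sum>i\<in>I. f i x) has_sum (\<Sum>i\<in>I. s i)) A"
  using assms by (induction I rule: finite_induct) (auto intro!: has_sum_add)

context potential
begin

lemma cone_lipschitz:
  assumes "cone f" "bounded_by G f M"
  shows "lipschitz_by G \<theta> f (K * \<theta> / (1 - \<theta>) * D * M)"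
proof (rule lipschitz_byI)
  define k where "k = K * \<theta> / (1 - \<theta>)"
  have k: "0 \<le> k" "D = exp k" using exponent_nonneg by (simp_all add: k_def D_def)
  have M: "0 \<le> M" by (rule bounded_by_nonneg[OF assms(2)])
  fix \<omega> \<upsilon> n assume *: "\<omega> \<in> X" "\<upsilon> \<in> X" "1 \<le> n" "agree n \<omega> \<upsilon>"
  have z: "0 \<le> k * \<theta> ^ n" "k * \<theta> ^ n \<le> k"
    using k \<theta>_pow_le_1[of n] \<theta>_pos mult_left_mono[of "\<theta> ^ n" 1 k] by auto
  have e: "exp (k * \<theta> ^ n) - 1 \<le> k * \<theta> ^ n * D"
    using abs_exp_minus_one_le[of "k * \<theta> ^ n" "k * \<theta> ^ n" k] z by (simp add: k(2))
  have le: "f x - f y \<le> k * D * M * \<theta> ^ n" if "x \<in> X" "y \<in> X" "agree n x y" for x y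
  proof -
    have "f x - f y \<le> (exp (k * \<theta> ^ n) - 1) * f y"
      using coneD[OF assms(1) that(1,2) *(3) that(3)] by (simp add: k_def algebra_simps)
    also have "\<dots> \<le> (k * \<theta> ^ n * D) * M"
      using e cone_nonneg[OF assms(1) that(2)] bounded_by_absD[OF assms(2) that(2)] z D_ge_1
      by (intro mult_mono) auto
    finally show ?thesis by (simp only: mult_ac)
  qed
  show "norm (f \<omega> - f \<upsilon>) \<le> K * \<theta> / (1 - \<theta>) * D * M * \<theta> ^ n"
    using le[OF *(1,2,4)] le[OF *(2,1) agree_sym[OF *(4)]] by (simp add: abs_le_iff k_def)
qed

text \<open>By submultiplicativity this is also the limit of the roots, the spectral radius on
  bounded functions. The infimum is the useful form: it gives \<open>lam ^ n \<le> growth n\<close>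
  for every \<open>n\<close>, and \<open>growth N \<le> x ^ N\<close> for arbitrarily large
  \<open>N\<close> once \<open>lam < x\<close>.\<close>

definition lam :: real where "lam = Inf ((\<lambda>n. root n (growth n)) ` {1..})"

lemma lam_bdd_below: "bdd_below ((\<lambda>n. root n (growth n)) ` {1..})"
  using growth_nonneg by (intro bdd_belowI[of _ 0]) auto

lemma lam_pos: "0 < lam"
proof -
  obtain \<mu> where \<mu>: "\<mu> > 0" "\<And>n. \<mu> ^ n \<le> growth n" using growth_lower by blast
  have "\<mu> \<le> root n (growth n)" if "n \<ge> 1" for n
  proof -
    have "root n (\<mu> ^ n) \<le> root n (growth n)" using \<mu>(2)[of n] that by simp
    then show ?thesis using \<mu>(1) that by (simp add: real_root_power_cancel)
  qed
  then have "\<mu> \<le> lam" unfolding lam_def by (intro cINF_greatest) auto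
  then show ?thesis using \<mu> by linarith
qed

lemma lam_pow_le: "lam ^ n \<le> growth n"
proof (cases "n = 0")
  case False
  then have "lam \<le> root n (growth n)" unfolding lam_def by (intro cINF_lower[OF lam_bdd_below]) auto
  then have "lam ^ n \<le> root n (growth n) ^ n" using lam_pos by (intro power_mono) auto
  then show ?thesis using False growth_nonneg by (simp add: real_root_pow_pos2)
qed simp

lemma growth_mult_le: "growth (n * j) \<le> growth n ^ j"
proof (induction j)
  case (Suc j)
  have "growth (n * Suc j) \<le> growth n * growth (n * j)" using growth_submult[of n "n * j"] by simp
  also have "\<dots> \<le> growth n * growth n ^ j" using Suc growth_nonneg by (intro mult_left_mono) auto
  finally show ?case by simp
qed simp

text \<open>One good index yields all its multiples by submultiplicativity, and the m-th multiple is
  at least \<open>m\<close>. At such an \<open>N\<close> the resolvent series can be cut with a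
  bounded boundary term.\<close>

lemma growth_le_pow:
  assumes "lam < x" obtains N where "m \<le> N" "growth N \<le> x ^ N"
proof -
  obtain n where n: "n \<ge> 1" "root n (growth n) < x"
    using assms unfolding lam_def by (subst (asm) cINF_less_iff[OF _ lam_bdd_below]) auto
  then have "growth n \<le> x ^ n"
    using power_mono[of "root n (growth n)" x n] growth_nonneg[of n] by (simp add: real_root_pow_pos2)
  then have "growth n ^ m \<le> (x ^ n) ^ m" using growth_nonneg by (intro power_mono) auto
  then have "growth (n * m) \<le> x ^ (n * m)" using growth_mult_le[of n m] by (simp add: power_mult)
  moreover have "m \<le> n * m" using n by simp
  ultimately show ?thesis by (rule that[rotated])
qed

text \<open>One more application of \<open>L\<close> sums over letters, and by distortion each
  letter may be sampled at its \<open>edge_point\<close>. The right-hand side no longer contains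
  \<open>\<omega>\<close>, so a countable sum of point values bounds
  \<open>growth (Suc n)\<close>.\<close>

lemma Lpow_one_Suc_le:
  assumes "\<omega> \<in> X"
  shows "(L ^^ Suc n) (\<lambda>_. 1) \<omega> \<le> D * (\<Sum>\<^sub>\<infinity>e\<in>arcs G. B e * (L ^^ n) (\<lambda>_. 1) (edge_point e))"
    and "(\<lambda>e. B e * (L ^^ n) (\<lambda>_. 1) (edge_point e)) summable_on arcs G"
proof -
  let ?g = "(L ^^ n) (\<lambda>_. 1)"
  have g: "cone ?g" "bounded_by G ?g (1 * growth n)"
    using cone_Lpow[OF cone_const] Lpow_bound[of "\<lambda>_. 1" 1] by (auto simp: bounded_by_def)
  show s: "(\<lambda>e. B e * ?g (edge_point e)) summable_on arcs G"
  proof (rule summable_on_comparison_test)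
    show "(\<lambda>e. B e * growth n) summable_on arcs G" by (rule summable_on_cmult_left[OF B_summable])
  qed (use g(2) Lpow_one_le Lpow_one_nonneg edge_point(1) B_nonneg in \<open>auto intro!: mult_left_mono mult_nonneg_nonneg\<close>)
  have "(L ^^ Suc n) (\<lambda>_. 1) \<omega> = (\<Sum>\<^sub>\<infinity>e\<in>preds G \<omega>. exp (\<psi> (prepend e \<omega>)) * ?g (prepend e \<omega>))"
    using assms by (simp add: L_def)
  also have "\<dots> \<le> (\<Sum>\<^sub>\<infinity>e\<in>arcs G. D * (B e * ?g (edge_point e)))"
  proof (rule infsum_mono_neutral)
    show "(\<lambda>e. exp (\<psi> (prepend e \<omega>)) * ?g (prepend e \<omega>)) summable_on preds G \<omega>"
      by (rule term_summable(1)[OF assms g(2)])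
    show "(\<lambda>e. D * (B e * ?g (edge_point e))) summable_on arcs G" by (rule summable_on_cmult_right[OF s])
    show "exp (\<psi> (prepend e \<omega>)) * ?g (prepend e \<omega>) \<le> D * (B e * ?g (edge_point e))"
      if "e \<in> preds G \<omega> \<inter> arcs G" for e
    proof -
      have e: "e \<in> arcs G" "prepend e \<omega> \<in> X" using that assms by auto
      have "exp (\<psi> (prepend e \<omega>)) * ?g (prepend e \<omega>) \<le> B e * (D * ?g (edge_point e))"
        using \<psi>_bound[OF e(2)] cone_D[OF g(1) e(2) edge_point(1)[OF e(1)]] edge_point(2)[OF e(1)] B_nonneg[OF e(1)]
          Lpow_one_nonneg[OF e(2)]
        by (intro mult_mono) auto
      then show ?thesis by (simp add: mult_ac)
    qed
    show "0 \<le> D * (B e * ?g (edge_point e))" if "e \<in> arcs G - preds G \<omega>" for e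
      using that D_ge_1 B_nonneg Lpow_one_nonneg edge_point(1) by auto
  qed (use preds_subset[of G \<omega>] in auto)
  also have "\<dots> = D * (\<Sum>\<^sub>\<infinity>e\<in>arcs G. B e * ?g (edge_point e))" by (rule infsum_cmult_right')
  finally show "(L ^^ Suc n) (\<lambda>_. 1) \<omega> \<le> D * (\<Sum>\<^sub>\<infinity>e\<in>arcs G. B e * ?g (edge_point e))" .
qed

text \<open>A truncated resolvent of \<open>L\<close> at \<open>x\<close>.\<close>

definition T :: "nat \<Rightarrow> real \<Rightarrow> ((nat \<Rightarrow> 'e) \<Rightarrow> real) \<Rightarrow> (nat \<Rightarrow> 'e) \<Rightarrow> real" where
  "T N x f \<omega> = (\<Sum>n<N. (1 / x) ^ Suc n * (L ^^ n) f \<omega>)"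

lemma T_Suc: "T (Suc N) x f = (\<lambda>\<omega>. T N x f \<omega> + (1 / x) ^ Suc N * (L ^^ N) f \<omega>)"
  by (rule ext) (simp add: T_def)

lemma T_0: "T 0 x f = (\<lambda>_. 0)"
  by (rule ext) (simp add: T_def)

lemma bd_T [simp]: "bd f \<Longrightarrow> bd (T N x f)"
  by (induction N) (auto simp: T_Suc T_0 simp del: power_Suc)

lemma cone_T: "cone f \<Longrightarrow> bd f \<Longrightarrow> 0 < x \<Longrightarrow> cone (T N x f)"
  by (induction N) (auto simp: T_Suc T_0 simp del: power_Suc intro!: cone_add cone_scale cone_Lpow cone_const)

lemma L_T: "bd f \<Longrightarrow> L (T N x f) = T N x (L f)"
proof (induction N)
  case 0
  then show ?case using L_scale[of 0 "\<lambda>_. 0"] by (simp add: T_0)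
next
  case (Suc N)
  then show ?case by (simp add: T_Suc L_add' L_scale funpow_swap1 del: power_Suc)
qed

text \<open>The resolvent identity: everything telescopes except \<open>f\<close> and the boundary
  term of the truncation.\<close>

lemma T_L:
  assumes "x > 0" "\<omega> \<in> X"
  shows "T N x (L f) \<omega> = x * T N x f \<omega> - f \<omega> + (1 / x) ^ N * (L ^^ N) f \<omega>"
proof (induction N)
  case (Suc N)
  have "x * (1 / x) ^ Suc N = (1 / x) ^ N" using assms by simp
  then show ?case using Suc by (simp add: T_Suc funpow_swap1 distrib_left mult.assoc[symmetric] del: power_Suc)
qed (simp add: T_def)

lemma T_diff: "bd f \<Longrightarrow> bd g \<Longrightarrow> T N x (\<lambda>\<omega>. f \<omega> - g \<omega>) = (\<lambda>\<omega>. T N x f \<omega> - T N x g \<omega>)"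
  by (rule ext) (simp add: T_def Lpow_diff sum_subtractf right_diff_distrib)

lemma T_add: "bd f \<Longrightarrow> bd g \<Longrightarrow> T N x (\<lambda>\<omega>. f \<omega> + g \<omega>) = (\<lambda>\<omega>. T N x f \<omega> + T N x g \<omega>)"
  by (rule ext) (simp add: T_def Lpow_add sum.distrib distrib_left)

lemma T_scale: "T N x (\<lambda>\<omega>. c * f \<omega>) = (\<lambda>\<omega>. c * T N x f \<omega>)"
  by (rule ext) (simp add: T_def Lpow_scale sum_distrib_left mult_ac)

lemma T_mono:
  assumes "bd f" "bd g" "\<And>\<omega>. \<omega> \<in> X \<Longrightarrow> f \<omega> \<le> g \<omega>" "0 < x" "\<omega> \<in> X"
  shows "T N x f \<omega> \<le> T N x g \<omega>"
  unfolding T_def by (intro sum_mono mult_left_mono Lpow_mono) (use assms in auto)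

lemma T_abs_le:
  assumes "bounded_by G f M" "0 < x" "\<omega> \<in> X"
  shows "\<bar>T N x f \<omega>\<bar> \<le> M * T N x (\<lambda>_. 1) \<omega>"
proof -
  have "\<bar>T N x f \<omega>\<bar> \<le> (\<Sum>n<N. (1 / x) ^ Suc n * (M * (L ^^ n) (\<lambda>_. 1) \<omega>))"
    unfolding T_def by (rule order_trans[OF sum_abs sum_mono])
      (use assms Lpow_le_one[OF assms(1,3)] in \<open>auto simp: abs_mult intro!: mult_left_mono divide_right_mono\<close>)
  then show ?thesis by (simp add: T_def sum_distrib_left mult_ac)
qed

text \<open>The growth condition bounds the boundary term of the truncation, and the last condition
  forces the truncated resolvents of 1 to become large. After normalisation the defect of invariance
  therefore tends to 0.\<close>

definition resolvent_seq :: "(nat \<Rightarrow> real) \<Rightarrow> (nat \<Rightarrow> nat) \<Rightarrow> bool" where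
  "resolvent_seq xs Ns \<longleftrightarrow> (\<forall>k. lam < xs k \<and> xs k < lam + 1 / real (Suc k) \<and> growth (Ns k) \<le> xs k ^ Ns k \<and>
     real k / 2 \<le> (\<Sum>n<Ns k. (lam / xs k) ^ Suc n))"

lemma resolvent_seq_exists: "\<exists>xs Ns. resolvent_seq xs Ns"
proof -
  have "\<exists>x N. lam < x \<and> x < lam + 1 / real (Suc k) \<and> growth N \<le> x ^ N \<and>
     real k / 2 \<le> (\<Sum>n<N. (lam / x) ^ Suc n)" for k
  proof -
    \<comment> \<open>For \<open>x\<close> close to \<open>lam\<close> each of the first
      \<open>k\<close> terms still exceeds 1/2, so they already sum to k/2. Further terms are
      nonnegative, which leaves \<open>N\<close> free above \<open>k\<close>.\<close>
    have "((\<lambda>x. (lam / x) ^ Suc k) \<longlongrightarrow> (lam / lam) ^ Suc k) (at_right lam)"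
      using lam_pos by (intro tendsto_intros) auto
    then have "eventually (\<lambda>x. 1 / 2 < (lam / x) ^ Suc k) (at_right lam)"
      using lam_pos by (intro order_tendstoD(1)) auto
    moreover have "eventually (\<lambda>x. lam < x \<and> x < lam + 1 / real (Suc k)) (at_right lam)"
      by (subst eventually_at_right[of lam "lam + 1"]) (auto intro!: exI[of _ "lam + 1 / real (Suc k)"])
    ultimately have "eventually (\<lambda>x. 1 / 2 < (lam / x) ^ Suc k \<and> lam < x \<and> x < lam + 1 / real (Suc k)) (at_right lam)"
      by (rule eventually_conj)
    then obtain x where x: "1 / 2 < (lam / x) ^ Suc k" "lam < x" "x < lam + 1 / real (Suc k)"
      using eventually_happens'[OF trivial_limit_at_right_real] by blast
    obtain N where N: "k \<le> N" "growth N \<le> x ^ N" by (rule growth_le_pow[OF x(2)])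
    have q: "0 \<le> lam / x" "lam / x \<le> 1" using x lam_pos by auto
    have "real k / 2 = (\<Sum>n<k. 1 / 2)" by simp
    also have "\<dots> \<le> (\<Sum>n<k. (lam / x) ^ Suc n)"
    proof (rule sum_mono)
      fix n assume "n \<in> {..<k}"
      then have "(lam / x) ^ Suc k \<le> (lam / x) ^ Suc n" using q by (intro power_decreasing) auto
      then show "1 / 2 \<le> (lam / x) ^ Suc n" using x(1) by linarith
    qed
    also have "\<dots> \<le> (\<Sum>n<N. (lam / x) ^ Suc n)"
      using N q(1) by (intro sum_mono2 zero_le_power) auto
    finally show ?thesis using x N by blast
  qed
  then have "\<exists>xs. \<forall>k. \<exists>N. lam < xs k \<and> xs k < lam + 1 / real (Suc k) \<and> growth N \<le> xs k ^ N \<and>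
     real k / 2 \<le> (\<Sum>n<N. (lam / xs k) ^ Suc n)" by (intro choice) blast
  then obtain xs where "\<forall>k. \<exists>N. lam < xs k \<and> xs k < lam + 1 / real (Suc k) \<and> growth N \<le> xs k ^ N \<and>
     real k / 2 \<le> (\<Sum>n<N. (lam / xs k) ^ Suc n)" by blast
  from choice[OF this] show ?thesis unfolding resolvent_seq_def by blast
qed

lemma resolvent_seq_tendsto: "resolvent_seq xs Ns \<Longrightarrow> xs \<longlonglongrightarrow> lam"
proof -
  assume "resolvent_seq xs Ns"
  then have b: "lam \<le> xs k" "xs k \<le> lam + 1 / real (Suc k)" for k
    by (auto simp: resolvent_seq_def less_imp_le)
  have "(\<lambda>k. lam + 1 / real (Suc k)) \<longlonglongrightarrow> lam + 0"
    by (intro tendsto_intros LIMSEQ_inverse_real_of_nat[unfolded inverse_eq_divide])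
  then show ?thesis
    using tendsto_sandwich[of "\<lambda>_. lam" xs sequentially "\<lambda>k. lam + 1 / real (Suc k)" lam] b
    by (auto intro!: always_eventually)
qed

text \<open>One \<open>M\<close> comes from the term \<open>f\<close> of the resolvent identity, the
  other from the boundary term through the growth condition.\<close>

lemma T_near_invariant:
  assumes "resolvent_seq xs Ns" "bounded_by G f M" "\<omega> \<in> X"
  shows "\<bar>T (Ns k) (xs k) (L f) \<omega> - xs k * T (Ns k) (xs k) f \<omega>\<bar> \<le> 2 * M"
proof -
  have x: "0 < xs k" "growth (Ns k) \<le> xs k ^ Ns k"
    using assms(1) lam_pos unfolding resolvent_seq_def by (auto intro: less_trans)
  have M: "0 \<le> M" by (rule bounded_by_nonneg[OF assms(2)])
  have "\<bar>(L ^^ Ns k) f \<omega>\<bar> \<le> M * growth (Ns k)" by (rule bounded_by_absD[OF Lpow_bound[OF assms(2)] assms(3)])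
  also have "\<dots> \<le> M * xs k ^ Ns k" by (rule mult_left_mono[OF x(2) M])
  finally have "(1 / xs k) ^ Ns k * \<bar>(L ^^ Ns k) f \<omega>\<bar> \<le> (1 / xs k) ^ Ns k * (M * xs k ^ Ns k)"
    using x by (intro mult_left_mono) auto
  then have "\<bar>(1 / xs k) ^ Ns k * (L ^^ Ns k) f \<omega>\<bar> \<le> M"
    using x by (simp add: abs_mult power_divide)
  then show ?thesis using T_L[OF x(1) assms(3), of "Ns k" f] bounded_by_absD[OF assms(2,3)] by linarith
qed

text \<open>If \<open>S\<close> bounds the resolvent of 1, then its values at the edge points,
  weighted by \<open>B\<close>, sum to at most \<open>S * SB\<close>. By
  \<open>Lpow_one_Suc_le\<close> this sum dominates, up to \<open>D\<close>, the series of (lam /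
  x)^(n+1). So the suprema grow at least linearly in \<open>k\<close>.\<close>

lemma T_one_large:
  assumes "resolvent_seq xs Ns" "\<And>\<omega>. \<omega> \<in> X \<Longrightarrow> T (Ns k) (xs k) (\<lambda>_. 1) \<omega> \<le> S"
  shows "real k / 2 \<le> D * (S * SB)"
proof -
  let ?x = "xs k" and ?N = "Ns k"
  have x: "0 < ?x" using assms(1) lam_pos unfolding resolvent_seq_def by (auto intro: less_trans)
  let ?m = "\<lambda>n. \<Sum>\<^sub>\<infinity>e\<in>arcs G. B e * (L ^^ n) (\<lambda>_. 1) (edge_point e)"
  obtain \<omega>\<^sub>0 where \<omega>\<^sub>0: "\<omega>\<^sub>0 \<in> X" using X_nonempty by auto
  have m: "growth (Suc n) \<le> D * ?m n" for n by (rule growth_le) (rule Lpow_one_Suc_le(1))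
  have sm: "((\<lambda>e. B e * (L ^^ n) (\<lambda>_. 1) (edge_point e)) has_sum ?m n) (arcs G)" for n
    using Lpow_one_Suc_le(2)[OF \<omega>\<^sub>0] by (rule has_sum_infsum)
  have "real k / 2 \<le> (\<Sum>n<?N. (lam / ?x) ^ Suc n)" using assms(1) by (simp add: resolvent_seq_def)
  also have "\<dots> \<le> (\<Sum>n<?N. D * ((1 / ?x) ^ Suc n * ?m n))"
  proof (rule sum_mono)
    fix n
    have "lam ^ Suc n \<le> D * ?m n" using lam_pow_le[of "Suc n"] m[of n] by linarith
    then have "(1 / ?x) ^ Suc n * lam ^ Suc n \<le> (1 / ?x) ^ Suc n * (D * ?m n)"
      using x by (intro mult_left_mono) auto
    then show "(lam / ?x) ^ Suc n \<le> D * ((1 / ?x) ^ Suc n * ?m n)"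
      by (simp add: power_divide mult_ac)
  qed
  also have "\<dots> = D * (\<Sum>n<?N. (1 / ?x) ^ Suc n * ?m n)" by (simp only: sum_distrib_left)
  also have "\<dots> \<le> D * (S * SB)"
  proof (rule mult_left_mono)
    have "((\<lambda>e. \<Sum>n<?N. (1 / ?x) ^ Suc n * (B e * (L ^^ n) (\<lambda>_. 1) (edge_point e))) has_sum
        (\<Sum>n<?N. (1 / ?x) ^ Suc n * ?m n)) (arcs G)"
      by (intro has_sum_sum_index has_sum_cmult_right sm) simp
    moreover have "((\<lambda>e. S * B e) has_sum S * SB) (arcs G)"
      unfolding SB_def using B_summable by (intro has_sum_cmult_right has_sum_infsum)
    moreover have "(\<Sum>n<?N. (1 / ?x) ^ Suc n * (B e * (L ^^ n) (\<lambda>_. 1) (edge_point e))) \<le> S * B e"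
      if e: "e \<in> arcs G" for e
    proof -
      have "(\<Sum>n<?N. (1 / ?x) ^ Suc n * (B e * (L ^^ n) (\<lambda>_. 1) (edge_point e)))
          = B e * T ?N ?x (\<lambda>_. 1) (edge_point e)"
        by (simp only: T_def sum_distrib_left mult_ac)
      also have "\<dots> \<le> B e * S" using assms(2) edge_point(1)[OF e] B_nonneg[OF e] by (intro mult_left_mono) auto
      finally show ?thesis by (simp add: mult.commute)
    qed
    ultimately show "(\<Sum>n<?N. (1 / ?x) ^ Suc n * ?m n) \<le> S * SB" by (rule has_sum_mono)
  qed (use D_ge_1 in simp)
  finally show ?thesis .
qed

text \<open>Positivity at one point spreads over the cylinder of its first letter by distortion, and
  from a letter to each successor by one term of \<open>L h\<close>; irreducibility reaches every
  letter.\<close>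

lemma eigenfunction_pos:
  assumes h: "cone h" "bd h" and eig: "\<And>\<omega>. \<omega> \<in> X \<Longrightarrow> L h \<omega> = l * h \<omega>" and l: "l > 0"
    and ne: "\<omega>\<^sub>0 \<in> X" "h \<omega>\<^sub>0 > 0" and \<omega>: "\<omega> \<in> X"
  shows "h \<omega> > 0"
proof -
  define P where "P e \<longleftrightarrow> (\<forall>\<omega>\<in>X. \<omega> 0 = e \<longrightarrow> h \<omega> > 0)" for e
  obtain M where M: "bounded_by G h M" using h by (auto simp: bd_def)
  have P0: "P (\<omega>\<^sub>0 0)" unfolding P_def
  proof (intro ballI impI)
    fix \<upsilon> assume "\<upsilon> \<in> X" "\<upsilon> 0 = \<omega>\<^sub>0 0"
    then have "h \<omega>\<^sub>0 \<le> D * h \<upsilon>" using cone_D[OF h(1) ne(1)] by simp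
    then have "0 < D * h \<upsilon>" using ne(2) by linarith
    then show "h \<upsilon> > 0" using D_ge_1 by (simp add: zero_less_mult_iff)
  qed
  have step: "P e'" if e: "P e" "(e, e') \<in> follows" for e e'
    unfolding P_def
  proof (intro ballI impI)
    fix \<upsilon> assume \<upsilon>: "\<upsilon> \<in> X" "\<upsilon> 0 = e'"
    have p: "e \<in> preds G \<upsilon>" using e \<upsilon> by (auto simp: follows_def preds_def incident_def)
    have "exp (\<psi> (prepend e \<upsilon>)) * h (prepend e \<upsilon>) \<le> L h (shift (prepend e \<upsilon>))"
      by (rule L_ge_term[OF M cone_nonneg[OF h(1)]]) (use p \<upsilon> in auto)
    moreover have "h (prepend e \<upsilon>) > 0" using e(1) p \<upsilon> by (auto simp: P_def)
    ultimately have "0 < L h \<upsilon>" using less_le_trans[OF mult_pos_pos[OF exp_gt_zero]] by simp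
    then show "h \<upsilon> > 0" using eig[OF \<upsilon>(1)] l by (simp add: zero_less_mult_iff)
  qed
  have "(\<omega>\<^sub>0 0, \<omega> 0) \<in> follows\<^sup>+"
    by (rule arcs_connected[OF shift_space_nth[OF ne(1)] shift_space_nth[OF \<omega>]])
  then have "P (\<omega> 0)" by (induction rule: trancl_induct) (use P0 step in blast)+
  then show ?thesis using \<omega> by (simp add: P_def)
qed

theorem eigenfunction_exists:
  obtains h where "cone h" "bounded_by G h 1" "\<And>\<omega>. \<omega> \<in> X \<Longrightarrow> L h \<omega> = lam * h \<omega>" "\<And>\<omega>. \<omega> \<in> X \<Longrightarrow> h \<omega> > 0"
proof -
  obtain xs Ns where R: "resolvent_seq xs Ns" using resolvent_seq_exists by blast
  \<comment> \<open>The shift to \<open>Suc k\<close> makes the lower bound of the suprema positive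
    at every index, so that all \<open>U k\<close> can be normalised.\<close>
  define U where "U k = T (Ns (Suc k)) (xs (Suc k)) (\<lambda>_. 1)" for k
  define S where "S k = (SUP \<omega>\<in>X. U k \<omega>)" for k
  have xpos: "0 < xs k" "lam < xs k" for k
    using R lam_pos unfolding resolvent_seq_def by (auto intro: less_trans)
  have U: "cone (U k)" "bd (U k)" for k unfolding U_def using cone_T cone_const xpos by auto
  have bdd: "bdd_above (U k ` X)" for k
  proof -
    obtain M where "bounded_by G (U k) M" using U(2) by (auto simp: bd_def)
    then show ?thesis by (auto simp: bounded_by_def abs_le_iff intro!: bdd_aboveI[of _ M])
  qed
  have US: "U k \<omega> \<le> S k" if "\<omega> \<in> X" for k \<omega> unfolding S_def by (rule cSUP_upper[OF that bdd])
  have S_ge: "real (Suc k) / 2 \<le> D * (S k * SB)" for k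
    by (rule T_one_large[OF R]) (use US in \<open>simp add: U_def\<close>)
  have S_pos: "0 < S k" for k
  proof -
    have "0 < D * (S k * SB)" by (rule less_le_trans[OF _ S_ge]) simp
    then show ?thesis using D_ge_1 SB_pos by (simp add: zero_less_mult_iff)
  qed
  define g where "g k \<omega> = 1 / S k * U k \<omega>" for k \<omega>
  have g: "cone (g k)" for k unfolding g_def by (rule cone_scale[OF U(1)]) (use S_pos in \<open>simp add: less_imp_le\<close>)
  have g1: "bounded_by G (g k) 1" for k
    unfolding bounded_by_def
  proof
    fix \<omega> assume "\<omega> \<in> X"
    then show "norm (g k \<omega>) \<le> 1"
      using US[of \<omega> k] S_pos[of k] cone_nonneg[OF U(1), of \<omega> k] by (simp add: g_def)
  qed
  have gU: "g k = (\<lambda>\<omega>. 1 / S k * U k \<omega>)" for k by (rule ext) (simp add: g_def)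
  have near: "\<bar>L (g k) \<omega> - xs (Suc k) * g k \<omega>\<bar> \<le> 2 / S k" if "\<omega> \<in> X" for k \<omega>
  proof -
    have "\<bar>L (U k) \<omega> - xs (Suc k) * U k \<omega>\<bar> \<le> 2 * 1" unfolding U_def
      by (subst L_T) (use T_near_invariant[OF R _ that, of "\<lambda>_. 1" 1] in \<open>auto simp: bounded_by_def\<close>)
    then have "\<bar>1 / S k * (L (U k) \<omega> - xs (Suc k) * U k \<omega>)\<bar> \<le> 1 / S k * 2"
      using S_pos[of k] by (simp add: abs_mult divide_right_mono)
    then show ?thesis unfolding gU L_scale by (simp add: algebra_simps)
  qed
  have S_inv: "(\<lambda>k. 2 / S k) \<longlonglongrightarrow> 0"
  proof (rule tendsto_sandwich[of "\<lambda>_. 0"])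
    have "2 / S k \<le> 4 * D * SB * (1 / real (Suc k))" for k
      using S_ge[of k] S_pos[of k] by (simp add: field_simps)
    then show "eventually (\<lambda>k. 2 / S k \<le> 4 * D * SB * (1 / real (Suc k))) sequentially"
      by (simp add: always_eventually)
    have "(\<lambda>k. 4 * D * SB * (1 / real (Suc k))) \<longlonglongrightarrow> 4 * D * SB * 0"
      by (intro tendsto_intros LIMSEQ_inverse_real_of_nat[unfolded inverse_eq_divide])
    then show "(\<lambda>k. 4 * D * SB * (1 / real (Suc k))) \<longlonglongrightarrow> 0" by simp
  qed (use S_pos in \<open>auto simp: less_imp_le\<close>)
  obtain \<sigma> h where \<sigma>: "strict_mono \<sigma>" and lim: "\<And>\<omega>. \<omega> \<in> X \<Longrightarrow> (\<lambda>k. g (\<sigma> k) \<omega>) \<longlonglongrightarrow> h \<omega>"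
    and h1: "bounded_by G h 1"
    using ascoli[of g, OF g1 cone_lipschitz[OF g g1]] by blast
  have h: "cone h" unfolding cone_def
  proof (intro conjI ballI allI impI)
    fix \<omega> assume "\<omega> \<in> X"
    then show "0 \<le> h \<omega>" by (intro LIMSEQ_le_const[OF lim]) (use cone_nonneg[OF g] in auto)
  next
    fix \<omega> \<upsilon> n assume *: "\<omega> \<in> X" "\<upsilon> \<in> X" "1 \<le> n" "agree n \<omega> \<upsilon>"
    show "h \<omega> \<le> exp (K * \<theta> / (1 - \<theta>) * \<theta> ^ n) * h \<upsilon>"
      by (rule LIMSEQ_le[OF lim[OF *(1)] tendsto_mult_left[OF lim[OF *(2)]]]) (use coneD[OF g *] in auto)
  qed
  have sub: "(\<lambda>k. 2 / S (\<sigma> k)) \<longlonglongrightarrow> 0" "(\<lambda>k. xs (Suc (\<sigma> k))) \<longlonglongrightarrow> lam"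
    using LIMSEQ_subseq_LIMSEQ[OF S_inv \<sigma>]
      LIMSEQ_subseq_LIMSEQ[OF LIMSEQ_Suc[OF resolvent_seq_tendsto[OF R]] \<sigma>] by (simp_all add: comp_def)
  have eig: "L h \<omega> = lam * h \<omega>" if "\<omega> \<in> X" for \<omega>
  proof -
    have "(\<lambda>k. L (g (\<sigma> k)) \<omega> - xs (Suc (\<sigma> k)) * g (\<sigma> k) \<omega>) \<longlonglongrightarrow> L h \<omega> - lam * h \<omega>"
      by (intro tendsto_intros L_tendsto[OF g1] lim sub that)
    moreover have "(\<lambda>k. L (g (\<sigma> k)) \<omega> - xs (Suc (\<sigma> k)) * g (\<sigma> k) \<omega>) \<longlonglongrightarrow> 0"
      by (rule Lim_null_comparison[OF _ sub(1)]) (use near[OF that] in \<open>auto intro!: always_eventually\<close>)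
    ultimately show ?thesis using LIMSEQ_unique by fastforce
  qed
  \<comment> \<open>A pointwise limit of functions with supremum 1 might vanish. Then some
    \<open>g\<close> is small at finitely many edge points, and with a small tail of
    \<open>B\<close> both \<open>L g\<close> and the defect stay below lam/2 in total on all of
    \<open>X\<close>. Near invariance gives g < 1/2 everywhere, against the supremum 1.\<close>
  have "\<exists>\<omega>\<in>X. h \<omega> > 0"
  proof (rule ccontr)
    assume "\<not> ?thesis"
    then have h0: "h \<omega> = 0" if "\<omega> \<in> X" for \<omega> using cone_nonneg[OF h that] that by force
    obtain F where F: "finite F" "F \<subseteq> arcs G" "infsum B (arcs G - F) < lam / 4"
      using tail_small[of "lam / 4"] lam_pos by auto
    have "(\<lambda>k. \<Sum>e\<in>F. B e * (D * g (\<sigma> k) (edge_point e))) \<longlonglongrightarrow> (\<Sum>e\<in>F. B e * (D * 0))"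
      using lim[OF edge_point(1)] h0[OF edge_point(1)] F(2) by (intro tendsto_intros) (force dest: subsetD)
    then have "(\<lambda>k. 2 / S (\<sigma> k) + ((\<Sum>e\<in>F. B e * (D * g (\<sigma> k) (edge_point e))) + infsum B (arcs G - F)))
        \<longlonglongrightarrow> 0 + (0 + infsum B (arcs G - F))"
      using sub(1) by (intro tendsto_intros) auto
    then have "eventually (\<lambda>k. 2 / S (\<sigma> k) + ((\<Sum>e\<in>F. B e * (D * g (\<sigma> k) (edge_point e))) + infsum B (arcs G - F))
        < lam / 2) sequentially"
      using F(3) lam_pos by (intro order_tendstoD(2)) auto
    then obtain k where k: "2 / S (\<sigma> k) + ((\<Sum>e\<in>F. B e * (D * g (\<sigma> k) (edge_point e))) + infsum B (arcs G - F))
        < lam / 2" using eventually_happens' sequentially_bot by blast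
    let ?g = "g (\<sigma> k)"
    have "U (\<sigma> k) \<omega> \<le> S (\<sigma> k) / 2" if \<omega>: "\<omega> \<in> X" for \<omega>
    proof -
      have "\<bar>L ?g \<omega>\<bar> \<le> (\<Sum>e\<in>F \<inter> preds G \<omega>. B e * \<bar>?g (prepend e \<omega>)\<bar>) + 1 * infsum B (arcs G - F)"
        by (rule L_split_bound[OF \<omega> F(1,2) g1])
      also have "(\<Sum>e\<in>F \<inter> preds G \<omega>. B e * \<bar>?g (prepend e \<omega>)\<bar>)
          \<le> (\<Sum>e\<in>F \<inter> preds G \<omega>. B e * (D * ?g (edge_point e)))"
      proof (intro sum_mono mult_left_mono)
        fix e assume "e \<in> F \<inter> preds G \<omega>"
        then have e: "e \<in> arcs G" "prepend e \<omega> \<in> X" using F \<omega> by auto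
        show "\<bar>?g (prepend e \<omega>)\<bar> \<le> D * ?g (edge_point e)"
          using cone_D[OF g e(2) edge_point(1)[OF e(1)]] edge_point(2)[OF e(1)] cone_nonneg[OF g e(2)] by simp
        show "0 \<le> B e" by (rule B_nonneg[OF e(1)])
      qed
      also have "\<dots> \<le> (\<Sum>e\<in>F. B e * (D * ?g (edge_point e)))"
      proof (rule sum_mono2)
        show "0 \<le> B e * (D * ?g (edge_point e))" if "e \<in> F - F \<inter> preds G \<omega>" for e
          using that F(2) B_nonneg D_ge_1 cone_nonneg[OF g] edge_point(1) by (intro mult_nonneg_nonneg) auto
      qed (use F in auto)
      finally have "xs (Suc (\<sigma> k)) * ?g \<omega> < lam / 2" using k near[OF \<omega>, of "\<sigma> k"] by linarith
      moreover have "lam * ?g \<omega> \<le> xs (Suc (\<sigma> k)) * ?g \<omega>"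
        using xpos cone_nonneg[OF g \<omega>] by (intro mult_right_mono) (auto simp: less_imp_le)
      ultimately have "lam * ?g \<omega> < lam * (1 / 2)" by simp
      then have "?g \<omega> < 1 / 2" using lam_pos by (simp only: mult_less_cancel_left_pos)
      then show ?thesis using S_pos[of "\<sigma> k"] by (simp add: g_def field_simps)
    qed
    then have "S (\<sigma> k) \<le> S (\<sigma> k) / 2" unfolding S_def by (intro cSUP_least[OF X_nonempty])
    then show False using S_pos[of "\<sigma> k"] by simp
  qed
  then have "h \<omega> > 0" if "\<omega> \<in> X" for \<omega>
    using eigenfunction_pos[OF h bdI[OF h1] eig lam_pos _ _ that] by blast
  then show ?thesis using that h h1 eig by blast
qed

end

section \<open>Measures on sequences with prescribed cylinder masses\<close>

lemma nn_integral_count_space_has_sum: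
  fixes f :: "'a \<Rightarrow> real"
  assumes "(f has_sum S) A" "\<And>x. x \<in> A \<Longrightarrow> 0 \<le> f x"
  shows "(\<integral>\<^sup>+x. ennreal (f x) \<partial>count_space A) = ennreal S"
proof -
  have "(\<lambda>x. norm (f x)) summable_on A"
    using assms by (subst summable_on_cong[of A _ f]) (auto dest: has_sum_imp_summable)
  then have "Infinite_Set_Sum.abs_summable_on f A" by (rule iffD1[OF abs_summable_equivalent])
  then show ?thesis
    using nn_integral_conv_infsetsum[of f A] infsetsum_infsum[of f A] assms by (simp add: infsumI)
qed

text \<open>The quotients m(w e) / m(w) are conditional laws of the next letter, of total mass 1 by
  consistency; the theorem of Ionescu Tulcea glues them to a measure on sequences.\<close>

lemma cylinder_measure_exists:
  fixes E :: "'e set" and m :: "'e list \<Rightarrow> real"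
  assumes E: "countable E" "E \<noteq> {}" and nil: "m [] = 1"
    and nonneg: "\<And>w. w \<in> lists E \<Longrightarrow> 0 \<le> m w"
    and consistent: "\<And>w. w \<in> lists E \<Longrightarrow> ((\<lambda>e. m (w @ [e])) has_sum m w) E"
  shows "\<exists>M. prob_space M \<and> sets M = sets (PiM UNIV (\<lambda>_::nat. count_space E)) \<and>
    (\<forall>w\<in>lists E. measure M {\<omega> \<in> space M. \<forall>i<length w. \<omega> i = w ! i} = m w)"
proof -
  obtain e\<^sub>0 where e\<^sub>0: "e\<^sub>0 \<in> E" using E by auto
  define word where "word n \<omega> = map \<omega> [0..<n]" for n and \<omega> :: "nat \<Rightarrow> 'e"
  \<comment> \<open>After a word of mass 0 the quotient is meaningless; the point mass at
    \<open>e\<^sub>0\<close> is an arbitrary choice that keeps the kernel a probability.\<close>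
  define P where "P n \<omega> = density (count_space E)
      (\<lambda>e. ennreal (if m (word n \<omega>) = 0 then indicator {e\<^sub>0} e else m (word n \<omega> @ [e]) / m (word n \<omega>)))" for n \<omega>
  let ?M = "\<lambda>_::nat. count_space E"
  have PiM: "PiM {0..<n} ?M = count_space (PiE {0..<n} (\<lambda>_. E))" for n
    by (rule count_space_PiM_finite) (use E in auto)
  have word: "word n \<omega> \<in> lists E" if "\<omega> \<in> PiE {0..<n} (\<lambda>_. E)" for n \<omega>
    using that by (auto simp: word_def)
  have P_prob: "prob_space (P n \<omega>)" if \<omega>: "\<omega> \<in> space (PiM {0..<n} ?M)" for n \<omega>
  proof
    have w: "word n \<omega> \<in> lists E" using word \<omega> by (simp add: PiM)
    let ?f = "\<lambda>e. if m (word n \<omega>) = 0 then indicator {e\<^sub>0} e else m (word n \<omega> @ [e]) / m (word n \<omega>)"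
    have f: "(?f has_sum 1) E"
    proof (cases "m (word n \<omega>) = 0")
      case True
      have "((\<lambda>e. indicator {e\<^sub>0} e :: real) has_sum 1) E"
        by (rule has_sum_finite_neutralI[of "{e\<^sub>0}"]) (use e\<^sub>0 in auto)
      then show ?thesis using True by simp
    next
      case False
      then show ?thesis using has_sum_cmult_right[OF consistent[OF w], of "1 / m (word n \<omega>)"] by simp
    qed
    have nn: "?f e \<ge> 0" if "e \<in> E" for e
      using nonneg[OF w] nonneg[of "word n \<omega> @ [e]"] w that by auto
    have "emeasure (P n \<omega>) (space (P n \<omega>)) = (\<integral>\<^sup>+e. ennreal (?f e) \<partial>count_space E)"
      unfolding P_def by (subst emeasure_density) (auto intro!: nn_integral_cong)
    also have "\<dots> = ennreal 1" by (rule nn_integral_count_space_has_sum[OF f nn])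
    also have "\<dots> = 1" by simp
    finally show "emeasure (P n \<omega>) (space (P n \<omega>)) = 1" .
  qed
  interpret IT: Ionescu_Tulcea P ?M
  proof (rule Ionescu_Tulcea.intro)
    fix n show "P n \<in> measurable (PiM {0..<n} ?M) (subprob_algebra (count_space E))"
      unfolding PiM measurable_count_space_eq1
    proof
      fix \<omega> assume "\<omega> \<in> PiE {0..<n} (\<lambda>_. E)"
      then have "prob_space (P n \<omega>)" using P_prob by (simp add: PiM)
      then show "P n \<omega> \<in> space (subprob_algebra (count_space E))"
        unfolding space_subprob_algebra mem_Collect_eq
        by (intro conjI prob_space_imp_subprob_space) (simp_all add: P_def)
    qed
  qed (rule P_prob)
  \<comment> \<open>The law of the first \<open>n\<close> letters at single points: each kernel
    multiplies the mass of the word so far by the conditional mass of the next letter.\<close>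
  have C: "emeasure (IT.C 0 n (\<lambda>_. undefined)) {x} = ennreal (m (word n x))"
    if "x \<in> PiE {0..<n} (\<lambda>_. E)" for n x
    using that
  proof (induction n arbitrary: x)
    case 0
    have "PiM {} ?M = count_space {\<lambda>_. undefined}" by (rule PiM_empty)
    then show ?case using 0 nil by (simp add: word_def)
  next
    case (Suc n)
    define y where "y = restrict x {0..<n}"
    have y: "y \<in> PiE {0..<n} (\<lambda>_. E)" and xn: "x n \<in> E" using Suc.prems by (auto simp: PiE_iff y_def)
    have wy: "word n y = word n x" by (simp add: word_def y_def)
    have w: "word n x \<in> lists E" using word[OF y] wy by simp
    have sp: "(\<lambda>_. undefined) \<in> space (PiM {0..<0} ?M)" by simp
    let ?C = "IT.C 0 n (\<lambda>_. undefined)"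
    have C_sets: "sets ?C = Pow (PiE {0..<n} (\<lambda>_. E))" using IT.sets_C[OF sp, of n] by (simp add: PiM)
    have C_space: "space ?C = PiE {0..<n} (\<lambda>_. E)" using IT.space_C[OF sp, of n] by (simp add: PiM)
    have upd: "fun_upd z n e = x \<longleftrightarrow> z = y \<and> e = x n" if "z \<in> PiE {0..<n} (\<lambda>_. E)" "e \<in> E" for z e
    proof
      assume u: "fun_upd z n e = x"
      have "z = y"
      proof
        fix i show "z i = y i" using u that(1) by (cases "i < n") (auto simp: y_def PiE_iff extensional_def)
      qed
      then show "z = y \<and> e = x n" using u by auto
    next
      assume u: "z = y \<and> e = x n"
      show "fun_upd z n e = x"
      proof
        fix i show "fun_upd z n e i = x i"
          using u Suc.prems by (cases "i < n") (auto simp: y_def PiE_iff extensional_def)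
      qed
    qed
    have "emeasure (IT.C 0 (Suc n) (\<lambda>_. undefined)) {x} = (\<integral>\<^sup>+z. emeasure (IT.eP n z) {x} \<partial>?C)"
    proof -
      have "IT.eP n \<in> measurable ?C (subprob_algebra (PiM {0..<Suc n} ?M))"
        using IT.measurable_eP[of n] by (subst measurable_cong_sets[of ?C "PiM {0..<n} ?M"]) (auto simp: C_sets PiM)
      moreover have "{x} \<in> sets (PiM {0..<Suc n} ?M)" using Suc.prems by (simp add: PiM)
      moreover have "space ?C \<noteq> {}" using y by (auto simp: C_space)
      ultimately show ?thesis by (simp add: emeasure_bind)
    qed
    also have "\<dots> = (\<integral>\<^sup>+z. emeasure (P n y) {x n} * indicator {y} z \<partial>?C)"
    proof (rule nn_integral_cong)
      fix z assume "z \<in> space ?C"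
      then have z: "z \<in> PiE {0..<n} (\<lambda>_. E)" by (simp add: C_space)
      have "emeasure (IT.eP n z) {x} = emeasure (P n z) ((\<lambda>e. fun_upd z n e) -` {x} \<inter> E)"
        by (subst IT.emeasure_eP) (use z Suc.prems in \<open>auto simp: PiM\<close>)
      also have "(\<lambda>e. fun_upd z n e) -` {x} \<inter> E = (if z = y then {x n} else {})"
        using upd[OF z] xn by (auto simp del: fun_upd_apply)
      finally show "emeasure (IT.eP n z) {x} = emeasure (P n y) {x n} * indicator {y} z"
        by (cases "z = y") simp_all
    qed
    also have "\<dots> = emeasure (P n y) {x n} * emeasure ?C {y}"
      by (rule nn_integral_cmult_indicator) (use y in \<open>simp add: C_sets\<close>)
    also have "emeasure ?C {y} = ennreal (m (word n x))" using Suc.IH[OF y] wy by simp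
    also have "emeasure (P n y) {x n} = ennreal (if m (word n x) = 0 then indicator {e\<^sub>0} (x n) else m (word n x @ [x n]) / m (word n x))"
      unfolding P_def wy using xn by (subst emeasure_density) (auto simp: nn_integral_count_space_indicator[symmetric])
    \<comment> \<open>Both cases fit because consistency bounds the mass of an extension by that of
      the word: a null word has only null extensions.\<close>
    also have "\<dots> * ennreal (m (word n x)) = ennreal (m (word n x @ [x n]))"
    proof (cases "m (word n x) = 0")
      case True
      have "m (word n x @ [x n]) \<le> m (word n x)"
        using finite_sum_le_has_sum[OF consistent[OF w], of "{x n}"] xn nonneg w by auto
      then show ?thesis using True nonneg[of "word n x @ [x n]"] w xn by simp
    next
      case False
      then show ?thesis using nonneg[OF w] nonneg[of "word n x @ [x n]"] w xn by (simp add: ennreal_mult[symmetric])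
    qed
    finally show ?case by (simp add: word_def)
  qed
  have lim_cyl: "emeasure IT.PF.lim {\<omega> \<in> space IT.PF.lim. \<forall>i<length w. \<omega> i = w ! i} = ennreal (m w)"
    if w: "w \<in> lists E" for w
  proof -
    let ?n = "length w"
    define x where "x = restrict (\<lambda>i. w ! i) {0..<?n}"
    have x: "x \<in> PiE {0..<?n} (\<lambda>_. E)" using w by (auto simp: x_def lists_eq_set)
    have wx: "word ?n x = w" by (rule nth_equalityI) (auto simp: word_def x_def)
    have "{\<omega> \<in> space IT.PF.lim. \<forall>i<?n. \<omega> i = w ! i} = IT.PF.emb UNIV {0..<?n} {x}"
      by (auto simp: prod_emb_def x_def fun_eq_iff space_PiM restrict_def split: if_splits)
    then have "emeasure IT.PF.lim {\<omega> \<in> space IT.PF.lim. \<forall>i<?n. \<omega> i = w ! i} = emeasure (IT.CI {0..<?n}) {x}"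
      using IT.lim[of "{0..<?n}" "{x}"] x by (simp add: PiM)
    also have "\<dots> = emeasure (IT.C 0 ?n (\<lambda>_. undefined)) (IT.PF.emb {0..<?n} {0..<?n} {x})"
      by (rule IT.emeasure_CI) (use x in \<open>auto simp: PiM\<close>)
    also have "IT.PF.emb {0..<?n} {0..<?n} {x} = {x}" 
      using x by (intro prod_emb_id) (auto simp: PiE_iff)
    finally show ?thesis using C[OF x] wx by simp
  qed
  show ?thesis
  proof (intro exI conjI ballI)
    have "emeasure IT.PF.lim (space IT.PF.lim) = 1" using lim_cyl[of "[]"] nil by simp
    then show "prob_space IT.PF.lim" by (rule prob_spaceI)
    show "sets IT.PF.lim = sets (PiM UNIV (\<lambda>_::nat. count_space E))" by simp
    show "measure IT.PF.lim {\<omega> \<in> space IT.PF.lim. \<forall>i<length w. \<omega> i = w ! i} = m w" if "w \<in> lists E" for w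
      using lim_cyl[OF that] nonneg[OF that] by (simp add: measure_def)
  qed
qed

section \<open>Topology and Borel sets of the edge shift\<close>

context edge_shift
begin

lemma mem_edge_union: "\<omega> \<in> edge_union G E \<longleftrightarrow> \<omega> \<in> X \<and> \<omega> 0 \<in> E"
  by (auto simp: edge_union_def cylinder_def)

lemma lipschitz_by_mono:
  assumes "lipschitz_by G \<theta> f V" "V \<le> V'" shows "lipschitz_by G \<theta> f V'"
  by (rule lipschitz_byI, rule order_trans[OF lipschitz_byD[OF assms(1)]])
    (use assms(2) \<theta>_pos in \<open>auto intro: mult_right_mono\<close>)

text \<open>The closed balls of radius \<theta>^n are cylinders of length \<open>n\<close>; this
  translates the metric notions into agreement of letters.\<close>

lemma shift_dist_le_iff: "shift_dist \<theta> \<omega> \<upsilon> \<le> \<theta> ^ n \<longleftrightarrow> agree n \<omega> \<upsilon>"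
proof (cases "\<omega> = \<upsilon>")
  case False
  let ?k = "LEAST n. \<omega> n \<noteq> \<upsilon> n"
  have k: "\<omega> ?k \<noteq> \<upsilon> ?k" using False by (intro LeastI_ex[of "\<lambda>n. \<omega> n \<noteq> \<upsilon> n"]) auto
  have below: "\<omega> i = \<upsilon> i" if "i < ?k" for i using not_less_Least[OF that] by simp
  have "shift_dist \<theta> \<omega> \<upsilon> \<le> \<theta> ^ n \<longleftrightarrow> n \<le> ?k"
    using False power_decreasing_iff[OF \<theta>_pos \<theta>_less_1] by (simp add: shift_dist_def)
  also have "\<dots> \<longleftrightarrow> agree n \<omega> \<upsilon>"
    unfolding agree_def using k below by (meson leI less_le_trans)
  finally show ?thesis .
qed (use \<theta>_pos in \<open>simp add: shift_dist_def\<close>)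

lemma shift_dist_nonneg: "0 \<le> shift_dist \<theta> \<omega> \<upsilon>"
  using \<theta>_pos by (simp add: shift_dist_def)

lemma shift_dist_cases:
  obtains "\<omega> = \<upsilon>" "shift_dist \<theta> \<omega> \<upsilon> = 0" | n where "shift_dist \<theta> \<omega> \<upsilon> = \<theta> ^ n"
  by (cases "\<omega> = \<upsilon>") (simp_all add: shift_dist_def)

lemma Metric_shift: "Metric_space X (shift_dist \<theta>)"
proof
  show "shift_dist \<theta> \<omega> \<upsilon> = shift_dist \<theta> \<upsilon> \<omega>" for \<omega> \<upsilon> by (simp add: shift_dist_def eq_commute)
  show "shift_dist \<theta> \<omega> \<upsilon> = 0 \<longleftrightarrow> \<omega> = \<upsilon>" for \<omega> \<upsilon> using \<theta>_pos by (simp add: shift_dist_def)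
  show "shift_dist \<theta> \<omega> \<zeta> \<le> shift_dist \<theta> \<omega> \<upsilon> + shift_dist \<theta> \<upsilon> \<zeta>" for \<omega> \<upsilon> \<zeta>
  proof -
    \<comment> \<open>The distance is an ultrametric: two agreements combine to the shorter
      one.\<close>
    have "shift_dist \<theta> \<omega> \<zeta> \<le> max (shift_dist \<theta> \<omega> \<upsilon>) (shift_dist \<theta> \<upsilon> \<zeta>)"
    proof (cases \<omega> \<upsilon> rule: shift_dist_cases)
      case (2 m)
      show ?thesis
      proof (cases \<upsilon> \<zeta> rule: shift_dist_cases)
        case (2 n)
        have "agree m \<omega> \<upsilon>" "agree n \<upsilon> \<zeta>"
          using shift_dist_le_iff \<open>shift_dist \<theta> \<omega> \<upsilon> = \<theta> ^ m\<close> \<open>shift_dist \<theta> \<upsilon> \<zeta> = \<theta> ^ n\<close> by (metis order_refl)+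
        then have "agree (min m n) \<omega> \<zeta>" by (auto simp: agree_def)
        then have "shift_dist \<theta> \<omega> \<zeta> \<le> \<theta> ^ min m n" by (simp add: shift_dist_le_iff)
        then show ?thesis using \<open>shift_dist \<theta> \<omega> \<upsilon> = \<theta> ^ m\<close> 2 by (auto simp: min_def split: if_splits)
      qed auto
    qed auto
    then show ?thesis using shift_dist_nonneg[of \<omega> \<upsilon>] shift_dist_nonneg[of \<upsilon> \<zeta>] by auto
  qed
qed (rule shift_dist_nonneg)

lemma pow_less: assumes "\<epsilon> > 0" obtains n where "n \<ge> 1" "\<theta> ^ n < \<epsilon>"
proof -
  obtain n where n: "\<theta> ^ n < \<epsilon>" using real_arch_pow_inv[OF assms \<theta>_less_1] by auto
  have "\<theta> ^ Suc n \<le> \<theta> ^ n" using \<theta>_pos \<theta>_less_1 by (intro power_decreasing) auto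
  then have "\<theta> ^ Suc n < \<epsilon>" using n by linarith
  then show ?thesis by (rule that[rotated]) simp
qed

lemma openin_shift_iff:
  "openin (shift_topology G \<theta>) U \<longleftrightarrow> U \<subseteq> X \<and> (\<forall>\<omega>\<in>U. \<exists>n. \<forall>\<upsilon>\<in>X. agree n \<omega> \<upsilon> \<longrightarrow> \<upsilon> \<in> U)"
proof -
  interpret Metric_space X "shift_dist \<theta>" by (rule Metric_shift)
  have "(\<exists>r>0. mball \<omega> r \<subseteq> U) \<longleftrightarrow> (\<exists>n. \<forall>\<upsilon>\<in>X. agree n \<omega> \<upsilon> \<longrightarrow> \<upsilon> \<in> U)" if "\<omega> \<in> X" for \<omega>
  proof
    assume "\<exists>r>0. mball \<omega> r \<subseteq> U"
    then obtain r where r: "r > 0" "mball \<omega> r \<subseteq> U" by auto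
    obtain n where n: "\<theta> ^ n < r" by (rule pow_less[OF r(1)])
    have "\<upsilon> \<in> U" if "\<upsilon> \<in> X" "agree n \<omega> \<upsilon>" for \<upsilon>
    proof -
      have "shift_dist \<theta> \<omega> \<upsilon> < r" using n shift_dist_le_iff[of \<omega> \<upsilon> n] that by simp
      then show ?thesis using r(2) that \<open>\<omega> \<in> X\<close> by (auto simp: in_mball)
    qed
    then show "\<exists>n. \<forall>\<upsilon>\<in>X. agree n \<omega> \<upsilon> \<longrightarrow> \<upsilon> \<in> U" by blast
  next
    assume "\<exists>n. \<forall>\<upsilon>\<in>X. agree n \<omega> \<upsilon> \<longrightarrow> \<upsilon> \<in> U"
    then obtain n where n: "\<And>\<upsilon>. \<upsilon> \<in> X \<Longrightarrow> agree n \<omega> \<upsilon> \<Longrightarrow> \<upsilon> \<in> U" by blast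
    have "mball \<omega> (\<theta> ^ n) \<subseteq> U"
    proof
      fix \<upsilon> assume "\<upsilon> \<in> mball \<omega> (\<theta> ^ n)"
      then have "\<upsilon> \<in> X" "shift_dist \<theta> \<omega> \<upsilon> \<le> \<theta> ^ n" by (auto simp: in_mball)
      then show "\<upsilon> \<in> U" using n by (simp add: shift_dist_le_iff)
    qed
    then show "\<exists>r>0. mball \<omega> r \<subseteq> U" using \<theta>_pow_pos by blast
  qed
  then show ?thesis unfolding shift_topology_def openin_mtopology by blast
qed

lemma topspace_shift [simp]: "topspace (shift_topology G \<theta>) = X"
  unfolding shift_topology_def using Metric_space.topspace_mtopology[OF Metric_shift] .

lemma cylinder_open: "openin (shift_topology G \<theta>) (cylinder G w)"
  unfolding openin_shift_iff by (auto simp: cylinder_def agree_def intro!: exI[of _ "length w"])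

lemma continuous_shift_iff:
  fixes f :: "(nat \<Rightarrow> 'e) \<Rightarrow> 'b::metric_space"
  shows "continuous_map (shift_topology G \<theta>) euclidean f \<longleftrightarrow>
    (\<forall>\<omega>\<in>X. \<forall>\<epsilon>>0. \<exists>n. \<forall>\<upsilon>\<in>X. agree n \<omega> \<upsilon> \<longrightarrow> dist (f \<omega>) (f \<upsilon>) < \<epsilon>)"
proof
  assume c: "continuous_map (shift_topology G \<theta>) euclidean f"
  show "\<forall>\<omega>\<in>X. \<forall>\<epsilon>>0. \<exists>n. \<forall>\<upsilon>\<in>X. agree n \<omega> \<upsilon> \<longrightarrow> dist (f \<omega>) (f \<upsilon>) < \<epsilon>"
  proof (intro ballI allI impI)
    fix \<omega> and \<epsilon> :: real assume "\<omega> \<in> X" "\<epsilon> > 0"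
    have "openin (shift_topology G \<theta>) {\<upsilon> \<in> X. f \<upsilon> \<in> ball (f \<omega>) \<epsilon>}"
      using openin_continuous_map_preimage[OF c, of "ball (f \<omega>) \<epsilon>"] by simp
    then show "\<exists>n. \<forall>\<upsilon>\<in>X. agree n \<omega> \<upsilon> \<longrightarrow> dist (f \<omega>) (f \<upsilon>) < \<epsilon>"
      unfolding openin_shift_iff using \<open>\<omega> \<in> X\<close> \<open>\<epsilon> > 0\<close> by auto
  qed
next
  assume c: "\<forall>\<omega>\<in>X. \<forall>\<epsilon>>0. \<exists>n. \<forall>\<upsilon>\<in>X. agree n \<omega> \<upsilon> \<longrightarrow> dist (f \<omega>) (f \<upsilon>) < \<epsilon>"
  have "openin (shift_topology G \<theta>) {\<upsilon> \<in> X. f \<upsilon> \<in> U}" if "open U" for U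
    unfolding openin_shift_iff
  proof (intro conjI ballI)
    fix \<omega> assume \<omega>: "\<omega> \<in> {\<upsilon> \<in> X. f \<upsilon> \<in> U}"
    then obtain \<epsilon> where \<epsilon>: "\<epsilon> > 0" "ball (f \<omega>) \<epsilon> \<subseteq> U" using \<open>open U\<close> by (auto elim: openE)
    then obtain n where "\<And>\<upsilon>. \<upsilon> \<in> X \<Longrightarrow> agree n \<omega> \<upsilon> \<Longrightarrow> dist (f \<omega>) (f \<upsilon>) < \<epsilon>" using c \<omega> by blast
    then show "\<exists>n. \<forall>\<upsilon>\<in>X. agree n \<omega> \<upsilon> \<longrightarrow> \<upsilon> \<in> {\<upsilon> \<in> X. f \<upsilon> \<in> U}"
      using \<epsilon>(2) by (intro exI[of _ n]) (auto simp: subset_iff)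
  qed auto
  then show "continuous_map (shift_topology G \<theta>) euclidean f"
    unfolding continuous_map by simp
qed

lemma lipschitz_continuous:
  assumes "lipschitz_by G \<theta> f V" shows "continuous_map (shift_topology G \<theta>) euclidean f"
  unfolding continuous_shift_iff
proof (intro ballI allI impI)
  fix \<omega> and \<epsilon> :: real assume \<omega>: "\<omega> \<in> X" and \<epsilon>: "\<epsilon> > 0"
  obtain n where n: "n \<ge> 1" "\<theta> ^ n < \<epsilon> / (\<bar>V\<bar> + 1)" using pow_less[of "\<epsilon> / (\<bar>V\<bar> + 1)"] \<epsilon> by (auto simp: divide_pos_pos)
  have "dist (f \<omega>) (f \<upsilon>) < \<epsilon>" if "\<upsilon> \<in> X" "agree n \<omega> \<upsilon>" for \<upsilon>
  proof -
    have "dist (f \<omega>) (f \<upsilon>) \<le> V * \<theta> ^ n"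
      using lipschitz_byD[OF assms \<omega> that(1) n(1) that(2)] by (simp add: dist_norm)
    also have "\<dots> \<le> (\<bar>V\<bar> + 1) * \<theta> ^ n" using \<theta>_pos by (intro mult_right_mono) auto
    also have "\<dots> < \<epsilon>" using n(2) by (simp add: pos_less_divide_eq mult.commute)
    finally show ?thesis .
  qed
  then show "\<exists>n. \<forall>\<upsilon>\<in>X. agree n \<omega> \<upsilon> \<longrightarrow> dist (f \<omega>) (f \<upsilon>) < \<epsilon>" by blast
qed

abbreviation borelX :: "(nat \<Rightarrow> 'e) measure" where "borelX \<equiv> shift_borel G \<theta>"

lemma space_borelX [simp]: "space borelX = X"
  unfolding shift_borel_def by (rule space_measure_of) (auto simp: openin_shift_iff)

lemma sets_borelX: "sets borelX = sigma_sets X {U. openin (shift_topology G \<theta>) U}"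
  unfolding shift_borel_def by (rule sets_measure_of) (auto simp: openin_shift_iff)

lemma open_sets_borelX: "openin (shift_topology G \<theta>) U \<Longrightarrow> U \<in> sets borelX"
  unfolding sets_borelX by (rule sigma_sets.Basic) simp

lemma cylinder_sets [measurable]: "cylinder G w \<in> sets borelX"
  by (rule open_sets_borelX[OF cylinder_open])

lemma cylinder_subset: "cylinder G w \<subseteq> X"
  by (auto simp: cylinder_def)

lemma open_eq_cylinders:
  assumes "openin (shift_topology G \<theta>) U"
  shows "U = \<Union> (cylinder G ` {w \<in> lists (arcs G). cylinder G w \<subseteq> U})"
proof
  show "U \<subseteq> \<Union> (cylinder G ` {w \<in> lists (arcs G). cylinder G w \<subseteq> U})"
  proof
    fix \<omega> assume \<omega>: "\<omega> \<in> U"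
    then have X: "\<omega> \<in> X" using assms by (auto simp: openin_shift_iff)
    obtain n where n: "\<And>\<upsilon>. \<upsilon> \<in> X \<Longrightarrow> agree n \<omega> \<upsilon> \<Longrightarrow> \<upsilon> \<in> U"
      using assms \<omega> unfolding openin_shift_iff by blast
    let ?w = "map \<omega> [0..<n]"
    have "cylinder G ?w \<subseteq> U" using n by (auto simp: cylinder_def agree_def)
    moreover have "\<omega> \<in> cylinder G ?w" using X by (auto simp: cylinder_def)
    moreover have "?w \<in> lists (arcs G)" using shift_space_nth[OF X] by auto
    ultimately show "\<omega> \<in> \<Union> (cylinder G ` {w \<in> lists (arcs G). cylinder G w \<subseteq> U})" by blast
  qed
qed auto

text \<open>An open set is the union of the cylinders that it contains, and there are only countably
  many words.\<close>

lemma sets_borelX_cylinders: "sets borelX = sigma_sets X (cylinder G ` lists (arcs G))"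
proof
  show "sets borelX \<subseteq> sigma_sets X (cylinder G ` lists (arcs G))"
    unfolding sets_borelX
  proof (rule sigma_sets_mono, rule subsetI, simp only: mem_Collect_eq)
    fix U assume U: "openin (shift_topology G \<theta>) U"
    have "sigma_algebra X (sigma_sets X (cylinder G ` lists (arcs G)))"
      by (rule sigma_algebra_sigma_sets) (auto simp: cylinder_def)
    then have "\<Union> (cylinder G ` {w \<in> lists (arcs G). cylinder G w \<subseteq> U}) \<in> sigma_sets X (cylinder G ` lists (arcs G))"
      by (rule sigma_algebra.countable_Union)
        (use countable_words in \<open>auto intro!: countable_image countable_subset[OF _ countable_words] sigma_sets.Basic\<close>)
    then show "U \<in> sigma_sets X (cylinder G ` lists (arcs G))" using open_eq_cylinders[OF U] by simp
  qed
  show "sigma_sets X (cylinder G ` lists (arcs G)) \<subseteq> sets borelX"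
    using sets.sigma_sets_subset[of "cylinder G ` lists (arcs G)" borelX, OF image_subsetI[OF cylinder_sets]]
    by simp
qed

lemma measurable_into_borelX:
  assumes "f \<in> space M \<rightarrow> X" "\<And>w. w \<in> lists (arcs G) \<Longrightarrow> f -` cylinder G w \<inter> space M \<in> sets M"
  shows "f \<in> measurable M borelX"
proof -
  have "f \<in> measurable M (sigma X (cylinder G ` lists (arcs G)))"
    by (rule measurable_measure_of) (use assms cylinder_subset in auto)
  moreover have "sets (sigma X (cylinder G ` lists (arcs G))) = sets borelX"
    unfolding sets_borelX_cylinders by (rule sets_measure_of) (auto simp: cylinder_def)
  ultimately show ?thesis using measurable_cong_sets[of M M "sigma X (cylinder G ` lists (arcs G))" borelX] by simp
qed

lemma continuous_measurable:
  fixes f :: "(nat \<Rightarrow> 'e) \<Rightarrow> 'b::metric_space"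
  assumes "continuous_map (shift_topology G \<theta>) euclidean f" shows "f \<in> borel_measurable borelX"
proof (rule borel_measurableI)
  fix S :: "'b set" assume "open S"
  then have "openin (shift_topology G \<theta>) {\<upsilon> \<in> X. f \<upsilon> \<in> S}"
    using openin_continuous_map_preimage[OF assms, of S] by simp
  moreover have "{\<upsilon> \<in> X. f \<upsilon> \<in> S} = f -` S \<inter> space borelX" by auto
  ultimately show "f -` S \<inter> space borelX \<in> sets borelX" using open_sets_borelX by simp
qed

end

section \<open>The eigenmeasure\<close>

context edge_shift
begin

text \<open>The measure is first built on all letter sequences. A sequence outside \<open>X\<close>
  has an initial word with empty cylinder; such words are countably many and have mass 0, so
  \<open>X\<close> has full measure.\<close>

lemma borel_measure_exists:
  fixes m :: "'e list \<Rightarrow> real"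
  assumes nil: "m [] = 1" and nonneg: "\<And>w. w \<in> lists (arcs G) \<Longrightarrow> 0 \<le> m w"
    and consistent: "\<And>w. w \<in> lists (arcs G) \<Longrightarrow> ((\<lambda>e. m (w @ [e])) has_sum m w) (arcs G)"
    and empty: "\<And>w. w \<in> lists (arcs G) \<Longrightarrow> cylinder G w = {} \<Longrightarrow> m w = 0"
  shows "\<exists>\<nu>. prob_space \<nu> \<and> sets \<nu> = sets borelX \<and> (\<forall>w\<in>lists (arcs G). measure \<nu> (cylinder G w) = m w)"
proof -
  obtain M where M: "prob_space M" "sets M = sets (PiM UNIV (\<lambda>_::nat. count_space (arcs G)))"
    "\<And>w. w \<in> lists (arcs G) \<Longrightarrow> measure M {\<omega> \<in> space M. \<forall>i<length w. \<omega> i = w ! i} = m w"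
    using cylinder_measure_exists[OF countable_arcs arcs_nonempty nil nonneg consistent] by blast
  interpret M: prob_space M by (rule M(1))
  have space_M: "space M = {\<omega>. \<forall>i. \<omega> i \<in> arcs G}"
    using sets_eq_imp_space_eq[OF M(2)] by (auto simp: space_PiM PiE_iff)
  let ?C = "\<lambda>w. {\<omega> \<in> space M. \<forall>i<length w. \<omega> i = w ! i}"
  have C: "?C w \<in> sets M" for w
  proof -
    have coord: "(\<lambda>\<omega>. \<omega> i) \<in> measurable M (count_space (arcs G))" for i
      by (subst measurable_cong_sets[OF M(2) refl]) (rule measurable_component_singleton, simp)
    have "(\<lambda>\<omega>. \<omega> i) -` ({w ! i} \<inter> arcs G) \<inter> space M \<in> sets M" for i
      using measurable_sets[OF coord[of i], of "{w ! i} \<inter> arcs G"] by simp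
    moreover have "(\<lambda>\<omega>. \<omega> i) -` ({w ! i} \<inter> arcs G) \<inter> space M = {\<omega> \<in> space M. \<omega> i = w ! i}" for i
      by (auto simp: space_M)
    ultimately have "{\<omega> \<in> space M. \<omega> i = w ! i} \<in> sets M" for i by simp
    then have "{\<omega> \<in> space M. \<forall>i\<in>{..<length w}. \<omega> i = w ! i} \<in> sets M"
      by (intro sets.sets_Collect_finite_All) auto
    then show ?thesis by (simp only: Ball_def lessThan_iff)
  qed
  let ?W = "{w \<in> lists (arcs G). cylinder G w = {}}"
  have compl: "space M - X = \<Union> (?C ` ?W)"
  proof
    show "space M - X \<subseteq> \<Union> (?C ` ?W)"
    proof
      fix \<omega> assume \<omega>: "\<omega> \<in> space M - X"
      then obtain n where n: "\<not> incident G (\<omega> n) (\<omega> (Suc n))" by (auto simp: space_M shift_space_def)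
      \<comment> \<open>Length \<open>n + 2\<close> is the least that contains both letters of the
        forbidden transition.\<close>
      let ?w = "map \<omega> [0..<n+2]"
      have "cylinder G ?w = {}"
      proof (rule ccontr)
        assume "cylinder G ?w \<noteq> {}"
        then obtain \<upsilon> where \<upsilon>: "\<upsilon> \<in> X" "\<forall>i<n+2. \<upsilon> i = \<omega> i" by (auto simp: cylinder_def simp del: upt_Suc)
        have "incident G (\<upsilon> n) (\<upsilon> (Suc n))" using \<upsilon>(1) by (simp add: shift_space_def)
        moreover have "\<upsilon> n = \<omega> n" "\<upsilon> (Suc n) = \<omega> (Suc n)" using \<upsilon>(2) by simp_all
        ultimately show False using n by simp
      qed
      moreover have "?w \<in> lists (arcs G)" using \<omega> by (auto simp: space_M simp del: upt_Suc)
      moreover have "\<omega> \<in> ?C ?w" using \<omega> by (auto simp del: upt_Suc)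
      ultimately show "\<omega> \<in> \<Union> (?C ` ?W)" by blast
    qed
    show "\<Union> (?C ` ?W) \<subseteq> space M - X" by (auto simp: cylinder_def)
  qed
  have "(\<Union>w\<in>?W. ?C w) \<in> null_sets M"
  proof (rule null_sets_UN')
    show "countable ?W" using countable_words by (rule countable_subset[rotated]) auto
    show "?C w \<in> null_sets M" if "w \<in> ?W" for w
    proof -
      have "w \<in> lists (arcs G)" "cylinder G w = {}" using that by blast+
      then have "measure M (?C w) = 0" using M(3)[of w] empty[of w] by simp
      then have "emeasure M (?C w) = 0" by (simp only: M.emeasure_eq_measure ennreal_0)
      then show ?thesis using C[of w] by (rule null_setsI)
    qed
  qed
  then have null: "space M - X \<in> null_sets M" using compl by simp
  then have XM: "X \<in> sets M"
  proof -
    have "X \<subseteq> space M" by (auto simp: space_M shift_space_def)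
    then have "X = space M - (space M - X)" by auto
    also have "\<dots> \<in> sets M" using null by auto
    finally show ?thesis .
  qed
  obtain \<omega>\<^sub>0 where \<omega>\<^sub>0: "\<omega>\<^sub>0 \<in> X" using X_nonempty by auto
  \<comment> \<open>The identity on \<open>X\<close>, made total by sending the null set outside to
    a fixed point; the image measure then lives on \<open>X\<close>.\<close>
  define \<phi> where "\<phi> \<omega> = (if \<omega> \<in> X then \<omega> else \<omega>\<^sub>0)" for \<omega>
  have \<phi>_pre: "\<phi> -` cylinder G w \<inter> space M = (?C w \<inter> X) \<union> (if \<omega>\<^sub>0 \<in> cylinder G w then space M - X else {})" for w
  proof (rule set_eqI)
    fix \<omega>
    have X: "\<omega> \<in> X \<Longrightarrow> \<omega> \<in> space M" using shift_space_nth[of \<omega> G] by (simp add: space_M)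
    have C: "\<omega> \<in> cylinder G w \<longleftrightarrow> \<omega> \<in> X \<and> (\<forall>i<length w. \<omega> i = w ! i)" by (simp add: cylinder_def)
    show "\<omega> \<in> \<phi> -` cylinder G w \<inter> space M \<longleftrightarrow>
        \<omega> \<in> (?C w \<inter> X) \<union> (if \<omega>\<^sub>0 \<in> cylinder G w then space M - X else {})"
    proof (cases "\<omega> \<in> X")
      case True
      then show ?thesis using X C by (simp add: \<phi>_def)
    qed (simp add: \<phi>_def)
  qed
  have \<phi>: "\<phi> \<in> measurable M borelX"
  proof (rule measurable_into_borelX)
    show "\<phi> \<in> space M \<rightarrow> X" using \<omega>\<^sub>0 by (simp add: \<phi>_def)
    show "\<phi> -` cylinder G w \<inter> space M \<in> sets M" for w
    proof -
      have "(if \<omega>\<^sub>0 \<in> cylinder G w then space M - X else {}) \<in> sets M"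
        using null_setsD2[OF null] by (cases "\<omega>\<^sub>0 \<in> cylinder G w") (simp_all only: if_True if_False sets.empty_sets)
      then show ?thesis unfolding \<phi>_pre by (rule sets.Un[OF sets.Int[OF C XM]])
    qed
  qed
  let ?\<nu> = "distr M borelX \<phi>"
  show ?thesis
  proof (intro exI[of _ ?\<nu>] conjI ballI)
    show "prob_space ?\<nu>" by (rule M.prob_space_distr[OF \<phi>])
    fix w assume w: "w \<in> lists (arcs G)"
    have "measure ?\<nu> (cylinder G w) = measure M (\<phi> -` cylinder G w \<inter> space M)"
      by (rule measure_distr[OF \<phi> cylinder_sets])
    also have "\<dots> = measure M (?C w)"
    proof (rule M.finite_measure_eq_AE)
      have "AE \<omega> in M. \<omega> \<notin> space M - X" by (rule AE_not_in[OF null])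
      then show "AE \<omega> in M. \<omega> \<in> \<phi> -` cylinder G w \<inter> space M \<longleftrightarrow> \<omega> \<in> ?C w"
        unfolding \<phi>_pre by (rule AE_mp) (rule AE_I2, simp)
      show "\<phi> -` cylinder G w \<inter> space M \<in> sets M" by (rule measurable_sets[OF \<phi> cylinder_sets])
    qed (rule C)
    also have "\<dots> = m w" by (rule M(3)[OF w])
    finally show "measure ?\<nu> (cylinder G w) = m w" .
  qed simp
qed

text \<open>The function is constant on n-cylinders, hence Lipschitz whatever the regularity of
  \<open>f\<close>. Together with \<open>rep_tendsto\<close> this approximates bounded continuous
  functions by bounded Lipschitz ones.\<close>

lemma rep_lipschitz:
  fixes f :: "(nat \<Rightarrow> 'e) \<Rightarrow> real"
  assumes f: "bounded_by G f M" shows "lipschitz_by G \<theta> (\<lambda>\<omega>. f (rep n \<omega>)) (2 * M / \<theta> ^ n)"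
proof (rule lipschitz_byI)
  fix \<omega> \<upsilon> k assume *: "\<omega> \<in> X" "\<upsilon> \<in> X" "1 \<le> k" "agree k \<omega> \<upsilon>"
  have M: "\<bar>f (rep n \<omega>)\<bar> \<le> M" "\<bar>f (rep n \<upsilon>)\<bar> \<le> M" using f rep(1) * by (auto simp: bounded_by_def)
  show "norm (f (rep n \<omega>) - f (rep n \<upsilon>)) \<le> 2 * M / \<theta> ^ n * \<theta> ^ k"
  proof (cases "n \<le> k")
    case True
    then have "rep n \<omega> = rep n \<upsilon>" by (intro rep_cong agree_mono[OF *(4)])
    then show ?thesis using M \<theta>_pos by simp
  next
    case False
    then have "\<theta> ^ n \<le> \<theta> ^ k" using \<theta>_pos \<theta>_less_1 by (intro power_decreasing) auto
    then have "2 * M * \<theta> ^ n \<le> 2 * M * \<theta> ^ k" using M by (intro mult_left_mono) auto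
    then have "2 * M \<le> 2 * M / \<theta> ^ n * \<theta> ^ k" using \<theta>_pos by (simp add: field_simps)
    then show ?thesis using M by simp
  qed
qed

lemma rep_tendsto:
  fixes f :: "(nat \<Rightarrow> 'e) \<Rightarrow> real"
  assumes "continuous_map (shift_topology G \<theta>) euclidean f" "\<omega> \<in> X"
  shows "(\<lambda>n. f (rep n \<omega>)) \<longlonglongrightarrow> f \<omega>"
proof (rule metric_LIMSEQ_I)
  fix \<epsilon> :: real assume "\<epsilon> > 0"
  then obtain n where n: "\<And>\<upsilon>. \<upsilon> \<in> X \<Longrightarrow> agree n \<omega> \<upsilon> \<Longrightarrow> dist (f \<omega>) (f \<upsilon>) < \<epsilon>"
    using assms unfolding continuous_shift_iff by blast
  have "dist (f (rep k \<omega>)) (f \<omega>) < \<epsilon>" if "k \<ge> n" for k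
    using n[OF rep(1)[OF assms(2)] agree_sym[OF agree_mono[OF rep(2)[OF assms(2)] that]]] by (simp add: dist_commute)
  then show "\<exists>no. \<forall>n\<ge>no. dist (f (rep n \<omega>)) (f \<omega>) < \<epsilon>" by blast
qed

text \<open>A function that is positive at a point exceeds half that value on a whole cylinder, and
  by \<open>supp\<close> cylinders have positive mass.\<close>

lemma positive_integral_zero:
  assumes \<nu>: "prob_space \<nu>" "sets \<nu> = sets borelX"
    and supp: "\<And>\<omega> n. \<omega> \<in> X \<Longrightarrow> 0 < measure \<nu> (cylinder G (map \<omega> [0..<n]))"
    and f: "continuous_map (shift_topology G \<theta>) euclidean f" "bounded_by G f M" "\<And>\<omega>. \<omega> \<in> X \<Longrightarrow> (0::real) \<le> f \<omega>"
    and zero: "integral\<^sup>L \<nu> f = 0" and \<omega>: "\<omega> \<in> X"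
  shows "f \<omega> = 0"
proof (rule ccontr)
  interpret prob_space \<nu> by (rule \<nu>)
  have sp: "space \<nu> = X" using sets_eq_imp_space_eq[OF \<nu>(2)] by simp
  assume "f \<omega> \<noteq> 0"
  then have pos: "0 < f \<omega>" using f(3)[OF \<omega>] by simp
  obtain n where n: "\<And>\<upsilon>. \<upsilon> \<in> X \<Longrightarrow> agree n \<omega> \<upsilon> \<Longrightarrow> dist (f \<omega>) (f \<upsilon>) < f \<omega> / 2"
    using f(1)[unfolded continuous_shift_iff, rule_format, OF \<omega>, of "f \<omega> / 2"] pos by auto
  let ?C = "cylinder G (map \<omega> [0..<n])"
  have meas: "f \<in> borel_measurable \<nu>" using continuous_measurable[OF f(1)] by (simp add: measurable_cong_sets[OF \<nu>(2)])
  have C: "?C \<in> sets \<nu>" using cylinder_sets \<nu>(2) by simp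
  have int: "integrable \<nu> f"
    by (rule integrable_const_bound[of _ M]) (use meas f(2) in \<open>auto simp: sp bounded_by_def intro!: AE_I2\<close>)
  have intC: "integrable \<nu> (\<lambda>\<upsilon>. f \<omega> / 2 * indicator ?C \<upsilon>)"
    using C by (intro integrable_mult_right integrable_real_indicator) (auto simp: emeasure_eq_measure)
  have "integral\<^sup>L \<nu> (\<lambda>\<upsilon>. f \<omega> / 2 * indicator ?C \<upsilon>) \<le> integral\<^sup>L \<nu> f"
  proof (rule integral_mono[OF intC int])
    fix \<upsilon> assume "\<upsilon> \<in> space \<nu>"
    then have X: "\<upsilon> \<in> X" by (simp add: sp)
    show "f \<omega> / 2 * indicator ?C \<upsilon> \<le> f \<upsilon>"
    proof (cases "\<upsilon> \<in> ?C")
      case True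
      then have "agree n \<omega> \<upsilon>" by (auto simp: cylinder_def agree_def)
      then have "\<bar>f \<omega> - f \<upsilon>\<bar> < f \<omega> / 2" using n[OF X] by (simp add: dist_real_def)
      then have "f \<omega> / 2 \<le> f \<upsilon>" by linarith
      then show ?thesis using True by simp
    qed (use f(3) X in simp)
  qed
  then have "f \<omega> / 2 * measure \<nu> ?C \<le> 0" using C zero by (simp add: emeasure_eq_measure)
  then show False using pos supp[OF \<omega>, of n] by (simp add: mult_le_0_iff)
qed

end

context potential
begin

text \<open>The test functions of tightness: a functional that is small on \<open>avoids i F\<close>
  for a suitable finite \<open>F\<close> gives little weight to letters outside \<open>F\<close> at
  position \<open>i\<close>.\<close>

definition avoids :: "nat \<Rightarrow> 'e set \<Rightarrow> (nat \<Rightarrow> 'e) \<Rightarrow> real" where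
  "avoids i F \<omega> = (if \<omega> i \<in> F then 0 else 1)"

lemma avoids_bounded: "bounded_by G (avoids i F) 1"
  by (simp add: bounded_by_def avoids_def)

text \<open>After \<open>i\<close> applications of \<open>L\<close> the condition on letter
  \<open>i\<close> has become one on letter 0, and the next application sums only over letters
  outside \<open>F\<close>. This is how the tail of \<open>B\<close> produces tightness.\<close>

lemma avoids_decay:
  assumes F: "finite F" "F \<subseteq> arcs G" and \<omega>: "\<omega> \<in> X"
  shows "(L ^^ Suc i) (avoids i F) \<omega> \<le> growth i * infsum B (arcs G - F)"
proof -
  have "avoids i F = (\<lambda>\<omega>. 1 * avoids 0 F ((shift ^^ i) \<omega>))"
    by (rule ext) (simp add: avoids_def funpow_shift)
  then have eq: "(L ^^ i) (avoids i F) = (\<lambda>\<omega>. avoids 0 F \<omega> * (L ^^ i) (\<lambda>_. 1) \<omega>)"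
    using Lpow_pullback[of i "\<lambda>_. 1" "avoids 0 F"] by (simp only:)
  have b: "bounded_by G (\<lambda>\<omega>. avoids 0 F \<omega> * (L ^^ i) (\<lambda>_. 1) \<omega>) (growth i)"
    unfolding bounded_by_def
  proof
    fix \<omega> assume "\<omega> \<in> X"
    then show "norm (avoids 0 F \<omega> * (L ^^ i) (\<lambda>_. 1) \<omega>) \<le> growth i"
      using Lpow_one_le[of \<omega> i] Lpow_one_nonneg[of \<omega> i] growth_nonneg[of i] by (simp add: avoids_def)
  qed
  have "(L ^^ Suc i) (avoids i F) \<omega> = L (\<lambda>\<omega>. avoids 0 F \<omega> * (L ^^ i) (\<lambda>_. 1) \<omega>) \<omega>" by (simp add: eq)
  also have "\<dots> \<le> \<bar>\<dots>\<bar>" by simp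
  also have "\<dots> \<le> growth i * infsum B (arcs G - F)"
    using L_split_bound[OF \<omega> F b] by (simp add: avoids_def)
  finally show ?thesis .
qed

lemma sum_cylinders:
  fixes n :: nat
  assumes "finite F" "F \<subseteq> arcs G" "\<omega> \<in> X"
  defines "W \<equiv> {w. set w \<subseteq> F \<and> length w = n}"
  shows "(\<Sum>w\<in>W. c w * indicator (cylinder G w) \<omega>) =
    (if \<forall>i<n. \<omega> i \<in> F then c (map \<omega> [0..<n]) else (0::real))"
proof -
  have W: "finite W" unfolding W_def by (rule finite_lists_length_eq[OF assms(1)])
  have ind: "indicator (cylinder G w) \<omega> = (if w = map \<omega> [0..<n] then 1 else (0::real))" if "w \<in> W" for w
    using that assms(3) by (auto simp: W_def cylinder_def indicator_def list_eq_iff_nth_eq)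
  have "(\<Sum>w\<in>W. c w * indicator (cylinder G w) \<omega>) = (\<Sum>w\<in>W. if w = map \<omega> [0..<n] then c w else 0)"
    by (rule sum.cong) (simp_all add: ind)
  also have "\<dots> = (if map \<omega> [0..<n] \<in> W then c (map \<omega> [0..<n]) else 0)" using W by (simp add: sum.delta)
  also have "map \<omega> [0..<n] \<in> W \<longleftrightarrow> (\<forall>i<n. \<omega> i \<in> F)" by (auto simp: W_def)
  finally show ?thesis .
qed

text \<open>The functionals \<open>\<Phi> k\<close> are the normalised truncated resolvents at a base point. They are
  asymptotically eigenvectors of the dual of \<open>L\<close>, and the summability of \<open>B\<close> makes them tight.\<close>

theorem eigenmeasure_exists_lipschitz:
  obtains \<nu> where "prob_space \<nu>" "sets \<nu> = sets borelX"
    "\<And>f M V. bounded_by G f M \<Longrightarrow> lipschitz_by G \<theta> f V \<Longrightarrow> integral\<^sup>L \<nu> (L f) = lam * integral\<^sup>L \<nu> f"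
proof -
  obtain h where h: "cone h" "bounded_by G h 1" "\<And>\<omega>. \<omega> \<in> X \<Longrightarrow> L h \<omega> = lam * h \<omega>" "\<And>\<omega>. \<omega> \<in> X \<Longrightarrow> h \<omega> > 0"
    using eigenfunction_exists by blast
  obtain xs0 Ns0 where R: "resolvent_seq xs0 Ns0" using resolvent_seq_exists by blast
  define xs where "xs k = xs0 (Suc k)" for k
  define Ns where "Ns k = Ns0 (Suc k)" for k
  obtain \<omega>\<^sub>0 where \<omega>\<^sub>0: "\<omega>\<^sub>0 \<in> X" using X_nonempty by auto
  have x: "0 < xs k" "lam < xs k" for k
    using R lam_pos unfolding resolvent_seq_def xs_def by (auto intro: less_trans)
  have xlim: "xs \<longlonglongrightarrow> lam" unfolding xs_def by (rule LIMSEQ_Suc[OF resolvent_seq_tendsto[OF R]])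
  define Z where "Z k = T (Ns k) (xs k) (\<lambda>_. 1) \<omega>\<^sub>0" for k
  have Lh: "(L ^^ n) h \<omega> = lam ^ n * h \<omega>" if "\<omega> \<in> X" for n \<omega>
    using that
  proof (induction n arbitrary: \<omega>)
    case (Suc n)
    have "L ((L ^^ n) h) = L (\<lambda>\<omega>. lam ^ n * h \<omega>)" by (rule L_cong) (rule Suc.IH)
    then have "L ((L ^^ n) h) \<omega> = lam ^ n * L h \<omega>" by (simp only: L_scale)
    then show ?case using h(3)[OF Suc.prems] by (simp add: mult_ac)
  qed simp
  \<comment> \<open>As \<open>h\<close> is at most 1, the resolvent of 1 dominates that of
    \<open>h\<close>, which is explicit at the base point. So \<open>Z\<close> is unbounded at this
    very point, whereas \<open>T_one_large\<close> controls the supremum only.\<close>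
  have Z_ge: "h \<omega>\<^sub>0 / lam * (real (Suc k) / 2) \<le> Z k" for k
  proof -
    have "h \<omega>\<^sub>0 / lam * (real (Suc k) / 2) \<le> h \<omega>\<^sub>0 / lam * (\<Sum>n<Ns k. (lam / xs k) ^ Suc n)"
    proof (rule mult_left_mono)
      show "real (Suc k) / 2 \<le> (\<Sum>n<Ns k. (lam / xs k) ^ Suc n)"
        using R unfolding resolvent_seq_def xs_def Ns_def by blast
    qed (use h(4)[OF \<omega>\<^sub>0] lam_pos in simp)
    also have "\<dots> = T (Ns k) (xs k) h \<omega>\<^sub>0"
      unfolding T_def sum_distrib_left using lam_pos by (intro sum.cong) (simp_all add: Lh[OF \<omega>\<^sub>0] power_divide)
    also have "\<dots> \<le> Z k" unfolding Z_def
      by (rule T_mono) (use bdI[OF h(2)] h(2) \<omega>\<^sub>0 x in \<open>auto simp: bounded_by_def abs_le_iff\<close>)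
    finally show ?thesis .
  qed
  have Z_pos: "0 < Z k" for k
    by (rule less_le_trans[OF _ Z_ge]) (use h(4)[OF \<omega>\<^sub>0] lam_pos in simp)
  have Z_inv: "(\<lambda>k. 1 / Z k) \<longlonglongrightarrow> 0"
  proof (rule tendsto_sandwich[of "\<lambda>_. 0"])
    let ?c = "2 * lam / h \<omega>\<^sub>0"
    have "1 / Z k \<le> ?c * (1 / real (Suc k))" for k
    proof -
      have "1 / Z k \<le> 1 / (h \<omega>\<^sub>0 / lam * (real (Suc k) / 2))"
        using Z_ge[of k] h(4)[OF \<omega>\<^sub>0] lam_pos by (intro divide_left_mono mult_pos_pos Z_pos) auto
      then show ?thesis by (simp add: mult_ac)
    qed
    then show "eventually (\<lambda>k. 1 / Z k \<le> ?c * (1 / real (Suc k))) sequentially"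
      by (simp add: always_eventually)
    have "(\<lambda>k. ?c * (1 / real (Suc k))) \<longlonglongrightarrow> ?c * 0"
      by (intro tendsto_intros LIMSEQ_inverse_real_of_nat[unfolded inverse_eq_divide])
    then show "(\<lambda>k. ?c * (1 / real (Suc k))) \<longlonglongrightarrow> 0" by simp
  qed (use Z_pos in \<open>auto simp: less_imp_le\<close>)
  define \<Phi> where "\<Phi> k f = T (Ns k) (xs k) f \<omega>\<^sub>0 / Z k" for k f
  have \<Phi>_add: "\<Phi> k (\<lambda>\<omega>. f \<omega> + g \<omega>) = \<Phi> k f + \<Phi> k g" if "bd f" "bd g" for k f g
    using that by (simp add: \<Phi>_def T_add add_divide_distrib)
  have \<Phi>_diff: "\<Phi> k (\<lambda>\<omega>. f \<omega> - g \<omega>) = \<Phi> k f - \<Phi> k g" if "bd f" "bd g" for k f g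
    using that by (simp add: \<Phi>_def T_diff diff_divide_distrib)
  have \<Phi>_scale: "\<Phi> k (\<lambda>\<omega>. c * f \<omega>) = c * \<Phi> k f" for k c f by (simp add: \<Phi>_def T_scale)
  have \<Phi>_one: "\<Phi> k (\<lambda>_. 1) = 1" for k using Z_pos[of k] by (simp add: \<Phi>_def Z_def)
  have \<Phi>_const: "\<Phi> k (\<lambda>_. c) = c" for k c using \<Phi>_scale[of k c "\<lambda>_. 1"] \<Phi>_one by simp
  have \<Phi>_mono: "\<Phi> k f \<le> \<Phi> k g" if "bd f" "bd g" "\<And>\<omega>. \<omega> \<in> X \<Longrightarrow> f \<omega> \<le> g \<omega>" for k f g
    unfolding \<Phi>_def using T_mono[OF that x(1) \<omega>\<^sub>0] Z_pos by (simp add: divide_right_mono less_imp_le)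
  have \<Phi>_cong: "\<Phi> k f = \<Phi> k g" if "bd f" "bd g" "\<And>\<omega>. \<omega> \<in> X \<Longrightarrow> f \<omega> = g \<omega>" for k f g
    by (rule antisym; rule \<Phi>_mono) (use that in auto)
  have \<Phi>_sum: "\<Phi> k (\<lambda>\<omega>. \<Sum>i\<in>I. f i \<omega>) = (\<Sum>i\<in>I. \<Phi> k (f i)) \<and> bd (\<lambda>\<omega>. \<Sum>i\<in>I. f i \<omega>)"
    if "finite I" "\<And>i. i \<in> I \<Longrightarrow> bd (f i)" for k and I :: "'i set" and f
    using that by (induction I rule: finite_induct) (auto simp: \<Phi>_add \<Phi>_const)
  have \<Phi>_abs: "\<bar>\<Phi> k f\<bar> \<le> M" if "bounded_by G f M" for k f M
    using T_abs_le[OF that x(1) \<omega>\<^sub>0, of "Ns k" k] Z_pos[of k] by (simp add: \<Phi>_def Z_def pos_divide_le_eq)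
  have \<Phi>_near: "(\<lambda>k. \<Phi> k (L f) - xs k * \<Phi> k f) \<longlonglongrightarrow> 0" if f: "bounded_by G f M" for f M
  proof (rule Lim_null_comparison)
    have "\<bar>\<Phi> k (L f) - xs k * \<Phi> k f\<bar> \<le> 2 * M * (1 / Z k)" for k
    proof -
      have "\<Phi> k (L f) - xs k * \<Phi> k f = (T (Ns k) (xs k) (L f) \<omega>\<^sub>0 - xs k * T (Ns k) (xs k) f \<omega>\<^sub>0) / Z k"
        by (simp add: \<Phi>_def diff_divide_distrib)
      moreover have "\<bar>T (Ns k) (xs k) (L f) \<omega>\<^sub>0 - xs k * T (Ns k) (xs k) f \<omega>\<^sub>0\<bar> \<le> 2 * M"
        unfolding xs_def Ns_def by (rule T_near_invariant[OF R f \<omega>\<^sub>0])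
      ultimately show ?thesis using Z_pos[of k] by (simp add: divide_right_mono)
    qed
    then show "eventually (\<lambda>k. norm (\<Phi> k (L f) - xs k * \<Phi> k f) \<le> 2 * M * (1 / Z k)) sequentially"
      by (simp add: always_eventually)
    show "(\<lambda>k. 2 * M * (1 / Z k)) \<longlonglongrightarrow> 0" using tendsto_mult_left[OF Z_inv, of "2 * M"] by simp
  qed
  have \<Phi>_near_pow: "(\<lambda>k. \<Phi> k ((L ^^ j) f) - xs k ^ j * \<Phi> k f) \<longlonglongrightarrow> 0" if f: "bounded_by G f M" for f M j
  proof (induction j)
    case (Suc j)
    have "(\<lambda>k. \<Phi> k (L ((L ^^ j) f)) - xs k * \<Phi> k ((L ^^ j) f)) \<longlonglongrightarrow> 0"
      by (rule \<Phi>_near[OF Lpow_bound[OF f]])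
    moreover have "(\<lambda>k. xs k * (\<Phi> k ((L ^^ j) f) - xs k ^ j * \<Phi> k f)) \<longlonglongrightarrow> lam * 0"
      by (intro tendsto_mult xlim Suc)
    ultimately have "(\<lambda>k. (\<Phi> k (L ((L ^^ j) f)) - xs k * \<Phi> k ((L ^^ j) f)) + xs k * (\<Phi> k ((L ^^ j) f) - xs k ^ j * \<Phi> k f))
        \<longlonglongrightarrow> 0 + lam * 0" by (rule tendsto_add)
    then show ?case by (simp add: algebra_simps)
  qed simp
  \<comment> \<open>By near invariance, \<open>lam ^ Suc i\<close> times the value on
    \<open>avoids i F\<close> is at most the value on the iterate of order \<open>Suc i\<close>, up
    to an error that tends to 0, and this iterate is uniformly small. Half of the allowance goes to
    the tail of \<open>B\<close> and half to the error.\<close>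
  have tight: "\<exists>F. finite F \<and> F \<subseteq> arcs G \<and> eventually (\<lambda>k. \<Phi> k (avoids i F) < \<epsilon>) sequentially"
    if "\<epsilon> > 0" for i \<epsilon>
  proof -
    let ?l = "lam ^ Suc i"
    have l: "0 < ?l" using lam_pos by simp
    have "0 < ?l * \<epsilon> / (2 * (growth i + 1))" using l that growth_nonneg[of i] by (intro divide_pos_pos mult_pos_pos) auto
    then obtain F where F: "finite F" "F \<subseteq> arcs G" "infsum B (arcs G - F) < ?l * \<epsilon> / (2 * (growth i + 1))"
      using tail_small by blast
    have "growth i * infsum B (arcs G - F) \<le> (growth i + 1) * (?l * \<epsilon> / (2 * (growth i + 1)))"
      using F(3) growth_nonneg[of i] tail_nonneg by (intro mult_mono) auto
    also have "\<dots> = ?l * \<epsilon> / 2" using growth_nonneg[of i] by (simp add: field_simps)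
    finally have g: "growth i * infsum B (arcs G - F) \<le> ?l * \<epsilon> / 2" .
    have "eventually (\<lambda>k. dist (\<Phi> k ((L ^^ Suc i) (avoids i F)) - xs k ^ Suc i * \<Phi> k (avoids i F)) 0 < ?l * \<epsilon> / 2) sequentially"
      by (rule tendstoD[OF \<Phi>_near_pow[OF avoids_bounded]]) (use l that in simp)
    then have "eventually (\<lambda>k. \<Phi> k (avoids i F) < \<epsilon>) sequentially"
    proof (rule eventually_mono)
      fix k assume k: "dist (\<Phi> k ((L ^^ Suc i) (avoids i F)) - xs k ^ Suc i * \<Phi> k (avoids i F)) 0 < ?l * \<epsilon> / 2"
      have "\<Phi> k ((L ^^ Suc i) (avoids i F)) \<le> \<Phi> k (\<lambda>_. growth i * infsum B (arcs G - F))"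
        by (rule \<Phi>_mono) (use avoids_decay[OF F(1,2)] bdI[OF avoids_bounded] in \<open>auto simp del: funpow.simps\<close>)
      then have "\<Phi> k ((L ^^ Suc i) (avoids i F)) \<le> ?l * \<epsilon> / 2" using g by (simp only: \<Phi>_const)
      then have 1: "xs k ^ Suc i * \<Phi> k (avoids i F) < ?l * \<epsilon>" using k unfolding dist_real_def by linarith
      have "0 \<le> \<Phi> k (avoids i F)"
        using \<Phi>_mono[of "\<lambda>_. 0" "avoids i F" k] bdI[OF avoids_bounded] by (simp add: \<Phi>_const avoids_def)
      then have "?l * \<Phi> k (avoids i F) \<le> xs k ^ Suc i * \<Phi> k (avoids i F)"
        using x[of k] lam_pos by (intro mult_right_mono power_mono) auto
      then have "?l * \<Phi> k (avoids i F) < ?l * \<epsilon>" using 1 by linarith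
      then show "\<Phi> k (avoids i F) < \<epsilon>" using l by (simp only: mult_less_cancel_left_pos)
    qed
    then show ?thesis using F by blast
  qed
  let ?I = "\<lambda>w. indicator (cylinder G w) :: _ \<Rightarrow> real"
  have I_bd: "bounded_by G (?I w) 1" for w by (simp add: bounded_by_def indicator_def)
  note I_bd' [simp] = bdI[OF I_bd]
  obtain \<sigma> :: "nat \<Rightarrow> nat" where \<sigma>: "strict_mono \<sigma>"
    and conv: "\<And>w. w \<in> lists (arcs G) \<Longrightarrow> \<exists>l. (\<lambda>k. \<Phi> (\<sigma> k) (?I w)) \<longlonglongrightarrow> l"
    by (rule function_convergent_subsequence[OF countable_words, of "\<lambda>k w. \<Phi> k (?I w)" 1])
      (use \<Phi>_abs[OF I_bd] in auto)
  define m where "m w = lim (\<lambda>k. \<Phi> (\<sigma> k) (?I w))" for w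
  have m: "(\<lambda>k. \<Phi> (\<sigma> k) (?I w)) \<longlonglongrightarrow> m w" if "w \<in> lists (arcs G)" for w
    using conv[OF that] unfolding m_def by (auto simp: convergent_LIMSEQ_iff[symmetric] convergent_def)
  have \<sigma>_ev: "eventually (\<lambda>k. P (\<sigma> k)) sequentially" if "eventually P sequentially" for P
    using filterlim_subseq[OF \<sigma>] that by (rule eventually_compose_filterlim[rotated])
  have m_nonneg: "0 \<le> m w" if "w \<in> lists (arcs G)" for w
    by (rule LIMSEQ_le_const[OF m[OF that]]) (use \<Phi>_mono[of "\<lambda>_. 0" "?I w"] in \<open>auto simp: \<Phi>_const\<close>)
  have m_nil: "m [] = 1"
  proof -
    have "\<Phi> k (?I []) = \<Phi> k (\<lambda>_. 1)" for k by (rule \<Phi>_cong[OF I_bd' bd_intros(1)]) (simp add: cylinder_def)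
    then have "\<Phi> k (?I []) = 1" for k by (simp only: \<Phi>_one)
    then show ?thesis using LIMSEQ_unique[OF m[of "[]"], of 1] by simp
  qed
  have m_empty: "m w = 0" if "w \<in> lists (arcs G)" "cylinder G w = {}" for w
  proof -
    have "?I w = (\<lambda>_. 0)" by (rule ext) (simp add: that)
    then have "\<Phi> k (?I w) = 0" for k by (simp only: \<Phi>_const)
    then show ?thesis using LIMSEQ_unique[OF m[OF that(1)], of 0] by simp
  qed
  \<comment> \<open>A cylinder splits into its extensions by letters of \<open>F\<close> and the
    part that leaves \<open>F\<close> at position \<open>length w\<close>, the first position after
    the word.\<close>
  have split: "?I w \<omega> = (\<Sum>e\<in>F. ?I (w @ [e]) \<omega>) + ?I w \<omega> * avoids (length w) F \<omega>"
    if "finite F" "\<omega> \<in> X" for w F \<omega>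
  proof -
    have "?I (w @ [e]) \<omega> = (if e = \<omega> (length w) then ?I w \<omega> else 0)" for e
      using that by (auto simp: cylinder_def indicator_def nth_append less_Suc_eq)
    then have "(\<Sum>e\<in>F. ?I (w @ [e]) \<omega>) = (if \<omega> (length w) \<in> F then ?I w \<omega> else 0)"
      using that by (simp add: sum.delta)
    then show ?thesis by (simp add: avoids_def)
  qed
  have m_cons: "((\<lambda>e. m (w @ [e])) has_sum m w) (arcs G)" if w: "w \<in> lists (arcs G)" for w
  proof -
    have we: "w @ [e] \<in> lists (arcs G)" if "e \<in> arcs G" for e using w that by simp
    have sumlim: "(\<lambda>k. \<Sum>e\<in>F. \<Phi> (\<sigma> k) (?I (w @ [e]))) \<longlonglongrightarrow> (\<Sum>e\<in>F. m (w @ [e]))" if "F \<subseteq> arcs G" for F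
      using that we by (intro tendsto_sum m) auto
    have upper: "(\<Sum>e\<in>F. m (w @ [e])) \<le> m w" if F: "finite F" "F \<subseteq> arcs G" for F
    proof (rule LIMSEQ_le[OF sumlim[OF F(2)] m[OF w]])
      have le: "(\<Sum>e\<in>F. ?I (w @ [e]) \<omega>) \<le> ?I w \<omega>" if "\<omega> \<in> X" for \<omega>
      proof -
        have "0 \<le> ?I w \<omega> * avoids (length w) F \<omega>" by (simp add: avoids_def)
        then show ?thesis using split[OF F(1) that, of w] by linarith
      qed
      have "(\<Sum>e\<in>F. \<Phi> (\<sigma> k) (?I (w @ [e]))) \<le> \<Phi> (\<sigma> k) (?I w)" for k
      proof -
        note s = \<Phi>_sum[OF F(1), of "\<lambda>e. ?I (w @ [e])" "\<sigma> k", OF I_bd']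
        have "\<Phi> (\<sigma> k) (\<lambda>\<omega>. \<Sum>e\<in>F. ?I (w @ [e]) \<omega>) \<le> \<Phi> (\<sigma> k) (?I w)"
          by (rule \<Phi>_mono[OF conjunct2[OF s] I_bd' le])
        then show ?thesis using s by linarith
      qed
      then show "\<exists>N. \<forall>k\<ge>N. (\<Sum>e\<in>F. \<Phi> (\<sigma> k) (?I (w @ [e]))) \<le> \<Phi> (\<sigma> k) (?I w)" by blast
    qed
    have summable: "(\<lambda>e. m (w @ [e])) summable_on arcs G"
      by (rule nonneg_bdd_above_summable_on) (use m_nonneg we upper in \<open>auto intro!: bdd_aboveI2[of _ _ "m w"]\<close>)
    moreover have "infsum (\<lambda>e. m (w @ [e])) (arcs G) \<le> m w"
      by (rule infsum_le_finite_sums[OF summable]) (rule upper)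
    \<comment> \<open>This direction rests on tightness: it prevents mass from escaping to ever new
      extension letters in the limit.\<close>
    moreover have "m w \<le> infsum (\<lambda>e. m (w @ [e])) (arcs G)"
    proof (rule field_le_epsilon)
      fix \<epsilon> :: real assume "\<epsilon> > 0"
      then obtain F where F: "finite F" "F \<subseteq> arcs G" "eventually (\<lambda>k. \<Phi> k (avoids (length w) F) < \<epsilon>) sequentially"
        using tight[of \<epsilon> "length w"] by blast
      have "m w \<le> (\<Sum>e\<in>F. m (w @ [e])) + \<epsilon>"
      proof (rule tendsto_le[OF sequentially_bot tendsto_add[OF sumlim[OF F(2)] tendsto_const] m[OF w]])
        show "eventually (\<lambda>k. \<Phi> (\<sigma> k) (?I w) \<le> (\<Sum>e\<in>F. \<Phi> (\<sigma> k) (?I (w @ [e]))) + \<epsilon>) sequentially"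
          using \<sigma>_ev[OF F(3)]
        proof (rule eventually_mono)
          fix k assume k: "\<Phi> (\<sigma> k) (avoids (length w) F) < \<epsilon>"
          note s = \<Phi>_sum[OF F(1), of "\<lambda>e. ?I (w @ [e])" "\<sigma> k", OF I_bd']
          have "\<Phi> (\<sigma> k) (?I w) \<le> \<Phi> (\<sigma> k) (\<lambda>\<omega>. (\<Sum>e\<in>F. ?I (w @ [e]) \<omega>) + avoids (length w) F \<omega>)"
          proof (rule \<Phi>_mono)
            fix \<omega> assume \<omega>: "\<omega> \<in> X"
            have "?I w \<omega> * avoids (length w) F \<omega> \<le> avoids (length w) F \<omega>" by (simp add: indicator_def avoids_def)
            then show "?I w \<omega> \<le> (\<Sum>e\<in>F. ?I (w @ [e]) \<omega>) + avoids (length w) F \<omega>"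
              using split[OF F(1) \<omega>, of w] by linarith
          qed (use s bdI[OF avoids_bounded] in auto)
          also have "\<dots> = (\<Sum>e\<in>F. \<Phi> (\<sigma> k) (?I (w @ [e]))) + \<Phi> (\<sigma> k) (avoids (length w) F)"
            using s by (subst \<Phi>_add) (auto simp: bdI[OF avoids_bounded])
          finally show "\<Phi> (\<sigma> k) (?I w) \<le> (\<Sum>e\<in>F. \<Phi> (\<sigma> k) (?I (w @ [e]))) + \<epsilon>" using k by linarith
        qed
      qed
      moreover have "(\<Sum>e\<in>F. m (w @ [e])) \<le> infsum (\<lambda>e. m (w @ [e])) (arcs G)"
        by (rule finite_sum_le_infsum[OF summable F(1,2)]) (use m_nonneg we in auto)
      ultimately show "m w \<le> infsum (\<lambda>e. m (w @ [e])) (arcs G) + \<epsilon>" by linarith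
    qed
    ultimately show ?thesis by (simp add: has_sum_iff)
  qed
  obtain \<nu> where \<nu>: "prob_space \<nu>" "sets \<nu> = sets borelX"
    "\<And>w. w \<in> lists (arcs G) \<Longrightarrow> measure \<nu> (cylinder G w) = m w"
    using borel_measure_exists[OF m_nil m_nonneg m_cons m_empty] by blast
  interpret prob_space \<nu> by (rule \<nu>(1))
  have sp: "space \<nu> = X" using sets_eq_imp_space_eq[OF \<nu>(2)] by simp
  have meas: "f \<in> borel_measurable \<nu>" if "lipschitz_by G \<theta> f V" for f :: "_ \<Rightarrow> real" and V
    using continuous_measurable[OF lipschitz_continuous[OF that]] by (simp add: measurable_cong_sets[OF \<nu>(2)])
  have int: "integrable \<nu> f" if "f \<in> borel_measurable \<nu>" "bounded_by G f M" for f :: "_ \<Rightarrow> real" and M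
    by (rule integrable_const_bound[of _ M]) (use that in \<open>auto simp: sp bounded_by_def intro!: AE_I2\<close>)
  \<comment> \<open>Convergence is known on cylinder indicators only. A Lipschitz function is
    replaced by the step function \<open>s\<close> over words of length \<open>n\<close> with
    letters in a finite \<open>F\<close>; the error is the Lipschitz error plus \<open>M\<close>
    times the weight of the set where \<open>J\<close> vanishes.\<close>
  have lim: "(\<lambda>k. \<Phi> (\<sigma> k) \<phi>) \<longlonglongrightarrow> integral\<^sup>L \<nu> \<phi>"
    if \<phi>: "bounded_by G \<phi> M" "lipschitz_by G \<theta> \<phi> V" for \<phi> M V
  proof (rule LIMSEQ_I)
    fix \<epsilon> :: real assume \<epsilon>: "\<epsilon> > 0"
    have M: "0 \<le> M" by (rule bounded_by_nonneg[OF \<phi>(1)])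
    obtain n where n: "n \<ge> 1" "\<theta> ^ n < \<epsilon> / (8 * (\<bar>V\<bar> + 1))"
      using pow_less[of "\<epsilon> / (8 * (\<bar>V\<bar> + 1))"] \<epsilon> by (auto simp: divide_pos_pos)
    have Vn: "V * \<theta> ^ n \<le> \<epsilon> / 8"
    proof -
      have "V * \<theta> ^ n \<le> (\<bar>V\<bar> + 1) * (\<epsilon> / (8 * (\<bar>V\<bar> + 1)))" using n(2) \<theta>_pos by (intro mult_mono) auto
      moreover have "c * (\<epsilon> / (8 * c)) = \<epsilon> / 8" if "c > 0" for c using that by (simp add: field_simps)
      from this[of "\<bar>V\<bar> + 1"] have "(\<bar>V\<bar> + 1) * (\<epsilon> / (8 * (\<bar>V\<bar> + 1))) = \<epsilon> / 8" by simp
      ultimately show ?thesis by linarith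
    qed
    \<comment> \<open>The division by \<open>n\<close> pays for the \<open>n\<close> positions at
      which a letter may leave \<open>F\<close>.\<close>
    let ?\<delta> = "\<epsilon> / (8 * (M + 1)) / real n"
    have \<delta>: "?\<delta> > 0" using \<epsilon> M n by simp
    have "\<forall>i. \<exists>F. finite F \<and> F \<subseteq> arcs G \<and> eventually (\<lambda>k. \<Phi> k (avoids i F) < ?\<delta>) sequentially"
      using tight[OF \<delta>] by blast
    from choice[OF this] obtain Fs where Fs: "\<And>i. finite (Fs i)" "\<And>i. Fs i \<subseteq> arcs G"
      "\<And>i. eventually (\<lambda>k. \<Phi> k (avoids i (Fs i)) < ?\<delta>) sequentially" by blast
    define F where "F = (\<Union>i<n. Fs i)"
    have F: "finite F" "F \<subseteq> arcs G" using Fs by (auto simp: F_def)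
    define W where "W = {w. set w \<subseteq> F \<and> length w = n}"
    have W: "finite W" "W \<subseteq> lists (arcs G)"
      unfolding W_def using finite_lists_length_eq[OF F(1)] F(2) by auto
    define J where "J \<omega> = (\<Sum>w\<in>W. 1 * ?I w \<omega>)" for \<omega>
    define s where "s \<omega> = (\<Sum>w\<in>W. \<phi> (word_point w) * ?I w \<omega>)" for \<omega>
    have J: "J \<omega> = (if \<forall>i<n. \<omega> i \<in> F then 1 else 0)" if "\<omega> \<in> X" for \<omega>
      unfolding J_def W_def by (rule sum_cylinders[OF F that])
    have s: "s \<omega> = (if \<forall>i<n. \<omega> i \<in> F then \<phi> (rep n \<omega>) else 0)" if "\<omega> \<in> X" for \<omega>
      unfolding s_def W_def rep_def by (rule sum_cylinders[OF F that])
    have close: "\<bar>\<phi> \<omega> - s \<omega>\<bar> \<le> V * \<theta> ^ n + M * (1 - J \<omega>)" if \<omega>: "\<omega> \<in> X" for \<omega>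
    proof -
      have l: "\<bar>\<phi> \<omega> - \<phi> (rep n \<omega>)\<bar> \<le> V * \<theta> ^ n"
        using lipschitz_byD[OF \<phi>(2) \<omega> rep(1)[OF \<omega>] n(1) agree_sym[OF rep(2)[OF \<omega>]]] by simp
      then show ?thesis using bounded_by_absD[OF \<phi>(1) \<omega>] s[OF \<omega>] J[OF \<omega>] by auto
    qed
    have bdJ: "bd J" and \<Phi>J: "\<Phi> k J = (\<Sum>w\<in>W. \<Phi> k (?I w))" for k
      using \<Phi>_sum[OF W(1), of "\<lambda>w \<omega>. 1 * ?I w \<omega>" k] by (auto simp: J_def[abs_def])
    have bds: "bd s" and \<Phi>s: "\<Phi> k s = (\<Sum>w\<in>W. \<phi> (word_point w) * \<Phi> k (?I w))" for k
      using \<Phi>_sum[OF W(1), of "\<lambda>w \<omega>. \<phi> (word_point w) * ?I w \<omega>" k] by (auto simp: s_def[abs_def] \<Phi>_scale)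
    have mW: "(\<lambda>k. \<Phi> (\<sigma> k) (?I w)) \<longlonglongrightarrow> m w" if "w \<in> W" for w using m W(2) that by blast
    have \<Phi>J_lim: "(\<lambda>k. \<Phi> (\<sigma> k) J) \<longlonglongrightarrow> (\<Sum>w\<in>W. m w)"
      unfolding \<Phi>J by (intro tendsto_sum mW)
    have \<Phi>s_lim: "(\<lambda>k. \<Phi> (\<sigma> k) s) \<longlonglongrightarrow> (\<Sum>w\<in>W. \<phi> (word_point w) * m w)"
      unfolding \<Phi>s by (intro tendsto_sum tendsto_mult_left mW)
    have cyl_int: "integrable \<nu> (?I w)" "integral\<^sup>L \<nu> (?I w) = m w" if "w \<in> W" for w
    proof -
      have c: "cylinder G w \<in> sets \<nu>" using cylinder_sets \<nu>(2) by simp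
      show "integrable \<nu> (?I w)" using c by (intro integrable_real_indicator) (auto simp: emeasure_eq_measure)
      show "integral\<^sup>L \<nu> (?I w) = m w"
        using that W(2) c \<nu>(3)[of w] cylinder_subset[of w] by (simp add: sp Int_absorb2 subset_iff)
    qed
    have J_int: "integrable \<nu> J" "integral\<^sup>L \<nu> J = (\<Sum>w\<in>W. m w)"
      unfolding J_def[abs_def] using cyl_int by (simp_all add: Bochner_Integration.integral_sum)
    have s_int: "integrable \<nu> s" "integral\<^sup>L \<nu> s = (\<Sum>w\<in>W. \<phi> (word_point w) * m w)"
      unfolding s_def[abs_def] using cyl_int by (simp_all add: Bochner_Integration.integral_sum)
    have J_ge: "1 - (\<Sum>w\<in>W. m w) \<le> \<epsilon> / (8 * (M + 1))"
    proof (rule tendsto_le[OF sequentially_bot tendsto_const tendsto_diff[OF tendsto_const \<Phi>J_lim]])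
      have "eventually (\<lambda>k. \<forall>i\<in>{..<n}. \<Phi> (\<sigma> k) (avoids i (Fs i)) < ?\<delta>) sequentially"
        by (intro eventually_ball_finite ballI \<sigma>_ev[OF Fs(3)]) simp
      then show "eventually (\<lambda>k. 1 - \<Phi> (\<sigma> k) J \<le> \<epsilon> / (8 * (M + 1))) sequentially"
      proof (rule eventually_mono)
        fix k assume k: "\<forall>i\<in>{..<n}. \<Phi> (\<sigma> k) (avoids i (Fs i)) < ?\<delta>"
        note av = \<Phi>_sum[of "{..<n}" "\<lambda>i. avoids i (Fs i)" "\<sigma> k"]
        have "1 - \<Phi> (\<sigma> k) J = \<Phi> (\<sigma> k) (\<lambda>\<omega>. 1 - J \<omega>)" using \<Phi>_diff[of "\<lambda>_. 1" J "\<sigma> k"] bdJ by (simp add: \<Phi>_one)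
        also have "\<dots> \<le> \<Phi> (\<sigma> k) (\<lambda>\<omega>. \<Sum>i<n. avoids i (Fs i) \<omega>)"
        proof (rule \<Phi>_mono)
          fix \<omega> assume \<omega>: "\<omega> \<in> X"
          show "1 - J \<omega> \<le> (\<Sum>i<n. avoids i (Fs i) \<omega>)"
          proof (cases "\<forall>i<n. \<omega> i \<in> F")
            case False
            then obtain i where i: "i < n" "\<omega> i \<notin> F" by auto
            then have "avoids i (Fs i) \<omega> = 1" by (auto simp: avoids_def F_def)
            then have "1 \<le> (\<Sum>i<n. avoids i (Fs i) \<omega>)"
              using member_le_sum[of i "{..<n}" "\<lambda>i. avoids i (Fs i) \<omega>"] i by (auto simp: avoids_def)
            then show ?thesis using J[OF \<omega>] False by simp
          qed (use J[OF \<omega>] in \<open>auto simp: avoids_def intro!: sum_nonneg\<close>)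
        qed (use av bdI[OF avoids_bounded] bdJ in auto)
        also have "\<dots> = (\<Sum>i<n. \<Phi> (\<sigma> k) (avoids i (Fs i)))" using av bdI[OF avoids_bounded] by simp
        also have "\<dots> \<le> (\<Sum>i<n. ?\<delta>)" using k by (intro sum_mono) (simp add: less_imp_le)
        also have "\<dots> = \<epsilon> / (8 * (M + 1))" using n by simp
        finally show "1 - \<Phi> (\<sigma> k) J \<le> \<epsilon> / (8 * (M + 1))" .
      qed
    qed
    have MJ: "M * (1 - (\<Sum>w\<in>W. m w)) \<le> \<epsilon> / 8"
    proof -
      have "M * (1 - (\<Sum>w\<in>W. m w)) \<le> M * (\<epsilon> / (8 * (M + 1)))" by (rule mult_left_mono[OF J_ge M])
      also have "\<dots> \<le> \<epsilon> / 8" using M \<epsilon> by (simp add: field_simps)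
      finally show ?thesis .
    qed
    have int_close: "\<bar>integral\<^sup>L \<nu> \<phi> - integral\<^sup>L \<nu> s\<bar> \<le> \<epsilon> / 4"
    proof -
      have i\<phi>: "integrable \<nu> \<phi>" by (rule int[OF meas[OF \<phi>(2)] \<phi>(1)])
      have "\<bar>integral\<^sup>L \<nu> \<phi> - integral\<^sup>L \<nu> s\<bar> = \<bar>integral\<^sup>L \<nu> (\<lambda>\<omega>. \<phi> \<omega> - s \<omega>)\<bar>"
        using i\<phi> s_int by simp
      also have "\<dots> \<le> integral\<^sup>L \<nu> (\<lambda>\<omega>. \<bar>\<phi> \<omega> - s \<omega>\<bar>)" by (rule integral_abs_bound)
      also have "\<dots> \<le> integral\<^sup>L \<nu> (\<lambda>\<omega>. V * \<theta> ^ n + M * (1 - J \<omega>))"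
        by (rule integral_mono) (use i\<phi> s_int J_int close in \<open>auto simp: sp\<close>)
      also have "\<dots> = V * \<theta> ^ n + M * (1 - (\<Sum>w\<in>W. m w))"
        using J_int by (simp add: prob_space)
      finally show ?thesis using Vn MJ by linarith
    qed
    have b\<phi>: "bd \<phi>" by (rule bdI[OF \<phi>(1)])
    have \<Phi>_close: "\<bar>\<Phi> k \<phi> - \<Phi> k s\<bar> \<le> \<epsilon> / 8 + M * (1 - \<Phi> k J)" for k
    proof -
      have b: "bd (\<lambda>\<omega>. V * \<theta> ^ n + M * (1 - J \<omega>))" using bdJ by simp
      have v: "\<Phi> k (\<lambda>\<omega>. V * \<theta> ^ n + M * (1 - J \<omega>)) = V * \<theta> ^ n + M * (1 - \<Phi> k J)"
        using bdJ by (simp add: \<Phi>_add \<Phi>_diff \<Phi>_scale \<Phi>_const)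
      have "\<Phi> k \<phi> - \<Phi> k s \<le> V * \<theta> ^ n + M * (1 - \<Phi> k J)"
        using \<Phi>_mono[of "\<lambda>\<omega>. \<phi> \<omega> - s \<omega>" "\<lambda>\<omega>. V * \<theta> ^ n + M * (1 - J \<omega>)" k] b\<phi> bds b close
        by (simp add: \<Phi>_diff v abs_le_iff)
      moreover have "\<Phi> k s - \<Phi> k \<phi> \<le> V * \<theta> ^ n + M * (1 - \<Phi> k J)"
        using \<Phi>_mono[of "\<lambda>\<omega>. s \<omega> - \<phi> \<omega>" "\<lambda>\<omega>. V * \<theta> ^ n + M * (1 - J \<omega>)" k] b\<phi> bds b close
        by (simp add: \<Phi>_diff v abs_le_iff)
      ultimately show ?thesis using Vn by linarith
    qed
    have "eventually (\<lambda>k. dist (M * (1 - \<Phi> (\<sigma> k) J)) (M * (1 - (\<Sum>w\<in>W. m w))) < \<epsilon> / 8) sequentially"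
      using \<epsilon> by (intro tendstoD tendsto_intros \<Phi>J_lim) auto
    moreover have "eventually (\<lambda>k. dist (\<Phi> (\<sigma> k) s) (\<Sum>w\<in>W. \<phi> (word_point w) * m w) < \<epsilon> / 8) sequentially"
      using \<epsilon> by (intro tendstoD[OF \<Phi>s_lim]) auto
    ultimately have "eventually (\<lambda>k. \<bar>\<Phi> (\<sigma> k) \<phi> - integral\<^sup>L \<nu> \<phi>\<bar> < \<epsilon>) sequentially"
    proof eventually_elim
      case (elim k)
      then show ?case using \<Phi>_close[of "\<sigma> k"] int_close MJ unfolding s_int(2) dist_real_def by linarith
    qed
    then show "\<exists>no. \<forall>k\<ge>no. norm (\<Phi> (\<sigma> k) \<phi> - integral\<^sup>L \<nu> \<phi>) < \<epsilon>"
      by (simp add: eventually_sequentially)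
  qed
  have eig: "integral\<^sup>L \<nu> (L f) = lam * integral\<^sup>L \<nu> f" if f: "bounded_by G f M" "lipschitz_by G \<theta> f V" for f M V
  proof -
    have f': "lipschitz_by G \<theta> f \<bar>V\<bar>"
      by (rule lipschitz_by_mono[OF f(2) abs_ge_self])
    have "lipschitz_by G \<theta> (L f) ((\<theta> ^ 1 * \<bar>V\<bar> + C_LY * M) * growth 1)"
      using Lpow_lipschitz[OF f(1) f', of 1] by simp
    note lim[OF L_bound[OF f(1)] this]
    moreover have "(\<lambda>k. (\<Phi> (\<sigma> k) (L f) - xs (\<sigma> k) * \<Phi> (\<sigma> k) f) + xs (\<sigma> k) * \<Phi> (\<sigma> k) f) \<longlonglongrightarrow> 0 + lam * integral\<^sup>L \<nu> f"
      using LIMSEQ_subseq_LIMSEQ[OF \<Phi>_near[OF f(1)] \<sigma>] LIMSEQ_subseq_LIMSEQ[OF xlim \<sigma>] lim[OF f]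
      by (intro tendsto_add tendsto_mult) (simp_all add: comp_def)
    then have "(\<lambda>k. \<Phi> (\<sigma> k) (L f)) \<longlonglongrightarrow> lam * integral\<^sup>L \<nu> f" by simp
    ultimately show ?thesis by (rule LIMSEQ_unique)
  qed
  show ?thesis by (rule that[OF \<nu>(1,2) eig])
qed

end

section \<open>Exponential convergence for a normalised potential\<close>

context potential
begin

text \<open>The equation is asked for bounded Lipschitz functions, the class for which it is
  constructed and which \<open>L\<close> preserves; \<open>eigenmeasure_continuous\<close> extends
  it to bounded continuous functions.\<close>

definition eigenmeasure :: "(nat \<Rightarrow> 'e) measure \<Rightarrow> real \<Rightarrow> bool" where
  "eigenmeasure \<nu> l \<longleftrightarrow> prob_space \<nu> \<and> sets \<nu> = sets borelX \<and>
    (\<forall>f M V. bounded_by G f M \<longrightarrow> lipschitz_by G \<theta> f V \<longrightarrow> integral\<^sup>L \<nu> (L f) = l * integral\<^sup>L \<nu> f)"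

lemma eigenmeasure_exists: "\<exists>\<nu>. eigenmeasure \<nu> lam"
  unfolding eigenmeasure_def using eigenmeasure_exists_lipschitz by metis

lemma space_eigenmeasure: "eigenmeasure \<nu> l \<Longrightarrow> space \<nu> = X"
  unfolding eigenmeasure_def using sets_eq_imp_space_eq[of \<nu> borelX] by simp

lemma eigenmeasure_measurable:
  assumes "eigenmeasure \<nu> l" "f \<in> borel_measurable borelX" shows "f \<in> borel_measurable \<nu>"
  using assms by (simp add: eigenmeasure_def measurable_cong_sets[of \<nu> borelX])

lemma eigenmeasure_integrable:
  fixes f :: "_ \<Rightarrow> real"
  assumes \<nu>: "eigenmeasure \<nu> l" and f: "f \<in> borel_measurable borelX" "bounded_by G f M"
  shows "integrable \<nu> f"
proof -
  interpret prob_space \<nu> using \<nu> by (simp add: eigenmeasure_def)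
  show ?thesis
    by (rule integrable_const_bound[of _ M])
      (use f space_eigenmeasure[OF \<nu>] eigenmeasure_measurable[OF \<nu>] in \<open>auto simp: bounded_by_def intro!: AE_I2\<close>)
qed

lemma lipschitz_measurable: "lipschitz_by G \<theta> (f :: _ \<Rightarrow> real) V \<Longrightarrow> f \<in> borel_measurable borelX"
  by (rule continuous_measurable[OF lipschitz_continuous])

lemma L_lipschitz:
  assumes "bounded_by G f M" "lipschitz_by G \<theta> f V"
  shows "lipschitz_by G \<theta> (L f) ((\<theta> * \<bar>V\<bar> + C_LY * M) * growth 1)"
  using Lpow_lipschitz[OF assms(1) lipschitz_by_mono[OF assms(2) abs_ge_self], of 1] by simp

lemma eigenmeasure_tendsto:
  fixes f :: "nat \<Rightarrow> _ \<Rightarrow> real"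
  assumes \<nu>: "eigenmeasure \<nu> l" and f: "\<And>k. f k \<in> borel_measurable borelX" "\<And>k. bounded_by G (f k) M"
    and lim: "\<And>\<omega>. \<omega> \<in> X \<Longrightarrow> (\<lambda>k. f k \<omega>) \<longlonglongrightarrow> g \<omega>"
  shows "(\<lambda>k. integral\<^sup>L \<nu> (f k)) \<longlonglongrightarrow> integral\<^sup>L \<nu> g" "g \<in> borel_measurable borelX"
proof -
  interpret prob_space \<nu> using \<nu> by (simp add: eigenmeasure_def)
  show g: "g \<in> borel_measurable borelX" by (rule borel_measurable_LIMSEQ_real[OF _ f(1)]) (use lim in simp)
  show "(\<lambda>k. integral\<^sup>L \<nu> (f k)) \<longlonglongrightarrow> integral\<^sup>L \<nu> g"
  proof (rule integral_dominated_convergence[where w="\<lambda>_. M"])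
    show "g \<in> borel_measurable \<nu>" by (rule eigenmeasure_measurable[OF \<nu> g])
    show "f k \<in> borel_measurable \<nu>" for k by (rule eigenmeasure_measurable[OF \<nu> f(1)])
  qed (use f(2) lim space_eigenmeasure[OF \<nu>] in \<open>auto simp: bounded_by_def intro!: AE_I2\<close>)
qed

text \<open>The approximations of \<open>f\<close> through \<open>rep n\<close> are Lipschitz, have
  a common bound and converge pointwise, and \<open>L\<close> commutes with such limits.
  Measurability of \<open>L f\<close> comes from the same limit.\<close>

lemma eigenmeasure_continuous:
  assumes \<nu>: "eigenmeasure \<nu> l" and f: "bounded_by G f M" "continuous_map (shift_topology G \<theta>) euclidean f"
  shows "integral\<^sup>L \<nu> (L f) = l * integral\<^sup>L \<nu> f" "L f \<in> borel_measurable borelX"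
proof -
  define g where "g n \<omega> = f (rep n \<omega>)" for n \<omega>
  have g: "bounded_by G (g n) M" "lipschitz_by G \<theta> (g n) (2 * M / \<theta> ^ n)" for n
    using rep_lipschitz[OF f(1)] f(1) rep(1) unfolding g_def by (auto simp: bounded_by_def)
  have lim: "(\<lambda>n. g n \<omega>) \<longlonglongrightarrow> f \<omega>" if "\<omega> \<in> X" for \<omega> unfolding g_def by (rule rep_tendsto[OF f(2) that])
  note 1 = eigenmeasure_tendsto[OF \<nu> lipschitz_measurable[OF g(2)] g(1) lim]
  note 2 = eigenmeasure_tendsto[OF \<nu> lipschitz_measurable[OF L_lipschitz[OF g]] L_bound[OF g(1)] L_tendsto[OF g(1) lim]]
  show "L f \<in> borel_measurable borelX" by (rule 2(2))
  have "integral\<^sup>L \<nu> (L (g n)) = l * integral\<^sup>L \<nu> (g n)" for n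
    using \<nu> g unfolding eigenmeasure_def by blast
  then have "(\<lambda>n. integral\<^sup>L \<nu> (L (g n))) \<longlonglongrightarrow> l * integral\<^sup>L \<nu> f" using tendsto_mult_left[OF 1(1), of l] by simp
  then show "integral\<^sup>L \<nu> (L f) = l * integral\<^sup>L \<nu> f" using LIMSEQ_unique[OF 2(1)] by simp
qed

lemma cylinder_lipschitz: "lipschitz_by G \<theta> (indicator (cylinder G w) :: _ \<Rightarrow> real) (1 / \<theta> ^ length w)"
proof (rule lipschitz_byI)
  fix \<omega> \<upsilon> n assume *: "\<omega> \<in> X" "\<upsilon> \<in> X" "1 \<le> n" "agree n \<omega> \<upsilon>"
  show "norm (indicator (cylinder G w) \<omega> - indicator (cylinder G w) \<upsilon> :: real) \<le> 1 / \<theta> ^ length w * \<theta> ^ n"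
  proof (cases "length w \<le> n")
    case True
    then have "\<omega> \<in> cylinder G w \<longleftrightarrow> \<upsilon> \<in> cylinder G w" using * by (auto simp: cylinder_def agree_def)
    then show ?thesis using \<theta>_pos by (simp add: indicator_def)
  next
    case False
    then have "\<theta> ^ length w \<le> \<theta> ^ n" using \<theta>_pos \<theta>_less_1 by (intro power_decreasing) auto
    then have "1 \<le> 1 / \<theta> ^ length w * \<theta> ^ n" using \<theta>_pos by (simp add: field_simps)
    then have "0 \<le> 1 / \<theta> ^ length w * \<theta> ^ n" "1 \<le> 1 / \<theta> ^ length w * \<theta> ^ n" by linarith+
    then show ?thesis unfolding indicator_def by (cases "\<omega> \<in> cylinder G w"; cases "\<upsilon> \<in> cylinder G w") simp_all
  qed
qed

lemma cylinder_bounded: "bounded_by G (indicator (cylinder G w) :: _ \<Rightarrow> real) 1"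
  by (simp add: bounded_by_def indicator_def)

text \<open>On the cylinder of \<open>w\<close>, the image under \<open>L\<close> of the indicator
  of the longer cylinder is at least exp \<psi> at one preimage, which is bounded below because
  \<psi> varies by at most \<open>K\<close> over points that begin with \<open>e\<close>.
  Integration transfers this to the masses.\<close>

lemma eigenmeasure_cylinder_step:
  assumes \<nu>: "eigenmeasure \<nu> l" and l: "l > 0" and e: "e \<in> arcs G" "incident G e (w ! 0)" and w: "w \<noteq> []"
    and pos: "0 < measure \<nu> (cylinder G w)"
  shows "0 < measure \<nu> (cylinder G (e # w))"
proof -
  interpret prob_space \<nu> using \<nu> by (simp add: eigenmeasure_def)
  have sp: "space \<nu> = X" by (rule space_eigenmeasure[OF \<nu>])
  have sets: "cylinder G v \<in> sets \<nu>" for v using \<nu> cylinder_sets by (simp add: eigenmeasure_def)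
  let ?I = "\<lambda>w. indicator (cylinder G w) :: _ \<Rightarrow> real"
  have I: "integral\<^sup>L \<nu> (?I v) = measure \<nu> (cylinder G v)" for v
    using cylinder_subset[of v] by (simp add: sp Int_absorb2)
  define c where "c = exp (\<psi> (edge_point e) - K)"
  have c: "c \<le> exp (\<psi> \<omega>)" if "\<omega> \<in> X" "\<omega> 0 = e" for \<omega>
  proof -
    have "\<bar>\<psi> (edge_point e) - \<psi> \<omega>\<bar> \<le> K * \<theta> ^ 1"
      by (rule \<psi>_lip) (use that edge_point[OF e(1)] in \<open>auto simp: agree_def\<close>)
    also have "\<dots> \<le> K * 1" using K_nonneg \<theta>_pow_le_1[of 1] by (intro mult_left_mono) auto
    finally show ?thesis unfolding c_def by simp
  qed
  have ge: "c * ?I w \<omega> \<le> L (?I (e # w)) \<omega>" if \<omega>: "\<omega> \<in> X" for \<omega>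
  proof (cases "\<omega> \<in> cylinder G w")
    case True
    then have "\<omega> 0 = w ! 0" using w by (auto simp: cylinder_def)
    then have p: "e \<in> preds G \<omega>" using e by (simp add: preds_def incident_def)
    then have X: "prepend e \<omega> \<in> X" using \<omega> by simp
    have "prepend e \<omega> i = (e # w) ! i" if "i < length (e # w)" for i
      using that True by (cases i) (auto simp: cylinder_def)
    then have "prepend e \<omega> \<in> cylinder G (e # w)" using X unfolding cylinder_def by blast
    then have "exp (\<psi> (prepend e \<omega>)) \<le> L (?I (e # w)) \<omega>"
      using L_ge_term[OF cylinder_bounded _ X, of "e # w"] by simp
    then show ?thesis using c[OF X] True by simp
  qed (simp add: L_nonneg)
  have "c * measure \<nu> (cylinder G w) = integral\<^sup>L \<nu> (\<lambda>\<omega>. c * ?I w \<omega>)"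
    by (simp only: integral_mult_right_zero I)
  also have "\<dots> \<le> integral\<^sup>L \<nu> (L (?I (e # w)))"
  proof (rule integral_mono)
    show "integrable \<nu> (\<lambda>\<omega>. c * ?I w \<omega>)" using sets by (simp add: emeasure_eq_measure)
    show "integrable \<nu> (L (?I (e # w)))"
      by (rule eigenmeasure_integrable[OF \<nu> lipschitz_measurable[OF L_lipschitz[OF cylinder_bounded cylinder_lipschitz]]
        L_bound[OF cylinder_bounded]])
  qed (use ge sp in simp)
  also have "\<dots> = l * measure \<nu> (cylinder G (e # w))"
    using \<nu> cylinder_bounded cylinder_lipschitz I unfolding eigenmeasure_def by metis
  finally have "0 < l * measure \<nu> (cylinder G (e # w))"
    using pos less_le_trans[OF mult_pos_pos[OF _ pos, of c]] by (simp add: c_def)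
  then show ?thesis using l by (simp add: zero_less_mult_iff)
qed

text \<open>Some letter has positive mass because letters are countably many. Irreducibility carries
  positivity backwards along a path to every letter, and words are then built by adding letters in
  front.\<close>

lemma eigenmeasure_cylinder_pos:
  assumes \<nu>: "eigenmeasure \<nu> l" and l: "l > 0" and ne: "cylinder G w \<noteq> {}"
  shows "0 < measure \<nu> (cylinder G w)"
proof -
  interpret prob_space \<nu> using \<nu> by (simp add: eigenmeasure_def)
  have sp: "space \<nu> = X" by (rule space_eigenmeasure[OF \<nu>])
  have sets: "cylinder G v \<in> sets \<nu>" for v using \<nu> cylinder_sets by (simp add: eigenmeasure_def)
  have "\<exists>e\<in>arcs G. 0 < measure \<nu> (cylinder G [e])"
  proof (rule ccontr)
    assume "\<not> ?thesis"
    then have zero: "measure \<nu> (cylinder G [e]) = 0" if "e \<in> arcs G" for e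
    proof -
      have "\<not> 0 < measure \<nu> (cylinder G [e])" using that \<open>\<not> (\<exists>e\<in>arcs G. _ e)\<close> by blast
      then show ?thesis using measure_nonneg[of \<nu> "cylinder G [e]"] by linarith
    qed
    have "(\<Union>e\<in>arcs G. cylinder G [e]) \<in> null_sets \<nu>"
    proof (rule null_sets_UN'[OF countable_arcs])
      fix e assume "e \<in> arcs G"
      then have "emeasure \<nu> (cylinder G [e]) = 0" using zero by (simp add: emeasure_eq_measure)
      then show "cylinder G [e] \<in> null_sets \<nu>" using sets by (rule null_setsI)
    qed
    moreover have "(\<Union>e\<in>arcs G. cylinder G [e]) = X" by (auto simp: cylinder_def shift_space_nth)
    ultimately show False using sp emeasure_space_1 by (simp add: null_sets_def)
  qed
  then obtain e where e: "e \<in> arcs G" "0 < measure \<nu> (cylinder G [e])" by blast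
  have all: "0 < measure \<nu> (cylinder G [e'])" if "e' \<in> arcs G" for e'
  proof -
    have "(e', e) \<in> follows\<^sup>+" by (rule arcs_connected[OF that e(1)])
    then show ?thesis
    proof (induction rule: converse_trancl_induct)
      case (base a)
      then have "0 < measure \<nu> (cylinder G [a, e])"
        by (intro eigenmeasure_cylinder_step[OF \<nu> l, of a "[e]"]) (use e(2) in \<open>auto simp: follows_def\<close>)
      also have "\<dots> \<le> measure \<nu> (cylinder G [a])"
        by (rule finite_measure_mono[OF _ sets]) (auto simp: cylinder_def)
      finally show ?case .
    next
      case (step a b)
      then have "0 < measure \<nu> (cylinder G [a, b])"
        by (intro eigenmeasure_cylinder_step[OF \<nu> l, of a "[b]"]) (auto simp: follows_def)
      also have "\<dots> \<le> measure \<nu> (cylinder G [a])"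
        by (rule finite_measure_mono[OF _ sets]) (auto simp: cylinder_def)
      finally show ?case .
    qed
  qed
  show ?thesis using ne
  proof (induction w)
    case Nil
    then show ?case using sp prob_space by (simp add: cylinder_def)
  next
    case (Cons a w)
    then obtain \<omega> where \<omega>: "\<omega> \<in> X" "\<And>i. i < length (a # w) \<Longrightarrow> \<omega> i = (a # w) ! i" by (auto simp: cylinder_def)
    have a: "a = \<omega> 0" using \<omega>(2)[of 0] by simp
    then have aE: "a \<in> arcs G" using \<omega>(1) shift_space_nth by metis
    show ?case
    proof (cases "w = []")
      case True
      then show ?thesis using all[OF aE] by simp
    next
      case False
      have w: "w ! i = \<omega> (Suc i)" if "i < length w" for i using \<omega>(2)[of "Suc i"] that by simp
      then have "shift \<omega> \<in> cylinder G w" using \<omega>(1) by (simp add: cylinder_def) (simp add: shift_def)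
      then have "0 < measure \<nu> (cylinder G w)" using Cons.IH by blast
      moreover have "incident G a (w ! 0)" using a w[of 0] False \<omega>(1) by (simp add: shift_space_def)
      ultimately show ?thesis using eigenmeasure_cylinder_step[OF \<nu> l aE] False by blast
    qed
  qed
qed

lemma eigenmeasure_zero:
  assumes \<nu>: "eigenmeasure \<nu> l" "l > 0" and f: "bounded_by G f M" "lipschitz_by G \<theta> f V" "\<And>\<omega>. \<omega> \<in> X \<Longrightarrow> (0::real) \<le> f \<omega>"
    and zero: "integral\<^sup>L \<nu> f = 0" and \<omega>: "\<omega> \<in> X"
  shows "f \<omega> = 0"
proof (rule positive_integral_zero[OF _ _ _ lipschitz_continuous[OF f(2)] f(1) f(3) zero \<omega>])
  show "0 < measure \<nu> (cylinder G (map \<omega> [0..<n]))" if "\<omega> \<in> X" for \<omega> n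
    by (rule eigenmeasure_cylinder_pos[OF \<nu>]) (use that in \<open>auto simp: cylinder_def\<close>)
qed (use \<nu> in \<open>auto simp: eigenmeasure_def\<close>)

end

locale normalized_potential = potential G \<theta> \<psi> B K
  for G :: "('v,'e) pre_digraph" and \<theta> :: real and \<psi> B K +
  fixes h :: "(nat \<Rightarrow> 'e) \<Rightarrow> real" and \<nu> :: "(nat \<Rightarrow> 'e) measure"
  assumes h_cone: "cone h" and h_bounded: "bounded_by G h 1"
    and h_eig: "\<And>\<omega>. \<omega> \<in> shift_space G \<Longrightarrow> L h \<omega> = h \<omega>"
    and h_pos: "\<And>\<omega>. \<omega> \<in> shift_space G \<Longrightarrow> 0 < h \<omega>"
    and \<nu>: "eigenmeasure \<nu> 1"
begin

sublocale prob_space \<nu>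
  using \<nu> by (simp add: eigenmeasure_def)

lemma space_\<nu> [simp]: "space \<nu> = X"
  by (rule space_eigenmeasure[OF \<nu>])

lemma int_L: "bounded_by G f M \<Longrightarrow> lipschitz_by G \<theta> f V \<Longrightarrow> integral\<^sup>L \<nu> (L f) = integral\<^sup>L \<nu> f"
  using \<nu> unfolding eigenmeasure_def by (metis mult_1)

lemma lip_integrable: "bounded_by G f M \<Longrightarrow> lipschitz_by G \<theta> f V \<Longrightarrow> integrable \<nu> (f :: _ \<Rightarrow> real)"
  by (rule eigenmeasure_integrable[OF \<nu> lipschitz_measurable])

lemma Lpow_lipschitz':
  assumes "bounded_by G f M" "lipschitz_by G \<theta> f V"
  shows "lipschitz_by G \<theta> ((L ^^ m) f) ((\<theta> ^ m * \<bar>V\<bar> + C_LY * M) * growth m)"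
  by (rule Lpow_lipschitz[OF assms(1) lipschitz_by_mono[OF assms(2) abs_ge_self]]) simp

lemma int_Lpow:
  assumes "bounded_by G f M" "lipschitz_by G \<theta> f V" shows "integral\<^sup>L \<nu> ((L ^^ n) f) = integral\<^sup>L \<nu> f"
proof (induction n)
  case (Suc n)
  then show ?case using int_L[OF Lpow_bound[OF assms(1)] Lpow_lipschitz'[OF assms], of n] by simp
qed simp

text \<open>On cylinders with first letter in a finite set \<open>F\<close> the iterates of \<open>1\<close> are controlled by \<open>h\<close>
  through the distortion bound and \<open>\<integral> L\<^sup>n 1 d\<nu> = 1\<close>; off \<open>F\<close> one application of \<open>L\<close> contracts.\<close>

lemma growth_bounded: "\<exists>C\<ge>1. \<forall>n. growth n \<le> C"
proof -
  obtain F where F: "finite F" "F \<subseteq> arcs G" "infsum B (arcs G - F) < 1 / 2" using tail_small[of "1 / 2"] by auto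
  have one: "bounded_by G (\<lambda>_. 1::real) 1" "lipschitz_by G \<theta> (\<lambda>_. 1::real) 0"
    using \<theta>_pos by (simp_all add: bounded_by_def lipschitz_by_def)
  \<comment> \<open>One factor \<open>D\<close> bounds the iterate of 1 on the cylinder through its
    integral, the other compares \<open>h\<close> with its value at
    \<open>edge_point e\<close>.\<close>
  define c where "c e = D * D / (measure \<nu> (cylinder G [e]) * h (edge_point e))" for e
  define C where "C = (\<Sum>e\<in>F. c e)"
  have pos: "0 < measure \<nu> (cylinder G [e])" "0 < h (edge_point e)" if "e \<in> arcs G" for e
  proof -
    have "edge_point e \<in> cylinder G [e]" using edge_point[OF that] by (simp add: cylinder_def)
    then show "0 < measure \<nu> (cylinder G [e])" by (intro eigenmeasure_cylinder_pos[OF \<nu>]) auto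
    show "0 < h (edge_point e)" by (rule h_pos[OF edge_point(1)[OF that]])
  qed
  have c_nonneg: "0 \<le> c e" if "e \<in> F" for e
    unfolding c_def using pos[of e] F(2) that D_ge_1 by (intro divide_nonneg_nonneg mult_nonneg_nonneg) auto
  have C: "0 \<le> C" unfolding C_def by (intro sum_nonneg c_nonneg)
  have onF: "(L ^^ n) (\<lambda>_. 1) \<omega> \<le> C * h \<omega>" if \<omega>: "\<omega> \<in> X" "\<omega> 0 \<in> F" for n \<omega>
  proof -
    let ?e = "\<omega> 0" and ?u = "(L ^^ n) (\<lambda>_. 1)"
    have e: "?e \<in> arcs G" by (rule shift_space_nth[OF \<omega>(1)])
    have sets: "cylinder G [?e] \<in> sets \<nu>" using \<nu> cylinder_sets by (simp add: eigenmeasure_def)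
    have cone: "cone ?u" using cone_Lpow[OF cone_const] by auto
    have "?u \<omega> * measure \<nu> (cylinder G [?e]) = integral\<^sup>L \<nu> (\<lambda>\<upsilon>. ?u \<omega> * indicator (cylinder G [?e]) \<upsilon>)"
      using cylinder_subset[of "[?e]"] by (simp add: Int_absorb2)
    also have "\<dots> \<le> integral\<^sup>L \<nu> (\<lambda>\<upsilon>. D * ?u \<upsilon>)"
    proof (rule integral_mono)
      show "integrable \<nu> (\<lambda>\<upsilon>. ?u \<omega> * indicator (cylinder G [?e]) \<upsilon>)"
        using sets by (simp add: emeasure_eq_measure)
      show "integrable \<nu> (\<lambda>\<upsilon>. D * ?u \<upsilon>)"
        by (rule integrable_mult_right[OF lip_integrable[OF Lpow_bound[OF one(1)] Lpow_lipschitz'[OF one]]])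
      show "?u \<omega> * indicator (cylinder G [?e]) \<upsilon> \<le> D * ?u \<upsilon>" if "\<upsilon> \<in> space \<nu>" for \<upsilon>
      proof (cases "\<upsilon> \<in> cylinder G [?e]")
        case True
        then show ?thesis using cone_D[OF cone \<omega>(1), of \<upsilon>] that by (simp add: cylinder_def)
      qed (use that D_ge_1 cone_nonneg[OF cone] in simp)
    qed
    also have "\<dots> = D" using int_Lpow[OF one, of n] prob_space[unfolded space_\<nu>] by simp
    finally have 1: "?u \<omega> \<le> D / measure \<nu> (cylinder G [?e])"
      using pos(1)[OF e] by (simp add: pos_le_divide_eq)
    have "h (edge_point ?e) \<le> D * h \<omega>" by (rule cone_D[OF h_cone edge_point(1)[OF e] \<omega>(1) edge_point(2)[OF e]])
    then have "1 \<le> D / h (edge_point ?e) * h \<omega>" using pos(2)[OF e] by (simp add: pos_le_divide_eq)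
    then have "D / measure \<nu> (cylinder G [?e]) * 1 \<le> D / measure \<nu> (cylinder G [?e]) * (D / h (edge_point ?e) * h \<omega>)"
      using D_ge_1 by (intro mult_left_mono) auto
    also have "\<dots> = c ?e * h \<omega>" by (simp add: c_def)
    also have "\<dots> \<le> C * h \<omega>"
      unfolding C_def using h_pos[OF \<omega>(1)] member_le_sum[OF \<omega>(2) _ F(1), of c] c_nonneg
      by (intro mult_right_mono) auto
    finally show ?thesis using 1 by linarith
  qed
  have hb: "bd h" by (rule bdI[OF h_bounded])
  have bound: "(L ^^ n) (\<lambda>_. 1) \<omega> \<le> C * h \<omega> + 1" if "\<omega> \<in> X" for n \<omega>
    using that
  proof (induction n arbitrary: \<omega>)
    case 0
    then show ?case using C h_pos[OF 0] by simp
  next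
    case (Suc n)
    have "L ((L ^^ n) (\<lambda>_. 1)) \<omega> \<le> L (\<lambda>\<omega>. C * h \<omega> + avoids 0 F \<omega>) \<omega>"
    proof (rule L_mono')
      fix \<upsilon> assume \<upsilon>: "\<upsilon> \<in> X"
      then show "(L ^^ n) (\<lambda>_. 1) \<upsilon> \<le> C * h \<upsilon> + avoids 0 F \<upsilon>"
        using Suc.IH[OF \<upsilon>] onF[OF \<upsilon>] by (auto simp: avoids_def)
    qed (use hb bdI[OF avoids_bounded] in auto)
    also have "\<dots> = C * h \<omega> + L (avoids 0 F) \<omega>"
      using hb bdI[OF avoids_bounded] h_eig[OF Suc.prems] by (simp add: L_add' L_scale)
    also have "L (avoids 0 F) \<omega> \<le> 1 / 2" using avoids_decay[OF F(1,2) Suc.prems, of 0] F(3) by simp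
    finally show ?case by simp
  qed
  have "growth n \<le> C + 1" for n
  proof (rule growth_le)
    fix \<omega> assume \<omega>: "\<omega> \<in> X"
    have "C * h \<omega> \<le> C * 1" using C bounded_by_absD[OF h_bounded \<omega>] by (intro mult_left_mono) auto
    then show "(L ^^ n) (\<lambda>_. 1) \<omega> \<le> C + 1" using bound[OF \<omega>, of n] by simp
  qed
  then show ?thesis using C by (intro exI[of _ "C + 1"]) auto
qed

definition C :: real where "C = (SOME C. 1 \<le> C \<and> (\<forall>n. growth n \<le> C))"

lemma C: "1 \<le> C" "growth n \<le> C"
  using someI_ex[OF growth_bounded] unfolding C_def by auto

lemma Lpow_C: assumes "bounded_by G f M" shows "bounded_by G ((L ^^ n) f) (M * C)"
  by (rule bounded_by_mono[OF Lpow_bound[OF assms]]) (intro mult_left_mono C bounded_by_nonneg[OF assms])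

lemma Lpow_lip_C:
  assumes "bounded_by G f M" "lipschitz_by G \<theta> f V" "0 \<le> V"
  shows "lipschitz_by G \<theta> ((L ^^ m) f) ((\<theta> ^ m * V + C_LY * M) * C)"
  by (rule lipschitz_by_mono[OF Lpow_lipschitz[OF assms]])
    (use assms(3) \<theta>_pos C_LY_nonneg bounded_by_nonneg[OF assms(1)] C in \<open>auto intro!: mult_left_mono\<close>)

end

text \<open>Mixing is taken in the form \<open>Es_mixing\<close>: two points of one class can be
  altered beyond any given length so that an iterate of the shift identifies them. They are then
  preimages of one point, where values of opposite sign would cancel.\<close>

locale cyclic_potential = normalized_potential G \<theta> \<psi> B K h \<nu>
  for G :: "('v,'e) pre_digraph" and \<theta> :: real and \<psi> B K h \<nu> +
  fixes p :: nat and Es :: "nat \<Rightarrow> 'e set"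
  assumes p_pos: "0 < p" and Es_cover: "(\<Union>i<p. Es i) = arcs G"
    and Es_disjoint: "\<And>i j. i < p \<Longrightarrow> j < p \<Longrightarrow> i \<noteq> j \<Longrightarrow> Es i \<inter> Es j = {}"
    and Es_step: "\<And>\<omega> i. \<omega> \<in> shift_space G \<Longrightarrow> i < p \<Longrightarrow> \<omega> 0 \<in> Es i \<Longrightarrow> \<omega> 1 \<in> Es (Suc i mod p)"
    and Es_mixing: "\<And>\<omega> \<upsilon> i n. \<omega> \<in> shift_space G \<Longrightarrow> \<upsilon> \<in> shift_space G \<Longrightarrow> i < p \<Longrightarrow> \<omega> 0 \<in> Es i \<Longrightarrow> \<upsilon> 0 \<in> Es i \<Longrightarrow>
      \<exists>k \<eta> \<zeta>. \<eta> \<in> shift_space G \<and> \<zeta> \<in> shift_space G \<and> agree n \<omega> \<eta> \<and> agree n \<upsilon> \<zeta> \<and> (shift ^^ k) \<eta> = (shift ^^ k) \<zeta>"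
begin

definition chi :: "nat \<Rightarrow> (nat \<Rightarrow> 'e) \<Rightarrow> real" where
  "chi j \<omega> = (if \<omega> 0 \<in> Es j then 1 else 0)"

lemma chi_bounded: "bounded_by G f M \<Longrightarrow> bounded_by G (\<lambda>\<omega>. f \<omega> * chi j \<omega>) M"
  using bounded_by_nonneg by (auto simp: bounded_by_def chi_def)

lemma chi_lipschitz:
  assumes "lipschitz_by G \<theta> f V" "0 \<le> V" shows "lipschitz_by G \<theta> (\<lambda>\<omega>. f \<omega> * chi j \<omega>) V"
proof (rule lipschitz_byI)
  fix \<omega> \<upsilon> n assume *: "\<omega> \<in> X" "\<upsilon> \<in> X" "1 \<le> n" "agree n \<omega> \<upsilon>"
  then have "chi j \<omega> = chi j \<upsilon>" by (simp add: chi_def agree_def)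
  then show "norm (f \<omega> * chi j \<omega> - f \<upsilon> * chi j \<upsilon>) \<le> V * \<theta> ^ n"
    using lipschitz_byD[OF assms(1) *] assms(2) \<theta>_pos by (cases "\<upsilon> 0 \<in> Es j") (simp_all add: chi_def)
qed

lemma Es_exists: assumes "\<omega> \<in> X" obtains i where "i < p" "\<omega> 0 \<in> Es i"
  using shift_space_nth[OF assms, of 0] Es_cover by blast

lemma chi_shift: assumes "j < p" "\<omega> \<in> X" shows "chi (Suc j mod p) (shift \<omega>) = chi j \<omega>"
proof -
  obtain i where i: "i < p" "\<omega> 0 \<in> Es i" by (rule Es_exists[OF assms(2)])
  have 1: "\<omega> 1 \<in> Es (Suc i mod p)" by (rule Es_step[OF assms(2) i])
  show ?thesis
  proof (cases "i = j")
    case True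
    then show ?thesis using i 1 by (simp add: chi_def shift_def)
  next
    case False
    then have "\<omega> 0 \<notin> Es j" using Es_disjoint[OF i(1) assms(1)] i(2) by blast
    moreover have "Suc i mod p \<noteq> Suc j mod p"
      using False i(1) assms(1) by (auto simp: mod_Suc split: if_splits)
    then have "Es (Suc i mod p) \<inter> Es (Suc j mod p) = {}" using p_pos by (intro Es_disjoint) auto
    then have "\<omega> 1 \<notin> Es (Suc j mod p)" using 1 by blast
    ultimately show ?thesis by (simp add: chi_def shift_def)
  qed
qed

lemma L_chi: assumes "j < p" "\<omega> \<in> X" shows "L (\<lambda>\<omega>. f \<omega> * chi j \<omega>) \<omega> = L f \<omega> * chi (Suc j mod p) \<omega>"
proof -
  have "L (\<lambda>\<omega>. f \<omega> * chi j \<omega>) = L (\<lambda>\<omega>. f \<omega> * chi (Suc j mod p) (shift \<omega>))"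
    by (rule L_cong) (simp add: chi_shift[OF assms(1)])
  also have "\<dots> = (\<lambda>\<omega>. chi (Suc j mod p) \<omega> * L f \<omega>)" by (rule L_pullback)
  finally show ?thesis by (simp add: mult.commute)
qed

lemma int_L_chi:
  assumes "bounded_by G f M" "lipschitz_by G \<theta> f V" "j < p"
  shows "integral\<^sup>L \<nu> (\<lambda>\<omega>. L f \<omega> * chi (Suc j mod p) \<omega>) = integral\<^sup>L \<nu> (\<lambda>\<omega>. f \<omega> * chi j \<omega>)"
proof -
  have "integral\<^sup>L \<nu> (\<lambda>\<omega>. L f \<omega> * chi (Suc j mod p) \<omega>) = integral\<^sup>L \<nu> (L (\<lambda>\<omega>. f \<omega> * chi j \<omega>))"
    by (rule Bochner_Integration.integral_cong) (use L_chi[OF assms(3)] in auto)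
  also have "\<dots> = integral\<^sup>L \<nu> (\<lambda>\<omega>. f \<omega> * chi j \<omega>)"
    by (rule int_L[OF chi_bounded[OF assms(1)] chi_lipschitz[OF lipschitz_by_mono[OF assms(2) abs_ge_self]]]) simp
  finally show ?thesis .
qed

text \<open>The real form of the common kernel of the peripheral functionals, whose values are the
  discrete Fourier transform of the integrals over the classes.\<close>

definition ker :: "((nat \<Rightarrow> 'e) \<Rightarrow> real) \<Rightarrow> bool" where
  "ker f \<longleftrightarrow> (\<forall>j<p. integral\<^sup>L \<nu> (\<lambda>\<omega>. f \<omega> * chi j \<omega>) = 0)"

text \<open>One constant for both bounds gives the balls of an equivalent norm. They are stable
  under pointwise limits, hence sequentially compact for pointwise convergence
  (\<open>ball_ascoli\<close>).\<close>

definition ball :: "real \<Rightarrow> ((nat \<Rightarrow> 'e) \<Rightarrow> real) \<Rightarrow> bool" where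
  "ball M f \<longleftrightarrow> bounded_by G f M \<and> lipschitz_by G \<theta> f M"

lemma ball_nonneg: "ball M f \<Longrightarrow> 0 \<le> M"
  using bounded_by_nonneg by (auto simp: ball_def)

lemma ker_L:
  assumes "ball M f" "ker f" shows "ker (L f)"
  unfolding ker_def
proof (intro allI impI)
  fix j assume j: "j < p"
  obtain i where i: "i < p" "Suc i mod p = j"
  proof (cases j)
    case 0
    then show ?thesis using that[of "p - 1"] p_pos by simp
  next
    case (Suc i)
    then show ?thesis using that[of i] j by simp
  qed
  show "integral\<^sup>L \<nu> (\<lambda>\<omega>. L f \<omega> * chi j \<omega>) = 0"
    using int_L_chi[OF _ _ i(1), of f M M] i assms by (simp add: ball_def ker_def)
qed

definition CL :: real where "CL = (1 + C_LY) * C"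

lemma CL: "1 \<le> CL" "C \<le> CL"
proof -
  have "1 * C \<le> (1 + C_LY) * C" using C_LY_nonneg C(1) by (intro mult_right_mono) auto
  then show "C \<le> CL" by (simp add: CL_def)
  then show "1 \<le> CL" using C(1) by linarith
qed

lemma ball_mono: "ball M f \<Longrightarrow> M \<le> M' \<Longrightarrow> ball M' f"
  unfolding ball_def using bounded_by_mono lipschitz_by_mono by blast

lemma ball_Lpow: assumes "ball M f" shows "ball (CL * M) ((L ^^ n) f)"
proof -
  have M: "0 \<le> M" by (rule ball_nonneg[OF assms])
  have f: "bounded_by G f M" "lipschitz_by G \<theta> f M" using assms by (auto simp: ball_def)
  have "(\<theta> ^ n * M + C_LY * M) * C \<le> (1 * M + C_LY * M) * C"
    using M C(1) \<theta>_pow_le_1 by (intro mult_right_mono add_right_mono) auto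
  also have "\<dots> = CL * M" by (simp add: CL_def algebra_simps)
  finally have "lipschitz_by G \<theta> ((L ^^ n) f) (CL * M)" by (rule lipschitz_by_mono[OF Lpow_lip_C[OF f M]])
  moreover have "M * C \<le> CL * M" using mult_right_mono[OF CL(2) M] by (simp add: mult.commute)
  then have "bounded_by G ((L ^^ n) f) (CL * M)" by (rule bounded_by_mono[OF Lpow_C[OF f(1)]])
  ultimately show ?thesis by (simp add: ball_def)
qed

lemma ker_Lpow: "ball M f \<Longrightarrow> ker f \<Longrightarrow> ker ((L ^^ n) f)"
proof (induction n)
  case (Suc n)
  then show ?case using ker_L[OF ball_Lpow[OF Suc.prems(1)]] by simp
qed simp

lemma ball_diff: "ball M f \<Longrightarrow> ball M' g \<Longrightarrow> ball (M + M') (\<lambda>\<omega>. f \<omega> - g \<omega>)"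
  unfolding ball_def
  using bounded_by_diff[of f M g M'] lipschitz_by_add[of G \<theta> f M "\<lambda>\<omega>. -1 * g \<omega>" M']
    lipschitz_by_scale[of G \<theta> g M' "-1"] by simp

lemma ball_abs: "ball M f \<Longrightarrow> ball M (\<lambda>\<omega>. \<bar>f \<omega>\<bar>)"
  unfolding ball_def lipschitz_by_def real_norm_def
  using bounded_by_abs[of f M] abs_triangle_ineq3 order_trans by blast

lemma ball_chi: "ball M f \<Longrightarrow> ball M (\<lambda>\<omega>. f \<omega> * chi j \<omega>)"
  using chi_bounded[of f M j] chi_lipschitz[of f M j] ball_nonneg[of M f] by (simp add: ball_def)

lemma ball_measurable: "ball M f \<Longrightarrow> f \<in> borel_measurable borelX"
  by (auto simp: ball_def intro: lipschitz_measurable)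

lemma ball_integrable: "ball M f \<Longrightarrow> integrable \<nu> f"
  by (auto simp: ball_def intro: lip_integrable)

lemma avoids_Lpow:
  assumes F: "finite F" "F \<subseteq> arcs G" and i: "i < m" and \<omega>: "\<omega> \<in> X"
  shows "(L ^^ m) (avoids i F) \<omega> \<le> C * (C * infsum B (arcs G - F))"
proof -
  have m: "m = (m - Suc i) + Suc i" using i by simp
  have "bounded_by G ((L ^^ Suc i) (avoids i F)) (C * infsum B (arcs G - F))"
    unfolding bounded_by_def
  proof
    fix \<upsilon> assume \<upsilon>: "\<upsilon> \<in> X"
    have "0 \<le> (L ^^ Suc i) (avoids i F) \<upsilon>" by (rule Lpow_nonneg[OF _ \<upsilon>]) (simp add: avoids_def)
    moreover have "(L ^^ Suc i) (avoids i F) \<upsilon> \<le> C * infsum B (arcs G - F)"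
      using avoids_decay[OF F \<upsilon>, of i] mult_right_mono[OF C(2)[of i] tail_nonneg[of F]] by linarith
    ultimately show "norm ((L ^^ Suc i) (avoids i F) \<upsilon>) \<le> C * infsum B (arcs G - F)" by simp
  qed
  from bounded_by_absD[OF Lpow_C[OF this, of "m - Suc i"] \<omega>] show ?thesis
    unfolding Lpow_add_exp[symmetric] using m by (simp add: mult_ac)
qed

text \<open>On finitely many cylinders of length \<open>m\<close> the functions become uniformly small up to \<open>\<theta>\<^sup>m\<close>,
  and the remaining cylinders have small weight.\<close>

lemma uniformly_small:
  assumes f: "\<And>k. ball M (f k)" and lim: "\<And>\<omega>. \<omega> \<in> X \<Longrightarrow> (\<lambda>k. f k \<omega>) \<longlonglongrightarrow> 0" and \<epsilon>: "\<epsilon> > 0"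
  shows "\<exists>m N. \<forall>k\<ge>N. \<forall>n\<ge>m. bounded_by G ((L ^^ n) (f k)) \<epsilon>"
proof -
  have M: "0 \<le> M" by (rule ball_nonneg[OF f])
  \<comment> \<open>A factor \<open>C\<close> is lost to \<open>L ^^ m\<close> and another to the
    remaining iterates, so the aim after \<open>m\<close> steps is \<open>\<epsilon> / C\<close>.
    Two thirds of it are spent on \<delta>, one third on the tail bound \<tau>.\<close>
  define \<delta> where "\<delta> = \<epsilon> / (3 * (C * C))"
  have C0: "0 < C" using C(1) by simp
  have \<delta>: "\<delta> > 0" using \<epsilon> C0 by (simp add: \<delta>_def)
  obtain m where m: "m \<ge> 1" "\<theta> ^ m < \<delta> / (M + 1)"
    using pow_less[of "\<delta> / (M + 1)"] \<delta> M by (metis add_nonneg_pos divide_pos_pos zero_less_one)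
  have Mm: "M * \<theta> ^ m \<le> \<delta>"
  proof -
    have "(M + 1) * \<theta> ^ m \<le> \<delta>" using m(2) M by (simp add: pos_less_divide_eq mult.commute less_imp_le)
    moreover have "M * \<theta> ^ m \<le> (M + 1) * \<theta> ^ m" using \<theta>_pos by (intro mult_right_mono) auto
    ultimately show ?thesis by linarith
  qed
  define \<tau> where "\<tau> = \<epsilon> / (3 * (C * (C * (C * ((M + 1) * real m)))))"
  have "\<tau> > 0" unfolding \<tau>_def using \<epsilon> C0 M m by (intro divide_pos_pos mult_pos_pos) auto
  then obtain F where F: "finite F" "F \<subseteq> arcs G" "infsum B (arcs G - F) < \<tau>" using tail_small by blast
  define W where "W = {w. set w \<subseteq> F \<and> length w = m \<and> cylinder G w \<noteq> {}}"
  have W: "finite W" unfolding W_def using finite_lists_length_eq[OF F(1), of m] by (rule rev_finite_subset) auto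
  have "eventually (\<lambda>k. \<bar>f k (word_point w)\<bar> < \<delta>) sequentially" if "w \<in> W" for w
  proof -
    have "word_point w \<in> X" using that word_point cylinder_subset by (auto simp: W_def)
    then show ?thesis using tendstoD[OF lim \<delta>] by (simp add: dist_real_def)
  qed
  then have "eventually (\<lambda>k. \<forall>w\<in>W. \<bar>f k (word_point w)\<bar> < \<delta>) sequentially"
    by (intro eventually_ball_finite W) auto
  then obtain N where N: "\<And>k w. k \<ge> N \<Longrightarrow> w \<in> W \<Longrightarrow> \<bar>f k (word_point w)\<bar> < \<delta>"
    by (auto simp: eventually_sequentially)
  have bd_av: "bd (\<lambda>\<omega>. \<Sum>i<j. avoids i F \<omega>)" for j
    by (induction j) (auto simp: bdI[OF avoids_bounded])
  have Lm_av: "(L ^^ m) (\<lambda>\<omega>. \<Sum>i<j. avoids i F \<omega>) \<omega> \<le> real j * (C * (C * infsum B (arcs G - F)))"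
    if "j \<le> m" "\<omega> \<in> X" for j \<omega>
    using that(1)
  proof (induction j)
    case 0
    then show ?case using Lpow_const[of m 0] by simp
  next
    case (Suc j)
    have "(L ^^ m) (\<lambda>\<omega>. \<Sum>i<Suc j. avoids i F \<omega>) \<omega> = (L ^^ m) (\<lambda>\<omega>. \<Sum>i<j. avoids i F \<omega>) \<omega> + (L ^^ m) (avoids j F) \<omega>"
      using Lpow_add[OF bd_av bdI[OF avoids_bounded], of m j] by simp
    moreover have "(L ^^ m) (\<lambda>\<omega>. \<Sum>i<j. avoids i F \<omega>) \<omega> \<le> real j * (C * (C * infsum B (arcs G - F)))"
      using Suc by simp
    moreover have "(L ^^ m) (avoids j F) \<omega> \<le> C * (C * infsum B (arcs G - F))"
      using Suc.prems by (intro avoids_Lpow[OF F(1,2) _ that(2)]) simp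
    ultimately show ?case by (simp add: distrib_right)
  qed
  have small: "bounded_by G ((L ^^ m) (f k)) (\<epsilon> / C)" if k: "k \<ge> N" for k
    unfolding bounded_by_def
  proof
    fix \<omega> assume \<omega>: "\<omega> \<in> X"
    have fk: "bounded_by G (f k) M" "lipschitz_by G \<theta> (f k) M" using f by (auto simp: ball_def)
    have pt: "\<bar>f k \<upsilon>\<bar> \<le> 2 * \<delta> + M * (\<Sum>i<m. avoids i F \<upsilon>)" if \<upsilon>: "\<upsilon> \<in> X" for \<upsilon>
    proof (cases "\<forall>i<m. \<upsilon> i \<in> F")
      case True
      have "\<upsilon> \<in> cylinder G (map \<upsilon> [0..<m])" using \<upsilon> by (auto simp: cylinder_def)
      then have "map \<upsilon> [0..<m] \<in> W" using True by (auto simp: W_def)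
      then have "\<bar>f k (rep m \<upsilon>)\<bar> < \<delta>" unfolding rep_def by (rule N[OF k])
      moreover have "\<bar>f k \<upsilon> - f k (rep m \<upsilon>)\<bar> \<le> M * \<theta> ^ m"
        using lipschitz_byD[OF fk(2) \<upsilon> rep(1)[OF \<upsilon>] m(1) agree_sym[OF rep(2)[OF \<upsilon>]]] by simp
      moreover have "0 \<le> M * (\<Sum>i<m. avoids i F \<upsilon>)"
        using M by (intro mult_nonneg_nonneg sum_nonneg) (auto simp: avoids_def)
      ultimately show ?thesis using Mm by linarith
    next
      case False
      then obtain i where i: "i < m" "\<upsilon> i \<notin> F" by auto
      then have "1 \<le> (\<Sum>i<m. avoids i F \<upsilon>)"
        using member_le_sum[of i "{..<m}" "\<lambda>i. avoids i F \<upsilon>"] by (auto simp: avoids_def)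
      then have "M * 1 \<le> M * (\<Sum>i<m. avoids i F \<upsilon>)" using M by (intro mult_left_mono) auto
      then show ?thesis using bounded_by_absD[OF fk(1) \<upsilon>] \<delta> by linarith
    qed
    have bdf: "bd (f k)" by (rule bdI[OF fk(1)])
    have "\<bar>(L ^^ m) (f k) \<omega>\<bar> \<le> (L ^^ m) (\<lambda>\<upsilon>. \<bar>f k \<upsilon>\<bar>) \<omega>" by (rule Lpow_abs_le[OF bdf \<omega>])
    also have "\<dots> \<le> (L ^^ m) (\<lambda>\<upsilon>. 2 * \<delta> + M * (\<Sum>i<m. avoids i F \<upsilon>)) \<omega>"
      by (rule Lpow_mono[OF _ _ pt \<omega>]) (use bdf bd_av in auto)
    also have "\<dots> = 2 * \<delta> * (L ^^ m) (\<lambda>_. 1) \<omega> + M * (L ^^ m) (\<lambda>\<upsilon>. \<Sum>i<m. avoids i F \<upsilon>) \<omega>"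
    proof -
      have "(L ^^ m) (\<lambda>\<upsilon>. 2 * \<delta> + M * (\<Sum>i<m. avoids i F \<upsilon>))
          = (\<lambda>\<omega>. (L ^^ m) (\<lambda>_. 2 * \<delta>) \<omega> + (L ^^ m) (\<lambda>\<upsilon>. M * (\<Sum>i<m. avoids i F \<upsilon>)) \<omega>)"
        by (rule Lpow_add) (use bd_av in auto)
      moreover have "(L ^^ m) (\<lambda>_. 2 * \<delta>) \<omega> = 2 * \<delta> * (L ^^ m) (\<lambda>_. 1) \<omega>" by (rule fun_cong[OF Lpow_const])
      ultimately show ?thesis by (simp only: Lpow_scale)
    qed
    also have "\<dots> \<le> 2 * \<delta> * C + M * (real m * (C * (C * \<tau>)))"
    proof (intro add_mono mult_left_mono)
      show "(L ^^ m) (\<lambda>_. 1) \<omega> \<le> C" using Lpow_one_le[OF \<omega>, of m] C(2)[of m] by linarith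
      have "(L ^^ m) (\<lambda>\<upsilon>. \<Sum>i<m. avoids i F \<upsilon>) \<omega> \<le> real m * (C * (C * infsum B (arcs G - F)))"
        by (rule Lm_av[OF order_refl \<omega>])
      also have "\<dots> \<le> real m * (C * (C * \<tau>))" using F(3) C0 by (intro mult_left_mono) auto
      finally show "(L ^^ m) (\<lambda>\<upsilon>. \<Sum>i<m. avoids i F \<upsilon>) \<omega> \<le> real m * (C * (C * \<tau>))" .
    qed (use \<delta> M in auto)
    also have "\<dots> \<le> 2 * (\<epsilon> / (3 * C)) + \<epsilon> / (3 * C)"
    proof (rule add_mono)
      show "2 * \<delta> * C \<le> 2 * (\<epsilon> / (3 * C))" using C0 by (simp add: \<delta>_def field_simps)
      have "M * (real m * (C * (C * \<tau>))) \<le> (M + 1) * (real m * (C * (C * \<tau>)))"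
        using \<open>\<tau> > 0\<close> C0 by (intro mult_right_mono mult_nonneg_nonneg) auto
      also have "\<dots> = \<epsilon> / (3 * C)"
      proof -
        have "c * (k * (C * (C * (\<epsilon> / (3 * (C * (C * (C * (c * k))))))))) = \<epsilon> / (3 * C)" if "c > 0" "k > 0" for c k
          using that C0 by (simp add: field_simps)
        then show ?thesis unfolding \<tau>_def using M m by simp
      qed
      finally show "M * (real m * (C * (C * \<tau>))) \<le> \<epsilon> / (3 * C)" .
    qed
    also have "\<dots> = \<epsilon> / C" using C0 by (simp add: field_simps)
    finally show "norm ((L ^^ m) (f k) \<omega>) \<le> \<epsilon> / C" by simp
  qed
  have "bounded_by G ((L ^^ n) (f k)) \<epsilon>" if "k \<ge> N" "n \<ge> m" for k n
  proof -
    have "(L ^^ n) (f k) = (L ^^ (n - m)) ((L ^^ m) (f k))" using that by (simp add: Lpow_add_exp[symmetric])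
    then show ?thesis using Lpow_C[OF small[OF that(1)], of "n - m"] C0 by simp
  qed
  then show ?thesis by blast
qed

lemma ball_ascoli:
  assumes "\<And>k. ball M (f k)"
  obtains \<sigma> :: "nat \<Rightarrow> nat" and g where "strict_mono \<sigma>" "\<And>\<omega>. \<omega> \<in> X \<Longrightarrow> (\<lambda>k. f (\<sigma> k) \<omega>) \<longlonglongrightarrow> g \<omega>" "ball M g"
proof -
  have 1: "bounded_by G (f k) M" "lipschitz_by G \<theta> (f k) M" for k using assms by (auto simp: ball_def)
  obtain \<sigma> :: "nat \<Rightarrow> nat" and g where "strict_mono \<sigma>" "\<And>\<omega>. \<omega> \<in> X \<Longrightarrow> (\<lambda>k. f (\<sigma> k) \<omega>) \<longlonglongrightarrow> g \<omega>"
    "bounded_by G g M" "lipschitz_by G \<theta> g M" using ascoli[of f, OF 1] by blast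
  then show ?thesis using that[of \<sigma> g] by (simp add: ball_def)
qed

lemma ker_limit:
  assumes "\<And>k. ball M (f k)" "\<And>k. ker (f k)" "\<And>\<omega>. \<omega> \<in> X \<Longrightarrow> (\<lambda>k. f k \<omega>) \<longlonglongrightarrow> g \<omega>"
  shows "ker g"
  unfolding ker_def
proof (intro allI impI)
  fix j assume j: "j < p"
  have "(\<lambda>k. integral\<^sup>L \<nu> (\<lambda>\<omega>. f k \<omega> * chi j \<omega>)) \<longlonglongrightarrow> integral\<^sup>L \<nu> (\<lambda>\<omega>. g \<omega> * chi j \<omega>)"
  proof (rule eigenmeasure_tendsto(1)[OF \<nu>])
    show "(\<lambda>\<omega>. f k \<omega> * chi j \<omega>) \<in> borel_measurable borelX" for k by (rule ball_measurable[OF ball_chi[OF assms(1)]])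
    show "bounded_by G (\<lambda>\<omega>. f k \<omega> * chi j \<omega>) M" for k using ball_chi[OF assms(1)] by (simp add: ball_def)
    show "(\<lambda>k. f k \<omega> * chi j \<omega>) \<longlonglongrightarrow> g \<omega> * chi j \<omega>" if "\<omega> \<in> X" for \<omega> by (intro tendsto_mult_right assms(3) that)
  qed
  moreover have "(\<lambda>k. integral\<^sup>L \<nu> (\<lambda>\<omega>. f k \<omega> * chi j \<omega>)) = (\<lambda>_. 0)" using assms(2) j by (simp add: ker_def)
  ultimately show "integral\<^sup>L \<nu> (\<lambda>\<omega>. g \<omega> * chi j \<omega>) = 0" using LIMSEQ_unique[OF _ tendsto_const[of 0]] by simp
qed

text \<open>Since \<open>\<bar>L\<^sup>k g\<bar> = L\<^sup>k \<bar>g\<bar>\<close> excludes cancellation, mixing forces \<open>g\<close> to have constant sign on each class.\<close>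

lemma no_cancellation_imp_zero:
  assumes g: "ball M g" "ker g" and eq: "\<And>k \<omega>. \<omega> \<in> X \<Longrightarrow> \<bar>(L ^^ k) g \<omega>\<bar> = (L ^^ k) (\<lambda>\<omega>. \<bar>g \<omega>\<bar>) \<omega>"
    and \<omega>: "\<omega> \<in> X"
  shows "g \<omega> = 0"
proof -
  have gb: "bounded_by G g M" "lipschitz_by G \<theta> g M" using g by (auto simp: ball_def)
  have bdg: "bd g" by (rule bdI[OF gb(1)])
  have sign: False if asm: "i < p" "\<omega> \<in> X" "\<upsilon> \<in> X" "\<omega> 0 \<in> Es i" "\<upsilon> 0 \<in> Es i" "g \<omega> > 0" "g \<upsilon> < 0" for i \<omega> \<upsilon>
  proof -
    note cont = lipschitz_continuous[OF gb(2), unfolded continuous_shift_iff, rule_format]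
    obtain n1 where n1: "\<And>\<eta>. \<eta> \<in> X \<Longrightarrow> agree n1 \<omega> \<eta> \<Longrightarrow> dist (g \<omega>) (g \<eta>) < g \<omega>"
      using cont[OF asm(2,6)] by blast
    obtain n2 where n2: "\<And>\<eta>. \<eta> \<in> X \<Longrightarrow> agree n2 \<upsilon> \<eta> \<Longrightarrow> dist (g \<upsilon>) (g \<eta>) < - g \<upsilon>" using cont[OF asm(3), of "- g \<upsilon>"] asm(7) by auto
    let ?n = "max n1 n2"
    obtain k \<eta> \<zeta> where kz: "\<eta> \<in> X" "\<zeta> \<in> X" "agree ?n \<omega> \<eta>" "agree ?n \<upsilon> \<zeta>" "(shift ^^ k) \<eta> = (shift ^^ k) \<zeta>"
      using Es_mixing[OF asm(2,3,1,4,5), of ?n] by blast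
    have \<eta>: "g \<eta> > 0" using n1[OF kz(1) agree_mono[OF kz(3)]] by (simp add: dist_real_def)
    have \<zeta>: "g \<zeta> < 0" using n2[OF kz(2) agree_mono[OF kz(4)]] by (simp add: dist_real_def)
    let ?z = "(shift ^^ k) \<eta>"
    have z: "?z \<in> X" using kz by simp
    \<comment> \<open>Both \<open>\<eta>\<close> and \<open>\<zeta>\<close> are preimages of
      \<open>?z\<close> of order \<open>k\<close>. The term at \<open>\<eta>\<close> makes the
      iterate of |g| + g positive at \<open>?z\<close>, the term at \<open>\<zeta>\<close> that of
      |g| - g, so the iterate of |g| strictly exceeds the modulus of the iterate of g.\<close>
    have a: "exp (\<Sum>i<k. \<psi> ((shift ^^ i) \<eta>)) * (\<bar>g \<eta>\<bar> + g \<eta>) \<le> (L ^^ k) (\<lambda>\<omega>. \<bar>g \<omega>\<bar> + g \<omega>) ?z"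
      by (rule Lpow_ge_term[OF _ _ kz(1)]) (use bdg in auto)
    have b: "exp (\<Sum>i<k. \<psi> ((shift ^^ i) \<zeta>)) * (\<bar>g \<zeta>\<bar> - g \<zeta>) \<le> (L ^^ k) (\<lambda>\<omega>. \<bar>g \<omega>\<bar> - g \<omega>) ?z"
      unfolding kz(5) by (rule Lpow_ge_term[OF _ _ kz(2)]) (use bdg in auto)
    have "0 < (L ^^ k) (\<lambda>\<omega>. \<bar>g \<omega>\<bar>) ?z + (L ^^ k) g ?z"
      using less_le_trans[OF mult_pos_pos[OF exp_gt_zero] a] \<eta> bdg by (simp add: Lpow_add)
    moreover have "0 < (L ^^ k) (\<lambda>\<omega>. \<bar>g \<omega>\<bar>) ?z - (L ^^ k) g ?z"
      using less_le_trans[OF mult_pos_pos[OF exp_gt_zero] b] \<zeta> bdg by (simp add: Lpow_diff)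
    ultimately show False using eq[OF z, of k] by linarith
  qed
  obtain i where i: "i < p" "\<omega> 0 \<in> Es i" by (rule Es_exists[OF \<omega>])
  have int0: "integral\<^sup>L \<nu> (\<lambda>\<omega>. g \<omega> * chi i \<omega>) = 0" using g(2) i by (simp add: ker_def)
  have bc: "ball M (\<lambda>\<omega>. g \<omega> * chi i \<omega>)" by (rule ball_chi[OF g(1)])
  have bc': "ball M (\<lambda>\<omega>. \<bar>g \<omega> * chi i \<omega>\<bar>)" by (rule ball_abs[OF bc])
  have "integral\<^sup>L \<nu> (\<lambda>\<omega>. \<bar>g \<omega> * chi i \<omega>\<bar>) = 0"
  proof (cases "\<exists>\<upsilon>\<in>X. \<upsilon> 0 \<in> Es i \<and> g \<upsilon> < 0")
    case True
    then have "g \<upsilon> * chi i \<upsilon> \<le> 0" if "\<upsilon> \<in> X" for \<upsilon> using sign[OF i(1) that] that by (force simp: chi_def)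
    then have "integral\<^sup>L \<nu> (\<lambda>\<omega>. \<bar>g \<omega> * chi i \<omega>\<bar>) = integral\<^sup>L \<nu> (\<lambda>\<omega>. - (g \<omega> * chi i \<omega>))"
      by (intro Bochner_Integration.integral_cong) auto
    then show ?thesis using int0 by simp
  next
    case False
    then have "0 \<le> g \<upsilon> * chi i \<upsilon>" if "\<upsilon> \<in> X" for \<upsilon> using that by (auto simp: chi_def not_less)
    then have "integral\<^sup>L \<nu> (\<lambda>\<omega>. \<bar>g \<omega> * chi i \<omega>\<bar>) = integral\<^sup>L \<nu> (\<lambda>\<omega>. g \<omega> * chi i \<omega>)"
      by (intro Bochner_Integration.integral_cong) auto
    then show ?thesis using int0 by simp
  qed
  then have "\<bar>g \<omega> * chi i \<omega>\<bar> = 0"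
    by (intro eigenmeasure_zero[OF \<nu> zero_less_one conjunct1[OF bc'[unfolded ball_def]]
          conjunct2[OF bc'[unfolded ball_def]] abs_ge_zero _ \<omega>])
  then show ?thesis using i(2) by (simp add: chi_def)
qed

lemma Lpow_tendsto:
  assumes "\<And>k. ball M (f k)" "\<And>\<omega>. \<omega> \<in> X \<Longrightarrow> (\<lambda>k. f k \<omega>) \<longlonglongrightarrow> g \<omega>" "\<omega> \<in> X"
  shows "(\<lambda>k. (L ^^ n) (f k) \<omega>) \<longlonglongrightarrow> (L ^^ n) g \<omega>"
  using assms(3)
proof (induction n arbitrary: \<omega>)
  case (Suc n)
  have "bounded_by G ((L ^^ n) (f k)) (CL * M)" for k using ball_Lpow[OF assms(1)] by (simp add: ball_def)
  from L_tendsto[OF this Suc.IH Suc.prems] show ?case by simp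
qed (use assms(2) in simp)

text \<open>The integral of |L^n f| does not increase, since |L u| <= L |u| and \<open>L\<close>
  preserves integrals. It is therefore constant along the orbit of any pointwise limit
  \<open>g\<close> of the iterates, and full support gives |L^k g| = L^k |g| everywhere. Hence
  \<open>g\<close> vanishes, and \<open>uniformly_small\<close> makes the decay uniform in the
  point.\<close>

lemma pointwise_decay:
  assumes f: "ball M f" "ker f" and \<epsilon>: "\<epsilon> > 0"
  shows "\<exists>N. \<forall>n\<ge>N. bounded_by G ((L ^^ n) f) \<epsilon>"
proof -
  define u where "u n = (L ^^ n) f" for n
  have u: "ball (CL * M) (u n)" "ker (u n)" for n unfolding u_def by (rule ball_Lpow[OF f(1)], rule ker_Lpow[OF f])
  have Lu: "(L ^^ j) (u n) = u (n + j)" for j n unfolding u_def Lpow_add_exp[symmetric] by (simp add: add.commute)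
  define I where "I n = integral\<^sup>L \<nu> (\<lambda>\<omega>. \<bar>u n \<omega>\<bar>)" for n
  have Iint: "integrable \<nu> (\<lambda>\<omega>. \<bar>u n \<omega>\<bar>)" for n by (rule ball_integrable[OF ball_abs[OF u(1)]])
  have "I (Suc n) \<le> I n" for n
  proof -
    have b: "ball (CL * M) (\<lambda>\<omega>. \<bar>u n \<omega>\<bar>)" by (rule ball_abs[OF u(1)])
    have "I (Suc n) \<le> integral\<^sup>L \<nu> (L (\<lambda>\<omega>. \<bar>u n \<omega>\<bar>))"
      unfolding I_def
    proof (rule integral_mono[OF Iint])
      show "integrable \<nu> (L (\<lambda>\<omega>. \<bar>u n \<omega>\<bar>))" using ball_integrable[OF ball_Lpow[OF b, of 1]] by simp
      show "\<bar>u (Suc n) \<omega>\<bar> \<le> L (\<lambda>\<omega>. \<bar>u n \<omega>\<bar>) \<omega>" if "\<omega> \<in> space \<nu>" for \<omega>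
        using Lpow_abs_le[of "u n" \<omega> 1] u(1)[of n] that bdI by (auto simp: ball_def u_def)
    qed
    also have "\<dots> = I n" unfolding I_def using int_L b by (auto simp: ball_def)
    finally show ?thesis .
  qed
  then have dec: "decseq I" by (rule decseq_SucI)
  have "0 \<le> I n" for n unfolding I_def by simp
  then obtain l where l: "I \<longlonglongrightarrow> l" using decseq_convergent[OF dec, of 0] by blast
  obtain \<sigma> g where \<sigma>: "strict_mono (\<sigma> :: nat \<Rightarrow> nat)" and lim: "\<And>\<omega>. \<omega> \<in> X \<Longrightarrow> (\<lambda>k. u (\<sigma> k) \<omega>) \<longlonglongrightarrow> g \<omega>"
    and g: "ball (CL * M) g" using ball_ascoli[of "CL * M" u, OF u(1)] by blast
  have kg: "ker g" by (rule ker_limit[OF u(1) u(2) lim])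
  have Il: "integral\<^sup>L \<nu> (\<lambda>\<omega>. \<bar>(L ^^ j) g \<omega>\<bar>) = l" for j
  proof -
    have "(\<lambda>k. integral\<^sup>L \<nu> (\<lambda>\<omega>. \<bar>u (\<sigma> k + j) \<omega>\<bar>)) \<longlonglongrightarrow> integral\<^sup>L \<nu> (\<lambda>\<omega>. \<bar>(L ^^ j) g \<omega>\<bar>)"
    proof (rule eigenmeasure_tendsto(1)[OF \<nu>])
      show "(\<lambda>\<omega>. \<bar>u (\<sigma> k + j) \<omega>\<bar>) \<in> borel_measurable borelX" for k by (rule ball_measurable[OF ball_abs[OF u(1)]])
      show "bounded_by G (\<lambda>\<omega>. \<bar>u (\<sigma> k + j) \<omega>\<bar>) (CL * M)" for k using ball_abs[OF u(1)] by (simp add: ball_def)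
      show "(\<lambda>k. \<bar>u (\<sigma> k + j) \<omega>\<bar>) \<longlonglongrightarrow> \<bar>(L ^^ j) g \<omega>\<bar>" if "\<omega> \<in> X" for \<omega>
        using tendsto_rabs[OF Lpow_tendsto[OF u(1) lim that, of j]] by (simp add: Lu)
    qed
    moreover have "(\<lambda>k. I (\<sigma> k + j)) \<longlonglongrightarrow> l"
      using LIMSEQ_subseq_LIMSEQ[OF LIMSEQ_ignore_initial_segment[OF l, of j] \<sigma>] by (simp add: comp_def)
    ultimately show ?thesis unfolding I_def by (rule LIMSEQ_unique)
  qed
  have "\<bar>(L ^^ k) g \<omega>\<bar> = (L ^^ k) (\<lambda>\<omega>. \<bar>g \<omega>\<bar>) \<omega>" if \<omega>: "\<omega> \<in> X" for k \<omega>
  proof -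
    have b1: "ball (CL * (CL * M)) ((L ^^ k) (\<lambda>\<omega>. \<bar>g \<omega>\<bar>))" by (rule ball_Lpow[OF ball_abs[OF g]])
    have b2: "ball (CL * (CL * M)) (\<lambda>\<omega>. \<bar>(L ^^ k) g \<omega>\<bar>)" by (rule ball_abs[OF ball_Lpow[OF g]])
    have b3: "ball (CL * (CL * M) + CL * (CL * M)) (\<lambda>\<omega>. (L ^^ k) (\<lambda>\<omega>. \<bar>g \<omega>\<bar>) \<omega> - \<bar>(L ^^ k) g \<omega>\<bar>)"
      by (rule ball_diff[OF b1 b2])
    have "integral\<^sup>L \<nu> ((L ^^ k) (\<lambda>\<omega>. \<bar>g \<omega>\<bar>)) = l"
      using int_Lpow[of "\<lambda>\<omega>. \<bar>g \<omega>\<bar>"] ball_abs[OF g] Il[of 0] by (auto simp: ball_def)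
    then have "integral\<^sup>L \<nu> (\<lambda>\<omega>. (L ^^ k) (\<lambda>\<omega>. \<bar>g \<omega>\<bar>) \<omega> - \<bar>(L ^^ k) g \<omega>\<bar>) = 0"
      using ball_integrable[OF b1] ball_integrable[OF b2] Il[of k] by simp
    note zero = this
    have "(L ^^ k) (\<lambda>\<omega>. \<bar>g \<omega>\<bar>) \<omega> - \<bar>(L ^^ k) g \<omega>\<bar> = 0"
    proof (rule eigenmeasure_zero[OF \<nu> zero_less_one conjunct1[OF b3[unfolded ball_def]] conjunct2[OF b3[unfolded ball_def]] _ zero \<omega>])
      have "bd g" using g by (auto simp: ball_def bd_def)
      then show "0 \<le> (L ^^ k) (\<lambda>\<omega>. \<bar>g \<omega>\<bar>) \<omega> - \<bar>(L ^^ k) g \<omega>\<bar>" if "\<omega> \<in> X" for \<omega>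
        using Lpow_abs_le[of g \<omega> k] that by simp
    qed
    then show ?thesis by simp
  qed
  then have "g \<omega> = 0" if "\<omega> \<in> X" for \<omega> using no_cancellation_imp_zero[OF g kg _ that] by blast
  then have lim0: "(\<lambda>k. u (\<sigma> k) \<omega>) \<longlonglongrightarrow> 0" if "\<omega> \<in> X" for \<omega> using lim[OF that] that by simp
  obtain m N where mN: "\<And>k n. k \<ge> N \<Longrightarrow> n \<ge> m \<Longrightarrow> bounded_by G ((L ^^ n) (u (\<sigma> k))) \<epsilon>"
    using uniformly_small[of "CL * M" "\<lambda>k. u (\<sigma> k)", OF u(1) lim0 \<epsilon>] by blast
  have "bounded_by G ((L ^^ n) f) \<epsilon>" if "n \<ge> \<sigma> N + m" for n
    using mN[of N "n - \<sigma> N"] that Lu[of "n - \<sigma> N" "\<sigma> N"] by (simp add: u_def)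
  then show ?thesis by blast
qed

text \<open>Functions that violate the bound at ever later times have a pointwise limit
  \<open>f\<close> in the same ball and kernel. \<open>pointwise_decay\<close> handles
  \<open>f\<close>, and \<open>uniformly_small\<close> the differences.\<close>

lemma uniform_decay:
  assumes \<epsilon>: "\<epsilon> > 0"
  shows "\<exists>N. \<forall>n\<ge>N. \<forall>f. ball 1 f \<longrightarrow> ker f \<longrightarrow> bounded_by G ((L ^^ n) f) \<epsilon>"
proof (rule ccontr)
  assume "\<not> ?thesis"
  then have "\<forall>N. \<exists>nf. fst nf \<ge> N \<and> ball 1 (snd nf) \<and> ker (snd nf) \<and> \<not> bounded_by G ((L ^^ fst nf) (snd nf)) \<epsilon>"
    by (auto simp: not_le)
  from choice[OF this] obtain nf where nf: "\<And>N. fst (nf N) \<ge> N" "\<And>N. ball 1 (snd (nf N))" "\<And>N. ker (snd (nf N))"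
    "\<And>N. \<not> bounded_by G ((L ^^ fst (nf N)) (snd (nf N))) \<epsilon>" by blast
  define ns where "ns N = fst (nf N)" for N
  define fs where "fs N = snd (nf N)" for N
  have nf: "ns N \<ge> N" "ball 1 (fs N)" "ker (fs N)" "\<not> bounded_by G ((L ^^ ns N) (fs N)) \<epsilon>" for N
    using nf unfolding ns_def fs_def by auto
  obtain \<sigma> f where \<sigma>: "strict_mono (\<sigma> :: nat \<Rightarrow> nat)" and lim: "\<And>\<omega>. \<omega> \<in> X \<Longrightarrow> (\<lambda>k. fs (\<sigma> k) \<omega>) \<longlonglongrightarrow> f \<omega>"
    and f: "ball 1 f" using ball_ascoli[of 1 fs, OF nf(2)] by blast
  have kf: "ker f" by (rule ker_limit[OF nf(2) nf(3) lim])
  obtain N1 where N1: "\<And>n. n \<ge> N1 \<Longrightarrow> bounded_by G ((L ^^ n) f) (\<epsilon> / 2)"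
    using pointwise_decay[OF f kf, of "\<epsilon> / 2"] \<epsilon> by auto
  have "(\<lambda>k. fs (\<sigma> k) \<omega> - f \<omega>) \<longlonglongrightarrow> 0" if "\<omega> \<in> X" for \<omega> using lim[OF that] by (rule LIM_zero)
  then obtain m N2 where N2: "\<And>k n. k \<ge> N2 \<Longrightarrow> n \<ge> m \<Longrightarrow> bounded_by G ((L ^^ n) (\<lambda>\<omega>. fs (\<sigma> k) \<omega> - f \<omega>)) (\<epsilon> / 2)"
    using uniformly_small[of "1 + 1" "\<lambda>k \<omega>. fs (\<sigma> k) \<omega> - f \<omega>" "\<epsilon> / 2"] ball_diff[OF nf(2) f] \<epsilon> by fastforce
  define k where "k = max N2 (max m N1)"
  have n: "ns (\<sigma> k) \<ge> k" using nf(1)[of "\<sigma> k"] seq_suble[OF \<sigma>, of k] by linarith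
  let ?n = "ns (\<sigma> k)"
  have 1: "bounded_by G ((L ^^ ?n) (\<lambda>\<omega>. fs (\<sigma> k) \<omega> - f \<omega>)) (\<epsilon> / 2)" by (rule N2) (use n in \<open>auto simp: k_def\<close>)
  have 2: "bounded_by G ((L ^^ ?n) f) (\<epsilon> / 2)" by (rule N1) (use n in \<open>auto simp: k_def\<close>)
  have bds: "bd (fs (\<sigma> k))" "bd f" using nf(2)[of "\<sigma> k"] f by (auto simp: ball_def bd_def)
  have "bounded_by G ((L ^^ ?n) (fs (\<sigma> k))) \<epsilon>"
    unfolding bounded_by_def
  proof
    fix \<omega> assume "\<omega> \<in> X"
    then have "\<bar>(L ^^ ?n) (fs (\<sigma> k)) \<omega> - (L ^^ ?n) f \<omega>\<bar> \<le> \<epsilon> / 2" "\<bar>(L ^^ ?n) f \<omega>\<bar> \<le> \<epsilon> / 2"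
      using bounded_by_absD[OF 1] bounded_by_absD[OF 2] Lpow_diff[OF bds] by auto
    then show "norm ((L ^^ ?n) (fs (\<sigma> k)) \<omega>) \<le> \<epsilon>" unfolding real_norm_def by linarith
  qed
  then show False using nf(4) by blast
qed

lemma ball_scale: "ball M f \<Longrightarrow> ball (\<bar>c\<bar> * M) (\<lambda>\<omega>. c * f \<omega>)"
  unfolding ball_def using bounded_by_scale[of f M c] lipschitz_by_scale[of G \<theta> f M c] by simp

text \<open>Decay of the supremum alone does not contract the ball: after \<open>N\<close> steps the
  Lipschitz constant is only known to be at most \<open>CL\<close>. Another \<open>m\<close> steps
  shrink it by \<theta>^m through the Lasota-Yorke inequality, whose second term is already
  small.\<close>

lemma contraction_unit: "\<exists>N. \<forall>f. ball 1 f \<longrightarrow> ker f \<longrightarrow> ball (1 / 2) ((L ^^ N) f)"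
proof -
  define \<epsilon> where "\<epsilon> = 1 / (4 * CL)"
  have CL0: "0 < CL" using CL(1) by simp
  have \<epsilon>: "\<epsilon> > 0" using CL0 by (simp add: \<epsilon>_def)
  obtain N where N: "\<And>f. ball 1 f \<Longrightarrow> ker f \<Longrightarrow> bounded_by G ((L ^^ N) f) \<epsilon>" using uniform_decay[OF \<epsilon>] by blast
  obtain m where m: "\<theta> ^ m < 1 / (4 * (CL * C))"
    using pow_less[of "1 / (4 * (CL * C))"] CL0 C(1) by (metis divide_pos_pos less_le_trans mult_pos_pos zero_less_numeral zero_less_one)
  have "ball (1 / 2) ((L ^^ (m + N)) f)" if f: "ball 1 f" "ker f" for f
  proof -
    let ?g = "(L ^^ N) f"
    have g: "bounded_by G ?g \<epsilon>" "lipschitz_by G \<theta> ?g CL"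
      using N[OF f] ball_Lpow[OF f(1), of N] by (auto simp: ball_def)
    have "C * \<epsilon> \<le> CL * \<epsilon>" using CL(2) \<epsilon> by (intro mult_right_mono) auto
    then have 1: "\<epsilon> * C \<le> 1 / 2" using CL0 by (simp add: \<epsilon>_def mult.commute)
    have "\<theta> ^ m * CL * C \<le> 1 / 4"
      using m CL0 C(1) by (simp add: pos_less_divide_eq mult_ac less_imp_le)
    moreover have "C_LY * \<epsilon> * C \<le> CL * \<epsilon>"
      using \<epsilon> C(1) C_LY_nonneg unfolding CL_def by (simp add: algebra_simps)
    moreover have "CL * \<epsilon> = 1 / 4" using CL0 by (simp add: \<epsilon>_def)
    ultimately have 2: "(\<theta> ^ m * CL + C_LY * \<epsilon>) * C \<le> 1 / 2" by (simp add: distrib_right)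
    have "bounded_by G ((L ^^ m) ?g) (1 / 2)" by (rule bounded_by_mono[OF Lpow_C[OF g(1)] 1])
    moreover have "lipschitz_by G \<theta> ((L ^^ m) ?g) (1 / 2)"
      by (rule lipschitz_by_mono[OF Lpow_lip_C[OF g] 2]) (use CL0 in simp)
    ultimately show ?thesis by (simp add: ball_def Lpow_add_exp)
  qed
  then show ?thesis by blast
qed

theorem exponential_decay:
  "\<exists>A \<rho>. 0 < \<rho> \<and> \<rho> < 1 \<and> 0 \<le> A \<and> (\<forall>n M f. ball M f \<longrightarrow> ker f \<longrightarrow> ball (A * \<rho> ^ n * M) ((L ^^ n) f))"
proof -
  obtain N0 where N0: "\<And>f. ball 1 f \<Longrightarrow> ker f \<Longrightarrow> ball (1 / 2) ((L ^^ N0) f)" using contraction_unit by blast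
  have half: "ball (M / 2) ((L ^^ N0) f)" if f: "ball M f" "ker f" for M f
  proof (cases "M = 0")
    case True
    then show ?thesis using ball_Lpow[OF f(1), of N0] by simp
  next
    case False
    then have M: "M > 0" using ball_nonneg[OF f(1)] by simp
    have 1: "ball 1 (\<lambda>\<omega>. 1 / M * f \<omega>)" using ball_scale[OF f(1), of "1 / M"] M by simp
    have "(\<lambda>\<omega>. 1 / M * f \<omega> * chi j \<omega>) = (\<lambda>\<omega>. 1 / M * (f \<omega> * chi j \<omega>))" for j by (simp add: mult.assoc)
    then have "ker (\<lambda>\<omega>. 1 / M * f \<omega>)" using f(2) unfolding ker_def by (simp only: integral_mult_right_zero) simp
    from N0[OF 1 this] have "ball (1 / 2) (\<lambda>\<omega>. 1 / M * (L ^^ N0) f \<omega>)" by (simp only: Lpow_scale)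
    from ball_scale[OF this, of M] show ?thesis using M by simp
  qed
  \<comment> \<open>The successor keeps the N-th root meaningful in the case
    \<open>N0 = 0\<close>.\<close>
  define N where "N = Suc N0"
  have N: "0 < N" by (simp add: N_def)
  have iter: "ball (M * (1 / 2) ^ j) ((L ^^ (j * N0)) f)" if f: "ball M f" "ker f" for j M f
  proof (induction j)
    case (Suc j)
    have "ball (M * (1 / 2) ^ j / 2) ((L ^^ N0) ((L ^^ (j * N0)) f))" by (rule half[OF Suc ker_Lpow[OF f]])
    then show ?case by (simp add: Lpow_add_exp[symmetric])
  qed (use f in simp)
  define \<rho> where "\<rho> = root N (1 / 2)"
  have \<rho>: "0 < \<rho>" "\<rho> < 1" "\<rho> ^ N = 1 / 2" using N by (auto simp: \<rho>_def real_root_lt_1_iff)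
  have "ball (2 * CL * \<rho> ^ n * M) ((L ^^ n) f)" if f: "ball M f" "ker f" for n M f
  proof -
    let ?j = "n div N"
    have le: "?j * N0 \<le> n"
    proof -
      have "?j * N0 \<le> ?j * N" by (simp add: N_def)
      then show ?thesis using div_times_less_eq_dividend[of n N] by linarith
    qed
    have eq: "(L ^^ n) f = (L ^^ (n - ?j * N0)) ((L ^^ (?j * N0)) f)" using le by (simp add: Lpow_add_exp[symmetric])
    have b: "ball (CL * (M * (1 / 2) ^ ?j)) ((L ^^ n) f)" unfolding eq by (rule ball_Lpow[OF iter[OF f]])
    \<comment> \<open>Rounding in \<open>n div N\<close> costs at most one factor 1/2; this is the 2
      in the final constant.\<close>
    have "\<rho> ^ (N * Suc ?j) \<le> \<rho> ^ n"
    proof (rule power_decreasing)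
      have "N * ?j + n mod N = n" "n mod N < N" using N by simp_all
      then show "n \<le> N * Suc ?j" unfolding mult_Suc_right by linarith
    qed (use \<rho> in auto)
    then have "(1 / 2) ^ Suc ?j \<le> \<rho> ^ n" using \<rho>(3) by (simp only: power_mult)
    then have "(1 / 2) ^ ?j \<le> 2 * \<rho> ^ n" by simp
    then have "CL * M * (1 / 2) ^ ?j \<le> CL * M * (2 * \<rho> ^ n)"
      using CL(1) ball_nonneg[OF f(1)] by (intro mult_left_mono) auto
    then show ?thesis by (intro ball_mono[OF b]) (simp add: mult_ac)
  qed
  then show ?thesis using \<rho> CL(1) by (intro exI[of _ "2 * CL"] exI[of _ \<rho>]) auto
qed

end

section \<open>Operators on the space of Hoelder functions\<close>

context edge_shift
begin

abbreviation FH :: "((nat \<Rightarrow> 'e) \<Rightarrow> complex) set" where "FH \<equiv> holder_space G \<theta>"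
abbreviation NH :: "((nat \<Rightarrow> 'e) \<Rightarrow> complex) \<Rightarrow> real" where "NH \<equiv> holder_norm G \<theta>"
abbreviation CB :: "((nat \<Rightarrow> 'e) \<Rightarrow> complex) set" where "CB \<equiv> bounded_continuous G \<theta>"

text \<open>Balls for complex functions that vanish off \<open>X\<close>. They and the Hoelder norm
  control each other (\<open>hball_norm\<close>, \<open>FH_hball\<close>), which confines the
  suprema of the norm to a few lemmas.\<close>

definition hball :: "real \<Rightarrow> ((nat \<Rightarrow> 'e) \<Rightarrow> complex) \<Rightarrow> bool" where
  "hball M f \<longleftrightarrow> (\<forall>\<omega>. \<omega> \<notin> X \<longrightarrow> f \<omega> = 0) \<and> bounded_by G f M \<and> lipschitz_by G \<theta> f M"

lemma hball_nonneg: "hball M f \<Longrightarrow> 0 \<le> M"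
proof -
  assume "hball M f"
  then have b: "bounded_by G f M" by (simp add: hball_def)
  obtain \<omega> where "\<omega> \<in> X" using X_nonempty by auto
  then show ?thesis using order_trans[OF norm_ge_zero bounded_byD[OF b]] by blast
qed

lemma hball_mono: "hball M f \<Longrightarrow> M \<le> M' \<Longrightarrow> hball M' f"
  unfolding hball_def using bounded_by_mono lipschitz_by_mono by blast

lemma bdd_CB: "f \<in> CB \<Longrightarrow> \<exists>M. bounded_by G f M"
  unfolding bounded_continuous_def bounded_by_def bounded_iff by auto

lemma CB_outside: "f \<in> CB \<Longrightarrow> \<omega> \<notin> X \<Longrightarrow> f \<omega> = 0"
  by (simp add: bounded_continuous_def)

lemma hball_imp_CB: "hball M f \<Longrightarrow> f \<in> CB"
  unfolding hball_def bounded_continuous_def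
  using lipschitz_continuous[of f M] by (auto simp: bounded_by_def bounded_iff)

lemma variation_set:
  assumes "bounded_by G f M"
  defines "S n \<equiv> {cmod (f \<omega> - f \<upsilon>) | \<omega> \<upsilon>. \<omega> \<in> X \<and> \<upsilon> \<in> X \<and> (\<forall>i<n. \<omega> i = \<upsilon> i)}"
  shows "S n \<noteq> {}" "bdd_above (S n)"
proof -
  obtain \<omega> where "\<omega> \<in> X" using X_nonempty by auto
  then show "S n \<noteq> {}" unfolding S_def by blast
  show "bdd_above (S n)"
  proof (rule bdd_aboveI[of _ "M + M"])
    fix x assume "x \<in> S n"
    then obtain \<omega> \<upsilon> where "x = cmod (f \<omega> - f \<upsilon>)" "\<omega> \<in> X" "\<upsilon> \<in> X" unfolding S_def by blast
    then show "x \<le> M + M"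
      using norm_triangle_ineq4[of "f \<omega>" "f \<upsilon>"] bounded_byD[OF assms(1), of \<omega>] bounded_byD[OF assms(1), of \<upsilon>] by simp
  qed
qed

lemma variation_le:
  assumes "bounded_by G f M" "\<And>\<omega> \<upsilon>. \<omega> \<in> X \<Longrightarrow> \<upsilon> \<in> X \<Longrightarrow> agree n \<omega> \<upsilon> \<Longrightarrow> cmod (f \<omega> - f \<upsilon>) \<le> c"
  shows "variation G n f \<le> c"
  unfolding variation_def
  by (rule cSup_least[OF variation_set(1)[OF assms(1)]]) (use assms(2) in \<open>auto simp: agree_def\<close>)

lemma variation_ge:
  assumes "bounded_by G f M" "\<omega> \<in> X" "\<upsilon> \<in> X" "agree n \<omega> \<upsilon>"
  shows "cmod (f \<omega> - f \<upsilon>) \<le> variation G n f"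
  unfolding variation_def
  by (rule cSup_upper[OF _ variation_set(2)[OF assms(1)]]) (use assms in \<open>auto simp: agree_def\<close>)

lemma hball_variation:
  assumes "hball M f" "n \<ge> 1" shows "variation G n f / \<theta> ^ n \<le> M"
proof -
  have "variation G n f \<le> M * \<theta> ^ n"
    using assms by (intro variation_le[of f M]) (auto simp: hball_def intro: lipschitz_byD)
  then show ?thesis using \<theta>_pos by (simp add: pos_divide_le_eq)
qed

lemma hball_imp_FH: "hball M f \<Longrightarrow> f \<in> FH"
  unfolding holder_space_def using hball_imp_CB[of M f] hball_variation[of M f]
  by (auto intro!: bdd_aboveI2[of _ _ M])

lemma hball_norm: assumes "hball M f" shows "NH f \<le> 2 * M"
proof -
  have "(SUP \<omega>\<in>X. cmod (f \<omega>)) \<le> M"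
    by (rule cSUP_least[OF X_nonempty]) (use assms in \<open>auto simp: hball_def bounded_by_def\<close>)
  moreover have "holder_seminorm G \<theta> f \<le> M"
    unfolding holder_seminorm_def by (rule cSUP_least) (use hball_variation[OF assms] in auto)
  ultimately show ?thesis by (simp add: holder_norm_def)
qed

lemma FH_hball: assumes "f \<in> FH" shows "hball (NH f) f"
proof -
  have C: "f \<in> CB" and bdd: "bdd_above ((\<lambda>n. variation G n f / \<theta> ^ n) ` {1..})"
    using assms by (auto simp: holder_space_def)
  obtain M where M: "bounded_by G f M" using bdd_CB[OF C] by blast
  have bs: "bdd_above ((\<lambda>\<omega>. cmod (f \<omega>)) ` X)" using M by (auto simp: bounded_by_def intro!: bdd_aboveI2[of _ _ M])
  let ?s = "SUP \<omega>\<in>X. cmod (f \<omega>)"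
  have s: "cmod (f \<omega>) \<le> ?s" if "\<omega> \<in> X" for \<omega> by (rule cSUP_upper[OF that bs])
  have v: "variation G n f / \<theta> ^ n \<le> holder_seminorm G \<theta> f" if "n \<ge> 1" for n
    unfolding holder_seminorm_def by (rule cSUP_upper[OF _ bdd]) (use that in auto)
  obtain \<omega>\<^sub>0 where \<omega>\<^sub>0: "\<omega>\<^sub>0 \<in> X" using X_nonempty by auto
  have s0: "0 \<le> ?s" using order_trans[OF norm_ge_zero s[OF \<omega>\<^sub>0]] .
  have "0 \<le> variation G 1 f" using order_trans[OF norm_ge_zero variation_ge[OF M \<omega>\<^sub>0 \<omega>\<^sub>0 agree_refl]] .
  then have "0 \<le> variation G 1 f / \<theta> ^ 1" using \<theta>_pos by simp
  then have v0: "0 \<le> holder_seminorm G \<theta> f" using v[of 1] by linarith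
  have "lipschitz_by G \<theta> f (NH f)"
  proof (rule lipschitz_byI)
    fix \<omega> \<upsilon> n assume *: "\<omega> \<in> X" "\<upsilon> \<in> X" "1 \<le> n" "agree n \<omega> \<upsilon>"
    have "variation G n f \<le> holder_seminorm G \<theta> f * \<theta> ^ n" using v[OF *(3)] \<theta>_pos by (simp add: pos_divide_le_eq)
    also have "\<dots> \<le> NH f * \<theta> ^ n" using s0 \<theta>_pos by (intro mult_right_mono) (auto simp: holder_norm_def)
    finally show "norm (f \<omega> - f \<upsilon>) \<le> NH f * \<theta> ^ n" using variation_ge[OF M *(1,2,4)] by linarith
  qed
  moreover have "bounded_by G f (NH f)" unfolding bounded_by_def
  proof
    fix \<omega> assume "\<omega> \<in> X"
    then show "cmod (f \<omega>) \<le> NH f" using s[of \<omega>] v0 unfolding holder_norm_def by linarith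
  qed
  ultimately show ?thesis using CB_outside[OF C] by (simp add: hball_def)
qed

lemma FH_iff: "f \<in> FH \<longleftrightarrow> (\<exists>M. hball M f)"
  using FH_hball hball_imp_FH by blast

lemma FH_CB: "f \<in> FH \<Longrightarrow> f \<in> CB"
  by (simp add: holder_space_def)

lemma hball_add: assumes "hball M f" "hball M' g" shows "hball (M + M') (\<lambda>\<omega>. f \<omega> + g \<omega>)"
  using assms lipschitz_by_add[of G \<theta> f M g M'] unfolding hball_def bounded_by_def
  by (auto intro: norm_triangle_mono)

lemma hball_scale: assumes "hball M f" shows "hball (cmod a * M) (\<lambda>\<omega>. a * f \<omega>)"
  using assms lipschitz_by_scale[of G \<theta> f M a] unfolding hball_def bounded_by_def
  by (auto simp: norm_mult intro!: mult_left_mono)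

lemma hball_zero: "hball 0 (\<lambda>_. 0)"
  by (simp add: hball_def bounded_by_def lipschitz_by_def)

lemma hball_diff: assumes "hball M f" "hball M' g" shows "hball (M + M') (\<lambda>\<omega>. f \<omega> - g \<omega>)"
  using hball_add[OF assms(1) hball_scale[OF assms(2), of "-1"]] by simp

lemma hball_sum: "(\<And>i. i < (n::nat) \<Longrightarrow> hball (c i) (g i)) \<Longrightarrow> hball (\<Sum>i<n. c i) (\<lambda>\<omega>. \<Sum>i<n. g i \<omega>)"
  by (induction n) (auto simp: hball_zero intro!: hball_add)

lemma FH_add: "f \<in> FH \<Longrightarrow> g \<in> FH \<Longrightarrow> (\<lambda>\<omega>. f \<omega> + g \<omega>) \<in> FH"
  unfolding FH_iff using hball_add by blast

lemma FH_diff: "f \<in> FH \<Longrightarrow> g \<in> FH \<Longrightarrow> (\<lambda>\<omega>. f \<omega> - g \<omega>) \<in> FH"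
  unfolding FH_iff using hball_diff by blast

lemma FH_scale: "f \<in> FH \<Longrightarrow> (\<lambda>\<omega>. a * f \<omega>) \<in> FH"
  unfolding FH_iff using hball_scale by blast

lemma FH_zero: "(\<lambda>_. 0) \<in> FH"
  unfolding FH_iff using hball_zero by blast

lemma FH_sum: "(\<And>i. i < (n::nat) \<Longrightarrow> g i \<in> FH) \<Longrightarrow> (\<lambda>\<omega>. \<Sum>i<n. g i \<omega>) \<in> FH"
  by (induction n) (auto simp: FH_zero intro!: FH_add)

text \<open>Completeness in the form in which it is used: a pointwise series with summable bounds
  has its sum in the space, with the expected bound.\<close>

lemma hball_series:
  assumes g: "\<And>n. hball (c n) (g n)" and c: "summable c"
  shows "hball (suminf c) (\<lambda>\<omega>. \<Sum>n. g n \<omega>)" "\<And>\<omega>. summable (\<lambda>n. g n \<omega>)"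
proof -
  have b: "norm (g n \<omega>) \<le> c n" for n \<omega>
    using g[of n] hball_nonneg[OF g] by (cases "\<omega> \<in> X") (auto simp: hball_def bounded_by_def)
  show s: "summable (\<lambda>n. g n \<omega>)" for \<omega> by (rule summable_comparison_test'[OF c]) (rule b)
  have "bounded_by G (\<lambda>\<omega>. \<Sum>n. g n \<omega>) (suminf c)"
    unfolding bounded_by_def
  proof
    fix \<omega> assume "\<omega> \<in> X"
    have sn: "summable (\<lambda>n. norm (g n \<omega>))" by (rule summable_comparison_test'[OF c]) (simp add: b)
    show "norm (\<Sum>n. g n \<omega>) \<le> suminf c" using summable_norm[OF sn] suminf_le[OF b sn c] by linarith
  qed
  moreover have "lipschitz_by G \<theta> (\<lambda>\<omega>. \<Sum>n. g n \<omega>) (suminf c)"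
  proof (rule lipschitz_byI)
    fix \<omega> \<upsilon> k assume *: "\<omega> \<in> X" "\<upsilon> \<in> X" "1 \<le> k" "agree k \<omega> \<upsilon>"
    have l: "norm (g n \<omega> - g n \<upsilon>) \<le> c n * \<theta> ^ k" for n
      using g[of n] lipschitz_byD[OF _ *] unfolding hball_def by blast
    have ck: "summable (\<lambda>n. c n * \<theta> ^ k)" by (rule summable_mult2[OF c])
    have sn: "summable (\<lambda>n. norm (g n \<omega> - g n \<upsilon>))" by (rule summable_comparison_test'[OF ck]) (simp add: l)
    have "norm ((\<Sum>n. g n \<omega>) - (\<Sum>n. g n \<upsilon>)) = norm (\<Sum>n. g n \<omega> - g n \<upsilon>)"
      by (simp add: suminf_diff[OF s s])
    also have "\<dots> \<le> (\<Sum>n. c n * \<theta> ^ k)" using summable_norm[OF sn] suminf_le[OF l sn ck] by linarith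
    also have "\<dots> = suminf c * \<theta> ^ k" by (rule suminf_mult2[OF c, symmetric])
    finally show "norm ((\<Sum>n. g n \<omega>) - (\<Sum>n. g n \<upsilon>)) \<le> suminf c * \<theta> ^ k" .
  qed
  moreover have "(\<Sum>n. g n \<omega>) = 0" if "\<omega> \<notin> X" for \<omega>
  proof -
    have "g n \<omega> = 0" for n using g that by (simp add: hball_def)
    then show ?thesis by simp
  qed
  ultimately show "hball (suminf c) (\<lambda>\<omega>. \<Sum>n. g n \<omega>)" by (simp add: hball_def)
qed

section \<open>Bounded operators and the Neumann series\<close>

definition lin :: "(((nat \<Rightarrow> 'e) \<Rightarrow> complex) \<Rightarrow> (nat \<Rightarrow> 'e) \<Rightarrow> complex) \<Rightarrow> bool" where
  "lin A \<longleftrightarrow> (\<forall>f\<in>FH. \<forall>g\<in>FH. A (\<lambda>x. f x + g x) = (\<lambda>x. A f x + A g x)) \<and>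
     (\<forall>f\<in>FH. \<forall>a. A (\<lambda>x. a * f x) = (\<lambda>x. a * A f x))"

lemma bounded_operatorI:
  assumes "lin A" "\<And>M f. hball M f \<Longrightarrow> hball (K * M) (A f)"
  shows "bounded_operator FH NH A"
  unfolding bounded_operator_def
proof (intro conjI)
  show "\<forall>f\<in>FH. A f \<in> FH" using hball_imp_FH[OF assms(2)[OF FH_hball]] by blast
  show "\<exists>K. \<forall>f\<in>FH. NH (A f) \<le> K * NH f"
  proof (intro exI[of _ "2 * K"] ballI)
    fix f assume "f \<in> FH"
    from hball_norm[OF assms(2)[OF FH_hball[OF this]]] show "NH (A f) \<le> 2 * K * NH f" by (simp add: mult.assoc)
  qed
qed (use assms(1) in \<open>auto simp: lin_def\<close>)

lemma lin_add: "lin A \<Longrightarrow> f \<in> FH \<Longrightarrow> g \<in> FH \<Longrightarrow> A (\<lambda>x. f x + g x) = (\<lambda>x. A f x + A g x)"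
  by (simp add: lin_def)

lemma lin_scale: "lin A \<Longrightarrow> f \<in> FH \<Longrightarrow> A (\<lambda>x. a * f x) = (\<lambda>x. a * A f x)"
  by (simp add: lin_def)

lemma lin_diff: assumes "lin A" "f \<in> FH" "g \<in> FH" shows "A (\<lambda>x. f x - g x) = (\<lambda>x. A f x - A g x)"
  using lin_add[OF assms(1,2) FH_scale[OF assms(3), of "-1"]] lin_scale[OF assms(1,3), of "-1"] by simp

lemma lin_zero: "lin A \<Longrightarrow> A (\<lambda>_. 0) = (\<lambda>_. 0)"
  using lin_scale[OF _ FH_zero, of A 0] by simp

lemma lin_sum:
  assumes "lin A" "\<And>i. i < (n::nat) \<Longrightarrow> g i \<in> FH"
  shows "A (\<lambda>\<omega>. \<Sum>i<n. g i \<omega>) = (\<lambda>\<omega>. \<Sum>i<n. A (g i) \<omega>)"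
  using assms(2)
proof (induction n)
  case 0
  then show ?case using lin_zero[OF assms(1)] by simp
next
  case (Suc n)
  then show ?case using lin_add[OF assms(1) FH_sum[of n g], of "g n"] by simp
qed

text \<open>The Neumann series with terms A^n / z^(n+1) inverts z - A; the power bounds make it
  converge geometrically as soon as |z| exceeds \<open>\<rho>\<close>. Upper bounds of spectral
  radii are thus read off from power bounds.\<close>

lemma resolvent_set:
  assumes A: "lin A" and K: "0 \<le> K" and \<rho>: "0 \<le> \<rho>"
    and pow: "\<And>n M f. hball M f \<Longrightarrow> hball (K * \<rho> ^ n * M) ((A ^^ n) f)" and z: "\<rho> < cmod z"
  shows "z \<notin> operator_spectrum FH NH A"
proof -
  have z0: "z \<noteq> 0" "0 < cmod z" using z \<rho> by auto
  define q where "q = \<rho> / cmod z"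
  have q: "0 \<le> q" "q < 1" using z \<rho> z0 by (auto simp: q_def)
  define g where "g f n \<omega> = inverse z ^ Suc n * (A ^^ n) f \<omega>" for f n \<omega>
  define c where "c M n = K * M / cmod z * q ^ n" for M :: real and n
  have gb: "hball (c M n) (g f n)" if "hball M f" for M f n
  proof -
    have "cmod (inverse z ^ Suc n) * (K * \<rho> ^ n * M) = c M n"
    proof -
      have "cmod (inverse z ^ Suc n) = inverse (cmod z) ^ Suc n" by (simp only: norm_power norm_inverse)
      then show ?thesis using z0(2) by (simp add: c_def q_def power_divide field_simps)
    qed
    then show ?thesis using hball_scale[OF pow[OF that, of n], of "inverse z ^ Suc n"] unfolding g_def by simp
  qed
  have c_sum: "summable (c M)" for M unfolding c_def using q by (intro summable_mult summable_geometric) simp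
  have c_suminf: "suminf (c M) = K / cmod z * (1 / (1 - q)) * M" for M
    unfolding c_def using q by (subst suminf_mult) (simp_all add: summable_geometric suminf_geometric)
  define Bf where "Bf f = (\<lambda>\<omega>. \<Sum>n. g f n \<omega>)" for f
  have summ: "summable (\<lambda>n. g f n \<omega>)" if "f \<in> FH" for f \<omega>
    by (rule hball_series(2)[OF gb[OF FH_hball[OF that]] c_sum])
  have Bb: "hball (K / cmod z * (1 / (1 - q)) * M) (Bf f)" if "hball M f" for f M
    using hball_series(1)[OF gb[OF that] c_sum] unfolding Bf_def c_suminf .
  have powF: "(A ^^ n) f \<in> FH" if "f \<in> FH" for f n
    using pow[OF FH_hball[OF that]] hball_imp_FH by blast
  have AF: "A f \<in> FH" if "f \<in> FH" for f using powF[OF that, of 1] by simp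
  have pow_add: "(A ^^ n) (\<lambda>x. f x + g x) = (\<lambda>x. (A ^^ n) f x + (A ^^ n) g x)" if "f \<in> FH" "g \<in> FH" for f g n
    by (induction n) (simp_all add: lin_add[OF A powF[OF that(1)] powF[OF that(2)]])
  have pow_scale: "(A ^^ n) (\<lambda>x. a * f x) = (\<lambda>x. a * (A ^^ n) f x)" if "f \<in> FH" for f a n
    by (induction n) (simp_all add: lin_scale[OF A powF[OF that]])
  have "lin Bf"
    unfolding lin_def
  proof (intro conjI ballI allI)
    fix f f' assume f: "f \<in> FH" "f' \<in> FH"
    show "Bf (\<lambda>x. f x + f' x) = (\<lambda>x. Bf f x + Bf f' x)"
    proof
      fix \<omega>
      have "g (\<lambda>x. f x + f' x) n \<omega> = g f n \<omega> + g f' n \<omega>" for n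
        unfolding g_def pow_add[OF f] by (simp add: distrib_left)
      then show "Bf (\<lambda>x. f x + f' x) \<omega> = Bf f \<omega> + Bf f' \<omega>"
        unfolding Bf_def by (simp add: suminf_add[OF summ[OF f(1)] summ[OF f(2)]])
    qed
  next
    fix f a assume f: "f \<in> FH"
    show "Bf (\<lambda>x. a * f x) = (\<lambda>x. a * Bf f x)"
    proof
      fix \<omega>
      have "g (\<lambda>x. a * f x) n \<omega> = a * g f n \<omega>" for n unfolding g_def pow_scale[OF f] by simp
      then show "Bf (\<lambda>x. a * f x) \<omega> = a * Bf f \<omega>" unfolding Bf_def by (simp add: suminf_mult[OF summ[OF f]])
    qed
  qed
  then have bo: "bounded_operator FH NH Bf" by (rule bounded_operatorI[OF _ Bb])
  have Bz: "Bf (\<lambda>x. z * f x - A f x) = f" if f: "f \<in> FH" for f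
  proof
    fix \<omega>
    have e: "g (\<lambda>x. z * f x - A f x) n \<omega> = inverse z ^ n * (A ^^ n) f \<omega> - inverse z ^ Suc n * (A ^^ Suc n) f \<omega>" for n
    proof -
      have "(\<lambda>x. z * f x - A f x) = (\<lambda>x. z * f x + -1 * A f x)" by simp
      then have "(A ^^ n) (\<lambda>x. z * f x - A f x) = (\<lambda>x. z * (A ^^ n) f x + -1 * (A ^^ n) (A f) x)"
        using pow_add[OF FH_scale[OF f, of z] FH_scale[OF AF[OF f], of "-1"], of n]
        by (simp only: pow_scale[OF f] pow_scale[OF AF[OF f]])
      then show ?thesis using z0 by (simp add: g_def funpow_swap1 algebra_simps)
    qed
    have "(\<lambda>n. inverse z ^ n * (A ^^ n) f \<omega>) \<longlonglongrightarrow> 0"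
    proof -
      have "(\<lambda>n. z * g f n \<omega>) \<longlonglongrightarrow> z * 0" by (intro tendsto_mult_left summable_LIMSEQ_zero summ f)
      then show ?thesis using z0 by (simp add: g_def mult.assoc[symmetric])
    qed
    from telescope_sums'[OF this] show "Bf (\<lambda>x. z * f x - A f x) \<omega> = f \<omega>"
      unfolding Bf_def e by (simp add: sums_iff)
  qed
  \<comment> \<open>The left inverse is plain telescoping. For the right inverse \<open>A\<close>
    has to pass through the infinite sum, which follows from its boundedness on the tails.\<close>
  have comm: "A (Bf f) = Bf (A f)" if f: "f \<in> FH" for f
  proof
    fix \<omega>
    let ?M = "NH f"
    have fM: "hball ?M f" by (rule FH_hball[OF f])
    define S where "S N = (\<lambda>\<omega>. \<Sum>n<N. g f n \<omega>)" for N
    have gF: "g f n \<in> FH" for n using gb[OF fM] hball_imp_FH by blast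
    have SF: "S N \<in> FH" for N unfolding S_def by (rule FH_sum) (rule gF)
    have BF: "Bf f \<in> FH" using Bb[OF fM] hball_imp_FH by blast
    have AS: "A (S N) \<omega> = (\<Sum>n<N. g (A f) n \<omega>)" for N
    proof -
      have "A (g f n) = g (A f) n" for n
        unfolding g_def lin_scale[OF A powF[OF f]] by (simp add: funpow_swap1)
      then show ?thesis unfolding S_def by (simp add: lin_sum[OF A gF])
    qed
    have tail: "hball (\<Sum>n. c ?M (n + N)) (\<lambda>\<omega>. Bf f \<omega> - S N \<omega>)" for N
    proof -
      have "(\<lambda>\<omega>. Bf f \<omega> - S N \<omega>) = (\<lambda>\<omega>. \<Sum>n. g f (n + N) \<omega>)"
        unfolding Bf_def S_def using suminf_minus_initial_segment[OF summ[OF f]] by auto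
      then show ?thesis
        using hball_series(1)[of "\<lambda>n. c ?M (n + N)" "\<lambda>n. g f (n + N)"] gb[OF fM] summable_ignore_initial_segment[OF c_sum]
        by simp
    qed
    have "(\<lambda>N. A (S N) \<omega>) \<longlonglongrightarrow> A (Bf f) \<omega>"
    proof (rule LIM_zero_cancel, rule Lim_null_comparison)
      have "norm (A (S N) \<omega> - A (Bf f) \<omega>) \<le> K * \<rho> ^ 1 * (\<Sum>n. c ?M (n + N))" for N
      proof -
        have "hball (K * \<rho> ^ 1 * (\<Sum>n. c ?M (n + N))) ((A ^^ 1) (\<lambda>\<omega>. Bf f \<omega> - S N \<omega>))" by (rule pow[OF tail])
        then have hb: "hball (K * \<rho> ^ 1 * (\<Sum>n. c ?M (n + N))) (\<lambda>\<omega>. A (Bf f) \<omega> - A (S N) \<omega>)"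
          by (simp add: lin_diff[OF A BF SF])
        then have "norm (A (Bf f) \<omega> - A (S N) \<omega>) \<le> K * \<rho> ^ 1 * (\<Sum>n. c ?M (n + N))"
          using hball_nonneg[OF hb] by (cases "\<omega> \<in> X") (auto simp: hball_def bounded_by_def)
        then show ?thesis by (simp add: norm_minus_commute)
      qed
      then show "eventually (\<lambda>N. norm (A (S N) \<omega> - A (Bf f) \<omega>) \<le> K * \<rho> ^ 1 * (\<Sum>n. c ?M (n + N))) sequentially"
        by (simp add: always_eventually)
      show "(\<lambda>N. K * \<rho> ^ 1 * (\<Sum>n. c ?M (n + N))) \<longlonglongrightarrow> 0"
        using tendsto_mult_left[OF suminf_exist_split2[OF c_sum[of ?M]], of "K * \<rho> ^ 1"] by simp
    qed
    moreover have "(\<lambda>N. A (S N) \<omega>) \<longlonglongrightarrow> Bf (A f) \<omega>"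
      unfolding AS Bf_def by (rule summable_LIMSEQ[OF summ[OF AF[OF f]]])
    ultimately show "A (Bf f) \<omega> = Bf (A f) \<omega>" by (rule LIMSEQ_unique)
  qed
  have zB: "(\<lambda>x. z * Bf f x - A (Bf f) x) = f" if f: "f \<in> FH" for f
  proof -
    have "(\<lambda>x. z * Bf f x - A (Bf f) x) = Bf (\<lambda>x. z * f x - A f x)"
      unfolding comm[OF f] using lin_diff[OF \<open>lin Bf\<close> FH_scale[OF f, of z] AF[OF f]] lin_scale[OF \<open>lin Bf\<close> f, of z] by simp
    then show ?thesis using Bz[OF f] by simp
  qed
  show ?thesis unfolding operator_spectrum_def using bo Bz zB by blast
qed

lemma eigenvalue_in_spectrum:
  assumes "eigenfunction FH A z g" shows "z \<in> operator_spectrum FH NH A"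
proof (rule ccontr)
  assume "z \<notin> operator_spectrum FH NH A"
  then obtain B where B: "bounded_operator FH NH B" "\<And>f. f \<in> FH \<Longrightarrow> B (\<lambda>x. z * f x - A f x) = f"
    unfolding operator_spectrum_def by blast
  have g: "g \<in> FH" "g \<noteq> (\<lambda>_. 0)" "A g = (\<lambda>x. z * g x)" using assms by (auto simp: eigenfunction_def)
  have "B (\<lambda>x. 0 * g x) = (\<lambda>x. 0 * B g x)" using B(1) g(1) unfolding bounded_operator_def by blast
  then have "B (\<lambda>_. 0) = (\<lambda>_. 0)" by simp
  then show False using B(2)[OF g(1)] g by simp
qed

end

section \<open>The spectral decomposition\<close>

text \<open>The interface between dynamics and spectral theory: growth at rate \<open>l\<close>, a
  strictly smaller rate when the integrals over all classes vanish, and the cyclic motion of the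
  classes. The potential itself no longer appears.\<close>

locale cyclic_spectrum = edge_shift G \<theta>
  for G :: "('v,'e) pre_digraph" and \<theta> :: real +
  fixes A :: "((nat \<Rightarrow> 'e) \<Rightarrow> complex) \<Rightarrow> (nat \<Rightarrow> 'e) \<Rightarrow> complex"
    and l \<rho> K :: real and h :: "(nat \<Rightarrow> 'e) \<Rightarrow> complex" and \<nu> :: "(nat \<Rightarrow> 'e) measure"
    and p :: nat and Es :: "nat \<Rightarrow> 'e set"
  assumes l_pos: "0 < l" and \<rho>: "0 < \<rho>" "\<rho> < 1" and K: "0 \<le> K"
    and A_lin: "lin A"
    and A_out: "\<And>f \<omega>. \<omega> \<notin> shift_space G \<Longrightarrow> A f \<omega> = 0"
    and A_pow: "\<And>n M f. hball M f \<Longrightarrow> hball (K * l ^ n * M) ((A ^^ n) f)"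
    and A_decay: "\<And>n M f. hball M f \<Longrightarrow> (\<And>j. j < p \<Longrightarrow> (LINT \<omega>:edge_union G (Es j)|\<nu>. f \<omega>) = 0) \<Longrightarrow>
      hball (K * (l * \<rho>) ^ n * M) ((A ^^ n) f)"
    and A_chi: "\<And>f j. f \<in> bounded_continuous G \<theta> \<Longrightarrow> j < p \<Longrightarrow>
      A (\<lambda>\<omega>. f \<omega> * indicator (edge_union G (Es j)) \<omega>) = (\<lambda>\<omega>. A f \<omega> * indicator (edge_union G (Es (Suc j mod p))) \<omega>)"
    and h_FH: "h \<in> holder_space G \<theta>" and h_eig: "A h = (\<lambda>\<omega>. of_real l * h \<omega>)" and h_int: "integral\<^sup>L \<nu> h = 1"
    and \<nu>_prob: "prob_space \<nu>" and \<nu>_sets: "sets \<nu> = sets (shift_borel G \<theta>)"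
    and \<nu>_eig: "\<And>f. f \<in> bounded_continuous G \<theta> \<Longrightarrow> integral\<^sup>L \<nu> (A f) = of_real l * integral\<^sup>L \<nu> f"
    and p_pos: "0 < p" and Es_cover: "(\<Union>i<p. Es i) = arcs G"
    and Es_disjoint: "\<And>i j. i < p \<Longrightarrow> j < p \<Longrightarrow> i \<noteq> j \<Longrightarrow> Es i \<inter> Es j = {}"
begin

sublocale prob_space \<nu> by (rule \<nu>_prob)

lemma space_\<nu> [simp]: "space \<nu> = X"
  using sets_eq_imp_space_eq[OF \<nu>_sets] by simp

abbreviation \<Sigma> :: "nat \<Rightarrow> (nat \<Rightarrow> 'e) set" where "\<Sigma> j \<equiv> edge_union G (Es j)"

definition \<kappa> :: complex where "\<kappa> = exp (2 * of_real pi * \<i> / of_nat p)"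

lemma \<kappa>_pow: "\<kappa> ^ p = 1"
proof -
  have "\<kappa> ^ p = exp (of_nat p * (2 * of_real pi * \<i> / of_nat p))" unfolding \<kappa>_def by (rule exp_of_nat_mult[symmetric])
  also have "of_nat p * (2 * of_real pi * \<i> / of_nat p) = 2 * of_real pi * \<i>" using p_pos by simp
  finally show ?thesis by simp
qed

lemma \<kappa>_nz [simp]: "\<kappa> \<noteq> 0"
  by (simp add: \<kappa>_def)

lemma \<kappa>_norm [simp]: "cmod \<kappa> = 1"
  by (simp add: \<kappa>_def)

lemma \<kappa>_mod: "\<kappa> ^ (n mod p) = \<kappa> ^ n"
proof -
  have "\<kappa> ^ n = \<kappa> ^ (p * (n div p) + n mod p)" by simp
  also have "\<dots> = \<kappa> ^ (n mod p)" unfolding power_add power_mult \<kappa>_pow by simp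
  finally show ?thesis by simp
qed

lemma \<kappa>_inj: assumes "i < p" "j < p" "\<kappa> ^ i = \<kappa> ^ j" shows "i = j"
proof -
  have *: "\<not> (i < j)" if "j < p" "\<kappa> ^ i = \<kappa> ^ j" for i j
  proof
    assume "i < j"
    then have "\<kappa> ^ j = \<kappa> ^ i * \<kappa> ^ (j - i)" by (simp add: power_add[symmetric])
    then have one: "\<kappa> ^ (j - i) = 1" using that by simp
    have "\<kappa> ^ (j - i) = exp (of_nat (j - i) * (2 * of_real pi * \<i> / of_nat p))"
      unfolding \<kappa>_def by (rule exp_of_nat_mult[symmetric])
    then have "exp (of_nat (j - i) * (2 * of_real pi * \<i> / of_nat p)) = 1" using one by simp
    then obtain n :: int where n: "of_nat (j - i) * (2 * of_real pi * \<i> / of_nat p) = of_int (2 * n) * of_real pi * \<i>"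
      unfolding exp_eq_1 by (auto simp: complex_eq_iff)
    have a: "Im (of_nat (j - i) * (2 * of_real pi * \<i> / of_nat p)) = real (j - i) * (2 * pi / real p)"
      by (simp add: Im_divide_of_nat)
    have b: "Im (of_int (2 * n) * of_real pi * \<i>) = 2 * real_of_int n * pi" by simp
    have "real (j - i) * (2 * pi / real p) = 2 * real_of_int n * pi" using a unfolding n b by simp
    then have "real_of_int (int (j - i)) = real_of_int (n * int p)" using p_pos by (simp add: field_simps)
    then have eq: "int (j - i) = n * int p" by (simp only: of_int_eq_iff)
    have "0 < n * int p" "n * int p < 1 * int p" unfolding eq[symmetric] using \<open>i < j\<close> \<open>j < p\<close> by auto
    then have "0 < n" "n < 1" using p_pos by (simp_all only: zero_less_mult_iff mult_less_cancel_right, auto)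
    then show False by simp
  qed
  show ?thesis using *[OF assms(2,3)] *[OF assms(1) assms(3)[symmetric]] by simp
qed

text \<open>Orthogonality of the characters of the cyclic group of order \<open>p\<close>.\<close>

lemma root_sum:
  assumes "j < p" "k < p"
  shows "(\<Sum>i<p. \<kappa> ^ (j * i) * inverse \<kappa> ^ (k * i)) = (if j = k then of_nat p else 0)"
proof -
  let ?z = "\<kappa> ^ j * inverse \<kappa> ^ k"
  have e: "\<kappa> ^ (j * i) * inverse \<kappa> ^ (k * i) = ?z ^ i" for i by (simp add: power_mult power_mult_distrib)
  have zp: "?z ^ p = 1"
  proof -
    have "?z ^ p = (\<kappa> ^ p) ^ j * inverse ((\<kappa> ^ p) ^ k)"
      by (simp add: power_mult_distrib power_inverse power_mult[symmetric] mult.commute)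
    then show ?thesis by (simp add: \<kappa>_pow)
  qed
  show ?thesis
  proof (cases "j = k")
    case True
    then have "?z = 1" by (simp add: power_inverse)
    then show ?thesis using True unfolding e by simp
  next
    case False
    have "?z \<noteq> 1"
    proof
      assume "?z = 1"
      then have "\<kappa> ^ j = \<kappa> ^ k" by (simp add: power_inverse field_simps)
      then show False using \<kappa>_inj assms False by blast
    qed
    then show ?thesis unfolding e using geometric_sum[of ?z p] zp False by simp
  qed
qed

lemma \<Sigma>_sets [measurable]: "\<Sigma> j \<in> sets \<nu>"
proof -
  have "openin (shift_topology G \<theta>) (\<Sigma> j)"
    unfolding edge_union_def by (intro openin_Union) (auto intro: cylinder_open)
  then show ?thesis using open_sets_borelX \<nu>_sets by simp
qed

lemma ind_mult: assumes "i < p" "j < p"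
  shows "indicator (\<Sigma> i) \<omega> * indicator (\<Sigma> j) \<omega> = (if i = j then indicator (\<Sigma> i) \<omega> else (0::complex))"
  using Es_disjoint[OF assms] by (auto simp: indicator_def mem_edge_union)

lemma ind_sum: assumes "\<omega> \<in> X" shows "(\<Sum>j<p. indicator (\<Sigma> j) \<omega>) = (1::complex)"
proof -
  obtain i where i: "i < p" "\<omega> 0 \<in> Es i" using shift_space_nth[OF assms, of 0] Es_cover by blast
  have "indicator (\<Sigma> j) \<omega> = (if j = i then 1 else (0::complex))" if "j < p" for j
    using Es_disjoint[OF that i(1)] i(2) assms by (auto simp: indicator_def mem_edge_union)
  then have "(\<Sum>j<p. indicator (\<Sigma> j) \<omega>) = (\<Sum>j<p. if j = i then 1 else (0::complex))" by (intro sum.cong) auto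
  then show ?thesis using i by simp
qed

lemma CB_chi: assumes "f \<in> CB" shows "(\<lambda>\<omega>. f \<omega> * indicator (\<Sigma> j) \<omega>) \<in> CB"
proof -
  have c: "continuous_map (shift_topology G \<theta>) euclidean f" using assms by (simp add: bounded_continuous_def)
  obtain M where M: "bounded_by G f M" using bdd_CB[OF assms] by blast
  have "continuous_map (shift_topology G \<theta>) euclidean (\<lambda>\<omega>. f \<omega> * indicator (\<Sigma> j) \<omega>)"
    unfolding continuous_shift_iff
  proof (intro ballI allI impI)
    fix \<omega> and \<epsilon> :: real assume *: "\<omega> \<in> X" "\<epsilon> > 0"
    obtain n where n: "\<And>\<upsilon>. \<upsilon> \<in> X \<Longrightarrow> agree n \<omega> \<upsilon> \<Longrightarrow> dist (f \<omega>) (f \<upsilon>) < \<epsilon>"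
      using c[unfolded continuous_shift_iff] * by blast
    have "dist (f \<omega> * indicator (\<Sigma> j) \<omega>) (f \<upsilon> * indicator (\<Sigma> j) \<upsilon>) < \<epsilon>" if "\<upsilon> \<in> X" "agree (Suc n) \<omega> \<upsilon>" for \<upsilon>
    proof -
      have "\<omega> 0 = \<upsilon> 0" using that(2) by (simp add: agree_def)
      then show ?thesis using n[OF that(1) agree_mono[OF that(2)]] * that(1) by (simp add: indicator_def mem_edge_union)
    qed
    then show "\<exists>n. \<forall>\<upsilon>\<in>X. agree n \<omega> \<upsilon> \<longrightarrow> dist (f \<omega> * indicator (\<Sigma> j) \<omega>) (f \<upsilon> * indicator (\<Sigma> j) \<upsilon>) < \<epsilon>" by blast
  qed
  moreover have "bounded ((\<lambda>\<omega>. f \<omega> * indicator (\<Sigma> j) \<omega>) ` X)"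
    using M bounded_byD[OF M] by (auto simp: bounded_iff indicator_def intro!: exI[of _ M] order_trans[OF norm_ge_zero])
  ultimately show ?thesis using CB_outside[OF assms] by (simp add: bounded_continuous_def)
qed

lemma hball_chi: assumes "hball M f" shows "hball M (\<lambda>\<omega>. f \<omega> * indicator (\<Sigma> j) \<omega>)"
proof -
  have M: "0 \<le> M" by (rule hball_nonneg[OF assms])
  have "lipschitz_by G \<theta> (\<lambda>\<omega>. f \<omega> * indicator (\<Sigma> j) \<omega>) M"
  proof (rule lipschitz_byI)
    fix \<omega> \<upsilon> n assume *: "\<omega> \<in> X" "\<upsilon> \<in> X" "1 \<le> n" "agree n \<omega> \<upsilon>"
    then have "\<omega> 0 = \<upsilon> 0" by (simp add: agree_def)
    moreover have "norm (f \<omega> - f \<upsilon>) \<le> M * \<theta> ^ n" using assms lipschitz_byD[OF _ *] unfolding hball_def by blast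
    ultimately show "norm (f \<omega> * indicator (\<Sigma> j) \<omega> - f \<upsilon> * indicator (\<Sigma> j) \<upsilon>) \<le> M * \<theta> ^ n"
      using * M \<theta>_pos by (simp add: indicator_def mem_edge_union)
  qed
  moreover have "bounded_by G (\<lambda>\<omega>. f \<omega> * indicator (\<Sigma> j) \<omega>) M"
    using assms M by (auto simp: hball_def bounded_by_def indicator_def)
  ultimately show ?thesis using assms by (simp add: hball_def)
qed

lemma CB_integrable: assumes "f \<in> CB" shows "integrable \<nu> f"
proof -
  obtain M where M: "bounded_by G f M" using bdd_CB[OF assms] by blast
  have "f \<in> borel_measurable borelX" using assms by (intro continuous_measurable) (simp add: bounded_continuous_def)
  then have "f \<in> borel_measurable \<nu>" by (simp add: measurable_cong_sets[OF \<nu>_sets])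
  then show ?thesis by (intro integrable_const_bound[of _ M]) (use M in \<open>auto simp: bounded_by_def intro!: AE_I2\<close>)
qed

definition mass :: "nat \<Rightarrow> ((nat \<Rightarrow> 'e) \<Rightarrow> complex) \<Rightarrow> complex" where
  "mass j f = integral\<^sup>L \<nu> (\<lambda>\<omega>. f \<omega> * indicator (\<Sigma> j) \<omega>)"

lemma mass_eq: "(LINT \<omega>:\<Sigma> j|\<nu>. f \<omega>) = mass j f"
  unfolding set_lebesgue_integral_def mass_def
  by (intro Bochner_Integration.integral_cong) (auto simp: indicator_def)

lemma mass_add: "f \<in> CB \<Longrightarrow> g \<in> CB \<Longrightarrow> mass j (\<lambda>\<omega>. f \<omega> + g \<omega>) = mass j f + mass j g"
  unfolding mass_def using CB_integrable[OF CB_chi] by (simp add: distrib_right)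

lemma mass_scale: "mass j (\<lambda>\<omega>. a * f \<omega>) = a * mass j f"
  unfolding mass_def by (simp add: mult.assoc)

lemma mass_bound: assumes "hball M f" shows "cmod (mass j f) \<le> M"
proof -
  have b: "hball M (\<lambda>\<omega>. f \<omega> * indicator (\<Sigma> j) \<omega>)" by (rule hball_chi[OF assms])
  have i: "integrable \<nu> (\<lambda>\<omega>. f \<omega> * indicator (\<Sigma> j) \<omega>)" by (rule CB_integrable[OF hball_imp_CB[OF b]])
  have "cmod (mass j f) \<le> integral\<^sup>L \<nu> (\<lambda>\<omega>. cmod (f \<omega> * indicator (\<Sigma> j) \<omega>))" unfolding mass_def by (rule integral_norm_bound)
  also have "\<dots> \<le> integral\<^sup>L \<nu> (\<lambda>_. M)"
    by (rule integral_mono) (use i b in \<open>auto simp: hball_def bounded_by_def\<close>)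
  also have "\<dots> = M" using prob_space by simp
  finally show ?thesis .
qed

lemma mass_A: assumes "f \<in> CB" "j < p" shows "mass (Suc j mod p) (A f) = of_real l * mass j f"
  unfolding mass_def A_chi[OF assms, symmetric] by (rule \<nu>_eig[OF CB_chi[OF assms(1)]])

lemma h_CB: "h \<in> CB"
  by (rule FH_CB[OF h_FH])

text \<open>\<open>A\<close> carries mass from class j to class j + 1 with the factor
  \<open>l\<close>, and \<open>h\<close> is an eigenfunction for \<open>l\<close>, so all classes
  carry the same share of the total 1.\<close>

lemma mass_h: assumes "j < p" shows "mass j h = 1 / of_nat p"
proof -
  have step: "mass (Suc j mod p) h = mass j h" if "j < p" for j
    using mass_A[OF h_CB that] l_pos unfolding h_eig mass_scale by simp
  have const: "mass j h = mass 0 h" if "j < p" for j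
    using that
  proof (induction j)
    case (Suc j)
    then show ?case using step[of j] by simp
  qed simp
  have "1 = integral\<^sup>L \<nu> (\<lambda>\<omega>. \<Sum>j<p. h \<omega> * indicator (\<Sigma> j) \<omega>)"
  proof -
    have "integral\<^sup>L \<nu> h = integral\<^sup>L \<nu> (\<lambda>\<omega>. \<Sum>j<p. h \<omega> * indicator (\<Sigma> j) \<omega>)"
      by (intro Bochner_Integration.integral_cong) (auto simp: sum_distrib_left[symmetric] ind_sum)
    then show ?thesis using h_int by simp
  qed
  also have "\<dots> = (\<Sum>j<p. mass j h)"
    unfolding mass_def by (rule Bochner_Integration.integral_sum) (rule CB_integrable[OF CB_chi[OF h_CB]])
  also have "\<dots> = (\<Sum>j<p. mass 0 h)" by (intro sum.cong refl const) simp
  also have "\<dots> = of_nat p * mass 0 h" by simp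
  finally have "of_nat p * mass 0 h = 1" by simp
  then have "mass 0 h = 1 / of_nat p" using p_pos by (simp add: field_simps)
  then show ?thesis using const[OF assms] by simp
qed

section \<open>Peripheral eigenfunctions, eigenfunctionals and projections\<close>

definition hi :: "nat \<Rightarrow> (nat \<Rightarrow> 'e) \<Rightarrow> complex" where "hi = rotated_eigenfunction p \<kappa> \<Sigma> h"

definition nui :: "nat \<Rightarrow> ((nat \<Rightarrow> 'e) \<Rightarrow> complex) \<Rightarrow> complex" where "nui = rotated_measure p \<kappa> \<Sigma> \<nu>"

definition lami :: "nat \<Rightarrow> complex" where "lami i = of_real l * \<kappa> ^ i"

lemma hi_eq: "hi i \<omega> = (\<Sum>j<p. inverse \<kappa> ^ (j * i) * (h \<omega> * indicator (\<Sigma> j) \<omega>))"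
  by (simp add: hi_def rotated_eigenfunction_def mult.assoc)

lemma nui_eq: "nui i f = (\<Sum>j<p. \<kappa> ^ (j * i) * mass j f)"
  by (simp add: nui_def rotated_measure_def mass_eq)

lemma hi_FH: "hi i \<in> FH"
  unfolding hi_eq[abs_def]
  by (intro FH_sum FH_scale) (use hball_chi[OF FH_hball[OF h_FH]] hball_imp_FH in blast)

lemma nui_add: "f \<in> CB \<Longrightarrow> g \<in> CB \<Longrightarrow> nui i (\<lambda>\<omega>. f \<omega> + g \<omega>) = nui i f + nui i g"
  by (simp add: nui_eq mass_add distrib_left sum.distrib)

lemma nui_scale: "nui i (\<lambda>\<omega>. a * f \<omega>) = a * nui i f"
  by (simp add: nui_eq mass_scale sum_distrib_left mult_ac)

lemma nui_diff: "f \<in> FH \<Longrightarrow> g \<in> FH \<Longrightarrow> nui i (\<lambda>\<omega>. f \<omega> - g \<omega>) = nui i f - nui i g"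
  using nui_add[of f "\<lambda>\<omega>. -1 * g \<omega>" i] FH_CB[of f] FH_CB[OF FH_scale[of g "-1"]] nui_scale[of i "-1" g] by simp

lemma nui_bound: assumes "hball M f" shows "cmod (nui i f) \<le> real p * M"
proof -
  have "cmod (nui i f) \<le> (\<Sum>j<p. cmod (\<kappa> ^ (j * i) * mass j f))" unfolding nui_eq by (rule norm_sum)
  also have "\<dots> \<le> (\<Sum>j<p. M)" by (intro sum_mono) (simp add: norm_mult norm_power mass_bound[OF assms])
  finally show ?thesis by simp
qed

lemma sum_rotate: fixes g :: "nat \<Rightarrow> complex" shows "(\<Sum>j<p. g (Suc j mod p)) = (\<Sum>j<p. g j)"
proof (rule sum.reindex_bij_witness[of _ "\<lambda>j. (j + (p - 1)) mod p" "\<lambda>j. Suc j mod p"])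
  fix j assume j: "j \<in> {..<p}"
  have "(Suc j mod p + (p - 1)) mod p = (Suc j + (p - 1)) mod p" by (simp add: mod_add_left_eq)
  also have "Suc j + (p - 1) = j + p" using p_pos by simp
  finally show "(Suc j mod p + (p - 1)) mod p = j" using j by simp
  have "Suc ((j + (p - 1)) mod p) mod p = Suc (j + (p - 1)) mod p" by (simp add: mod_Suc_eq)
  also have "Suc (j + (p - 1)) = j + p" using p_pos by simp
  finally show "Suc ((j + (p - 1)) mod p) mod p = j" using j by simp
qed (use p_pos in auto)

lemma \<kappa>_Suc_mod: "\<kappa> ^ ((Suc j mod p) * i) = \<kappa> ^ (j * i) * \<kappa> ^ i"
proof -
  have "\<kappa> ^ ((Suc j mod p) * i) = (\<kappa> ^ (Suc j mod p)) ^ i" by (rule power_mult)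
  also have "\<dots> = (\<kappa> ^ Suc j) ^ i" unfolding \<kappa>_mod ..
  also have "\<dots> = \<kappa> ^ (j * i) * \<kappa> ^ i" by (simp only: power_mult[symmetric] mult_Suc add.commute[of i] power_add)
  finally show ?thesis .
qed

lemma nui_A: assumes "f \<in> CB" shows "nui i (A f) = lami i * nui i f"
proof -
  have "nui i (A f) = (\<Sum>j<p. \<kappa> ^ ((Suc j mod p) * i) * mass (Suc j mod p) (A f))"
    unfolding nui_eq by (rule sum_rotate[symmetric])
  also have "\<dots> = (\<Sum>j<p. lami i * (\<kappa> ^ (j * i) * mass j f))"
  proof (rule sum.cong)
    fix j assume "j \<in> {..<p}"
    then have "mass (Suc j mod p) (A f) = of_real l * mass j f" using mass_A[OF assms] by simp
    then show "\<kappa> ^ ((Suc j mod p) * i) * mass (Suc j mod p) (A f) = lami i * (\<kappa> ^ (j * i) * mass j f)"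
      unfolding \<kappa>_Suc_mod lami_def by simp
  qed simp
  finally show ?thesis by (simp add: nui_eq sum_distrib_left)
qed

text \<open>The coefficient \<kappa>^(-ji) of class j is moved to class j + 1, where it equals
  \<kappa>^i times the coefficient \<kappa>^(-(j+1)i) that belongs there. The discrepancy \<kappa>^i
  is the twist of the eigenvalue.\<close>

lemma A_hi: "A (hi i) = (\<lambda>\<omega>. lami i * hi i \<omega>)"
proof -
  have F: "(\<lambda>\<omega>. h \<omega> * indicator (\<Sigma> j) \<omega>) \<in> FH" for j
    using hball_chi[OF FH_hball[OF h_FH]] hball_imp_FH by blast
  have "A (hi i) = (\<lambda>\<omega>. \<Sum>j<p. A (\<lambda>\<omega>. inverse \<kappa> ^ (j * i) * (h \<omega> * indicator (\<Sigma> j) \<omega>)) \<omega>)"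
    unfolding hi_eq[abs_def] by (rule lin_sum[OF A_lin]) (rule FH_scale[OF F])
  also have "\<dots> = (\<lambda>\<omega>. \<Sum>j<p. lami i * (inverse \<kappa> ^ ((Suc j mod p) * i) * (h \<omega> * indicator (\<Sigma> (Suc j mod p)) \<omega>)))"
  proof (intro ext sum.cong refl)
    fix \<omega> j assume "j \<in> {..<p}"
    then have j: "j < p" by simp
    have 1: "A (\<lambda>\<omega>. inverse \<kappa> ^ (j * i) * (h \<omega> * indicator (\<Sigma> j) \<omega>)) \<omega>
        = inverse \<kappa> ^ (j * i) * (of_real l * h \<omega> * indicator (\<Sigma> (Suc j mod p)) \<omega>)"
      unfolding lin_scale[OF A_lin F] A_chi[OF h_CB j] h_eig ..
    have 2: "inverse \<kappa> ^ (j * i) = \<kappa> ^ i * inverse \<kappa> ^ ((Suc j mod p) * i)"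
      unfolding power_inverse \<kappa>_Suc_mod by (simp add: field_simps)
    show "A (\<lambda>\<omega>. inverse \<kappa> ^ (j * i) * (h \<omega> * indicator (\<Sigma> j) \<omega>)) \<omega>
        = lami i * (inverse \<kappa> ^ ((Suc j mod p) * i) * (h \<omega> * indicator (\<Sigma> (Suc j mod p)) \<omega>))"
      unfolding 1 unfolding 2 lami_def by (simp only: mult_ac)
  qed
  also have "\<dots> = (\<lambda>\<omega>. lami i * hi i \<omega>)"
    unfolding hi_eq sum_distrib_left[symmetric]
    using sum_rotate[of "\<lambda>j. inverse \<kappa> ^ (j * i) * (h _ * indicator (\<Sigma> j) _)"] by (simp add: sum_rotate[of "\<lambda>j. inverse \<kappa> ^ (j * i) * (h _ * indicator (\<Sigma> j) _)"])
  finally show ?thesis .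
qed

lemma mass_hi: assumes "j < p" shows "mass j (hi k) = inverse \<kappa> ^ (j * k) / of_nat p"
proof -
  have c: "(\<lambda>\<omega>. h \<omega> * indicator (\<Sigma> i) \<omega>) \<in> CB" for i by (rule CB_chi[OF h_CB])
  have e: "(\<lambda>\<omega>. hi k \<omega> * indicator (\<Sigma> j) \<omega>) = (\<lambda>\<omega>. inverse \<kappa> ^ (j * k) * (h \<omega> * indicator (\<Sigma> j) \<omega>))"
  proof
    fix \<omega>
    have "hi k \<omega> * indicator (\<Sigma> j) \<omega> = (\<Sum>i<p. inverse \<kappa> ^ (i * k) * (h \<omega> * (indicator (\<Sigma> i) \<omega> * indicator (\<Sigma> j) \<omega>)))"
      unfolding hi_eq sum_distrib_right by (simp only: mult.assoc)
    also have "\<dots> = (\<Sum>i<p. if i = j then inverse \<kappa> ^ (j * k) * (h \<omega> * indicator (\<Sigma> j) \<omega>) else 0)"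
      by (intro sum.cong refl) (use ind_mult[OF _ assms] in auto)
    finally show "hi k \<omega> * indicator (\<Sigma> j) \<omega> = inverse \<kappa> ^ (j * k) * (h \<omega> * indicator (\<Sigma> j) \<omega>)"
      using assms by simp
  qed
  have "mass j (hi k) = inverse \<kappa> ^ (j * k) * mass j h"
    unfolding mass_def e by simp
  then show ?thesis using mass_h[OF assms] by simp
qed

text \<open>Biorthogonality: the share 1/p of \<open>h\<close> on each class cancels the p of
  \<open>root_sum\<close>. This is why the \<open>Pr i\<close> are projections that annihilate each
  other.\<close>

lemma nui_hi: assumes "i < p" "k < p" shows "nui i (hi k) = (if i = k then 1 else 0)"
proof -
  have "nui i (hi k) = (\<Sum>j<p. (\<kappa> ^ (i * j) * inverse \<kappa> ^ (k * j)) / of_nat p)"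
    unfolding nui_eq by (intro sum.cong refl) (simp add: mass_hi mult.commute)
  also have "\<dots> = (\<Sum>j<p. \<kappa> ^ (i * j) * inverse \<kappa> ^ (k * j)) / of_nat p" by (rule sum_divide_distrib[symmetric])
  finally show ?thesis using root_sum[OF assms] p_pos by simp
qed

text \<open>Inversion of the discrete Fourier transform from the masses of the classes to the
  peripheral functionals; through it \<open>A_decay\<close> applies to the range of
  \<open>Q\<close>.\<close>

lemma nui_zero_imp_mass: assumes "\<And>i. i < p \<Longrightarrow> nui i f = 0" "k < p" shows "mass k f = 0"
proof -
  have "0 = (\<Sum>i<p. inverse \<kappa> ^ (k * i) * nui i f)" using assms(1) by simp
  also have "\<dots> = (\<Sum>i<p. \<Sum>j<p. (\<kappa> ^ (j * i) * inverse \<kappa> ^ (k * i)) * mass j f)"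
    unfolding nui_eq sum_distrib_left by (simp only: mult_ac)
  also have "\<dots> = (\<Sum>j<p. \<Sum>i<p. (\<kappa> ^ (j * i) * inverse \<kappa> ^ (k * i)) * mass j f)" by (rule sum.swap)
  also have "\<dots> = (\<Sum>j<p. (if j = k then of_nat p else 0) * mass j f)"
    unfolding sum_distrib_right[symmetric] by (intro sum.cong refl) (simp add: root_sum assms(2))
  also have "\<dots> = (\<Sum>j<p. if j = k then of_nat p * mass k f else 0)" by (intro sum.cong) auto
  also have "\<dots> = of_nat p * mass k f" using assms(2) by simp
  finally show ?thesis using p_pos by simp
qed

definition Pr :: "nat \<Rightarrow> ((nat \<Rightarrow> 'e) \<Rightarrow> complex) \<Rightarrow> (nat \<Rightarrow> 'e) \<Rightarrow> complex" where
  "Pr i = hi i \<otimes>\<^sub>o nui i"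

lemma Pr_eq: "Pr i f = (\<lambda>\<omega>. nui i f * hi i \<omega>)"
  by (simp add: Pr_def tensor_op_def)

lemma Pr_bound: assumes "hball M f" shows "hball (real p * NH (hi i) * M) (Pr i f)"
proof (rule hball_mono)
  show "hball (cmod (nui i f) * NH (hi i)) (Pr i f)" unfolding Pr_eq by (rule hball_scale[OF FH_hball[OF hi_FH]])
  have "cmod (nui i f) * NH (hi i) \<le> (real p * M) * NH (hi i)"
    by (rule mult_right_mono[OF nui_bound[OF assms] hball_nonneg[OF FH_hball[OF hi_FH]]])
  then show "cmod (nui i f) * NH (hi i) \<le> real p * NH (hi i) * M" by (simp only: mult_ac)
qed

lemma Pr_lin: "lin (Pr i)"
  unfolding lin_def Pr_eq by (auto simp: nui_add FH_CB nui_scale distrib_right)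

lemma Pr_FH: "f \<in> FH \<Longrightarrow> Pr i f \<in> FH"
  unfolding Pr_eq by (rule FH_scale[OF hi_FH])

text \<open>The projection complementary to the peripheral ones, onto the common kernel of the
  functionals \<open>nui i\<close>.\<close>

definition Q :: "((nat \<Rightarrow> 'e) \<Rightarrow> complex) \<Rightarrow> (nat \<Rightarrow> 'e) \<Rightarrow> complex" where
  "Q f = (\<lambda>\<omega>. f \<omega> - (\<Sum>i<p. Pr i f \<omega>))"

lemma Q_FH: "f \<in> FH \<Longrightarrow> Q f \<in> FH"
  unfolding Q_def by (intro FH_diff FH_sum Pr_FH)

lemma Q_bound: "\<exists>c\<ge>1. \<forall>M f. hball M f \<longrightarrow> hball (c * M) (Q f)"
proof -
  define c where "c = 1 + (\<Sum>i<p. real p * NH (hi i))"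
  have "0 \<le> (\<Sum>i<p. real p * NH (hi i))"
    by (intro sum_nonneg mult_nonneg_nonneg hball_nonneg[OF FH_hball[OF hi_FH]]) auto
  then have "1 \<le> c" by (simp add: c_def)
  moreover have "hball (c * M) (Q f)" if "hball M f" for M f
    using hball_diff[OF that hball_sum[of p "\<lambda>i. real p * NH (hi i) * M" "\<lambda>i. Pr i f"]] Pr_bound[OF that]
    unfolding Q_def c_def by (simp add: distrib_right sum_distrib_right)
  ultimately show ?thesis by blast
qed

lemma nui_sum:
  assumes "\<And>i. i < (n::nat) \<Longrightarrow> g i \<in> FH" shows "nui k (\<lambda>\<omega>. \<Sum>i<n. g i \<omega>) = (\<Sum>i<n. nui k (g i))"
  using assms
proof (induction n)
  case 0
  then show ?case using nui_scale[of k 0 "\<lambda>_. 0"] by simp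
next
  case (Suc n)
  have "(\<lambda>\<omega>. \<Sum>i<n. g i \<omega>) \<in> CB" "g n \<in> CB" using Suc.prems by (auto intro!: FH_CB FH_sum)
  then show ?case using Suc by (simp add: nui_add)
qed

lemma nui_Q: assumes "f \<in> FH" "k < p" shows "nui k (Q f) = 0"
proof -
  have "nui k (Q f) = nui k f - (\<Sum>i<p. nui k (Pr i f))"
    unfolding Q_def by (subst nui_diff) (simp_all add: assms(1) FH_sum Pr_FH nui_sum)
  also have "(\<Sum>i<p. nui k (Pr i f)) = (\<Sum>i<p. if i = k then nui k f else 0)"
    by (intro sum.cong refl) (use nui_hi[OF assms(2)] in \<open>auto simp: Pr_eq nui_scale\<close>)
  finally show ?thesis using assms(2) by simp
qed

lemma Q_ker: assumes "\<And>i. i < p \<Longrightarrow> nui i f = 0" shows "Q f = f"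
  unfolding Q_def Pr_eq using assms by simp

lemma A_FH: assumes "f \<in> FH" shows "A f \<in> FH"
  using A_pow[OF FH_hball[OF assms], of 1] hball_imp_FH by simp

lemma Apow_FH: assumes "f \<in> FH" shows "(A ^^ n) f \<in> FH"
  using A_pow[OF FH_hball[OF assms]] hball_imp_FH by blast

definition R :: "((nat \<Rightarrow> 'e) \<Rightarrow> complex) \<Rightarrow> (nat \<Rightarrow> 'e) \<Rightarrow> complex" where
  "R f = (\<lambda>\<omega>. A f \<omega> - (\<Sum>i<p. lami i * Pr i f \<omega>))"

lemma R_eq: assumes "f \<in> FH" shows "R f = A (Q f)"
proof -
  have "A (Pr i f) = (\<lambda>\<omega>. lami i * Pr i f \<omega>)" for i
    unfolding Pr_eq lin_scale[OF A_lin hi_FH] A_hi by (simp add: mult_ac)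
  then have "A (Q f) = (\<lambda>\<omega>. A f \<omega> - (\<Sum>i<p. lami i * Pr i f \<omega>))"
    unfolding Q_def by (subst lin_diff[OF A_lin assms]) (simp_all add: FH_sum Pr_FH assms lin_sum[OF A_lin])
  then show ?thesis by (simp add: R_def)
qed

lemma nui_Apow_Q: assumes "f \<in> FH" "i < p" shows "nui i ((A ^^ n) (Q f)) = 0"
proof (induction n)
  case (Suc n)
  then show ?case using nui_A[OF FH_CB[OF Apow_FH[OF Q_FH[OF assms(1)], of n]]] by simp
qed (use nui_Q assms in simp)

text \<open>\<open>R\<close> is \<open>A\<close> after \<open>Q\<close>, and \<open>A\<close>
  preserves the range of \<open>Q\<close>, on which \<open>Q\<close> is the identity; so
  \<open>Q\<close> acts only once in a power of \<open>R\<close>.\<close>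

lemma R_pow: assumes "f \<in> FH" shows "(R ^^ Suc n) f = (A ^^ Suc n) (Q f)"
proof (induction n)
  case 0
  then show ?case using R_eq[OF assms] by simp
next
  case (Suc n)
  have F: "(A ^^ Suc n) (Q f) \<in> FH" by (rule Apow_FH[OF Q_FH[OF assms]])
  have "(R ^^ Suc (Suc n)) f = R ((A ^^ Suc n) (Q f))" using Suc by simp
  also have "\<dots> = A (Q ((A ^^ Suc n) (Q f)))" by (rule R_eq[OF F])
  also have "Q ((A ^^ Suc n) (Q f)) = (A ^^ Suc n) (Q f)" by (rule Q_ker[OF nui_Apow_Q[OF assms]])
  finally show ?case by simp
qed

lemma R_lin: "lin R"
proof -
  have "lin A" "\<And>i. lin (Pr i)" using A_lin Pr_lin by auto
  then show ?thesis unfolding lin_def R_def by (auto simp: distrib_left sum.distrib sum_distrib_left right_diff_distrib mult_ac)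
qed

lemma R_power_bound: "\<exists>c. 0 \<le> c \<and> (\<forall>n M f. hball M f \<longrightarrow> hball (c * (l * \<rho>) ^ n * M) ((R ^^ n) f))"
proof -
  obtain q where q: "q \<ge> 1" "\<And>M f. hball M f \<Longrightarrow> hball (q * M) (Q f)" using Q_bound by blast
  \<comment> \<open>The added 1 covers the power 0, where \<open>R ^^ 0\<close> is the identity and
    not \<open>Q\<close>.\<close>
  define c where "c = K * q + 1"
  have c: "0 \<le> c" "1 \<le> c" "K * q \<le> c" using K q by (auto simp: c_def)
  have "hball (c * (l * \<rho>) ^ n * M) ((R ^^ n) f)" if f: "hball M f" for n M f
  proof (cases n)
    case 0
    have "1 * M \<le> c * M" using c hball_nonneg[OF f] by (intro mult_right_mono) auto
    then show ?thesis using 0 hball_mono[OF f] by simp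
  next
    case (Suc m)
    have F: "f \<in> FH" by (rule hball_imp_FH[OF f])
    have "hball (K * (l * \<rho>) ^ n * (q * M)) ((A ^^ n) (Q f))"
    proof (rule A_decay[OF q(2)[OF f]])
      fix j assume j: "j < p"
      show "(LINT \<omega>:\<Sigma> j|\<nu>. Q f \<omega>) = 0" unfolding mass_eq by (rule nui_zero_imp_mass[OF nui_Q[OF F] j])
    qed
    moreover have "K * (l * \<rho>) ^ n * (q * M) \<le> c * (l * \<rho>) ^ n * M"
    proof -
      have "(K * q) * ((l * \<rho>) ^ n * M) \<le> c * ((l * \<rho>) ^ n * M)"
        using c l_pos \<rho> hball_nonneg[OF f] by (intro mult_right_mono) auto
      then show ?thesis by (simp only: mult_ac)
    qed
    ultimately show ?thesis using R_pow[OF F, of m] Suc hball_mono by simp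
  qed
  then show ?thesis using c by blast
qed

definition c_R :: real where
  "c_R = (SOME c. 0 \<le> c \<and> (\<forall>n M f. hball M f \<longrightarrow> hball (c * (l * \<rho>) ^ n * M) ((R ^^ n) f)))"

lemma c_R: "0 \<le> c_R" "hball M f \<Longrightarrow> hball (c_R * (l * \<rho>) ^ n * M) ((R ^^ n) f)"
proof -
  have "0 \<le> c_R \<and> (\<forall>n M f. hball M f \<longrightarrow> hball (c_R * (l * \<rho>) ^ n * M) ((R ^^ n) f))"
    unfolding c_R_def by (rule someI_ex) (rule R_power_bound)
  then show "0 \<le> c_R" "hball M f \<Longrightarrow> hball (c_R * (l * \<rho>) ^ n * M) ((R ^^ n) f)" by simp_all
qed

lemma A_bounded: "bounded_operator FH NH A"
  using A_pow[of _ _ 1] by (intro bounded_operatorI[OF A_lin, of "K * l"]) simp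

lemma R_bounded: "bounded_operator FH NH R"
  using c_R(2)[of _ _ 1] by (intro bounded_operatorI[OF R_lin, of "c_R * (l * \<rho>)"]) simp

lemma Pr_bounded: "bounded_operator FH NH (Pr i)"
  by (rule bounded_operatorI[OF Pr_lin Pr_bound])

lemma Pr_Pr: assumes "i < p" "k < p" shows "Pr i (Pr k f) = (if i = k then Pr k f else (\<lambda>_. 0))"
  unfolding Pr_eq nui_scale using nui_hi[OF assms] by auto

lemma hi_nonzero: assumes "i < p" shows "hi i \<noteq> (\<lambda>_. 0)"
proof
  assume "hi i = (\<lambda>_. 0)"
  then have "nui i (hi i) = 0" using nui_scale[of i 0 "\<lambda>_. 0"] by simp
  then show False using nui_hi[OF assms assms] by simp
qed

lemma hi_eigen: "i < p \<Longrightarrow> eigenfunction FH A (lami i) (hi i)"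
  unfolding eigenfunction_def using hi_FH hi_nonzero A_hi by auto

lemma R_hi: assumes "k < p" shows "R (hi k) = (\<lambda>_. 0)"
proof -
  have "(\<lambda>\<omega>. \<Sum>i<p. Pr i (hi k) \<omega>) = hi k"
  proof
    fix \<omega>
    have "(\<Sum>i<p. Pr i (hi k) \<omega>) = (\<Sum>i<p. if i = k then hi k \<omega> else 0)"
      by (intro sum.cong refl) (use nui_hi[OF _ assms] in \<open>auto simp: Pr_eq\<close>)
    then show "(\<Sum>i<p. Pr i (hi k) \<omega>) = hi k \<omega>" using assms by simp
  qed
  from fun_cong[OF this] have "Q (hi k) = (\<lambda>_. 0)" unfolding Q_def by simp
  then show ?thesis using R_eq[OF hi_FH] lin_zero[OF A_lin] by simp
qed

lemma R_Pr: assumes "f \<in> FH" "i < p" shows "R (Pr i f) = (\<lambda>_. 0)"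
  unfolding Pr_eq lin_scale[OF R_lin hi_FH] R_hi[OF assms(2)] by simp

lemma Pr_R: assumes "f \<in> FH" "i < p" shows "Pr i (R f) = (\<lambda>_. 0)"
  unfolding Pr_eq R_eq[OF assms(1)] nui_A[OF FH_CB[OF Q_FH[OF assms(1)]]] nui_Q[OF assms] by simp

section \<open>Spectral radii and simplicity of the peripheral eigenvalues\<close>

lemma spectral_radius_A: "operator_spectral_radius FH NH A = l"
proof -
  have "l \<in> cmod ` operator_spectrum FH NH A"
    using eigenvalue_in_spectrum[OF hi_eigen[OF p_pos]] l_pos by (intro image_eqI[of _ _ "lami 0"]) (auto simp: lami_def)
  moreover have "cmod z \<le> l" if "z \<in> operator_spectrum FH NH A" for z
    using resolvent_set[OF A_lin K less_imp_le[OF l_pos] A_pow] that by force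
  ultimately show ?thesis unfolding operator_spectral_radius_def by (intro cSup_eq_maximum) auto
qed

lemma spectral_radius_R: "operator_spectral_radius FH NH R < l"
proof -
  \<comment> \<open>\<open>R\<close> annihilates \<open>hi 0\<close>, so 0 lies in its spectrum and
    the supremum is taken over a nonempty set.\<close>
  have "eigenfunction FH R 0 (hi 0)" unfolding eigenfunction_def using hi_FH hi_nonzero[OF p_pos] R_hi[OF p_pos] by simp
  then have ne: "operator_spectrum FH NH R \<noteq> {}" using eigenvalue_in_spectrum by blast
  have "cmod z \<le> l * \<rho>" if "z \<in> operator_spectrum FH NH R" for z
    using resolvent_set[OF R_lin c_R(1) _ c_R(2)] l_pos \<rho> that by force
  then have "operator_spectral_radius FH NH R \<le> l * \<rho>"
    unfolding operator_spectral_radius_def using ne by (intro cSup_least) auto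
  also have "\<dots> < l" using l_pos \<rho> by simp
  finally show ?thesis .
qed

lemma R_no_eigenvector:
  assumes "f \<in> FH" "R f = (\<lambda>x. z * f x)" "cmod z = l" shows "f = (\<lambda>_. 0)"
proof (rule ccontr)
  assume "f \<noteq> (\<lambda>_. 0)"
  then have "eigenfunction FH R z f" using assms by (simp add: eigenfunction_def)
  then have "z \<in> operator_spectrum FH NH R" by (rule eigenvalue_in_spectrum)
  then have "cmod z \<le> l * \<rho>" using resolvent_set[OF R_lin c_R(1) _ c_R(2)] l_pos \<rho> by force
  moreover have "l * \<rho> < l" using l_pos \<rho> by simp
  ultimately show False using assms(3) by simp
qed

text \<open>\<open>nui i\<close> vanishes on the range of A - lami i, and A - lami i is injective on
  the kernel of \<open>nui i\<close>. Once its component along \<open>hi i\<close> is removed, a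
  generalised eigenfunction is therefore forced to 0 one power at a time: there is no Jordan
  block.\<close>

lemma simple: assumes i: "i < p" shows "simple_eigenvalue FH A (lami i)"
  unfolding simple_eigenvalue_def
proof (intro exI conjI)
  show "eigenfunction FH A (lami i) (hi i)" by (rule hi_eigen[OF i])
  let ?D = "\<lambda>f x. A f x - lami i * f x"
  have DF: "?D f \<in> FH" if "f \<in> FH" for f by (intro FH_diff FH_scale A_FH that)
  have DpF: "(?D ^^ n) f \<in> FH" if "f \<in> FH" for f n using that DF by (induction n) auto
  have nuD: "nui i (?D f) = 0" if "f \<in> FH" for f
    using nui_diff[OF A_FH[OF that] FH_scale[OF that, of "lami i"], of i] nui_A[OF FH_CB[OF that], of i] nui_scale[of i "lami i" f] by simp
  have Dzero: "?D (\<lambda>_. 0) = (\<lambda>_. 0)" using lin_zero[OF A_lin] by simp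
  have Dhi: "?D (\<lambda>\<omega>. a * hi i \<omega>) = (\<lambda>_. 0)" for a
    unfolding lin_scale[OF A_lin hi_FH] A_hi by simp
  \<comment> \<open>The other functionals vanish on such an \<open>f\<close> because the eigenvalues
    differ. So \<open>f\<close> lies in the range of \<open>Q\<close> and would be an eigenfunction
    of \<open>R\<close> for an eigenvalue of modulus \<open>l\<close>, outside the spectrum of
    \<open>R\<close>.\<close>
  have inj: "f = (\<lambda>_. 0)" if f: "f \<in> FH" "nui i f = 0" "?D f = (\<lambda>_. 0)" for f
  proof -
    have Af: "A f = (\<lambda>x. lami i * f x)" using f(3) by (auto simp: fun_eq_iff)
    have "nui k f = 0" if k: "k < p" for k
    proof (cases "k = i")
      case False
      have "lami k * nui k f = lami i * nui k f"
        using nui_A[OF FH_CB[OF f(1)], of k] unfolding Af nui_scale by (rule sym)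
      moreover have "lami k \<noteq> lami i" using \<kappa>_inj[OF k i] False l_pos by (auto simp: lami_def)
      ultimately show ?thesis by simp
    qed (use f in simp)
    then have "Q f = f" by (rule Q_ker)
    then have "R f = (\<lambda>x. lami i * f x)" using R_eq[OF f(1)] Af by simp
    then show ?thesis by (rule R_no_eigenvector[OF f(1)]) (use l_pos in \<open>simp add: lami_def norm_mult norm_power\<close>)
  qed
  show "{f \<in> FH. \<exists>n. (?D ^^ n) f = (\<lambda>_. 0)} = range (\<lambda>a x. a * hi i x)"
  proof
    show "range (\<lambda>a x. a * hi i x) \<subseteq> {f \<in> FH. \<exists>n. (?D ^^ n) f = (\<lambda>_. 0)}"
    proof
      fix f assume "f \<in> range (\<lambda>a x. a * hi i x)"
      then obtain a where a: "f = (\<lambda>x. a * hi i x)" by blast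
      have "(?D ^^ 1) f = (\<lambda>_. 0)" using Dhi[of a] unfolding a by simp
      then show "f \<in> {f \<in> FH. \<exists>n. (?D ^^ n) f = (\<lambda>_. 0)}" using a FH_scale[OF hi_FH] by blast
    qed
    show "{f \<in> FH. \<exists>n. (?D ^^ n) f = (\<lambda>_. 0)} \<subseteq> range (\<lambda>a x. a * hi i x)"
    proof
      fix f assume "f \<in> {f \<in> FH. \<exists>n. (?D ^^ n) f = (\<lambda>_. 0)}"
      then obtain n where f: "f \<in> FH" and n: "(?D ^^ n) f = (\<lambda>_. 0)" by blast
      define g where "g = (\<lambda>x. f x - nui i f * hi i x)"
      have gF: "g \<in> FH" unfolding g_def by (intro FH_diff f FH_scale hi_FH)
      have ng: "nui i g = 0"
        unfolding g_def using nui_diff[OF f FH_scale[OF hi_FH]] nui_scale[of i "nui i f" "hi i"] nui_hi[OF i i] by simp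
      have Dg: "?D g = ?D f"
      proof
        fix x
        have "A g x = A f x - lami i * (nui i f * hi i x)"
          unfolding g_def lin_diff[OF A_lin f FH_scale[OF hi_FH]] lin_scale[OF A_lin hi_FH] A_hi by simp
        then show "?D g x = ?D f x" by (simp add: g_def algebra_simps)
      qed
      have Dn: "(?D ^^ Suc n) g = (\<lambda>_. 0)"
      proof -
        have "(?D ^^ Suc n) g = (?D ^^ n) (?D g)" by (simp only: funpow_Suc_right comp_apply)
        also have "\<dots> = (?D ^^ Suc n) f" unfolding Dg by (simp only: funpow_Suc_right comp_apply)
        also have "\<dots> = ?D (\<lambda>_. 0)" using n by simp
        finally show ?thesis using Dzero by simp
      qed
      have nz: "nui i ((?D ^^ m) g) = 0" for m
        by (cases m) (use ng nuD[OF DpF[OF gF]] in auto)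
      have "(?D ^^ (Suc n - m)) g = (\<lambda>_. 0)" if "m \<le> Suc n" for m
        using that
      proof (induction m)
        case (Suc m)
        then have "?D ((?D ^^ (Suc n - Suc m)) g) = (\<lambda>_. 0)" by (simp add: Suc_diff_le)
        then show ?case by (rule inj[OF DpF[OF gF] nz])
      qed (use Dn in simp)
      from this[of "Suc n"] have "g = (\<lambda>_. 0)" by simp
      then have "f = (\<lambda>x. nui i f * hi i x)" by (auto simp: g_def fun_eq_iff)
      then show "f \<in> range (\<lambda>a x. a * hi i x)" by blast
    qed
  qed
qed

lemma dual: "i < p \<Longrightarrow> dual_eigenvector CB A (lami i) (nui i)"
  unfolding dual_eigenvector_def
  by (intro conjI bexI[of _ "hi i"] ballI nui_A FH_CB[OF hi_FH[of i]]) (simp add: nui_hi)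

theorem spectral_decomposition:
  "(\<forall>i<p. simple_eigenvalue FH A (lami i) \<and> eigenfunction FH A (lami i) (hi i) \<and>
      dual_eigenvector CB A (lami i) (nui i) \<and> is_projection FH NH (Pr i)) \<and>
   (\<forall>i<p. \<forall>k<p. i \<noteq> k \<longrightarrow> (\<forall>f\<in>FH. Pr i (Pr k f) = (\<lambda>_. 0))) \<and>
   (\<exists>R. bounded_operator FH NH R \<and>
      (\<forall>f\<in>FH. A f = (\<lambda>\<omega>. (\<Sum>i<p. lami i * Pr i f \<omega>) + R f \<omega>)) \<and>
      (\<forall>i<p. \<forall>f\<in>FH. Pr i (R f) = (\<lambda>_. 0) \<and> R (Pr i f) = (\<lambda>_. 0)) \<and>
      operator_spectral_radius FH NH R < l)"
proof (intro conjI exI[of _ R])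
  show "\<forall>f\<in>FH. A f = (\<lambda>\<omega>. (\<Sum>i<p. lami i * Pr i f \<omega>) + R f \<omega>)" by (simp add: R_def)
qed (use simple hi_eigen dual Pr_bounded Pr_Pr R_bounded Pr_R R_Pr spectral_radius_R in \<open>auto simp: is_projection_def\<close>)

lemma spectral_decomposition_explicit:
  defines "\<kappa>' \<equiv> exp (2 * of_real pi * \<i> / of_nat p)"
  defines "lami' \<equiv> \<lambda>i. of_real l * \<kappa>' ^ i"
  shows
    "let \<Sigma> = (\<lambda>j. edge_union G (Es j));
         hi = rotated_eigenfunction p \<kappa>' \<Sigma> h;
         nui = rotated_measure p \<kappa>' \<Sigma> \<nu>;
         Pr = (\<lambda>i. hi i \<otimes>\<^sub>o nui i)
     in (\<forall>i<p. simple_eigenvalue FH A (lami' i) \<and>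
                eigenfunction FH A (lami' i) (hi i) \<and>
                dual_eigenvector CB A (lami' i) (nui i) \<and>
                is_projection FH NH (Pr i)) \<and>
        (\<forall>i<p. \<forall>k<p. i \<noteq> k \<longrightarrow> (\<forall>f\<in>FH. Pr i (Pr k f) = (\<lambda>_. 0))) \<and>
        (\<exists>R. bounded_operator FH NH R \<and>
             (\<forall>f\<in>FH. A f = (\<lambda>\<omega>. (\<Sum>i<p. lami' i * Pr i f \<omega>) + R f \<omega>)) \<and>
             (\<forall>i<p. \<forall>f\<in>FH. Pr i (R f) = (\<lambda>_. 0) \<and> R (Pr i f) = (\<lambda>_. 0)) \<and>
             operator_spectral_radius FH NH R < l)"
  using spectral_decomposition
  unfolding Let_def \<kappa>'_def lami'_def Pr_def hi_def nui_def lami_def \<kappa>_def .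

end

section \<open>Complex functions\<close>

context potential
begin

abbreviation A :: "((nat \<Rightarrow> 'e) \<Rightarrow> complex) \<Rightarrow> (nat \<Rightarrow> 'e) \<Rightarrow> complex" where "A \<equiv> ruelle_operator G \<psi>"

lemma Re_bounded: "bounded_by G f M \<Longrightarrow> bounded_by G (\<lambda>\<omega>. Re (f \<omega>)) M"
  and Im_bounded: "bounded_by G f M \<Longrightarrow> bounded_by G (\<lambda>\<omega>. Im (f \<omega>)) M"
  by (auto simp: bounded_by_def intro: order_trans[OF abs_Re_le_cmod] order_trans[OF abs_Im_le_cmod])

lemma A_eq:
  assumes f: "bounded_by G f M" and \<omega>: "\<omega> \<in> X"
  shows "A f \<omega> = Complex (L (\<lambda>\<omega>. Re (f \<omega>)) \<omega>) (L (\<lambda>\<omega>. Im (f \<omega>)) \<omega>)"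
proof -
  let ?e = "\<lambda>e. exp (\<psi> (prepend e \<omega>))"
  have 1: "((\<lambda>e. complex_of_real (?e e * Re (f (prepend e \<omega>)))) has_sum of_real (L (\<lambda>\<omega>. Re (f \<omega>)) \<omega>)) (preds G \<omega>)"
    by (rule has_sum_of_real[OF L_has_sum[OF \<omega> Re_bounded[OF f]]])
  have 2: "((\<lambda>e. complex_of_real (?e e * Im (f (prepend e \<omega>)))) has_sum of_real (L (\<lambda>\<omega>. Im (f \<omega>)) \<omega>)) (preds G \<omega>)"
    by (rule has_sum_of_real[OF L_has_sum[OF \<omega> Im_bounded[OF f]]])
  have eq: "of_real (?e e) * f (prepend e \<omega>)
      = complex_of_real (?e e * Re (f (prepend e \<omega>))) + \<i> * complex_of_real (?e e * Im (f (prepend e \<omega>)))" for e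
    by (simp add: complex_eq_iff)
  have "((\<lambda>e. of_real (?e e) * f (prepend e \<omega>)) has_sum
      (of_real (L (\<lambda>\<omega>. Re (f \<omega>)) \<omega>) + \<i> * of_real (L (\<lambda>\<omega>. Im (f \<omega>)) \<omega>))) (preds G \<omega>)"
    unfolding eq by (intro has_sum_add 1 has_sum_cmult_right 2)
  then have "A f \<omega> = of_real (L (\<lambda>\<omega>. Re (f \<omega>)) \<omega>) + \<i> * of_real (L (\<lambda>\<omega>. Im (f \<omega>)) \<omega>)"
    unfolding ruelle_operator_def preds_def[symmetric] using \<omega> by (simp add: infsumI)
  then show ?thesis by (simp add: complex_eq_iff)
qed

lemma A_outside: "\<omega> \<notin> X \<Longrightarrow> A f \<omega> = 0"
  by (simp add: ruelle_operator_def)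

lemma A_bounded_by: assumes f: "bounded_by G f M" shows "bounded_by G (A f) (2 * (M * SB))"
  unfolding bounded_by_def
proof
  fix \<omega> assume \<omega>: "\<omega> \<in> X"
  have "\<bar>L (\<lambda>\<omega>. Re (f \<omega>)) \<omega>\<bar> \<le> M * SB" "\<bar>L (\<lambda>\<omega>. Im (f \<omega>)) \<omega>\<bar> \<le> M * SB"
    using bounded_by_absD[OF L_bound[OF Re_bounded[OF f]] \<omega>] bounded_by_absD[OF L_bound[OF Im_bounded[OF f]] \<omega>] .
  then show "cmod (A f \<omega>) \<le> 2 * (M * SB)" using cmod_le[of "A f \<omega>"] unfolding A_eq[OF f \<omega>] by simp
qed

lemma A_add:
  assumes "bounded_by G f M" "bounded_by G g M'" shows "A (\<lambda>\<omega>. f \<omega> + g \<omega>) = (\<lambda>\<omega>. A f \<omega> + A g \<omega>)"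
proof
  fix \<omega>
  have s: "bounded_by G (\<lambda>\<omega>. f \<omega> + g \<omega>) (M + M')"
    using assms unfolding bounded_by_def by (auto intro: norm_triangle_mono)
  show "A (\<lambda>\<omega>. f \<omega> + g \<omega>) \<omega> = A f \<omega> + A g \<omega>"
  proof (cases "\<omega> \<in> X")
    case True
    show ?thesis
      unfolding A_eq[OF s True] A_eq[OF assms(1) True] A_eq[OF assms(2) True]
      using L_add[OF Re_bounded[OF assms(1)] Re_bounded[OF assms(2)]] L_add[OF Im_bounded[OF assms(1)] Im_bounded[OF assms(2)]]
      by (simp add: complex_eq_iff)
  qed (simp add: A_outside)
qed

lemma A_scale: "A (\<lambda>\<omega>. a * f \<omega>) = (\<lambda>\<omega>. a * A f \<omega>)"
proof
  fix \<omega>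
  show "A (\<lambda>\<omega>. a * f \<omega>) \<omega> = a * A f \<omega>"
    unfolding ruelle_operator_def by (simp add: infsum_cmult_right'[symmetric] mult.left_commute)
qed

lemma A_lin: "lin A"
  unfolding lin_def
proof (intro conjI ballI allI)
  fix f g assume "f \<in> FH" "g \<in> FH"
  then have "bounded_by G f (NH f)" "bounded_by G g (NH g)" using FH_hball by (auto simp: hball_def)
  then show "A (\<lambda>x. f x + g x) = (\<lambda>x. A f x + A g x)" by (rule A_add)
qed (rule A_scale)

lemma A_pow_eq:
  assumes f: "bounded_by G f M" and \<omega>: "\<omega> \<in> X"
  shows "(A ^^ n) f \<omega> = Complex ((L ^^ n) (\<lambda>\<omega>. Re (f \<omega>)) \<omega>) ((L ^^ n) (\<lambda>\<omega>. Im (f \<omega>)) \<omega>)"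
proof -
  have b: "\<exists>M. bounded_by G ((A ^^ n) f) M" for n
    by (induction n) (use f A_bounded_by in auto)
  show ?thesis using \<omega>
  proof (induction n arbitrary: \<omega>)
    case (Suc n)
    obtain M' where M': "bounded_by G ((A ^^ n) f) M'" using b by blast
    have "L (\<lambda>\<omega>. Re ((A ^^ n) f \<omega>)) = L ((L ^^ n) (\<lambda>\<omega>. Re (f \<omega>)))"
      "L (\<lambda>\<omega>. Im ((A ^^ n) f \<omega>)) = L ((L ^^ n) (\<lambda>\<omega>. Im (f \<omega>)))"
      by (rule L_cong, simp add: Suc.IH)+
    then show ?case using A_eq[OF M' Suc.prems] by simp
  qed (simp add: complex_eq_iff)
qed

text \<open>The factor 2 comes from |a + ib| <= |a| + |b|.\<close>

lemma hball_Complex: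
  assumes "bounded_by G a M" "bounded_by G b M" "lipschitz_by G \<theta> a M" "lipschitz_by G \<theta> b M"
    and g: "\<And>\<omega>. \<omega> \<in> X \<Longrightarrow> g \<omega> = Complex (a \<omega>) (b \<omega>)" "\<And>\<omega>. \<omega> \<notin> X \<Longrightarrow> g \<omega> = 0"
  shows "hball (2 * M) g"
proof -
  have "lipschitz_by G \<theta> g (2 * M)"
  proof (rule lipschitz_byI)
    fix \<omega> \<upsilon> n assume *: "\<omega> \<in> X" "\<upsilon> \<in> X" "1 \<le> n" "agree n \<omega> \<upsilon>"
    have "\<bar>a \<omega> - a \<upsilon>\<bar> \<le> M * \<theta> ^ n" "\<bar>b \<omega> - b \<upsilon>\<bar> \<le> M * \<theta> ^ n"
      using lipschitz_byD[OF assms(3) *] lipschitz_byD[OF assms(4) *] by simp_all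
    then show "norm (g \<omega> - g \<upsilon>) \<le> 2 * M * \<theta> ^ n"
      using cmod_le[of "g \<omega> - g \<upsilon>"] unfolding g(1)[OF *(1)] g(1)[OF *(2)] by simp
  qed
  moreover have "bounded_by G g (2 * M)" unfolding bounded_by_def
  proof
    fix \<omega> assume \<omega>: "\<omega> \<in> X"
    show "norm (g \<omega>) \<le> 2 * M"
      using cmod_le[of "g \<omega>"] bounded_by_absD[OF assms(1) \<omega>] bounded_by_absD[OF assms(2) \<omega>] unfolding g(1)[OF \<omega>] by simp
  qed
  ultimately show ?thesis using g(2) by (simp add: hball_def)
qed

lemma A_pow_outside: "(\<And>\<omega>. \<omega> \<notin> X \<Longrightarrow> f \<omega> = 0) \<Longrightarrow> \<omega> \<notin> X \<Longrightarrow> (A ^^ n) f \<omega> = 0"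
  by (cases n) (simp_all add: A_outside)

lemma CB_Re_Im:
  assumes "f \<in> CB"
  shows CB_Re: "continuous_map (shift_topology G \<theta>) euclidean (\<lambda>\<omega>. Re (f \<omega>))"
    and CB_Im: "continuous_map (shift_topology G \<theta>) euclidean (\<lambda>\<omega>. Im (f \<omega>))"
proof -
  have f: "continuous_map (shift_topology G \<theta>) euclidean f" using assms by (simp add: bounded_continuous_def)
  have "continuous_map euclidean euclidean Re" "continuous_map euclidean euclidean Im"
    by (simp_all add: continuous_on_Re continuous_on_Im)
  from continuous_map_compose[OF f this(1)] continuous_map_compose[OF f this(2)]
  show "continuous_map (shift_topology G \<theta>) euclidean (\<lambda>\<omega>. Re (f \<omega>))"
    "continuous_map (shift_topology G \<theta>) euclidean (\<lambda>\<omega>. Im (f \<omega>))"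
    by (simp_all add: comp_def)
qed

lemma eigenmeasure_complex:
  assumes \<nu>: "eigenmeasure \<nu> l" and f: "f \<in> CB"
  shows "integral\<^sup>L \<nu> (A f) = of_real l * integral\<^sup>L \<nu> f"
proof -
  obtain M where M: "bounded_by G f M" using bdd_CB[OF f] by blast
  let ?r = "\<lambda>\<omega>. Re (f \<omega>)" and ?i = "\<lambda>\<omega>. Im (f \<omega>)"
  note b = Re_bounded[OF M] Im_bounded[OF M]
  note c = CB_Re[OF f] CB_Im[OF f]
  have int: "integrable \<nu> ?r" "integrable \<nu> ?i"
    using eigenmeasure_integrable[OF \<nu> continuous_measurable[OF c(1)] b(1)]
      eigenmeasure_integrable[OF \<nu> continuous_measurable[OF c(2)] b(2)] .
  have intL: "integrable \<nu> (L ?r)" "integrable \<nu> (L ?i)"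
    using eigenmeasure_integrable[OF \<nu> eigenmeasure_continuous(2)[OF \<nu> b(1) c(1)] L_bound[OF b(1)]]
      eigenmeasure_integrable[OF \<nu> eigenmeasure_continuous(2)[OF \<nu> b(2) c(2)] L_bound[OF b(2)]] .
  have combine: "integral\<^sup>L \<nu> (\<lambda>\<omega>. complex_of_real (u \<omega>) + \<i> * complex_of_real (v \<omega>))
      = of_real (integral\<^sup>L \<nu> u) + \<i> * of_real (integral\<^sup>L \<nu> v)" if "integrable \<nu> u" "integrable \<nu> v" for u v
    using that by simp
  have "integral\<^sup>L \<nu> (A f) = integral\<^sup>L \<nu> (\<lambda>\<omega>. complex_of_real (L ?r \<omega>) + \<i> * complex_of_real (L ?i \<omega>))"
    by (rule Bochner_Integration.integral_cong) (simp_all add: space_eigenmeasure[OF \<nu>] A_eq[OF M] complex_eq_iff)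
  also have "\<dots> = of_real (l * integral\<^sup>L \<nu> ?r) + \<i> * of_real (l * integral\<^sup>L \<nu> ?i)"
    unfolding combine[OF intL] eigenmeasure_continuous(1)[OF \<nu> b(1) c(1)] eigenmeasure_continuous(1)[OF \<nu> b(2) c(2)] ..
  also have "\<dots> = of_real l * (of_real (integral\<^sup>L \<nu> ?r) + \<i> * of_real (integral\<^sup>L \<nu> ?i))"
    by (simp add: algebra_simps)
  also have "of_real (integral\<^sup>L \<nu> ?r) + \<i> * of_real (integral\<^sup>L \<nu> ?i) = integral\<^sup>L \<nu> f"
    unfolding combine[OF int, symmetric] by (rule Bochner_Integration.integral_cong) (simp_all add: complex_eq_iff)
  finally show ?thesis .
qed

lemma potential_normalized: "potential G \<theta> (\<lambda>\<omega>. \<psi> \<omega> - ln lam) (\<lambda>e. B e / lam) K"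
proof
  show "(\<lambda>e. B e / lam) summable_on arcs G"
    using summable_on_cmult_left[OF B_summable, of "1 / lam"] by simp
  show "exp (\<psi> \<omega> - ln lam) \<le> B (\<omega> 0) / lam" if "\<omega> \<in> X" for \<omega>
    using \<psi>_bound[OF that] lam_pos by (simp add: exp_diff divide_right_mono)
qed (use K_nonneg \<psi>_lip in auto)

end

section \<open>Normalisation by the leading eigenvalue and passage to complex functions\<close>

context potential
begin

lemma normalized_L:
  shows "potential.L G (\<lambda>\<omega>. \<psi> \<omega> - ln lam) f = (\<lambda>\<omega>. L f \<omega> / lam)"
proof
  interpret N: potential G \<theta> "\<lambda>\<omega>. \<psi> \<omega> - ln lam" "\<lambda>e. B e / lam" K by (rule potential_normalized)
  fix \<omega>
  have e: "exp (\<psi> \<upsilon> - ln lam) * x = (1 / lam) * (exp (\<psi> \<upsilon>) * x)" for \<upsilon> x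
    using lam_pos by (simp add: exp_diff)
  have "N.L f \<omega> = (1 / lam) * L f \<omega>"
    unfolding N.L_def L_def e infsum_cmult_right' by simp
  then show "N.L f \<omega> = L f \<omega> / lam" by simp
qed

lemma normalized_Lpow: "(L ^^ n) f \<omega> = lam ^ n * ((potential.L G (\<lambda>\<omega>. \<psi> \<omega> - ln lam)) ^^ n) f \<omega>"
proof (induction n arbitrary: \<omega>)
  case (Suc n)
  have "(L ^^ n) f = (\<lambda>\<omega>. lam ^ n * (potential.L G (\<lambda>\<omega>. \<psi> \<omega> - ln lam) ^^ n) f \<omega>)"
    by (rule ext) (rule Suc.IH)
  then have "(L ^^ Suc n) f \<omega> = lam ^ n * L ((potential.L G (\<lambda>\<omega>. \<psi> \<omega> - ln lam) ^^ n) f) \<omega>"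
    by (simp add: L_scale)
  also have "\<dots> = lam ^ Suc n * (potential.L G (\<lambda>\<omega>. \<psi> \<omega> - ln lam) ^^ Suc n) f \<omega>"
    using lam_pos by (simp add: normalized_L[of "(potential.L G (\<lambda>\<omega>. \<psi> \<omega> - ln lam) ^^ n) f"])
  finally show ?case .
qed simp

lemma normalized_potential:
  assumes h: "cone h" "bounded_by G h 1" "\<And>\<omega>. \<omega> \<in> X \<Longrightarrow> L h \<omega> = lam * h \<omega>" "\<And>\<omega>. \<omega> \<in> X \<Longrightarrow> 0 < h \<omega>"
    and \<nu>: "eigenmeasure \<nu> lam"
  shows "normalized_potential G \<theta> (\<lambda>\<omega>. \<psi> \<omega> - ln lam) (\<lambda>e. B e / lam) K h \<nu>"
proof -
  interpret N: potential G \<theta> "\<lambda>\<omega>. \<psi> \<omega> - ln lam" "\<lambda>e. B e / lam" K by (rule potential_normalized)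
  show ?thesis
  proof
    show "N.cone h" using h(1) unfolding N.cone_def cone_def .
    show "N.L h \<omega> = h \<omega>" if "\<omega> \<in> X" for \<omega>
      using h(3)[OF that] lam_pos by (simp add: normalized_L)
    show "N.eigenmeasure \<nu> 1"
      using \<nu> lam_pos unfolding N.eigenmeasure_def eigenmeasure_def normalized_L by simp
  qed (use h in auto)
qed

lemma eigenfunction_integral_pos:
  assumes h: "cone h" "bounded_by G h 1" "\<And>\<omega>. \<omega> \<in> X \<Longrightarrow> 0 < h \<omega>" and \<nu>: "eigenmeasure \<nu> lam"
  shows "0 < integral\<^sup>L \<nu> h"
proof -
  note lip = cone_lipschitz[OF h(1,2)]
  obtain \<omega> where \<omega>: "\<omega> \<in> X" using X_nonempty by auto
  have "integral\<^sup>L \<nu> h \<noteq> 0"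
    using eigenmeasure_zero[OF \<nu> lam_pos h(2) lip less_imp_le[OF h(3)] _ \<omega>] h(3)[OF \<omega>] by auto
  moreover have "0 \<le> integral\<^sup>L \<nu> h"
    by (rule Bochner_Integration.integral_nonneg_AE) (use h(3) space_eigenmeasure[OF \<nu>] in \<open>auto intro!: AE_I2 less_imp_le\<close>)
  ultimately show ?thesis by simp
qed

text \<open>By \<open>chi\<close> the indicator of \<open>E\<close> is the pullback of that of
  \<open>E'\<close> under the shift, so it leaves the operator by \<open>L_pullback\<close>.\<close>

lemma A_chi:
  assumes f: "bounded_by G f M"
    and chi: "\<And>\<omega>. \<omega> \<in> X \<Longrightarrow> indicator E' (shift \<omega>) = (indicator E \<omega> :: real)"
  shows "A (\<lambda>\<omega>. f \<omega> * indicator E \<omega>) = (\<lambda>\<omega>. A f \<omega> * indicator E' \<omega>)"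
proof
  fix \<omega>
  show "A (\<lambda>\<omega>. f \<omega> * indicator E \<omega>) \<omega> = A f \<omega> * indicator E' \<omega>"
  proof (cases "\<omega> \<in> X")
    case True
    have b: "bounded_by G (\<lambda>\<omega>. f \<omega> * indicator E \<omega>) M"
      using f bounded_by_nonneg[OF f] by (auto simp: bounded_by_def indicator_def)
    have L: "L (\<lambda>\<omega>. u \<omega> * indicator E \<omega>) = (\<lambda>\<omega>. indicator E' \<omega> * L u \<omega>)" for u
    proof -
      have "L (\<lambda>\<omega>. u \<omega> * indicator E \<omega>) = L (\<lambda>\<omega>. u \<omega> * indicator E' (shift \<omega>))"
        by (rule L_cong) (simp add: chi)
      then show ?thesis by (simp add: L_pullback)
    qed
    have eq: "Re (f \<omega> * indicator E \<omega>) = Re (f \<omega>) * indicator E \<omega>" "Im (f \<omega> * indicator E \<omega>) = Im (f \<omega>) * indicator E \<omega>" for \<omega>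
      by (simp_all add: indicator_def)
    show ?thesis unfolding A_eq[OF b True] A_eq[OF f True] eq L
      by (simp add: indicator_def complex_eq_iff)
  qed (simp add: A_outside)
qed

theorem cyclic_spectrum_exists:
  assumes h: "cone h" "bounded_by G h 1" "\<And>\<omega>. \<omega> \<in> X \<Longrightarrow> L h \<omega> = lam * h \<omega>" "\<And>\<omega>. \<omega> \<in> X \<Longrightarrow> 0 < h \<omega>"
    and \<nu>: "eigenmeasure \<nu> lam"
    and p: "0 < p" and Es: "(\<Union>i<p. Es i) = arcs G"
    "\<And>i j. i < p \<Longrightarrow> j < p \<Longrightarrow> i \<noteq> j \<Longrightarrow> Es i \<inter> Es j = {}"
    "\<And>\<omega> i. \<omega> \<in> X \<Longrightarrow> i < p \<Longrightarrow> \<omega> 0 \<in> Es i \<Longrightarrow> \<omega> 1 \<in> Es (Suc i mod p)"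
    "\<And>\<omega> \<upsilon> i n. \<omega> \<in> X \<Longrightarrow> \<upsilon> \<in> X \<Longrightarrow> i < p \<Longrightarrow> \<omega> 0 \<in> Es i \<Longrightarrow> \<upsilon> 0 \<in> Es i \<Longrightarrow>
      \<exists>k \<eta> \<zeta>. \<eta> \<in> X \<and> \<zeta> \<in> X \<and> agree n \<omega> \<eta> \<and> agree n \<upsilon> \<zeta> \<and> (shift ^^ k) \<eta> = (shift ^^ k) \<zeta>"
  defines "hc \<equiv> \<lambda>\<omega>. if \<omega> \<in> X then of_real (h \<omega> / integral\<^sup>L \<nu> h) else 0"
  shows "\<exists>\<rho> K'. cyclic_spectrum G \<theta> A lam \<rho> K' hc \<nu> p Es"
proof -
  interpret N: cyclic_potential G \<theta> "\<lambda>\<omega>. \<psi> \<omega> - ln lam" "\<lambda>e. B e / lam" K h \<nu> p Es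
    by (intro cyclic_potential.intro cyclic_potential_axioms.intro normalized_potential[OF h \<nu>] p Es)
  note hI = eigenfunction_integral_pos[OF h(1,2,4) \<nu>]
  obtain a \<rho> where \<rho>: "0 < \<rho>" "\<rho> < 1" and a: "0 \<le> a"
    and decay: "\<And>n M f. N.ball M f \<Longrightarrow> N.ker f \<Longrightarrow> N.ball (a * \<rho> ^ n * M) ((N.L ^^ n) f)"
    using N.exponential_decay by auto
  \<comment> \<open>The factor 2 pays for recombining real and imaginary parts; the maximum lets one
    constant serve both the general bound and the decay.\<close>
  define K' where "K' = 2 * max N.CL a"
  have K': "2 * N.CL \<le> K'" "2 * a \<le> K'" "0 \<le> K'" using a by (auto simp: K'_def)
  have pow: "hball (lam ^ n * (2 * c)) ((A ^^ n) f)"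
    if f: "hball M f" and c: "N.ball c ((N.L ^^ n) (\<lambda>\<omega>. Re (f \<omega>)))" "N.ball c ((N.L ^^ n) (\<lambda>\<omega>. Im (f \<omega>)))" for n c M f
  proof -
    have b: "bounded_by G f M" and out: "\<And>\<omega>. \<omega> \<notin> X \<Longrightarrow> f \<omega> = 0" using f by (auto simp: hball_def)
    have sc: "bounded_by G ((L ^^ n) u) (lam ^ n * c)" "lipschitz_by G \<theta> ((L ^^ n) u) (lam ^ n * c)"
      if "N.ball c ((N.L ^^ n) u)" for u
    proof -
      have "(L ^^ n) u = (\<lambda>\<omega>. lam ^ n * (N.L ^^ n) u \<omega>)" by (rule ext) (rule normalized_Lpow)
      then show "bounded_by G ((L ^^ n) u) (lam ^ n * c)" "lipschitz_by G \<theta> ((L ^^ n) u) (lam ^ n * c)"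
        using N.ball_scale[OF that, of "lam ^ n"] lam_pos by (simp_all add: N.ball_def)
    qed
    show ?thesis
      using hball_Complex[OF sc(1)[OF c(1)] sc(1)[OF c(2)] sc(2)[OF c(1)] sc(2)[OF c(2)] A_pow_eq[OF b] A_pow_outside[OF out]]
      by (simp add: mult.left_commute)
  qed
  have ball: "N.ball M (\<lambda>\<omega>. Re (f \<omega>))" "N.ball M (\<lambda>\<omega>. Im (f \<omega>))" if f: "hball M f" for M f
  proof -
    have b: "bounded_by G f M" and l: "lipschitz_by G \<theta> f M" using f by (auto simp: hball_def)
    have "\<bar>Re (f \<omega>) - Re (f \<upsilon>)\<bar> \<le> cmod (f \<omega> - f \<upsilon>)" "\<bar>Im (f \<omega>) - Im (f \<upsilon>)\<bar> \<le> cmod (f \<omega> - f \<upsilon>)" for \<omega> \<upsilon>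
      using abs_Re_le_cmod[of "f \<omega> - f \<upsilon>"] abs_Im_le_cmod[of "f \<omega> - f \<upsilon>"] by simp_all
    then show "N.ball M (\<lambda>\<omega>. Re (f \<omega>))" "N.ball M (\<lambda>\<omega>. Im (f \<omega>))"
      using Re_bounded[OF b] Im_bounded[OF b] l unfolding N.ball_def lipschitz_by_def real_norm_def
      by (smt (verit))+
  qed
  have chi: "N.chi j \<omega> = indicator (edge_union G (Es j)) \<omega>" if "\<omega> \<in> X" for j \<omega>
    using that by (simp add: N.chi_def indicator_def mem_edge_union)
  have "cyclic_spectrum G \<theta> A lam \<rho> K' hc \<nu> p Es"
  proof
    show "hball (K' * lam ^ n * M) ((A ^^ n) f)" if f: "hball M f" for n M f
    proof (rule hball_mono[OF pow[OF f]])
      show "N.ball (N.CL * M) ((N.L ^^ n) (\<lambda>\<omega>. Re (f \<omega>)))" "N.ball (N.CL * M) ((N.L ^^ n) (\<lambda>\<omega>. Im (f \<omega>)))"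
        using N.ball_Lpow[OF ball(1)[OF f]] N.ball_Lpow[OF ball(2)[OF f]] .
      have "2 * N.CL * (lam ^ n * M) \<le> K' * (lam ^ n * M)"
        using K'(1) hball_nonneg[OF f] lam_pos by (intro mult_right_mono) auto
      then show "lam ^ n * (2 * (N.CL * M)) \<le> K' * lam ^ n * M" by (simp add: mult_ac)
    qed
    show "hball (K' * (lam * \<rho>) ^ n * M) ((A ^^ n) f)"
      if f: "hball M f" and ker: "\<And>j. j < p \<Longrightarrow> (LINT \<omega>:edge_union G (Es j)|\<nu>. f \<omega>) = 0" for n M f
    proof (rule hball_mono[OF pow[OF f]])
      have z: "integral\<^sup>L \<nu> (\<lambda>\<omega>. Re (f \<omega>) * N.chi j \<omega>) = 0 \<and> integral\<^sup>L \<nu> (\<lambda>\<omega>. Im (f \<omega>) * N.chi j \<omega>) = 0"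
        if j: "j < p" for j
      proof -
        let ?g = "\<lambda>\<omega>. indicator (edge_union G (Es j)) \<omega> *\<^sub>R f \<omega>"
        let ?g' = "\<lambda>\<omega>. complex_of_real (Re (f \<omega>) * N.chi j \<omega>) + \<i> * complex_of_real (Im (f \<omega>) * N.chi j \<omega>)"
        note i = N.ball_integrable[OF N.ball_chi[OF ball(1)[OF f]], of j] N.ball_integrable[OF N.ball_chi[OF ball(2)[OF f]], of j]
        have "0 = integral\<^sup>L \<nu> ?g" using ker[OF j] by (simp add: set_lebesgue_integral_def)
        also have "\<dots> = integral\<^sup>L \<nu> ?g'"
          by (rule Bochner_Integration.integral_cong) (simp_all add: chi complex_eq_iff)
        also have "\<dots> = of_real (integral\<^sup>L \<nu> (\<lambda>\<omega>. Re (f \<omega>) * N.chi j \<omega>)) + \<i> * of_real (integral\<^sup>L \<nu> (\<lambda>\<omega>. Im (f \<omega>) * N.chi j \<omega>))"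
          using i by (simp del: of_real_mult)
        finally show ?thesis by (simp add: complex_eq_iff)
      qed
      then have k: "N.ker (\<lambda>\<omega>. Re (f \<omega>))" "N.ker (\<lambda>\<omega>. Im (f \<omega>))" unfolding N.ker_def by blast+
      show "N.ball (a * \<rho> ^ n * M) ((N.L ^^ n) (\<lambda>\<omega>. Re (f \<omega>)))" "N.ball (a * \<rho> ^ n * M) ((N.L ^^ n) (\<lambda>\<omega>. Im (f \<omega>)))"
        using decay[OF ball(1)[OF f] k(1)] decay[OF ball(2)[OF f] k(2)] .
      have "2 * a * (lam ^ n * \<rho> ^ n * M) \<le> K' * (lam ^ n * \<rho> ^ n * M)"
        using K'(2) hball_nonneg[OF f] lam_pos \<rho> by (intro mult_right_mono) auto
      then show "lam ^ n * (2 * (a * \<rho> ^ n * M)) \<le> K' * (lam * \<rho>) ^ n * M" by (simp add: mult_ac power_mult_distrib)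
    qed
    show "A (\<lambda>\<omega>. f \<omega> * indicator (edge_union G (Es j)) \<omega>) = (\<lambda>\<omega>. A f \<omega> * indicator (edge_union G (Es (Suc j mod p))) \<omega>)"
      if f: "f \<in> CB" and j: "j < p" for f j
    proof -
      obtain M where M: "bounded_by G f M" using bdd_CB[OF f] by blast
      have "indicator (edge_union G (Es (Suc j mod p))) (shift \<omega>) = (indicator (edge_union G (Es j)) \<omega> :: real)" if "\<omega> \<in> X" for \<omega>
        using N.chi_shift[OF j that] chi[OF that] chi[OF shift_in[OF that]] by simp
      from A_chi[OF M this] show ?thesis .
    qed
    obtain c where hb: "N.ball c (\<lambda>\<omega>. 1 / integral\<^sup>L \<nu> h * h \<omega>)"
    proof -
      have "N.ball (max 1 (K * \<theta> / (1 - \<theta>) * D * 1)) h"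
        unfolding N.ball_def
        by (intro conjI bounded_by_mono[OF h(2)] lipschitz_by_mono[OF cone_lipschitz[OF h(1,2)]]) (rule max.cobounded1 max.cobounded2)+
      from N.ball_scale[OF this, of "1 / integral\<^sup>L \<nu> h"] show thesis by (rule that)
    qed
    have c: "0 \<le> c" by (rule N.ball_nonneg[OF hb])
    show "hc \<in> FH"
    proof (rule hball_imp_FH)
      show "hball (2 * c) hc"
      proof (rule hball_Complex)
        show "bounded_by G (\<lambda>\<omega>. 1 / integral\<^sup>L \<nu> h * h \<omega>) c" "lipschitz_by G \<theta> (\<lambda>\<omega>. 1 / integral\<^sup>L \<nu> h * h \<omega>) c"
          using hb by (simp_all only: N.ball_def)
        show "bounded_by G (\<lambda>_. 0::real) c" "lipschitz_by G \<theta> (\<lambda>_. 0::real) c"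
          using c \<theta>_pos by (simp_all add: bounded_by_def lipschitz_by_def)
      qed (simp_all add: hc_def complex_eq_iff)
    qed
    show "A hc = (\<lambda>\<omega>. of_real lam * hc \<omega>)"
    proof
      fix \<omega>
      show "A hc \<omega> = of_real lam * hc \<omega>"
      proof (cases "\<omega> \<in> X")
        case True
        have b: "bounded_by G hc (1 / integral\<^sup>L \<nu> h)"
          using h(2) hI by (simp add: bounded_by_def hc_def divide_right_mono norm_divide)
        have "L (\<lambda>\<omega>. Re (hc \<omega>)) = L (\<lambda>\<omega>. 1 / integral\<^sup>L \<nu> h * h \<omega>)" "L (\<lambda>\<omega>. Im (hc \<omega>)) = L (\<lambda>\<omega>. 0 * h \<omega>)"
          by (rule L_cong, simp add: hc_def)+
        then show ?thesis unfolding A_eq[OF b True] L_scale using h(3)[OF True] True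
          by (simp add: hc_def complex_eq_iff)
      qed (simp add: A_outside hc_def)
    qed
    have "integral\<^sup>L \<nu> hc = integral\<^sup>L \<nu> (\<lambda>\<omega>. complex_of_real (h \<omega> / integral\<^sup>L \<nu> h))"
      by (rule Bochner_Integration.integral_cong) (simp_all add: hc_def)
    also have "\<dots> = of_real (integral\<^sup>L \<nu> (\<lambda>\<omega>. h \<omega> / integral\<^sup>L \<nu> h))" by (rule integral_complex_of_real)
    also have "integral\<^sup>L \<nu> (\<lambda>\<omega>. h \<omega> / integral\<^sup>L \<nu> h) = 1" using hI by simp
    finally show "integral\<^sup>L \<nu> hc = 1" by simp
    show "sets \<nu> = sets borelX" using \<nu> by (simp add: eigenmeasure_def)
    show "integral\<^sup>L \<nu> (A f) = of_real lam * integral\<^sup>L \<nu> f" if "f \<in> CB" for f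
      by (rule eigenmeasure_complex[OF \<nu> that])
  qed (use lam_pos \<rho> K' A_lin A_outside p Es in auto)
  then show ?thesis by blast
qed

end

section \<open>Pressure\<close>

context potential
begin

abbreviation birkhoff :: "nat \<Rightarrow> (nat \<Rightarrow> 'e) \<Rightarrow> real" where
  "birkhoff n \<omega> \<equiv> \<Sum>i<n. \<psi> ((shift ^^ i) \<omega>)"

lemma birkhoff_Suc: "birkhoff (Suc n) \<omega> = \<psi> \<omega> + birkhoff n (shift \<omega>)"
  unfolding sum.lessThan_Suc_shift by (simp add: funpow_swap1)

lemma exp_birkhoff_le: assumes "\<omega> \<in> X" shows "exp (birkhoff n \<omega>) \<le> (\<Prod>i<n. B (\<omega> i))"
  using assms
proof (induction n)
  case (Suc n)
  have "exp (\<psi> ((shift ^^ n) \<omega>)) \<le> B (\<omega> n)"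
    using \<psi>_bound[OF funpow_shift_in[OF Suc.prems], of n] by (simp add: funpow_shift)
  moreover have "0 \<le> (\<Prod>i<n. B (\<omega> i))"
    using B_nonneg shift_space_nth[OF Suc.prems] by (intro prod_nonneg) auto
  ultimately show ?case using Suc by (simp add: exp_add mult_mono)
qed simp

lemma word_weight_ge:
  assumes "\<omega> \<in> cylinder G w" shows "exp (birkhoff (length w) \<omega>) \<le> word_weight G \<psi> w"
proof -
  have "birkhoff (length w) \<upsilon> \<le> ln (\<Prod>i<length w. B (w ! i))" if "\<upsilon> \<in> cylinder G w" for \<upsilon>
  proof -
    have "exp (birkhoff (length w) \<upsilon>) \<le> (\<Prod>i<length w. B (w ! i))"
      using exp_birkhoff_le[of \<upsilon> "length w"] that by (simp add: cylinder_def)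
    moreover from this have "0 < (\<Prod>i<length w. B (w ! i))" by (rule less_le_trans[OF exp_gt_zero])
    ultimately show ?thesis by (simp add: ln_ge_iff)
  qed
  then have "bdd_above (birkhoff (length w) ` cylinder G w)" by (rule bdd_aboveI2)
  then show ?thesis unfolding word_weight_def using cSUP_upper[OF assms, of "birkhoff (length w)"] by simp
qed

lemma word_weight_le:
  assumes "cylinder G w \<noteq> {}" and le: "\<And>\<omega>. \<omega> \<in> cylinder G w \<Longrightarrow> exp (birkhoff (length w) \<omega>) \<le> c"
  shows "word_weight G \<psi> w \<le> c"
proof -
  obtain \<omega> where "\<omega> \<in> cylinder G w" using assms(1) by auto
  then have c: "0 < c" using less_le_trans[OF exp_gt_zero le] by blast
  have "(SUP \<omega>\<in>cylinder G w. birkhoff (length w) \<omega>) \<le> ln c"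
    by (rule cSUP_least[OF assms(1)]) (use le c in \<open>simp add: ln_ge_iff\<close>)
  then show ?thesis unfolding word_weight_def using c by (simp add: ln_ge_iff)
qed

text \<open>A point has at most one preimage of order \<open>length w\<close> in the cylinder of
  \<open>w\<close>, so the iterate consists of at most one term. The induction absorbs the first
  letter into the function, hence the arbitrary \<open>f\<close>.\<close>

lemma Lpow_cylinder_le:
  assumes "0 \<le> c" "\<And>\<omega>. \<omega> \<in> cylinder G w \<Longrightarrow> exp (birkhoff (length w) \<omega>) * f \<omega> \<le> c" "\<omega> \<in> X"
  shows "(L ^^ length w) (\<lambda>\<omega>. f \<omega> * indicator (cylinder G w) \<omega>) \<omega> \<le> c"
  using assms(2,3)
proof (induction w arbitrary: f \<omega>)
  case Nil
  have "\<omega> \<in> cylinder G []" using Nil(2) by (simp add: cylinder_def)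
  then show ?case using Nil(1)[of \<omega>] by simp
next
  case (Cons e w)
  let ?f = "\<lambda>\<omega>. if e \<in> preds G \<omega> then exp (\<psi> (prepend e \<omega>)) * f (prepend e \<omega>) else 0"
  have mem: "prepend e \<eta> \<in> cylinder G (e # w) \<longleftrightarrow> \<eta> \<in> cylinder G w" if "\<eta> \<in> X" "e \<in> preds G \<eta>" for \<eta>
    using that by (auto simp: cylinder_def nth_Cons less_Suc_eq_0_disj split: nat.splits)
  have "L (\<lambda>\<omega>. f \<omega> * indicator (cylinder G (e # w)) \<omega>) \<eta> = ?f \<eta> * indicator (cylinder G w) \<eta>" if \<eta>: "\<eta> \<in> X" for \<eta>
  proof -
    let ?t = "\<lambda>a. exp (\<psi> (prepend a \<eta>)) * (f (prepend a \<eta>) * indicator (cylinder G (e # w)) (prepend a \<eta>))"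
    have "infsum ?t (preds G \<eta>) = infsum ?t ({e} \<inter> preds G \<eta>)"
      by (rule infsum_cong_neutral) (auto simp: cylinder_def indicator_def)
    also have "\<dots> = (if e \<in> preds G \<eta> then ?t e else 0)" by simp
    finally have "infsum ?t (preds G \<eta>) = (if e \<in> preds G \<eta> then ?t e else 0)" .
    then show ?thesis using \<eta> mem[OF \<eta>] by (auto simp: L_def indicator_def)
  qed
  then have "(L ^^ length (e # w)) (\<lambda>\<omega>. f \<omega> * indicator (cylinder G (e # w)) \<omega>) \<omega>
      = (L ^^ length w) (\<lambda>\<omega>. ?f \<omega> * indicator (cylinder G w) \<omega>) \<omega>"
    unfolding list.size(4) add_Suc_right add_0_right Lpow_Suc by (intro Lpow_cong Cons.prems)
  also have "\<dots> \<le> c"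
  proof (rule Cons.IH[OF _ Cons.prems(2)])
    fix \<eta> assume \<eta>: "\<eta> \<in> cylinder G w"
    then have X: "\<eta> \<in> X" by (simp add: cylinder_def)
    show "exp (birkhoff (length w) \<eta>) * ?f \<eta> \<le> c"
    proof (cases "e \<in> preds G \<eta>")
      case True
      have "exp (birkhoff (length (e # w)) (prepend e \<eta>)) * f (prepend e \<eta>) \<le> c"
        by (rule Cons.prems(1)) (use mem[OF X True] \<eta> in simp)
      then show ?thesis using True by (simp only: length_Cons birkhoff_Suc shift_prepend if_True exp_add mult_ac)
    qed (use assms(1) in simp)
  qed
  finally show ?case .
qed

lemma cylinder_disjoint:
  assumes "length w = length w'" "w \<noteq> w'" shows "cylinder G w \<inter> cylinder G w' = {}"
proof -
  obtain i where "i < length w" "w ! i \<noteq> w' ! i" using assms by (auto simp: list_eq_iff_nth_eq)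
  then show ?thesis using assms(1) by (auto simp: cylinder_def)
qed

lemma words_cover: "(\<Union>w\<in>nonempty_words G n. cylinder G w) = X"
proof
  show "X \<subseteq> (\<Union>w\<in>nonempty_words G n. cylinder G w)"
  proof
    fix \<omega> assume \<omega>: "\<omega> \<in> X"
    then have "\<omega> \<in> cylinder G (map \<omega> [0..<n])" by (auto simp: cylinder_def)
    moreover from this have "map \<omega> [0..<n] \<in> nonempty_words G n"
      using \<omega> by (auto simp: nonempty_words_def shift_space_nth)
    ultimately show "\<omega> \<in> (\<Union>w\<in>nonempty_words G n. cylinder G w)" by blast
  qed
qed (auto simp: cylinder_def)

text \<open>Along the orbit the agreement shrinks letter by letter, and the Lipschitz bounds of
  \<psi> add up to a geometric series below the exponent of \<open>D\<close>.\<close>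

lemma birkhoff_distortion:
  assumes "\<omega> \<in> X" "\<upsilon> \<in> X" "agree (Suc n) \<omega> \<upsilon>" shows "exp (birkhoff n \<omega>) \<le> D * exp (birkhoff n \<upsilon>)"
proof -
  let ?k = "K * \<theta> / (1 - \<theta>)"
  have "birkhoff n \<omega> \<le> birkhoff n \<upsilon> + ?k * (1 - \<theta> ^ n)"
    using assms
  proof (induction n arbitrary: \<omega> \<upsilon>)
    case (Suc n)
    have 1: "birkhoff n (shift \<omega>) \<le> birkhoff n (shift \<upsilon>) + ?k * (1 - \<theta> ^ n)"
      using Suc.IH[of "shift \<omega>" "shift \<upsilon>"] agree_shift[OF Suc.prems(3)] Suc.prems by simp
    have "\<bar>\<psi> \<omega> - \<psi> \<upsilon>\<bar> \<le> K * \<theta> ^ Suc (Suc n)"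
      by (rule \<psi>_lip) (use Suc.prems in auto)
    moreover have "K * \<theta> ^ Suc (Suc n) \<le> K * \<theta> ^ Suc n"
      using K_nonneg \<theta>_pos \<theta>_less_1 by (intro mult_left_mono power_decreasing) auto
    moreover have "?k * (1 - \<theta> ^ Suc n) = ?k * (1 - \<theta> ^ n) + K * \<theta> ^ Suc n"
      using \<theta>_less_1 by (simp add: field_simps)
    ultimately show ?case unfolding birkhoff_Suc using 1 by linarith
  qed simp
  moreover have "?k * (1 - \<theta> ^ n) \<le> ?k * 1"
    using exponent_nonneg less_imp_le[OF \<theta>_pow_pos[of n]] by (intro mult_left_mono) simp_all
  ultimately have "birkhoff n \<omega> \<le> ?k + birkhoff n \<upsilon>" by linarith
  then show ?thesis by (simp add: D_def exp_add[symmetric])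
qed

lemma Lpow_sum: "finite W \<Longrightarrow> (\<And>w. w \<in> W \<Longrightarrow> bd (f w)) \<Longrightarrow>
    (L ^^ n) (\<lambda>\<omega>. \<Sum>w\<in>W. f w \<omega>) = (\<lambda>\<omega>. \<Sum>w\<in>W. (L ^^ n) (f w) \<omega>) \<and> bd (\<lambda>\<omega>. \<Sum>w\<in>W. f w \<omega>)"
proof (induction W rule: finite_induct)
  case empty
  show ?case using Lpow_scale[of n 0 "\<lambda>_. 0"] by simp
qed (simp add: Lpow_add)

text \<open>A weight is a supremum over a cylinder, whereas \<open>L\<close> samples at one point.
  All letters but the last are compared by distortion with a branch of \<open>L ^^ n\<close> that
  ends at \<open>edge_point a\<close>; the last letter costs \<open>B a\<close>.\<close>

lemma word_weight_snoc:
  assumes w: "w @ [a] \<in> nonempty_words G (Suc n)"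
  shows "word_weight G \<psi> (w @ [a]) \<le> D * (B a * (L ^^ n) (indicator (cylinder G w)) (edge_point a))"
proof (rule word_weight_le)
  have n: "length w = n" and a: "a \<in> arcs G" using w by (auto simp: nonempty_words_def)
  fix \<omega> assume \<omega>: "\<omega> \<in> cylinder G (w @ [a])"
  then have X: "\<omega> \<in> X" and wi: "\<And>i. i < n \<Longrightarrow> \<omega> i = w ! i" and wn: "\<omega> n = a"
    using n by (auto simp: cylinder_def nth_append)
  \<comment> \<open>The word \<open>w\<close> continued by \<open>edge_point a\<close>: it agrees
    with \<open>\<omega>\<close> on \<open>n + 1\<close> letters, since both have \<open>a\<close>
    at position \<open>n\<close>.\<close>
  define \<upsilon> where "\<upsilon> = (\<lambda>i. if i < n then \<omega> i else edge_point a (i - n))"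
  have \<upsilon>: "\<upsilon> \<in> X"
  proof -
    have "incident G (\<upsilon> i) (\<upsilon> (Suc i))" for i
    proof -
      consider "Suc i < n" | "Suc i = n" | "n \<le> i" by linarith
      then show ?thesis
      proof cases
        case 3
        then show ?thesis using edge_point(1)[OF a] by (simp add: \<upsilon>_def shift_space_def Suc_diff_le)
      next
        case 2
        have "incident G (\<omega> i) (\<omega> (Suc i))" using X by (simp add: shift_space_def)
        then show ?thesis using 2 wn edge_point(2)[OF a] by (simp add: \<upsilon>_def)
      qed (use X in \<open>simp add: \<upsilon>_def shift_space_def\<close>)
    qed
    then show ?thesis using X edge_point(1)[OF a] by (simp add: shift_space_def \<upsilon>_def)
  qed
  have ag: "agree (Suc n) \<omega> \<upsilon>" using wn edge_point(2)[OF a] by (auto simp: agree_def \<upsilon>_def less_Suc_eq)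
  have sh: "(shift ^^ n) \<upsilon> = edge_point a" by (rule ext) (simp add: funpow_shift \<upsilon>_def)
  have "exp (birkhoff n \<upsilon>) * indicator (cylinder G w) \<upsilon> \<le> (L ^^ n) (indicator (cylinder G w)) ((shift ^^ n) \<upsilon>)"
    by (rule Lpow_ge_term[OF bdI[OF cylinder_bounded] _ \<upsilon>]) simp
  moreover have "\<upsilon> \<in> cylinder G w" using \<upsilon> wi n by (simp add: cylinder_def \<upsilon>_def)
  ultimately have 1: "exp (birkhoff n \<upsilon>) \<le> (L ^^ n) (indicator (cylinder G w)) (edge_point a)" by (simp add: sh)
  have 2: "exp (\<psi> ((shift ^^ n) \<omega>)) \<le> B a"
    using \<psi>_bound[OF funpow_shift_in[OF X], of n] wn by (simp add: funpow_shift)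
  have "exp (birkhoff (length (w @ [a])) \<omega>) = exp (birkhoff n \<omega>) * exp (\<psi> ((shift ^^ n) \<omega>))"
    using n by (simp add: exp_add)
  also have "\<dots> \<le> (D * (L ^^ n) (indicator (cylinder G w)) (edge_point a)) * B a"
  proof (rule mult_mono[OF _ 2])
    have "D * exp (birkhoff n \<upsilon>) \<le> D * (L ^^ n) (indicator (cylinder G w)) (edge_point a)"
      using 1 D_ge_1 by (intro mult_left_mono) auto
    then show "exp (birkhoff n \<omega>) \<le> D * (L ^^ n) (indicator (cylinder G w)) (edge_point a)"
      using birkhoff_distortion[OF X \<upsilon> ag] by linarith
    then show "0 \<le> D * (L ^^ n) (indicator (cylinder G w)) (edge_point a)"
      by (rule order_trans[OF exp_ge_zero])
  qed simp
  finally show "exp (birkhoff (length (w @ [a])) \<omega>) \<le> D * (B a * (L ^^ n) (indicator (cylinder G w)) (edge_point a))"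
    by (simp add: mult_ac)
qed (use w in \<open>simp add: nonempty_words_def\<close>)

text \<open>For a fixed last letter the cylinders of the remaining words are disjoint, so their
  contributions sum to at most the iterate of 1, hence to \<open>growth n\<close>; summing
  \<open>B\<close> over the last letters gives \<open>SB\<close>. The finite set \<open>F\<close> is
  enlarged to a product to separate the two sums.\<close>

lemma partition_sum_le:
  assumes F: "finite F" "F \<subseteq> nonempty_words G (Suc n)"
  shows "(\<Sum>w\<in>F. word_weight G \<psi> w) \<le> D * (SB * growth n)"
proof -
  define W where "W = butlast ` F"
  define E where "E = last ` F"
  let ?u = "\<lambda>w a. D * (B a * (L ^^ n) (indicator (cylinder G w)) (edge_point a))"
  have fin: "finite W" "finite E" using F(1) by (simp_all add: W_def E_def)
  have ne: "w \<noteq> []" if "w \<in> F" for w using F(2) that by (auto simp: nonempty_words_def)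
  have arcs: "E \<subseteq> arcs G" using F(2) ne by (force simp: E_def nonempty_words_def)
  have len: "length w = n" if "w \<in> W" for w using that F(2) by (auto simp: W_def nonempty_words_def)
  have Lnn: "0 \<le> (L ^^ n) (indicator (cylinder G w)) (edge_point a)" if "a \<in> E" for w a
    by (rule Lpow_nonneg) (use arcs that edge_point in auto)
  have unn: "0 \<le> ?u w a" if "a \<in> E" for w a
    using Lnn[OF that] B_nonneg[of a] arcs that D_ge_1 by (auto intro!: mult_nonneg_nonneg)
  have one: "(\<Sum>w\<in>W. (L ^^ n) (indicator (cylinder G w)) (edge_point a)) \<le> growth n" if a: "a \<in> E" for a
  proof -
    have X: "edge_point a \<in> X" using arcs a edge_point by auto
    have b: "bd (indicator (cylinder G w))" for w by (rule bdI[OF cylinder_bounded])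
    have le: "(\<Sum>w\<in>W. indicator (cylinder G w) \<omega>) \<le> (1::real)" for \<omega>
    proof (cases "\<exists>w\<in>W. \<omega> \<in> cylinder G w")
      case True
      then obtain w where w: "w \<in> W" "\<omega> \<in> cylinder G w" by blast
      have "indicator (cylinder G w') \<omega> = (if w' = w then 1 else (0::real))" if "w' \<in> W" for w'
        using cylinder_disjoint[of w w'] len[OF w(1)] len[OF that] w(2) by (auto simp: indicator_def)
      then have "(\<Sum>w\<in>W. indicator (cylinder G w) \<omega>) = (\<Sum>w'\<in>W. if w' = w then 1 else (0::real))" by (rule sum.cong[OF refl])
      then show ?thesis using fin w by simp
    qed (auto simp: indicator_def intro!: sum_nonpos order_trans[OF _ zero_le_one])
    have "(\<Sum>w\<in>W. (L ^^ n) (indicator (cylinder G w)) (edge_point a)) = (L ^^ n) (\<lambda>\<omega>. \<Sum>w\<in>W. indicator (cylinder G w) \<omega>) (edge_point a)"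
      using Lpow_sum[OF fin(1) b, of n "\<lambda>w. w"] by simp
    also have "\<dots> \<le> (L ^^ n) (\<lambda>_. 1) (edge_point a)"
      by (rule Lpow_mono) (use Lpow_sum[OF fin(1) b, of n "\<lambda>w. w"] le X in auto)
    also have "\<dots> \<le> growth n" by (rule Lpow_one_le[OF X])
    finally show ?thesis .
  qed
  have "(\<Sum>w\<in>F. word_weight G \<psi> w) \<le> (\<Sum>w\<in>F. ?u (butlast w) (last w))"
  proof (rule sum_mono)
    fix w assume w: "w \<in> F"
    have eq: "butlast w @ [last w] = w" by (rule append_butlast_last_id[OF ne[OF w]])
    have "w \<in> nonempty_words G (Suc n)" by (rule subsetD[OF F(2) w])
    from word_weight_snoc[of "butlast w" "last w" n, unfolded eq, OF this]
    show "word_weight G \<psi> w \<le> ?u (butlast w) (last w)" .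
  qed
  also have "\<dots> = (\<Sum>(w, a)\<in>(\<lambda>w. (butlast w, last w)) ` F. ?u w a)"
  proof (subst sum.reindex)
    show "inj_on (\<lambda>w. (butlast w, last w)) F"
    proof (rule inj_onI)
      fix v w assume vw: "v \<in> F" "w \<in> F" and eq: "(butlast v, last v) = (butlast w, last w)"
      have "v = butlast v @ [last v]" by (rule append_butlast_last_id[OF ne[OF vw(1)], symmetric])
      also have "\<dots> = butlast w @ [last w]" using eq by (simp only: prod.inject)
      also have "\<dots> = w" by (rule append_butlast_last_id[OF ne[OF vw(2)]])
      finally show "v = w" .
    qed
  qed (simp add: comp_def)
  also have "\<dots> \<le> (\<Sum>(w, a)\<in>W \<times> E. ?u w a)"
    by (rule sum_mono2) (use fin unn in \<open>auto simp: W_def E_def\<close>)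
  also have "\<dots> = (\<Sum>a\<in>E. \<Sum>w\<in>W. ?u w a)"
    by (simp add: sum.cartesian_product[symmetric] sum.swap[of _ W E])
  also have "\<dots> = (\<Sum>a\<in>E. D * (B a * (\<Sum>w\<in>W. (L ^^ n) (indicator (cylinder G w)) (edge_point a))))"
    by (simp only: sum_distrib_left)
  also have "\<dots> \<le> (\<Sum>a\<in>E. D * (B a * growth n))"
    using one arcs B_nonneg D_ge_1 by (intro sum_mono mult_left_mono) auto
  also have "\<dots> = D * ((\<Sum>a\<in>E. B a) * growth n)" by (simp add: sum_distrib_left sum_distrib_right)
  also have "\<dots> \<le> D * (SB * growth n)"
  proof -
    have "sum B E \<le> SB" unfolding SB_def
      by (rule finite_sum_le_infsum) (use B_summable fin arcs B_nonneg in auto)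
    then show ?thesis using D_ge_1 growth_nonneg by (intro mult_left_mono mult_right_mono) auto
  qed
  finally show ?thesis .
qed

lemma cylinder_lipschitz_nonneg: "0 \<le> 1 / \<theta> ^ length w"
  using \<theta>_pos by simp

lemma eigenmeasure_lipschitz:
  "eigenmeasure \<nu> l \<Longrightarrow> bounded_by G f M \<Longrightarrow> lipschitz_by G \<theta> f V \<Longrightarrow> integral\<^sup>L \<nu> (L f) = l * integral\<^sup>L \<nu> f"
  unfolding eigenmeasure_def by blast

lemma word_weight_nonneg: "0 \<le> word_weight G \<psi> w"
  by (simp add: word_weight_def)

lemma partition_summable:
  assumes "1 \<le> n" shows "word_weight G \<psi> summable_on nonempty_words G n"
proof (rule nonneg_bdd_above_summable_on)
  obtain m where "n = Suc m" using assms by (cases n) auto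
  then show "bdd_above (sum (word_weight G \<psi>) ` {F. F \<subseteq> nonempty_words G n \<and> finite F})"
    using partition_sum_le by (auto intro!: bdd_aboveI2)
qed (rule word_weight_nonneg)

text \<open>The mass of a cylinder times \<open>lam ^ n\<close> is the integral of the iterate of
  its indicator, which never exceeds the weight of the word. Summing over all words of length
  \<open>n\<close> recovers the total mass 1.\<close>

lemma partition_lower:
  assumes \<nu>: "eigenmeasure \<nu> lam" and n: "1 \<le> n"
  shows "lam ^ n \<le> (\<Sum>\<^sub>\<infinity>w\<in>nonempty_words G n. word_weight G \<psi> w)"
proof -
  interpret prob_space \<nu> using \<nu> by (simp add: eigenmeasure_def)
  let ?I = "nonempty_words G n"
  have sets: "cylinder G w \<in> sets \<nu>" for w
    using \<nu> cylinder_open open_sets_borelX by (auto simp: eigenmeasure_def)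
  have w: "lam ^ n * measure \<nu> (cylinder G w) \<le> word_weight G \<psi> w" if "w \<in> ?I" for w
  proof -
    have len: "length w = n" using that by (simp add: nonempty_words_def)
    have step: "integral\<^sup>L \<nu> ((L ^^ k) (indicator (cylinder G w))) = lam ^ k * integral\<^sup>L \<nu> (indicator (cylinder G w))" for k
    proof (induction k)
      case (Suc k)
      have b: "bounded_by G ((L ^^ k) (indicator (cylinder G w))) (1 * growth k)"
        by (rule Lpow_bound[OF cylinder_bounded])
      note V = Lpow_lipschitz[OF cylinder_bounded[of w] cylinder_lipschitz[of w] cylinder_lipschitz_nonneg[of w], of k]
      have "integral\<^sup>L \<nu> (L ((L ^^ k) (indicator (cylinder G w)))) = lam * integral\<^sup>L \<nu> ((L ^^ k) (indicator (cylinder G w)))"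
        by (rule eigenmeasure_lipschitz[OF \<nu> b V])
      then show ?case using Suc by simp
    qed simp
    have "(L ^^ n) (indicator (cylinder G w)) \<omega> \<le> word_weight G \<psi> w" if "\<omega> \<in> X" for \<omega>
      using Lpow_cylinder_le[of "word_weight G \<psi> w" w "\<lambda>_. 1" \<omega>] word_weight_ge[of _ w] word_weight_nonneg[of w] that len by auto
    moreover have "integrable \<nu> ((L ^^ n) (indicator (cylinder G w)))"
    proof -
      note V = Lpow_lipschitz[OF cylinder_bounded[of w] cylinder_lipschitz[of w] cylinder_lipschitz_nonneg[of w], of n]
      show ?thesis by (rule eigenmeasure_integrable[OF \<nu> lipschitz_measurable[OF V] Lpow_bound[OF cylinder_bounded]])
    qed
    ultimately have "integral\<^sup>L \<nu> ((L ^^ n) (indicator (cylinder G w))) \<le> integral\<^sup>L \<nu> (\<lambda>_. word_weight G \<psi> w)"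
      by (intro integral_mono_AE) (auto simp: space_eigenmeasure[OF \<nu>] intro!: AE_I2)
    then show ?thesis using step[of n] sets by (simp add: prob_space)
  qed
  have sum: "(\<lambda>w. word_weight G \<psi> w / lam ^ n) summable_on ?I"
    using summable_on_cmult_left[OF partition_summable[OF n], of "1 / lam ^ n"] by simp
  have nn: "0 \<le> word_weight G \<psi> w / lam ^ n" for w using word_weight_nonneg lam_pos by simp
  have abs: "Infinite_Set_Sum.abs_summable_on (\<lambda>w. word_weight G \<psi> w / lam ^ n) ?I"
    unfolding abs_summable_equivalent[symmetric] real_norm_def abs_of_nonneg[OF nn] by (rule sum)
  have "?I \<subseteq> lists (arcs G)" by (auto simp: nonempty_words_def)
  then have count: "countable ?I" using countable_words countable_subset by blast
  have "1 = emeasure \<nu> (\<Union>w\<in>?I. cylinder G w)"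
    using emeasure_space_1 unfolding words_cover space_eigenmeasure[OF \<nu>] by simp
  also have "\<dots> = (\<integral>\<^sup>+w. emeasure \<nu> (cylinder G w) \<partial>count_space ?I)"
    by (rule emeasure_UN_countable)
      (use sets count cylinder_disjoint in \<open>auto simp: disjoint_family_on_def nonempty_words_def\<close>)
  also have "\<dots> \<le> (\<integral>\<^sup>+w. ennreal (word_weight G \<psi> w / lam ^ n) \<partial>count_space ?I)"
  proof (rule nn_integral_mono)
    fix x assume "x \<in> space (count_space ?I)"
    then have "measure \<nu> (cylinder G x) \<le> word_weight G \<psi> x / lam ^ n"
      using w[of x] lam_pos by (simp add: field_simps)
    then show "emeasure \<nu> (cylinder G x) \<le> ennreal (word_weight G \<psi> x / lam ^ n)"
      unfolding emeasure_eq_measure by (rule ennreal_leI)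
  qed
  also have "\<dots> = ennreal (infsetsum (\<lambda>w. word_weight G \<psi> w / lam ^ n) ?I)"
    by (rule nn_integral_conv_infsetsum[OF abs nn])
  finally have "1 \<le> infsetsum (\<lambda>w. word_weight G \<psi> w / lam ^ n) ?I" by simp
  also have "\<dots> = (\<Sum>\<^sub>\<infinity>w\<in>?I. word_weight G \<psi> w / lam ^ n)" by (rule infsetsum_infsum[OF abs])
  also have "\<dots> = (\<Sum>\<^sub>\<infinity>w\<in>?I. word_weight G \<psi> w * (1 / lam ^ n))" by simp
  also have "\<dots> = (\<Sum>\<^sub>\<infinity>w\<in>?I. word_weight G \<psi> w) * (1 / lam ^ n)" by (rule infsum_cmult_left')
  finally show ?thesis using lam_pos by (simp add: field_simps)
qed

text \<open>The partition sums lie between \<open>lam ^ n\<close> and \<open>c * lam ^ n\<close>: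
  the lower bound is that of the eigenmeasure, the upper one holds because the iterates of 1 are
  bounded after normalisation.\<close>

theorem pressure:
  assumes h: "cone h" "bounded_by G h 1" "\<And>\<omega>. \<omega> \<in> X \<Longrightarrow> L h \<omega> = lam * h \<omega>" "\<And>\<omega>. \<omega> \<in> X \<Longrightarrow> 0 < h \<omega>"
    and \<nu>: "eigenmeasure \<nu> lam"
  shows "has_pressure G \<psi> (ln lam)"
  unfolding has_pressure_def
proof (intro conjI allI impI)
  interpret N: normalized_potential G \<theta> "\<lambda>\<omega>. \<psi> \<omega> - ln lam" "\<lambda>e. B e / lam" K h \<nu>
    by (rule normalized_potential[OF h \<nu>])
  let ?Z = "\<lambda>n. \<Sum>\<^sub>\<infinity>w\<in>nonempty_words G n. word_weight G \<psi> w"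
  have g: "growth n \<le> lam ^ n * N.C" for n
  proof (rule growth_le)
    fix \<omega> assume "\<omega> \<in> X"
    then have "(N.L ^^ n) (\<lambda>_. 1) \<omega> \<le> N.C" by (rule order_trans[OF N.Lpow_one_le N.C(2)])
    then show "(L ^^ n) (\<lambda>_. 1) \<omega> \<le> lam ^ n * N.C"
      unfolding normalized_Lpow using lam_pos by (intro mult_left_mono) auto
  qed
  define c where "c = D * SB * N.C / lam"
  have c: "0 < c" using D_ge_1 SB_pos N.C(1) lam_pos by (simp add: c_def)
  have up: "?Z n \<le> c * lam ^ n" if n: "1 \<le> n" for n
  proof (rule infsum_le_finite_sums[OF partition_summable[OF n]])
    fix F assume F: "finite F" "F \<subseteq> nonempty_words G n"
    obtain m where m: "n = Suc m" using n by (cases n) auto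
    have "D * (SB * growth m) \<le> D * (SB * (lam ^ m * N.C))"
    proof (intro mult_left_mono)
      show "growth m \<le> lam ^ m * N.C" by (rule g)
      show "0 \<le> SB" by (rule less_imp_le[OF SB_pos])
      show "0 \<le> D" by (rule order_trans[OF zero_le_one D_ge_1])
    qed
    also have "\<dots> = c * lam ^ n" unfolding c_def m power_Suc using lam_pos by (simp add: field_simps)
    finally have le: "D * (SB * growth m) \<le> c * lam ^ n" .
    show "sum (word_weight G \<psi>) F \<le> c * lam ^ n"
      by (rule order_trans[OF partition_sum_le[OF F(1) F(2)[unfolded m]] le])
  qed
  have "(\<lambda>n. 1 / real n * ln (?Z n)) \<longlonglongrightarrow> ln lam"
  proof (rule tendsto_sandwich)
    show "\<forall>\<^sub>F n in sequentially. ln lam \<le> 1 / real n * ln (?Z n)"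
      using eventually_ge_at_top[of 1]
    proof eventually_elim
      case (elim n)
      have "ln (lam ^ n) \<le> ln (?Z n)" using partition_lower[OF \<nu> elim] lam_pos by (intro ln_mono) auto
      then show ?case using elim lam_pos by (simp add: ln_realpow field_simps)
    qed
    show "\<forall>\<^sub>F n in sequentially. 1 / real n * ln (?Z n) \<le> ln lam + ln c / real n"
      using eventually_ge_at_top[of 1]
    proof eventually_elim
      case (elim n)
      have "0 < ?Z n" by (rule less_le_trans[OF zero_less_power[OF lam_pos] partition_lower[OF \<nu> elim]])
      then have 1: "ln (?Z n) \<le> ln (c * lam ^ n)" using up[OF elim] by (intro ln_mono) auto
      have 2: "ln (c * lam ^ n) = ln c + real n * ln lam"
        using c lam_pos by (simp add: ln_mult ln_realpow)
      from 1 show ?case unfolding 2 using elim by (simp add: field_simps)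
    qed
    have "(\<lambda>n. ln lam + ln c / real n) \<longlonglongrightarrow> ln lam + 0"
      by (intro tendsto_intros lim_const_over_n)
    then show "(\<lambda>n. ln lam + ln c / real n) \<longlonglongrightarrow> ln lam" by simp
  qed simp
  then show "(\<lambda>n. 1 / real n * ln (?Z n)) \<longlonglongrightarrow> ln lam" .
qed (rule partition_summable)

end

section \<open>Cyclic decompositions\<close>

context edge_shift
begin

lemma follows_path: "\<omega> \<in> X \<Longrightarrow> (\<omega> i, \<omega> (i + n)) \<in> follows ^^ n"
  by (induction n) (auto simp: follows_def shift_space_def)

lemma path_trans: "(a, b) \<in> follows ^^ m \<Longrightarrow> (b, c) \<in> follows ^^ n \<Longrightarrow> (a, c) \<in> follows ^^ (m + n)"
  unfolding relpow_add by (rule relcompI)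

lemma path_exists: assumes "a \<in> arcs G" "b \<in> arcs G" shows "\<exists>n\<ge>1. (a, b) \<in> follows ^^ n"
  using trancl_power[THEN iffD1, OF arcs_connected[OF assms]] by (auto simp: Suc_le_eq)

lemma path_prepend:
  assumes "\<upsilon> \<in> X" "(a, \<upsilon> 0) \<in> follows ^^ n"
  shows "\<exists>\<zeta>\<in>X. \<zeta> 0 = a \<and> (shift ^^ n) \<zeta> = \<upsilon>"
  using assms
proof (induction n arbitrary: \<upsilon>)
  case (Suc n)
  then obtain b where b: "(a, b) \<in> follows ^^ n" "(b, \<upsilon> 0) \<in> follows" by auto
  have pre: "b \<in> preds G \<upsilon>" using b(2) by (simp add: preds_def follows_def incident_def)
  have "prepend b \<upsilon> \<in> X" by (rule prepend_in[OF Suc.prems(1) pre])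
  moreover have "(a, prepend b \<upsilon> 0) \<in> follows ^^ n" using b(1) by simp
  ultimately obtain \<zeta> where \<zeta>: "\<zeta> \<in> X" "\<zeta> 0 = a" "(shift ^^ n) \<zeta> = prepend b \<upsilon>" using Suc.IH by blast
  have "(shift ^^ Suc n) \<zeta> = \<upsilon>" using \<zeta>(3) by simp
  then show ?case using \<zeta> by blast
qed auto

lemma path_insert:
  assumes "\<omega> \<in> X" "\<upsilon> \<in> X" "(\<omega> k, \<upsilon> 0) \<in> follows ^^ n"
  shows "\<exists>\<zeta>\<in>X. agree (Suc k) \<omega> \<zeta> \<and> (shift ^^ (k + n)) \<zeta> = \<upsilon>"
  using assms(1,3)
proof (induction k arbitrary: \<omega>)
  case 0
  from path_prepend[OF assms(2) 0(2)] obtain \<zeta> where "\<zeta> \<in> X" "\<zeta> 0 = \<omega> 0" "(shift ^^ n) \<zeta> = \<upsilon>" by blast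
  then show ?case by (intro bexI[of _ \<zeta>]) (simp_all add: agree_def)
next
  case (Suc k)
  have "(shift \<omega> k, \<upsilon> 0) \<in> follows ^^ n" using Suc.prems(2) by (simp add: shift_def)
  from Suc.IH[OF shift_in[OF Suc.prems(1)] this]
  obtain \<zeta> where \<zeta>: "\<zeta> \<in> X" "agree (Suc k) (shift \<omega>) \<zeta>" "(shift ^^ (k + n)) \<zeta> = \<upsilon>" by blast
  have "\<omega> 0 \<in> preds G \<zeta>"
    using nth_0_preds[OF Suc.prems(1)] agree_preds[OF \<zeta>(2), of G] by simp
  then have "prepend (\<omega> 0) \<zeta> \<in> X" by (rule prepend_in[OF \<zeta>(1)])
  moreover have "agree (Suc (Suc k)) \<omega> (prepend (\<omega> 0) \<zeta>)"
    using agree_prepend[OF \<zeta>(2), of "\<omega> 0"] by (simp only: prepend_shift)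
  moreover have "(shift ^^ (Suc k + n)) (prepend (\<omega> 0) \<zeta>) = \<upsilon>"
    using \<zeta>(3) by (simp add: funpow_Suc_right del: funpow.simps)
  ultimately show ?case by blast
qed

lemma admissible_loop_iff:
  assumes "1 \<le> n" shows "(\<exists>w. admissible_loop G n w) \<longleftrightarrow> (\<exists>a. (a, a) \<in> follows ^^ n)"
proof
  assume "\<exists>w. admissible_loop G n w"
  then obtain w where w: "admissible_loop G n w" by blast
  then have "(w 0, w n) \<in> follows ^^ n"
    unfolding relpow_fun_conv by (intro exI[of _ w]) (auto simp: admissible_loop_def follows_def)
  then show "\<exists>a. (a, a) \<in> follows ^^ n" using w by (auto simp: admissible_loop_def)
next
  assume "\<exists>a. (a, a) \<in> follows ^^ n"
  then obtain a w where w: "w 0 = a" "w n = a" "\<And>i. i < n \<Longrightarrow> (w i, w (Suc i)) \<in> follows"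
    unfolding relpow_fun_conv by auto
  have "w k \<in> arcs G" if "k \<le> n" for k
  proof (cases k)
    case 0
    then show ?thesis using w(3)[of 0] assms by (simp add: follows_def)
  next
    case (Suc m)
    then show ?thesis using w(3)[of m] that by (simp add: follows_def)
  qed
  then have "admissible_loop G n w" using w by (auto simp: admissible_loop_def follows_def)
  then show "\<exists>w. admissible_loop G n w" by blast
qed

lemma period_Gcd: "period G = Gcd {n. 1 \<le> n \<and> (\<exists>a. (a, a) \<in> follows ^^ n)}"
  unfolding period_def using admissible_loop_iff by (metis (no_types, lifting))

lemma period_dvd: assumes "(a, a) \<in> follows ^^ n" shows "period G dvd n"
proof (cases "n = 0")
  case False
  then show ?thesis unfolding period_Gcd using assms by (intro Gcd_dvd) auto
qed simp

lemma period_pos: "0 < period G"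
proof -
  obtain a where a: "a \<in> arcs G" using arcs_nonempty by auto
  obtain n where n: "n \<ge> 1" "(a, a) \<in> follows ^^ n" using path_exists[OF a a] by blast
  have "period G dvd n" by (rule period_dvd[OF n(2)])
  then show ?thesis using n(1) by (auto intro: gr0I)
qed

text \<open>The period is a gcd over loops at all edges. A loop at \<open>b\<close> can be inserted
  into a closed path through \<open>a\<close> and \<open>b\<close>; both lengths, with and without
  it, are divisible by \<open>d\<close>, hence so is the length of the loop.\<close>

lemma period_greatest:
  assumes a: "a \<in> arcs G" and d: "\<And>n. (a, a) \<in> follows ^^ n \<Longrightarrow> d dvd n"
  shows "d dvd period G"
  unfolding period_Gcd
proof (rule Gcd_greatest)
  fix n assume "n \<in> {n. 1 \<le> n \<and> (\<exists>b. (b, b) \<in> follows ^^ n)}"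
  then obtain b where n: "n \<ge> 1" "(b, b) \<in> follows ^^ n" by auto
  have "b \<in> arcs G" using n by (cases n) (auto simp: follows_def)
  then obtain k m where k: "(a, b) \<in> follows ^^ k" and m: "(b, a) \<in> follows ^^ m"
    using path_exists a by blast
  have "d dvd k + m" "d dvd (k + n) + m"
    using d[OF path_trans[OF k m]] d[OF path_trans[OF path_trans[OF k n(2)] m]] .
  moreover have "(k + n) + m = n + (k + m)" by simp
  ultimately show "d dvd n" by (metis dvd_add_left_iff)
qed

text \<open>The least positive difference of two loop lengths at \<open>a\<close> divides every loop length at \<open>a\<close>, so it is the period.\<close>

lemma loop_lengths:
  assumes a: "a \<in> arcs G"
  shows "\<exists>y\<ge>1. (a, a) \<in> follows ^^ y \<and> (a, a) \<in> follows ^^ (y + period G)"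
proof -
  define P where "P d \<longleftrightarrow> 0 < d \<and> (\<exists>y. (a, a) \<in> follows ^^ y \<and> (a, a) \<in> follows ^^ (y + d))" for d
  obtain l where l: "l \<ge> 1" "(a, a) \<in> follows ^^ l" using path_exists[OF a a] by blast
  have "P l" unfolding P_def using l by (auto intro!: exI[of _ 0])
  define d where "d = (LEAST d. P d)"
  have d: "P d" unfolding d_def by (rule LeastI[of P, OF \<open>P l\<close>])
  have least: "d \<le> e" if "P e" for e unfolding d_def by (rule Least_le[of P, OF that])
  obtain y where y: "(a, a) \<in> follows ^^ y" "(a, a) \<in> follows ^^ (y + d)" and d0: "0 < d"
    using d by (auto simp: P_def)
  have mult: "(a, a) \<in> follows ^^ (q * m)" if "(a, a) \<in> follows ^^ m" for q m
    by (induction q) (auto intro: path_trans that)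
  have dvd: "d dvd n" if n: "(a, a) \<in> follows ^^ n" for n
  proof (rule ccontr)
    assume "\<not> d dvd n"
    then have r: "0 < n mod d" by (simp add: dvd_eq_mod_eq_0)
    let ?q = "n div d"
    \<comment> \<open>Two loop lengths at \<open>a\<close> that differ by \<open>n mod d\<close>:
      \<open>?q\<close> loops of length \<open>y\<close> followed by the loop of length
      \<open>n\<close>, against \<open>?q\<close> loops of length \<open>y + d\<close>. A nonzero
      remainder would contradict the choice of \<open>d\<close>.\<close>
    have eq: "?q * y + n = ?q * (y + d) + n mod d" by (simp add: algebra_simps)
    have "(a, a) \<in> follows ^^ (?q * (y + d) + n mod d)"
      using path_trans[OF mult[OF y(1), of ?q] n] unfolding eq .
    then have "P (n mod d)" unfolding P_def using r mult[OF y(2), of ?q] by blast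
    from least[OF this] show False using mod_less_divisor[OF d0, of n] by simp
  qed
  have "period G dvd d"
  proof -
    have "period G dvd y" "period G dvd y + d" using y by (auto intro: period_dvd)
    then show ?thesis using dvd_add_right_iff by blast
  qed
  then have p: "period G = d" using period_greatest[OF a dvd] by (auto intro: dvd_antisym)
  \<comment> \<open>The least difference may be attained with \<open>y = 0\<close>; one further loop
    makes the length positive.\<close>
  have "(a, a) \<in> follows ^^ (y + l)" by (rule path_trans[OF y(1) l(2)])
  moreover have "(a, a) \<in> follows ^^ (y + l + d)"
    using path_trans[OF y(2) l(2)] by (simp add: ac_simps)
  ultimately show ?thesis unfolding p using l(1) by (intro exI[of _ "y + l"]) auto
qed

text \<open>Let p be the period and y = p q. For t >= q^2 and r = t mod q one has t div q = r + k
  for some k, because t div q >= q > r. Then t p = k y + r (y + p) is a combination of the two loop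
  lengths.\<close>

lemma long_loops:
  assumes a: "a \<in> arcs G" shows "\<exists>N. \<forall>t\<ge>N. (a, a) \<in> follows ^^ (t * period G)"
proof -
  obtain y where y: "y \<ge> 1" "(a, a) \<in> follows ^^ y" "(a, a) \<in> follows ^^ (y + period G)"
    using loop_lengths[OF a] by blast
  have mult: "(a, a) \<in> follows ^^ (q * m)" if "(a, a) \<in> follows ^^ m" for q m
    by (induction q) (auto intro: path_trans that)
  obtain q where q: "y = period G * q" using period_dvd[OF y(2)] by (auto elim: dvdE)
  have q0: "0 < q" using y(1) q by (auto intro: gr0I)
  have "(a, a) \<in> follows ^^ (t * period G)" if t: "q * q \<le> t" for t
  proof -
    have b: "t mod q < q" by (rule mod_less_divisor[OF q0])
    have "q \<le> t div q" using t q0 by (simp add: less_eq_div_iff_mult_less_eq)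
    then obtain k where k: "t div q = t mod q + k" using b by (metis le_iff_add less_imp_le order_trans)
    have eq: "((r + k) * q + r) * period G = k * y + r * (y + period G)" for r
      by (simp add: q algebra_simps)
    have "t = (t mod q + k) * q + t mod q" unfolding k[symmetric] by simp
    from arg_cong[OF this, of "\<lambda>t. t * period G"]
    have "t * period G = k * y + t mod q * (y + period G)" unfolding eq .
    then show ?thesis using path_trans[OF mult[OF y(2), of k] mult[OF y(3), of "t mod q"]] by simp
  qed
  then show ?thesis by blast
qed

lemma long_paths:
  assumes ab: "(a, b) \<in> follows ^^ k" "a \<in> arcs G"
  shows "\<exists>N. \<forall>m\<ge>N. m mod period G = k mod period G \<longrightarrow> (a, b) \<in> follows ^^ m"
proof -
  obtain N where N: "\<And>t. t \<ge> N \<Longrightarrow> (a, a) \<in> follows ^^ (t * period G)" using long_loops[OF ab(2)] by blast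
  have "(a, b) \<in> follows ^^ m" if m: "N * period G + k \<le> m" "m mod period G = k mod period G" for m
  proof -
    have km: "k \<le> m" using m(1) by simp
    then have "period G dvd m - k" using m(2) by (metis mod_eq_dvd_iff_nat)
    then obtain t where t: "m - k = period G * t" by (rule dvdE)
    have "N * period G \<le> m - k" using m(1) by simp
    then have "N * period G \<le> t * period G" unfolding t by (simp only: mult.commute[of t])
    then have "N \<le> t" using period_pos mult_le_cancel2[of N "period G" t] by blast
    have "(a, b) \<in> follows ^^ (t * period G + k)" by (rule path_trans[OF N[OF \<open>N \<le> t\<close>] ab(1)])
    moreover have "t * period G + k = m" using t km by (simp add: mult.commute)
    ultimately show ?thesis by simp
  qed
  then show ?thesis by blast
qed

text \<open>The classical cyclic classes: by \<open>path_length_mod\<close> the length of a path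
  from \<open>a\<close> to a given edge is determined modulo the period.\<close>

definition residue_class :: "'e \<Rightarrow> nat \<Rightarrow> 'e set" where
  "residue_class a i = {e \<in> arcs G. \<exists>n. (a, e) \<in> follows ^^ n \<and> n mod period G = i}"

lemma path_length_mod:
  assumes "(a, e) \<in> follows ^^ n" "(a, e) \<in> follows ^^ m" "a \<in> arcs G" "e \<in> arcs G"
  shows "n mod period G = m mod period G"
proof -
  obtain k where k: "(e, a) \<in> follows ^^ k" using path_exists[OF assms(4,3)] by blast
  have "int (period G) dvd int (n + k)" "int (period G) dvd int (m + k)"
    using period_dvd[OF path_trans[OF assms(1) k]] period_dvd[OF path_trans[OF assms(2) k]] by (simp_all only: int_dvd_int_iff)
  then have "int (period G) dvd int (n + k) - int (m + k)" by (rule dvd_diff)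
  then have "int n mod int (period G) = int m mod int (period G)" by (simp add: mod_eq_dvd_iff)
  then show ?thesis by (simp flip: of_nat_mod)
qed

lemma openin_edge_union:
  "openin (subtopology (shift_topology G \<theta>) (edge_union G E)) {\<eta> \<in> X. agree (Suc n) \<omega> \<eta> \<and> \<omega> 0 \<in> E}"
proof -
  have "openin (shift_topology G \<theta>) {\<eta> \<in> X. agree (Suc n) \<omega> \<eta> \<and> \<omega> 0 \<in> E}"
    unfolding openin_shift_iff by (auto simp: agree_def intro!: exI[of _ "Suc n"])
  moreover have "{\<eta> \<in> X. agree (Suc n) \<omega> \<eta> \<and> \<omega> 0 \<in> E} \<subseteq> edge_union G E"
    by (auto simp: mem_edge_union agree_def)
  ultimately show ?thesis unfolding openin_subtopology by blast
qed

lemma residue_class_step: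
  assumes "e \<in> residue_class a i" "(e, f) \<in> follows" shows "f \<in> residue_class a (Suc i mod period G)"
proof -
  obtain n where n: "(a, e) \<in> follows ^^ n" "n mod period G = i" using assms(1) by (auto simp: residue_class_def)
  have "(a, f) \<in> follows ^^ Suc n" using n(1) assms(2) by auto
  moreover have "Suc n mod period G = Suc i mod period G" using n(2) by (metis mod_Suc_eq)
  ultimately show ?thesis using assms(2) unfolding residue_class_def follows_def by blast
qed

lemma residue_class_disjoint:
  assumes "a \<in> arcs G" "e \<in> residue_class a i" "e \<in> residue_class a j" shows "i = j"
  using assms path_length_mod[of a e] unfolding residue_class_def by blast

lemma residue_class_exists:
  assumes "a \<in> arcs G" "e \<in> arcs G" shows "\<exists>i<period G. e \<in> residue_class a i"
proof -
  obtain n where "(a, e) \<in> follows ^^ n" using path_exists[OF assms] by blast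
  then show ?thesis using assms(2) mod_less_divisor[OF period_pos, of n]
    unfolding residue_class_def by blast
qed

lemma residue_class_mixing:
  assumes a: "a \<in> arcs G"
  shows "topologically_mixing (subtopology (shift_topology G \<theta>) (edge_union G (residue_class a i))) (shift ^^ period G)"
  unfolding topologically_mixing_def
proof (intro allI impI)
  let ?S = "edge_union G (residue_class a i)"
  fix U V assume "openin (subtopology (shift_topology G \<theta>) ?S) U \<and> openin (subtopology (shift_topology G \<theta>) ?S) V \<and> U \<noteq> {} \<and> V \<noteq> {}"
  then have op: "openin (subtopology (shift_topology G \<theta>) ?S) U" "openin (subtopology (shift_topology G \<theta>) ?S) V"
    and ne: "U \<noteq> {}" "V \<noteq> {}" by auto
  obtain \<omega> \<upsilon> where \<omega>: "\<omega> \<in> U" and \<upsilon>: "\<upsilon> \<in> V" using ne by auto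
  have S: "\<omega> \<in> X" "\<omega> 0 \<in> residue_class a i" "\<upsilon> \<in> X" "\<upsilon> 0 \<in> residue_class a i"
    using openin_subset[OF op(1)] openin_subset[OF op(2)] \<omega> \<upsilon> by (auto simp: mem_edge_union)
  obtain T where T: "openin (shift_topology G \<theta>) T" "U = T \<inter> ?S" using op(1) unfolding openin_subtopology by blast
  then obtain n where n: "\<forall>\<upsilon>\<in>X. agree n \<omega> \<upsilon> \<longrightarrow> \<upsilon> \<in> T"
    using \<omega> unfolding openin_shift_iff by blast
  have arcs: "\<omega> n \<in> arcs G" "\<upsilon> 0 \<in> arcs G" by (rule shift_space_nth S)+
  obtain k where k: "(\<omega> n, \<upsilon> 0) \<in> follows ^^ k" using path_exists[OF arcs] by blast
  obtain x where x: "(a, \<omega> 0) \<in> follows ^^ x" "x mod period G = i" using S(2) by (auto simp: residue_class_def)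
  obtain x' where x': "(a, \<upsilon> 0) \<in> follows ^^ x'" "x' mod period G = i" using S(4) by (auto simp: residue_class_def)
  have "(\<omega> 0, \<upsilon> 0) \<in> follows ^^ (n + k)" using path_trans[OF follows_path[OF S(1), of 0 n] ] k by simp
  from path_length_mod[OF path_trans[OF x(1) this] x'(1) a arcs(2)]
  have "(x + (n + k)) mod period G = x mod period G" using x x' by simp
  \<comment> \<open>A path of length \<open>n + k\<close> joins two edges of the same class, so its
    length is a multiple of the period.\<close>
  then have nk: "period G dvd n + k" by (metis add_diff_cancel_left' le_add1 mod_eq_dvd_iff_nat)
  obtain N where N: "\<And>m. m \<ge> N \<Longrightarrow> m mod period G = k mod period G \<Longrightarrow> (\<omega> n, \<upsilon> 0) \<in> follows ^^ m"
    using long_paths[OF k arcs(1)] by blast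
  show "\<exists>N. \<forall>m\<ge>N. ((shift ^^ period G) ^^ m) ` U \<inter> V \<noteq> {}"
  proof (intro exI allI impI)
    fix m assume m: "n + N + k \<le> m"
    have big: "n + N + k \<le> period G * m"
      using m period_pos by (metis One_nat_def Suc_leI le_trans mult_le_mono1 nat_mult_1)
    have "period G dvd period G * m - n - k"
    proof -
      have "period G * m - n - k = period G * m - (n + k)" by simp
      then show ?thesis using nk by simp
    qed
    \<comment> \<open>This is the length of the connection to be inserted after letter
      \<open>n\<close> in order to arrive at \<open>\<upsilon>\<close> at time
      \<open>period G * m\<close>. It has the residue of \<open>k\<close>, so
      \<open>long_paths\<close> provides it.\<close>
    then have "(period G * m - n) mod period G = k mod period G"
      using big by (subst mod_eq_dvd_iff_nat) auto
    then have "(\<omega> n, \<upsilon> 0) \<in> follows ^^ (period G * m - n)" using big by (intro N) auto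
    from path_insert[OF S(1,3) this]
    obtain \<zeta> where \<zeta>: "\<zeta> \<in> X" "agree (Suc n) \<omega> \<zeta>" "(shift ^^ (n + (period G * m - n))) \<zeta> = \<upsilon>" by blast
    have "\<zeta> \<in> T" using n \<zeta>(1) agree_mono[OF \<zeta>(2), of n] by simp
    moreover have "\<zeta> 0 = \<omega> 0" using \<zeta>(2) by (simp add: agree_def)
    ultimately have "\<zeta> \<in> U" using T(2) \<zeta>(1) S(2) by (simp add: mem_edge_union)
    moreover have "((shift ^^ period G) ^^ m) \<zeta> = \<upsilon>" using \<zeta>(3) big by (simp add: funpow_mult)
    ultimately show "((shift ^^ period G) ^^ m) ` U \<inter> V \<noteq> {}" using \<upsilon> by blast
  qed
qed

theorem cyclic_decomposition_exists: "\<exists>Es. cyclic_decomposition G \<theta> Es"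
proof -
  obtain a where a: "a \<in> arcs G" using arcs_nonempty by auto
  let ?E = "residue_class a"
  have "shift ` edge_union G (?E i) = edge_union G (?E (Suc i mod period G))" if i: "i < period G" for i
  proof
    show "shift ` edge_union G (?E i) \<subseteq> edge_union G (?E (Suc i mod period G))"
    proof
      fix \<upsilon> assume "\<upsilon> \<in> shift ` edge_union G (?E i)"
      then obtain \<omega> where \<omega>: "\<omega> \<in> X" "\<omega> 0 \<in> ?E i" "\<upsilon> = shift \<omega>" by (auto simp: mem_edge_union)
      have "(\<omega> 0, \<omega> 1) \<in> follows" using \<omega>(1) by (auto simp: follows_def shift_space_def)
      then show "\<upsilon> \<in> edge_union G (?E (Suc i mod period G))"
        using residue_class_step[OF \<omega>(2)] \<omega> by (simp add: mem_edge_union shift_def[of \<omega>, THEN fun_cong])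
    qed
    show "edge_union G (?E (Suc i mod period G)) \<subseteq> shift ` edge_union G (?E i)"
    proof
      fix \<upsilon> assume "\<upsilon> \<in> edge_union G (?E (Suc i mod period G))"
      then have \<upsilon>: "\<upsilon> \<in> X" "\<upsilon> 0 \<in> ?E (Suc i mod period G)" by (auto simp: mem_edge_union)
      have "\<upsilon> 0 \<in> arcs G" by (rule shift_space_nth[OF \<upsilon>(1)])
      from arcs_connected[OF this this] obtain e where e: "(e, \<upsilon> 0) \<in> follows" by (auto elim: tranclE)
      have "e \<in> arcs G" using e by (simp add: follows_def)
      then obtain j where j: "j < period G" "e \<in> ?E j" using residue_class_exists[OF a] by blast
      have "Suc j mod period G = Suc i mod period G"
        by (rule residue_class_disjoint[OF a residue_class_step[OF j(2) e] \<upsilon>(2)])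
      then have "j = i" using i j(1) by (auto simp: mod_Suc split: if_splits)
      have pre: "e \<in> preds G \<upsilon>" using e by (simp add: preds_def follows_def incident_def)
      have "prepend e \<upsilon> \<in> edge_union G (?E i)"
        using prepend_in[OF \<upsilon>(1) pre] j(2) \<open>j = i\<close> by (simp add: mem_edge_union)
      from imageI[OF this, of shift] show "\<upsilon> \<in> shift ` edge_union G (?E i)" by simp
    qed
  qed
  moreover have "(\<Union>i<period G. ?E i) = arcs G"
  proof
    show "arcs G \<subseteq> (\<Union>i<period G. ?E i)" using residue_class_exists[OF a] by blast
  qed (auto simp: residue_class_def)
  moreover have "disjoint_family_on ?E {..<period G}"
    unfolding disjoint_family_on_def using residue_class_disjoint[OF a] by blast
  ultimately have "cyclic_decomposition G \<theta> ?E"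
    unfolding cyclic_decomposition_def using residue_class_mixing[OF a] by blast
  then show ?thesis by blast
qed

text \<open>Mixing is applied to the cylinders of both points with one common target, the cylinder
  of the letter \<open>\<omega> 0\<close>, and one common time \<open>k\<close>. Two points with the
  same letter at time \<open>k\<close> can share their future: the tail of \<open>\<eta>\<close> is
  grafted onto \<open>\<zeta>\<close>.\<close>

lemma cyclic_decomposition_common_future:
  assumes C: "cyclic_decomposition G \<theta> Es" and i: "i < period G"
    and \<omega>: "\<omega> \<in> X" "\<omega> 0 \<in> Es i" and \<upsilon>: "\<upsilon> \<in> X" "\<upsilon> 0 \<in> Es i"
  shows "\<exists>k \<eta> \<zeta>. \<eta> \<in> X \<and> \<zeta> \<in> X \<and> agree n \<omega> \<eta> \<and> agree n \<upsilon> \<zeta> \<and> (shift ^^ k) \<eta> = (shift ^^ k) \<zeta>"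
proof -
  let ?T = "subtopology (shift_topology G \<theta>) (edge_union G (Es i))"
  let ?U = "\<lambda>n \<omega>. {\<eta> \<in> X. agree (Suc n) \<omega> \<eta> \<and> \<omega> 0 \<in> Es i}"
  have mix: "topologically_mixing ?T (shift ^^ period G)"
    using C i by (simp add: cyclic_decomposition_def)
  have ev: "\<exists>N. \<forall>m\<ge>N. ((shift ^^ period G) ^^ m) ` ?U n \<xi> \<inter> ?U 0 \<omega> \<noteq> {}" if \<xi>: "\<xi> \<in> X" "\<xi> 0 \<in> Es i" for \<xi>
  proof -
    have "\<xi> \<in> ?U n \<xi>" "\<omega> \<in> ?U 0 \<omega>" using \<xi> \<omega> by auto
    then have ne: "?U n \<xi> \<noteq> {}" "?U 0 \<omega> \<noteq> {}" by blast+
    from mix[unfolded topologically_mixing_def, rule_format, of "?U n \<xi>" "?U 0 \<omega>"]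
    show ?thesis using openin_edge_union[of "Es i" n \<xi>] openin_edge_union[of "Es i" 0 \<omega>] ne by blast
  qed
  obtain N where N: "\<forall>m\<ge>N. ((shift ^^ period G) ^^ m) ` ?U n \<omega> \<inter> ?U 0 \<omega> \<noteq> {}" using ev[OF \<omega>] by blast
  obtain N' where N': "\<forall>m\<ge>N'. ((shift ^^ period G) ^^ m) ` ?U n \<upsilon> \<inter> ?U 0 \<omega> \<noteq> {}" using ev[OF \<upsilon>] by blast
  \<comment> \<open>\<open>N + N'\<close> serves both intersections, and the summand
    \<open>n\<close> ensures \<open>n \<le> k\<close>, so that the graft leaves the first
    \<open>n\<close> letters untouched.\<close>
  define m where "m = N + N' + n"
  define k where "k = period G * m"
  have nk: "n \<le> k" unfolding k_def m_def using period_pos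
    by (metis One_nat_def Suc_leI le_add2 le_trans mult_le_mono1 nat_mult_1)
  have "((shift ^^ period G) ^^ m) ` ?U n \<omega> \<inter> ?U 0 \<omega> \<noteq> {}" "((shift ^^ period G) ^^ m) ` ?U n \<upsilon> \<inter> ?U 0 \<omega> \<noteq> {}"
    using N N' by (simp_all add: m_def)
  then obtain \<eta> \<zeta> where \<eta>: "\<eta> \<in> ?U n \<omega>" "(shift ^^ k) \<eta> \<in> ?U 0 \<omega>" and \<zeta>: "\<zeta> \<in> ?U n \<upsilon>" "(shift ^^ k) \<zeta> \<in> ?U 0 \<omega>"
    unfolding k_def funpow_mult by blast
  have "\<eta> k = \<omega> 0" "\<zeta> k = \<omega> 0" using \<eta>(2) \<zeta>(2) by (simp_all add: agree_def funpow_shift)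
  then have eq: "\<zeta> k = \<eta> k" by simp
  define \<zeta>' where "\<zeta>' = (\<lambda>i. if i < k then \<zeta> i else \<eta> i)"
  have "\<zeta>' \<in> X" unfolding \<zeta>'_def using \<eta>(1) \<zeta>(1) eq by (intro shift_space_glue) auto
  moreover have "agree n \<omega> \<eta>" "agree n \<upsilon> \<zeta>'"
    using \<eta>(1) \<zeta>(1) nk by (auto simp: agree_def \<zeta>'_def)
  moreover have "(shift ^^ k) \<eta> = (shift ^^ k) \<zeta>'" by (rule ext) (simp add: funpow_shift \<zeta>'_def)
  ultimately show ?thesis using \<eta>(1) by blast
qed

lemma cyclic_decomposition_step:
  assumes C: "cyclic_decomposition G \<theta> Es" and i: "i < period G" and \<omega>: "\<omega> \<in> X" "\<omega> 0 \<in> Es i"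
  shows "\<omega> 1 \<in> Es (Suc i mod period G)"
proof -
  have "shift ` edge_union G (Es i) = edge_union G (Es (Suc i mod period G))"
    using C i by (simp add: cyclic_decomposition_def)
  moreover have "\<omega> \<in> edge_union G (Es i)" using \<omega> by (simp add: mem_edge_union)
  ultimately have "shift \<omega> \<in> edge_union G (Es (Suc i mod period G))" by blast
  then show ?thesis by (simp add: mem_edge_union shift_def)
qed

lemma cyclic_decomposition_disjoint:
  "cyclic_decomposition G \<theta> Es \<Longrightarrow> i < period G \<Longrightarrow> j < period G \<Longrightarrow> i \<noteq> j \<Longrightarrow> Es i \<inter> Es j = {}"
  unfolding cyclic_decomposition_def disjoint_family_on_def by auto

end

section \<open>Graph directed systems\<close>

context
  fixes V :: "'y::real_vector set" and n :: "'y \<Rightarrow> real"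
  assumes V: "subspace V" and n: "is_norm_on V n"
begin

lemma norm_on_nonneg: "x \<in> V \<Longrightarrow> 0 \<le> n x"
  and norm_on_eq_0: "x \<in> V \<Longrightarrow> n x = 0 \<longleftrightarrow> x = 0"
  and norm_on_scale: "x \<in> V \<Longrightarrow> n (a *\<^sub>R x) = \<bar>a\<bar> * n x"
  and norm_on_add: "x \<in> V \<Longrightarrow> y \<in> V \<Longrightarrow> n (x + y) \<le> n x + n y"
  using n by (auto simp: is_norm_on_def)

lemma norm_on_zero: "n 0 = 0"
  using norm_on_eq_0[of 0] subspace_0[OF V] by simp

lemma norm_on_minus: assumes "x \<in> V" "y \<in> V" shows "n (x - y) = n (y - x)"
  using norm_on_scale[OF subspace_diff[OF V assms], of "-1"] by simp

lemma norm_on_triangle: assumes "x \<in> V" "y \<in> V" "z \<in> V" shows "n (x - z) \<le> n (x - y) + n (y - z)"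
  using norm_on_add[OF subspace_diff[OF V assms(1,2)] subspace_diff[OF V assms(2,3)]] by simp

lemma Metric_space_norm: "Metric_space V (norm_dist V n)"
proof
  show "0 \<le> norm_dist V n x y" for x y
    using norm_on_nonneg[OF subspace_diff[OF V, of x y]] by (simp add: norm_dist_def)
  show "norm_dist V n x y = norm_dist V n y x" for x y
    using norm_on_minus[of x y] by (simp add: norm_dist_def)
  show "norm_dist V n x y = 0 \<longleftrightarrow> x = y" if "x \<in> V" "y \<in> V" for x y
    using norm_on_eq_0[OF subspace_diff[OF V that]] that by (simp add: norm_dist_def)
  show "norm_dist V n x z \<le> norm_dist V n x y + norm_dist V n y z" if "x \<in> V" "y \<in> V" "z \<in> V" for x y z
    using norm_on_triangle[OF that] that by (simp add: norm_dist_def)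
qed

lemma complete_closed_limit:
  assumes c: "Metric_space.mcomplete V (norm_dist V n)" and J: "closedin (norm_topology V n) J"
    and \<sigma>: "\<And>k. \<sigma> k \<in> J" and cauchy: "\<And>k j. n (\<sigma> k - \<sigma> (k + j)) \<le> \<epsilon> k" and \<epsilon>: "\<epsilon> \<longlonglongrightarrow> 0"
  shows "\<exists>z\<in>J. (\<lambda>k. n (\<sigma> k - z)) \<longlonglongrightarrow> 0"
proof -
  interpret Metric_space V "norm_dist V n" by (rule Metric_space_norm)
  have JV: "J \<subseteq> V" using closedin_subset[OF J] by (simp add: norm_topology_def)
  then have \<sigma>V: "\<sigma> k \<in> V" for k using \<sigma> by blast
  have d: "norm_dist V n (\<sigma> k) (\<sigma> (k + j)) \<le> \<epsilon> k" for k j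
    using cauchy \<sigma>V by (simp add: norm_dist_def)
  have "MCauchy \<sigma>" unfolding MCauchy_def
  proof (intro conjI allI impI)
    fix e :: real assume e: "e > 0"
    then have "eventually (\<lambda>k. \<epsilon> k < e) sequentially" by (rule order_tendstoD(2)[OF \<epsilon>])
    then obtain N where N: "\<And>k. k \<ge> N \<Longrightarrow> \<epsilon> k < e" by (auto simp: eventually_sequentially)
    have "norm_dist V n (\<sigma> a) (\<sigma> b) < e" if "N \<le> a" "N \<le> b" for a b
    proof (cases "a \<le> b")
      case True
      then show ?thesis using d[of a "b - a"] N[OF that(1)] by simp
    next
      case False
      then show ?thesis using d[of b "a - b"] N[OF that(2)] commute[of "\<sigma> a" "\<sigma> b"] by simp
    qed
    then show "\<exists>N. \<forall>a b. N \<le> a \<longrightarrow> N \<le> b \<longrightarrow> norm_dist V n (\<sigma> a) (\<sigma> b) < e" by blast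
  qed (use \<sigma>V in auto)
  then obtain z where z: "limitin mtopology \<sigma> z sequentially" using c unfolding mcomplete_def by blast
  have "z \<in> J"
    using J z \<sigma> unfolding norm_topology_def metric_closedin_iff_sequentially_closed by blast
  moreover have "(\<lambda>k. n (\<sigma> k - z)) \<longlonglongrightarrow> 0"
  proof (rule LIMSEQ_I)
    fix e :: real assume "e > 0"
    then obtain N where "\<forall>k\<ge>N. \<sigma> k \<in> V \<and> norm_dist V n (\<sigma> k) z < e"
      using z unfolding limit_metric_sequentially by blast
    then show "\<exists>N. \<forall>k\<ge>N. norm (n (\<sigma> k - z) - 0) < e"
      using \<open>z \<in> J\<close> JV norm_on_nonneg[OF subspace_diff[OF V \<sigma>V, of z]]
      by (intro exI[of _ N]) (auto simp: norm_dist_def subset_eq)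
  qed
  ultimately show ?thesis by blast
qed

context
  fixes W :: "'y set" and m :: "'y \<Rightarrow> real"
  assumes W: "subspace W" and m: "is_norm_on W m"
begin

lemma op_norm_le:
  assumes L: "bounded_linear_between V n W m L" and u: "u \<in> V"
  shows "m (L u) \<le> op_norm V n m L * n u"
proof (cases "u = 0")
  case True
  have "L (0 *\<^sub>R u) = 0 *\<^sub>R L u" using L u unfolding bounded_linear_between_def by blast
  moreover have "m 0 = 0" using m subspace_0[OF W] unfolding is_norm_on_def by blast
  ultimately show ?thesis using True norm_on_zero by simp
next
  case False
  have nu: "0 < n u" using False norm_on_nonneg[OF u] norm_on_eq_0[OF u] by simp
  obtain K where K: "\<And>u. u \<in> V \<Longrightarrow> m (L u) \<le> K * n u" using L unfolding bounded_linear_between_def by blast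
  have "bdd_above ((\<lambda>u. m (L u)) ` {u \<in> V. n u \<le> 1})"
  proof (rule bdd_aboveI2)
    fix x assume x: "x \<in> {u \<in> V. n u \<le> 1}"
    have "m (L x) \<le> K * n x" using K x by simp
    also have "\<dots> \<le> \<bar>K\<bar> * 1"
      using x norm_on_nonneg[of x] by (intro mult_mono) auto
    finally show "m (L x) \<le> \<bar>K\<bar>" by simp
  qed
  moreover have x: "(1 / n u) *\<^sub>R u \<in> {u \<in> V. n u \<le> 1}"
    using subspace_mul[OF V u] norm_on_scale[OF u] nu by simp
  ultimately have "m (L ((1 / n u) *\<^sub>R u)) \<le> op_norm V n m L"
    unfolding op_norm_def by (intro cSUP_upper)
  moreover have "L ((1 / n u) *\<^sub>R u) = (1 / n u) *\<^sub>R L u" using L u unfolding bounded_linear_between_def by blast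
  moreover have "m ((1 / n u) *\<^sub>R L u) = \<bar>1 / n u\<bar> * m (L u)"
    using m L u unfolding is_norm_on_def bounded_linear_between_def by blast
  ultimately show ?thesis using nu by (simp add: field_simps)
qed

text \<open>With the slope r + \<epsilon> the inequality holds on short parameter intervals around
  each point of the segment by differentiability there, and it adds up over adjacent intervals.
  Bisection (\<open>Bolzano\<close>) extends it to the whole segment.\<close>

lemma mean_value_inequality:
  assumes U: "convex U" "U \<subseteq> V" and f: "f ` U \<subseteq> W"
    and deriv: "\<And>x. x \<in> U \<Longrightarrow> has_frechet_derivative_in V n W m U f (D x) x"
    and D: "\<And>x. x \<in> U \<Longrightarrow> op_norm V n m (D x) \<le> r" and x: "x \<in> U" and y: "y \<in> U"
  shows "m (f x - f y) \<le> r * n (x - y)"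
proof (rule field_le_epsilon)
  fix \<epsilon>' :: real assume \<epsilon>': "\<epsilon>' > 0"
  have Wadd: "m (a - c) \<le> m (a - b) + m (b - c)" if "a \<in> W" "b \<in> W" "c \<in> W" for a b c
  proof -
    have "m ((a - b) + (b - c)) \<le> m (a - b) + m (b - c)"
      using m subspace_diff[OF W that(1,2)] subspace_diff[OF W that(2,3)] unfolding is_norm_on_def by blast
    then show ?thesis by simp
  qed
  have Wsym: "m (a - b) = m (b - a)" if "a \<in> W" "b \<in> W" for a b
  proof -
    have "m ((-1) *\<^sub>R (b - a)) = \<bar>-1\<bar> * m (b - a)"
      using m subspace_diff[OF W that(2,1)] unfolding is_norm_on_def by blast
    then show ?thesis by simp
  qed
  define k where "k = n (x - y)"
  have xyV: "x - y \<in> V" using U x y by (intro subspace_diff[OF V]) auto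
  have k: "0 \<le> k" unfolding k_def by (rule norm_on_nonneg[OF xyV])
  \<comment> \<open>The excess over the whole segment is \<open>\<epsilon> * k\<close>, at most
    \<open>\<epsilon>'\<close>; the denominator \<open>k + 1\<close> covers the case
    \<open>x = y\<close>.\<close>
  define \<epsilon> where "\<epsilon> = \<epsilon>' / (k + 1)"
  have \<epsilon>: "\<epsilon> > 0" "\<epsilon> * k \<le> \<epsilon>'" using \<epsilon>' k by (auto simp: \<epsilon>_def field_simps)
  define g where "g t = y + t *\<^sub>R (x - y)" for t
  have gU: "g t \<in> U" if "0 \<le> t" "t \<le> 1" for t
  proof -
    have "g t = (1 - t) *\<^sub>R y + t *\<^sub>R x" by (simp add: g_def algebra_simps)
    then show ?thesis using convexD[OF U(1) y x, of "1 - t" t] that by simp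
  qed
  have gdiff: "n (g a - g b) = \<bar>a - b\<bar> * k" for a b
  proof -
    have "g a - g b = (a - b) *\<^sub>R (x - y)" by (simp add: g_def algebra_simps)
    then show ?thesis using norm_on_scale[OF xyV] by (simp add: k_def)
  qed
  define P where "P a b \<longleftrightarrow> (0 \<le> a \<and> b \<le> 1 \<longrightarrow> m (f (g b) - f (g a)) \<le> (r + \<epsilon>) * ((b - a) * k))" for a b :: real
  have "(0::real) \<le> 1" by simp
  then have "P 0 1"
  proof (induction rule: Bolzano)
    case (trans a b c)
    show ?case unfolding P_def
    proof
      assume ac: "0 \<le> a \<and> c \<le> 1"
      have "f (g a) \<in> W" "f (g b) \<in> W" "f (g c) \<in> W" using f gU ac trans(3,4) by (auto simp: image_subset_iff)
      then have "m (f (g c) - f (g a)) \<le> m (f (g c) - f (g b)) + m (f (g b) - f (g a))" by (intro Wadd)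
      also have "\<dots> \<le> (r + \<epsilon>) * ((c - b) * k) + (r + \<epsilon>) * ((b - a) * k)"
        using trans ac by (intro add_mono) (auto simp: P_def)
      finally show "m (f (g c) - f (g a)) \<le> (r + \<epsilon>) * ((c - a) * k)" by (simp add: algebra_simps)
    qed
  next
    case (local t)
    let ?z = "g t"
    have z: "?z \<in> U" by (rule gU) (use local in auto)
    have L: "bounded_linear_between V n W m (D ?z)" using deriv[OF z] by (simp add: has_frechet_derivative_in_def)
    obtain \<delta> where \<delta>: "\<delta> > 0" and est: "\<And>w. w \<in> U \<Longrightarrow> n (w - ?z) < \<delta> \<Longrightarrow> m (f w - f ?z - D ?z (w - ?z)) \<le> \<epsilon> * n (w - ?z)"
      using deriv[OF z] \<epsilon>(1) unfolding has_frechet_derivative_in_def by blast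
    have near: "m (f w - f ?z) \<le> (r + \<epsilon>) * n (w - ?z)" if w: "w \<in> U" "n (w - ?z) < \<delta>" for w
    proof -
      have wz: "w - ?z \<in> V" using U w z by (intro subspace_diff[OF V]) auto
      have DW: "D ?z (w - ?z) \<in> W" using L wz by (simp add: bounded_linear_between_def)
      have fW: "f w - f ?z \<in> W" using f w z by (intro subspace_diff[OF W]) auto
      have "m ((f w - f ?z - D ?z (w - ?z)) + D ?z (w - ?z)) \<le> m (f w - f ?z - D ?z (w - ?z)) + m (D ?z (w - ?z))"
        using m subspace_diff[OF W fW DW] DW unfolding is_norm_on_def by blast
      moreover have "m (D ?z (w - ?z)) \<le> r * n (w - ?z)"
        using op_norm_le[OF L wz] mult_right_mono[OF D[OF z] norm_on_nonneg[OF wz]] by linarith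
      ultimately show ?thesis using est[OF w] by (simp add: distrib_right)
    qed
    show ?case
    proof (intro exI[of _ "\<delta> / (k + 1)"] conjI allI impI)
      show "0 < \<delta> / (k + 1)" using \<delta> k by simp
      fix a b assume ab: "a \<le> t \<and> t \<le> b \<and> b - a < \<delta> / (k + 1)"
      have small: "s * k < \<delta>" if "0 \<le> s" "s \<le> b - a" for s
      proof -
        have "s * k \<le> s * (k + 1)" using that by (intro mult_left_mono) auto
        also have "\<dots> \<le> (b - a) * (k + 1)" using that k by (intro mult_right_mono) auto
        also have "\<dots> < \<delta>" using ab k by (simp add: field_simps)
        finally show ?thesis .
      qed
      show "P a b" unfolding P_def
      proof
        assume ab': "0 \<le> a \<and> b \<le> 1"
        have U': "g a \<in> U" "g b \<in> U" using ab ab' by (auto intro!: gU)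
        have W': "f (g a) \<in> W" "f (g b) \<in> W" "f ?z \<in> W" using f U' z by auto
        have na: "n (g a - ?z) = (t - a) * k" "n (g b - ?z) = (b - t) * k" using gdiff ab by (simp_all add: abs_if)
        have "m (f (g b) - f (g a)) \<le> m (f (g b) - f ?z) + m (f (g a) - f ?z)"
          using Wadd[OF W'(2,3,1)] Wsym[OF W'(3,1)] by simp
        also have "\<dots> \<le> (r + \<epsilon>) * ((b - t) * k) + (r + \<epsilon>) * ((t - a) * k)"
          using near[OF U'(2)] near[OF U'(1)] small[of "b - t"] small[of "t - a"] ab unfolding na
          by (intro add_mono) auto
        finally show "m (f (g b) - f (g a)) \<le> (r + \<epsilon>) * ((b - a) * k)" by (simp add: algebra_simps)
      qed
    qed
  qed
  then have "m (f x - f y) \<le> (r + \<epsilon>) * k" by (simp add: P_def g_def)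
  then show "m (f x - f y) \<le> r * n (x - y) + \<epsilon>'" using \<epsilon>(2) by (simp add: k_def distrib_right)
qed

end

end

section \<open>The coding map and the regularity of the geometric potential\<close>

locale contracting_system =
  fixes S :: "('v, 'e, 'y::real_vector) graph_system" and r c \<beta> :: real
  assumes multigraph: "wf_digraph (graph S)" "countable (arcs (graph S))" "arcs (graph S) \<noteq> {}" "strongly_connected (graph S)"
    and banach: "\<And>v. v \<in> verts (graph S) \<Longrightarrow> banach_space_on (Ysp S v) (Ynorm S v)"
    and J_nonempty: "\<And>v. v \<in> verts (graph S) \<Longrightarrow> Jset S v \<noteq> {}"
    and J_closed: "\<And>v. v \<in> verts (graph S) \<Longrightarrow> closedin (norm_topology (Ysp S v) (Ynorm S v)) (Jset S v)"
    and J_diam: "\<exists>D. \<forall>v\<in>verts (graph S). \<forall>x\<in>Jset S v. \<forall>y\<in>Jset S v. Ynorm S v (x - y) \<le> D"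
    and O_open: "\<And>v. v \<in> verts (graph S) \<Longrightarrow> openin (norm_topology (Ysp S v) (Ynorm S v)) (Oset S v)"
    and O_convex: "\<And>v. v \<in> verts (graph S) \<Longrightarrow> convex (Oset S v)"
    and J_O: "\<And>v. v \<in> verts (graph S) \<Longrightarrow> Jset S v \<subseteq> Oset S v"
    and T_O: "\<And>e. e \<in> arcs (graph S) \<Longrightarrow> Tmap S e ` Oset S (head (graph S) e) \<subseteq> Oset S (tail (graph S) e)"
    and T_C1: "\<And>e. e \<in> arcs (graph S) \<Longrightarrow>
      C1_map_between (Ysp S (head (graph S) e)) (Ynorm S (head (graph S) e))
        (Ysp S (tail (graph S) e)) (Ynorm S (tail (graph S) e)) (Oset S (head (graph S) e)) (Tmap S e)"
    and T_J: "\<And>e. e \<in> arcs (graph S) \<Longrightarrow> Tmap S e ` Jset S (head (graph S) e) \<subseteq> Jset S (tail (graph S) e)"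
    and r: "0 < r" "r < 1"
    and DT_le: "\<And>e x. e \<in> arcs (graph S) \<Longrightarrow> x \<in> Oset S (head (graph S) e) \<Longrightarrow> DTnorm S e x \<le> r"
    and c_pos: "0 < c" and \<beta>: "0 < \<beta>" "\<beta> \<le> 1"
    and DT_holder: "\<And>e x y. e \<in> arcs (graph S) \<Longrightarrow> x \<in> Jset S (head (graph S) e) \<Longrightarrow> y \<in> Jset S (head (graph S) e) \<Longrightarrow>
      \<bar>DTnorm S e x - DTnorm S e y\<bar> \<le> c * DTnorm S e x * Ynorm S (head (graph S) e) (x - y) powr \<beta>"
    and DT_pos: "\<And>e x. e \<in> arcs (graph S) \<Longrightarrow> x \<in> Jset S (head (graph S) e) \<Longrightarrow> 0 < DTnorm S e x"
begin

abbreviation G :: "('v, 'e) pre_digraph" where "G \<equiv> graph S"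

definition \<theta> :: real where "\<theta> = r powr \<beta>"

lemma \<theta>: "0 < \<theta>" "\<theta> < 1"
  using r \<beta> powr_less_mono2[of \<beta> r 1] by (simp_all add: \<theta>_def)

sublocale edge_shift G \<theta>
  by (intro edge_shift.intro multigraph \<theta>)

lemma verts: "e \<in> arcs G \<Longrightarrow> head G e \<in> verts G" "e \<in> arcs G \<Longrightarrow> tail G e \<in> verts G"
  using multigraph(1) by (simp_all add: wf_digraph.head_in_verts wf_digraph.tail_in_verts)

lemma Y: assumes "v \<in> verts G"
  shows "subspace (Ysp S v)" "is_norm_on (Ysp S v) (Ynorm S v)" "Metric_space.mcomplete (Ysp S v) (norm_dist (Ysp S v) (Ynorm S v))"
    "Oset S v \<subseteq> Ysp S v" "Jset S v \<subseteq> Ysp S v"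
proof -
  show b: "subspace (Ysp S v)" "is_norm_on (Ysp S v) (Ynorm S v)" "Metric_space.mcomplete (Ysp S v) (norm_dist (Ysp S v) (Ynorm S v))"
    using banach[OF assms] by (simp_all add: banach_space_on_def)
  interpret Metric_space "Ysp S v" "norm_dist (Ysp S v) (Ynorm S v)" by (rule Metric_space_norm[OF b(1,2)])
  show "Oset S v \<subseteq> Ysp S v" using openin_subset[OF O_open[OF assms]] by (simp add: norm_topology_def)
  then show "Jset S v \<subseteq> Ysp S v" using J_O[OF assms] by blast
qed

lemma T_contraction:
  assumes e: "e \<in> arcs G" and x: "x \<in> Oset S (head G e)" and y: "y \<in> Oset S (head G e)"
  shows "Ynorm S (tail G e) (Tmap S e x - Tmap S e y) \<le> r * Ynorm S (head G e) (x - y)"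
proof (rule mean_value_inequality)
  let ?u = "head G e" and ?v = "tail G e"
  show "has_frechet_derivative_in (Ysp S ?u) (Ynorm S ?u) (Ysp S ?v) (Ynorm S ?v) (Oset S ?u) (Tmap S e)
      (frechet_derivative_in (Ysp S ?u) (Ynorm S ?u) (Ysp S ?v) (Ynorm S ?v) (Oset S ?u) (Tmap S e) z) z"
    if z: "z \<in> Oset S ?u" for z
  proof -
    have "\<exists>L. has_frechet_derivative_in (Ysp S ?u) (Ynorm S ?u) (Ysp S ?v) (Ynorm S ?v) (Oset S ?u) (Tmap S e) L z"
      using T_C1[OF e] z by (simp add: C1_map_between_def)
    then show ?thesis unfolding frechet_derivative_in_def by (rule someI_ex)
  qed
  show "op_norm (Ysp S ?u) (Ynorm S ?u) (Ynorm S ?v)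
      (frechet_derivative_in (Ysp S ?u) (Ynorm S ?u) (Ysp S ?v) (Ynorm S ?v) (Oset S ?u) (Tmap S e) z) \<le> r"
    if z: "z \<in> Oset S ?u" for z
    using DT_le[OF e z] by (simp add: DTnorm_def Let_def)
  show "Tmap S e ` Oset S ?u \<subseteq> Ysp S ?v" using T_O[OF e] Y(4)[OF verts(2)[OF e]] by blast
qed (use Y verts e O_convex x y in auto)

text \<open>A common bound of the diameters, taken at least 1 so that it is positive even if all the
  sets are singletons.\<close>

definition diam :: real where
  "diam = (SOME D. 1 \<le> D \<and> (\<forall>v\<in>verts G. \<forall>x\<in>Jset S v. \<forall>y\<in>Jset S v. Ynorm S v (x - y) \<le> D))"

lemma diam: "1 \<le> diam" "v \<in> verts G \<Longrightarrow> x \<in> Jset S v \<Longrightarrow> y \<in> Jset S v \<Longrightarrow> Ynorm S v (x - y) \<le> diam"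
proof -
  obtain D where D: "\<forall>v\<in>verts G. \<forall>x\<in>Jset S v. \<forall>y\<in>Jset S v. Ynorm S v (x - y) \<le> D" using J_diam by blast
  have "\<exists>D\<ge>1. \<forall>v\<in>verts G. \<forall>x\<in>Jset S v. \<forall>y\<in>Jset S v. Ynorm S v (x - y) \<le> D"
    by (rule exI[of _ "max 1 D"]) (use D in \<open>force simp: le_max_iff_disj\<close>)
  from someI_ex[OF this] have "1 \<le> diam \<and> (\<forall>v\<in>verts G. \<forall>x\<in>Jset S v. \<forall>y\<in>Jset S v. Ynorm S v (x - y) \<le> diam)"
    unfolding diam_def .
  then show "1 \<le> diam" "v \<in> verts G \<Longrightarrow> x \<in> Jset S v \<Longrightarrow> y \<in> Jset S v \<Longrightarrow> Ynorm S v (x - y) \<le> diam" by auto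
qed

text \<open>The definition appends the innermost map; this recursion peels off the outermost one,
  which is what the shift removes.\<close>

lemma T_along_Suc: "T_along S \<omega> (Suc n) x = Tmap S (\<omega> 0) (T_along S (shift \<omega>) n x)"
  by (induction n arbitrary: x) (simp_all add: shift_def)

lemma T_along_cong: "agree (Suc n) \<omega> \<upsilon> \<Longrightarrow> T_along S \<omega> n = T_along S \<upsilon> n"
  by (induction n) (simp_all add: agree_def)

lemma head_tail: "\<omega> \<in> X \<Longrightarrow> head G (\<omega> n) = tail G (\<omega> (Suc n))"
  by (simp add: shift_space_def incident_def)

lemma T_along_contraction:
  assumes "\<omega> \<in> X" "x \<in> Jset S (head G (\<omega> n))" "y \<in> Jset S (head G (\<omega> n))"
  shows "T_along S \<omega> n x \<in> Jset S (tail G (\<omega> 0)) \<and>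
    Ynorm S (tail G (\<omega> 0)) (T_along S \<omega> n x - T_along S \<omega> n y) \<le> r ^ Suc n * Ynorm S (head G (\<omega> n)) (x - y)"
  using assms
proof (induction n arbitrary: x y)
  case 0
  have e: "\<omega> 0 \<in> arcs G" by (rule shift_space_nth[OF 0(1)])
  show ?case using T_contraction[OF e, of x y] T_J[OF e] J_O[OF verts(1)[OF e]] 0 by auto
next
  case (Suc n)
  let ?e = "\<omega> (Suc n)"
  have e: "?e \<in> arcs G" by (rule shift_space_nth[OF Suc.prems(1)])
  have J: "Tmap S ?e x \<in> Jset S (head G (\<omega> n))" "Tmap S ?e y \<in> Jset S (head G (\<omega> n))"
    using T_J[OF e] Suc.prems(2,3) head_tail[OF Suc.prems(1)] by auto
  have O: "x \<in> Oset S (head G ?e)" "y \<in> Oset S (head G ?e)" using J_O[OF verts(1)[OF e]] Suc.prems by auto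
  have "r ^ Suc n * Ynorm S (head G (\<omega> n)) (Tmap S ?e x - Tmap S ?e y) \<le> r ^ Suc n * (r * Ynorm S (head G ?e) (x - y))"
    using T_contraction[OF e O] r head_tail[OF Suc.prems(1)] by (intro mult_left_mono) auto
  then show ?case using Suc.IH[OF Suc.prems(1) J] by (simp add: mult_ac)
qed

lemma T_along_diam:
  assumes "\<omega> \<in> X" "x \<in> Jset S (head G (\<omega> n))" "y \<in> Jset S (head G (\<omega> n))"
  shows "Ynorm S (tail G (\<omega> 0)) (T_along S \<omega> n x - T_along S \<omega> n y) \<le> r ^ Suc n * diam"
proof -
  have "Ynorm S (head G (\<omega> n)) (x - y) \<le> diam"
    by (rule diam(2)[OF verts(1)[OF shift_space_nth[OF assms(1)]] assms(2,3)])
  then have "r ^ Suc n * Ynorm S (head G (\<omega> n)) (x - y) \<le> r ^ Suc n * diam"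
    using r by (intro mult_left_mono) auto
  then show ?thesis using T_along_contraction[OF assms] by linarith
qed

lemma T_along_add: "T_along S \<omega> (n + Suc k) x = T_along S \<omega> n (T_along S ((shift ^^ Suc n) \<omega>) k x)"
  by (induction k arbitrary: x) (simp_all add: funpow_shift shift_def add.commute)

definition base_point :: "'v \<Rightarrow> 'y" where "base_point v = (SOME x. x \<in> Jset S v)"

lemma base_point: "e \<in> arcs G \<Longrightarrow> base_point (head G e) \<in> Jset S (head G e)"
  unfolding base_point_def by (rule someI_ex) (use J_nonempty[OF verts(1)] in auto)

definition approximant :: "(nat \<Rightarrow> 'e) \<Rightarrow> nat \<Rightarrow> 'y" where
  "approximant \<omega> n = T_along S \<omega> n (base_point (head G (\<omega> n)))"

lemma limit_point_exists:
  assumes \<omega>: "\<omega> \<in> X"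
  shows "\<exists>z\<in>Jset S (tail G (\<omega> 0)). (\<lambda>n. Ynorm S (tail G (\<omega> 0)) (approximant \<omega> n - z)) \<longlonglongrightarrow> 0"
proof (rule complete_closed_limit[OF Y(1,2,3) J_closed])
  show v: "tail G (\<omega> 0) \<in> verts G" "tail G (\<omega> 0) \<in> verts G" "tail G (\<omega> 0) \<in> verts G" "tail G (\<omega> 0) \<in> verts G"
    using verts shift_space_nth[OF \<omega>] by auto
  have base: "base_point (head G (\<upsilon> n)) \<in> Jset S (head G (\<upsilon> n))" if "\<upsilon> \<in> X" for \<upsilon> n
    by (rule base_point[OF shift_space_nth[OF that]])
  show "approximant \<omega> k \<in> Jset S (tail G (\<omega> 0))" for k
    unfolding approximant_def using T_along_contraction[OF \<omega> base[OF \<omega>] base[OF \<omega>]] by blast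
  show "Ynorm S (tail G (\<omega> 0)) (approximant \<omega> k - approximant \<omega> (k + j)) \<le> r ^ Suc k * diam" for k j
  proof (cases j)
    case 0
    then show ?thesis using T_along_diam[OF \<omega> base[OF \<omega>] base[OF \<omega>], of k] by (simp add: approximant_def)
  next
    case (Suc i)
    let ?\<upsilon> = "(shift ^^ Suc k) \<omega>"
    have \<upsilon>: "?\<upsilon> \<in> X" by (rule funpow_shift_in[OF \<omega>])
    have eq: "approximant \<omega> (k + j) = T_along S \<omega> k (T_along S ?\<upsilon> i (base_point (head G (?\<upsilon> i))))"
      unfolding approximant_def Suc T_along_add by (simp add: funpow_shift shift_def add.commute)
    have "T_along S ?\<upsilon> i (base_point (head G (?\<upsilon> i))) \<in> Jset S (tail G (?\<upsilon> 0))"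
      using T_along_contraction[OF \<upsilon> base[OF \<upsilon>] base[OF \<upsilon>]] by blast
    moreover have "tail G (?\<upsilon> 0) = head G (\<omega> k)" using head_tail[OF \<omega>, of k] by (simp add: funpow_shift shift_def)
    ultimately show ?thesis
      unfolding eq approximant_def[of \<omega> k] by (intro T_along_diam[OF \<omega> base[OF \<omega>]]) simp
  qed
  show "(\<lambda>k. r ^ Suc k * diam) \<longlonglongrightarrow> 0"
    using tendsto_mult_left_zero[OF LIMSEQ_power_zero[of r, THEN LIMSEQ_Suc], of diam] r by simp
qed

text \<open>The sets in the definition of the coding map are images that need not be closed, so
  completeness does not place a point in their intersection directly. The point is taken as a limit
  in the closed set \<open>Jset\<close>, and its membership in all the images is derived from the
  functional equation \<open>limit_point_shift\<close>.\<close>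

definition limit_point :: "(nat \<Rightarrow> 'e) \<Rightarrow> 'y" where
  "limit_point \<omega> = (SOME z. z \<in> Jset S (tail G (\<omega> 0)) \<and> (\<lambda>n. Ynorm S (tail G (\<omega> 0)) (approximant \<omega> n - z)) \<longlonglongrightarrow> 0)"

lemma limit_point:
  assumes "\<omega> \<in> X"
  shows "limit_point \<omega> \<in> Jset S (tail G (\<omega> 0))"
    "(\<lambda>n. Ynorm S (tail G (\<omega> 0)) (approximant \<omega> n - limit_point \<omega>)) \<longlonglongrightarrow> 0"
proof -
  have "\<exists>z. z \<in> Jset S (tail G (\<omega> 0)) \<and> (\<lambda>n. Ynorm S (tail G (\<omega> 0)) (approximant \<omega> n - z)) \<longlonglongrightarrow> 0"
    using limit_point_exists[OF assms] by blast
  from someI_ex[OF this] show "limit_point \<omega> \<in> Jset S (tail G (\<omega> 0))"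
    "(\<lambda>n. Ynorm S (tail G (\<omega> 0)) (approximant \<omega> n - limit_point \<omega>)) \<longlonglongrightarrow> 0"
    unfolding limit_point_def by auto
qed

lemma approximant_in: "\<omega> \<in> X \<Longrightarrow> approximant \<omega> n \<in> Jset S (tail G (\<omega> 0))"
  unfolding approximant_def
  using T_along_contraction[of \<omega> _ n, OF _ base_point base_point] shift_space_nth by blast

text \<open>The first map is a contraction, hence continuous, and passes to the limit in the
  recursion of the approximants; both sides are limits of the same sequence.\<close>

lemma limit_point_shift:
  assumes \<omega>: "\<omega> \<in> X" shows "limit_point \<omega> = Tmap S (\<omega> 0) (limit_point (shift \<omega>))"
proof -
  let ?u = "head G (\<omega> 0)" and ?v = "tail G (\<omega> 0)"
  have e: "\<omega> 0 \<in> arcs G" by (rule shift_space_nth[OF \<omega>])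
  have sh: "tail G (shift \<omega> 0) = ?u" using head_tail[OF \<omega>, of 0] by (simp add: shift_def)
  note lu = limit_point[OF shift_in[OF \<omega>], unfolded sh] and au = approximant_in[OF shift_in[OF \<omega>], unfolded sh]
  note lv = limit_point[OF \<omega>] and av = approximant_in[OF \<omega>]
  let ?p = "Tmap S (\<omega> 0) (limit_point (shift \<omega>))"
  have p: "?p \<in> Jset S ?v" using T_J[OF e] lu(1) by blast
  have inY: "\<And>x. x \<in> Jset S ?v \<Longrightarrow> x \<in> Ysp S ?v" using Y(5)[OF verts(2)[OF e]] by blast
  have O: "\<And>x. x \<in> Jset S ?u \<Longrightarrow> x \<in> Oset S ?u" using J_O[OF verts(1)[OF e]] by blast
  note nv = Y(1,2)[OF verts(2)[OF e]]
  have app: "approximant \<omega> (Suc n) = Tmap S (\<omega> 0) (approximant (shift \<omega>) n)" for n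
    unfolding approximant_def T_along_Suc by (simp add: shift_def)
  have "Ynorm S ?v (?p - limit_point \<omega>) \<le> 0"
  proof (rule LIMSEQ_le_const)
    show "(\<lambda>n. r * Ynorm S ?u (approximant (shift \<omega>) n - limit_point (shift \<omega>)) + Ynorm S ?v (approximant \<omega> (Suc n) - limit_point \<omega>)) \<longlonglongrightarrow> 0"
      using tendsto_add[OF tendsto_mult_right_zero[OF lu(2), of r] LIMSEQ_Suc[OF lv(2)]] by simp
    have "Ynorm S ?v (?p - limit_point \<omega>) \<le> r * Ynorm S ?u (approximant (shift \<omega>) n - limit_point (shift \<omega>)) + Ynorm S ?v (approximant \<omega> (Suc n) - limit_point \<omega>)" for n
    proof -
      have "Ynorm S ?v (?p - limit_point \<omega>) \<le> Ynorm S ?v (?p - approximant \<omega> (Suc n)) + Ynorm S ?v (approximant \<omega> (Suc n) - limit_point \<omega>)"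
        by (rule norm_on_triangle[OF nv inY[OF p] inY[OF av] inY[OF lv(1)]])
      moreover have "Ynorm S ?v (?p - approximant \<omega> (Suc n)) \<le> r * Ynorm S ?u (approximant (shift \<omega>) n - limit_point (shift \<omega>))"
        using T_contraction[OF e O[OF au] O[OF lu(1)]] norm_on_minus[OF nv inY[OF p] inY[OF av], of "Suc n"]
        unfolding app by simp
      ultimately show ?thesis by linarith
    qed
    then show "\<exists>N. \<forall>n\<ge>N. Ynorm S ?v (?p - limit_point \<omega>) \<le> r * Ynorm S ?u (approximant (shift \<omega>) n - limit_point (shift \<omega>)) + Ynorm S ?v (approximant \<omega> (Suc n) - limit_point \<omega>)"
      by blast
  qed
  moreover have pl: "?p - limit_point \<omega> \<in> Ysp S ?v" by (rule subspace_diff[OF nv(1) inY[OF p] inY[OF lv(1)]])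
  ultimately have "Ynorm S ?v (?p - limit_point \<omega>) = 0" using norm_on_nonneg[OF nv pl] by simp
  then show ?thesis using norm_on_eq_0[OF nv pl] by simp
qed

lemma limit_point_T_along:
  "\<omega> \<in> X \<Longrightarrow> limit_point \<omega> = T_along S \<omega> n (limit_point ((shift ^^ Suc n) \<omega>))"
proof (induction n arbitrary: \<omega>)
  case 0
  then show ?case using limit_point_shift by simp
next
  case (Suc n)
  have "limit_point \<omega> = Tmap S (\<omega> 0) (limit_point (shift \<omega>))" by (rule limit_point_shift[OF Suc.prems])
  also have "limit_point (shift \<omega>) = T_along S (shift \<omega>) n (limit_point ((shift ^^ Suc n) (shift \<omega>)))"
    by (rule Suc.IH[OF shift_in[OF Suc.prems]])
  also have "(shift ^^ Suc n) (shift \<omega>) = (shift ^^ Suc (Suc n)) \<omega>" by (simp only: funpow_Suc_right comp_apply)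
  finally show ?case unfolding T_along_Suc by simp
qed

lemma limit_point_J: assumes "\<omega> \<in> X" shows "limit_point ((shift ^^ Suc n) \<omega>) \<in> Jset S (head G (\<omega> n))"
  using limit_point(1)[OF funpow_shift_in[OF assms, of "Suc n"]] head_tail[OF assms, of n] by (simp add: funpow_shift shift_def)

lemma coding_map_eq: assumes \<omega>: "\<omega> \<in> X" shows "coding_map S \<omega> = limit_point \<omega>"
proof -
  let ?A = "\<lambda>n. T_along S \<omega> n ` Jset S (head G (\<omega> n))" and ?v = "tail G (\<omega> 0)"
  have e: "\<omega> 0 \<in> arcs G" by (rule shift_space_nth[OF \<omega>])
  note nv = Y(1,2)[OF verts(2)[OF e]]
  have "limit_point \<omega> \<in> ?A n" for n
    using limit_point_T_along[OF \<omega>, of n] limit_point_J[OF \<omega>, of n] by (metis imageI)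
  moreover have "y = limit_point \<omega>" if y: "\<And>n. y \<in> ?A n" for y
  proof -
    have yJ: "y \<in> Jset S ?v" using y[of 0] T_J[OF e] by auto
    have d: "y - limit_point \<omega> \<in> Ysp S ?v"
      using Y(5)[OF verts(2)[OF e]] yJ limit_point(1)[OF \<omega>] by (intro subspace_diff[OF nv(1)]) auto
    have "Ynorm S ?v (y - limit_point \<omega>) \<le> 0"
    proof (rule LIMSEQ_le_const)
      show "(\<lambda>k. r ^ Suc k * diam) \<longlonglongrightarrow> 0"
        using tendsto_mult_left_zero[OF LIMSEQ_power_zero[of r, THEN LIMSEQ_Suc], of diam] r by simp
      have "Ynorm S ?v (y - limit_point \<omega>) \<le> r ^ Suc n * diam" for n
      proof -
        obtain x where x: "x \<in> Jset S (head G (\<omega> n))" "y = T_along S \<omega> n x" using y[of n] by blast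
        have "Ynorm S ?v (T_along S \<omega> n x - T_along S \<omega> n (limit_point ((shift ^^ Suc n) \<omega>))) \<le> r ^ Suc n * diam"
          by (rule T_along_diam[OF \<omega> x(1) limit_point_J[OF \<omega>]])
        then show ?thesis unfolding x(2) limit_point_T_along[OF \<omega>, of n, symmetric] .
      qed
      then show "\<exists>N. \<forall>n\<ge>N. Ynorm S ?v (y - limit_point \<omega>) \<le> r ^ Suc n * diam" by blast
    qed
    then have "Ynorm S ?v (y - limit_point \<omega>) = 0" using norm_on_nonneg[OF nv d] by simp
    then show ?thesis using norm_on_eq_0[OF nv d] by simp
  qed
  ultimately have "(\<Inter>n. ?A n) = {limit_point \<omega>}" by blast
  then show ?thesis by (simp add: coding_map_def)
qed

lemma coding_map_in: "\<omega> \<in> X \<Longrightarrow> coding_map S (shift \<omega>) \<in> Jset S (head G (\<omega> 0))"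
  using limit_point_J[of \<omega> 0] coding_map_eq[of "shift \<omega>"] by simp

lemma coding_map_dist:
  assumes \<omega>: "\<omega> \<in> X" and \<upsilon>: "\<upsilon> \<in> X" and ag: "agree (Suc n) \<omega> \<upsilon>"
  shows "Ynorm S (head G (\<omega> 0)) (coding_map S (shift \<omega>) - coding_map S (shift \<upsilon>)) \<le> r ^ n * diam"
proof (cases n)
  \<comment> \<open>Only the first letters are known to agree, so the shifted points need not share
    any letter and the diameter is the only bound.\<close>
  case 0
  have "\<upsilon> 0 = \<omega> 0" using ag by (simp add: agree_def)
  then show ?thesis
    using diam(2)[OF verts(1)[OF shift_space_nth[OF \<omega>, of 0]] coding_map_in[OF \<omega>]] coding_map_in[OF \<upsilon>] 0 by simp
next
  case (Suc m)
  let ?\<omega> = "shift \<omega>" and ?\<upsilon> = "shift \<upsilon>"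
  have X: "?\<omega> \<in> X" "?\<upsilon> \<in> X" using \<omega> \<upsilon> by simp_all
  have ag': "agree (Suc m) ?\<omega> ?\<upsilon>" using agree_shift[OF ag] Suc by simp
  have "?\<upsilon> m = ?\<omega> m" using ag' by (simp add: agree_def)
  then have J: "limit_point ((shift ^^ Suc m) ?\<upsilon>) \<in> Jset S (head G (?\<omega> m))" using limit_point_J[OF X(2), of m] by simp
  have "tail G (?\<omega> 0) = head G (\<omega> 0)" using head_tail[OF \<omega>, of 0] by (simp add: shift_def)
  then show ?thesis
    using T_along_diam[OF X(1) limit_point_J[OF X(1)] J]
    unfolding coding_map_eq[OF X(1)] coding_map_eq[OF X(2)] Suc
      limit_point_T_along[OF X(1), of m] limit_point_T_along[OF X(2), of m] T_along_cong[OF ag'] by simp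
qed

text \<open>The Hoelder condition is relative to the size of the derivative. Used in both directions
  it bounds both quotients of the derivative norms by 1 + q, and ln (1 + q) <= q. Distances of order
  r^n enter with the power \<beta>, which is the origin of \<theta> = r^\<beta>.\<close>

lemma log_derivative_lipschitz:
  assumes \<omega>: "\<omega> \<in> X" and \<upsilon>: "\<upsilon> \<in> X" and ag: "agree (Suc n) \<omega> \<upsilon>"
  shows "\<bar>log_derivative S \<omega> - log_derivative S \<upsilon>\<bar> \<le> c * diam powr \<beta> * \<theta> ^ n"
proof -
  let ?x = "coding_map S (shift \<omega>)" and ?y = "coding_map S (shift \<upsilon>)" and ?e = "\<omega> 0"
  have e: "?e \<in> arcs G" by (rule shift_space_nth[OF \<omega>])
  have \<upsilon>0: "\<upsilon> 0 = ?e" using ag by (simp add: agree_def)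
  have x: "?x \<in> Jset S (head G ?e)" and y: "?y \<in> Jset S (head G ?e)"
    using coding_map_in[OF \<omega>] coding_map_in[OF \<upsilon>] \<upsilon>0 by auto
  let ?a = "DTnorm S ?e ?x" and ?b = "DTnorm S ?e ?y" and ?d = "Ynorm S (head G ?e) (?x - ?y)"
  have pos: "0 < ?a" "0 < ?b" by (rule DT_pos[OF e x], rule DT_pos[OF e y])
  note ny = Y(1,2)[OF verts(1)[OF e]]
  have Yx: "?x \<in> Ysp S (head G ?e)" and Yy: "?y \<in> Ysp S (head G ?e)" using Y(5)[OF verts(1)[OF e]] x y by auto
  have d0: "0 \<le> ?d" by (rule norm_on_nonneg[OF ny subspace_diff[OF ny(1) Yx Yy]])
  have "?d powr \<beta> \<le> (r ^ n * diam) powr \<beta>"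
    using coding_map_dist[OF \<omega> \<upsilon> ag] d0 \<beta> by (intro powr_mono2) auto
  also have "\<dots> = diam powr \<beta> * \<theta> ^ n"
    using r diam(1) by (simp add: powr_mult \<theta>_def powr_power powr_realpow[symmetric] powr_powr mult.commute)
  finally have dd: "c * ?d powr \<beta> \<le> c * diam powr \<beta> * \<theta> ^ n" using c_pos by (simp add: mult.assoc)
  have "\<bar>?a - ?b\<bar> \<le> c * ?a * ?d powr \<beta>" by (rule DT_holder[OF e x y])
  then have b1: "?b \<le> ?a * (1 + c * ?d powr \<beta>)" by (simp add: algebra_simps)
  have "\<bar>?b - ?a\<bar> \<le> c * ?b * ?d powr \<beta>"
    using DT_holder[OF e y x] norm_on_minus[OF ny Yx Yy] by simp
  then have b2: "?a \<le> ?b * (1 + c * ?d powr \<beta>)" by (simp add: algebra_simps)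
  have q: "0 \<le> c * ?d powr \<beta>" using c_pos by simp
  have ln: "ln u \<le> ln w + c * ?d powr \<beta>" if "u \<le> w * (1 + c * ?d powr \<beta>)" "0 < u" "0 < w" for u w
  proof -
    have "ln u \<le> ln (w * (1 + c * ?d powr \<beta>))" using that q by (intro ln_mono) auto
    also have "\<dots> = ln w + ln (1 + c * ?d powr \<beta>)" using that q by (intro ln_mult_pos) auto
    also have "ln (1 + c * ?d powr \<beta>) \<le> c * ?d powr \<beta>" by (rule ln_add_one_self_le_self[OF q])
    finally show ?thesis by simp
  qed
  have "\<bar>ln ?a - ln ?b\<bar> \<le> c * ?d powr \<beta>" using ln[OF b1 pos(2,1)] ln[OF b2 pos] by linarith
  then show ?thesis using dd unfolding log_derivative_def \<upsilon>0 by linarith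
qed

lemma summable_exponent_below:
  assumes "summable_exponents S \<noteq> {}" "Inf (summable_exponents S) < s"
  shows "\<exists>t\<in>summable_exponents S. t < s" "0 < s"
proof -
  show "\<exists>t\<in>summable_exponents S. t < s" using cInf_lessD[OF assms] .
  have "0 \<le> Inf (summable_exponents S)" by (rule cInf_greatest[OF assms(1)]) (simp add: summable_exponents_def)
  then show "0 < s" using assms(2) by linarith
qed

lemma DT_powr_le_1: "e \<in> arcs G \<Longrightarrow> 0 \<le> t \<Longrightarrow> x \<in> Jset S (head G e) \<Longrightarrow> DTnorm S e x powr t \<le> 1"
proof -
  assume *: "e \<in> arcs G" "0 \<le> t" "x \<in> Jset S (head G e)"
  have "DTnorm S e x \<le> 1" using DT_le[OF *(1), of x] J_O[OF verts(1)[OF *(1)]] *(3) r by force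
  then have "DTnorm S e x powr t \<le> 1 powr t" using DT_pos[OF *(1,3)] *(2) by (intro powr_mono2) auto
  then show ?thesis by simp
qed

text \<open>As \<open>s\<close> exceeds the infimum, some exponent \<open>t < s\<close> already has
  a finite sum. Derivative norms are at most 1, so their power \<open>s\<close> is below their power
  \<open>t\<close>, and the majorant \<open>B\<close> is taken at \<open>t\<close>.\<close>

theorem log_derivative_potential:
  assumes "summable_exponents S \<noteq> {}" "Inf (summable_exponents S) < s"
  shows "\<exists>B K. potential G \<theta> (\<lambda>\<omega>. s * log_derivative S \<omega>) B K"
proof -
  obtain t where t: "t \<in> summable_exponents S" "t < s" using summable_exponent_below(1)[OF assms] by blast
  note s = summable_exponent_below(2)[OF assms]
  define B where "B e = (SUP x\<in>Jset S (head G e). DTnorm S e x powr t)" for e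
  have t0: "0 \<le> t" and B_sum: "B summable_on arcs G" using t(1) unfolding summable_exponents_def B_def by blast+
  \<comment> \<open>The division by \<theta> makes up for the letter lost to the shift: agreement on
    \<open>Suc m\<close> letters gives only \<open>\<theta> ^ m\<close>.\<close>
  define K where "K = s * (c * diam powr \<beta>) / \<theta>"
  have "potential G \<theta> (\<lambda>\<omega>. s * log_derivative S \<omega>) B K"
  proof
    show "0 \<le> K" using s c_pos \<theta> by (simp add: K_def)
    show "\<bar>s * log_derivative S \<omega> - s * log_derivative S \<upsilon>\<bar> \<le> K * \<theta> ^ n"
      if *: "\<omega> \<in> X" "\<upsilon> \<in> X" "1 \<le> n" "agree n \<omega> \<upsilon>" for \<omega> \<upsilon> n
    proof -
      obtain m where m: "n = Suc m" using *(3) by (cases n) auto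
      have "s * \<bar>log_derivative S \<omega> - log_derivative S \<upsilon>\<bar> \<le> s * (c * diam powr \<beta> * \<theta> ^ m)"
        using log_derivative_lipschitz[OF *(1,2) *(4)[unfolded m]] s by (intro mult_left_mono) auto
      also have "\<dots> = K * \<theta> ^ n" using \<theta>(1) by (simp add: K_def m)
      finally show ?thesis using s by (simp add: right_diff_distrib[symmetric] abs_mult)
    qed
    show "exp (s * log_derivative S \<omega>) \<le> B (\<omega> 0)" if \<omega>: "\<omega> \<in> X" for \<omega>
    proof -
      let ?x = "coding_map S (shift \<omega>)" and ?e = "\<omega> 0"
      have e: "?e \<in> arcs G" by (rule shift_space_nth[OF \<omega>])
      note x = coding_map_in[OF \<omega>]
      have a: "0 < DTnorm S ?e ?x" by (rule DT_pos[OF e x])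
      have a1: "DTnorm S ?e ?x \<le> 1" using DT_le[OF e, of ?x] J_O[OF verts(1)[OF e]] x r by force
      have "exp (s * log_derivative S \<omega>) = DTnorm S ?e ?x powr s" using a by (simp add: log_derivative_def powr_def)
      also have "\<dots> \<le> DTnorm S ?e ?x powr t" by (rule powr_mono') (use a a1 t in auto)
      also have "\<dots> \<le> B ?e" unfolding B_def
        by (rule cSUP_upper[OF x]) (use DT_powr_le_1[OF e t0] in \<open>auto intro!: bdd_aboveI2\<close>)
      finally show ?thesis .
    qed
  qed (rule B_sum)
  then show ?thesis by blast
qed

end

theorem theorem6p4:
  fixes S :: "('v, 'e, 'y::real_vector) graph_system"
    and r c \<beta> s :: real
  defines "G \<equiv> graph S"
  assumes multigraph: "wf_digraph G" "countable (verts G)" "countable (arcs G)" "arcs G \<noteq> {}"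
    and G1: "strongly_connected G"
    and G2: "\<And>v. v \<in> verts G \<Longrightarrow> banach_space_on (Ysp S v) (Ynorm S v)"
      "\<And>v. v \<in> verts G \<Longrightarrow> Jset S v \<noteq> {}"
      "\<And>v. v \<in> verts G \<Longrightarrow> closedin (norm_topology (Ysp S v) (Ynorm S v)) (Jset S v)"
      "\<exists>D. \<forall>v\<in>verts G. \<forall>x\<in>Jset S v. \<forall>y\<in>Jset S v. Ynorm S v (x - y) \<le> D"
    and G3: "\<And>v. v \<in> verts G \<Longrightarrow> openin (norm_topology (Ysp S v) (Ynorm S v)) (Oset S v)"
      "\<And>v. v \<in> verts G \<Longrightarrow> convex (Oset S v)"
      "\<And>v. v \<in> verts G \<Longrightarrow> Jset S v \<subseteq> Oset S v"
    and G4_maps: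
      "\<And>e. e \<in> arcs G \<Longrightarrow> Tmap S e ` Oset S (head G e) \<subseteq> Oset S (tail G e)"
      "\<And>e. e \<in> arcs G \<Longrightarrow>
         C1_map_between (Ysp S (head G e)) (Ynorm S (head G e))
                        (Ysp S (tail G e)) (Ynorm S (tail G e)) (Oset S (head G e)) (Tmap S e)"
      "\<And>e. e \<in> arcs G \<Longrightarrow> Tmap S e ` Jset S (head G e) \<subseteq> Jset S (tail G e)"
    and G4_contraction: "0 < r" "r < 1"
      "\<And>e x. e \<in> arcs G \<Longrightarrow> x \<in> Oset S (head G e) \<Longrightarrow> DTnorm S e x \<le> r"
    and G4_holder: "0 < c" "0 < \<beta>" "\<beta> \<le> 1"
      "\<And>e x y. e \<in> arcs G \<Longrightarrow> x \<in> Jset S (head G e) \<Longrightarrow> y \<in> Jset S (head G e) \<Longrightarrow>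
         \<bar>DTnorm S e x - DTnorm S e y\<bar>
           \<le> c * DTnorm S e x * Ynorm S (head G e) (x - y) powr \<beta>"
    and derivative_nonzero:
      "\<And>e x. e \<in> arcs G \<Longrightarrow> x \<in> Jset S (head G e) \<Longrightarrow> 0 < DTnorm S e x"
    and G5: "summable_exponents S \<noteq> {}"
    and s: "s > Inf (summable_exponents S)"
  shows
    "let \<theta> = r powr \<beta>;
         \<psi> = (\<lambda>\<omega>. s * log_derivative S \<omega>);
         L = ruelle_operator G \<psi>;
         F = holder_space G \<theta>;
         N = holder_norm G \<theta>;
         C = bounded_continuous G \<theta>;
         p = period G;
         \<kappa> = exp (2 * of_real pi * \<i> / of_nat p)
     in bounded_operator F N L \<and>
        (\<exists>P \<nu> h. has_pressure G \<psi> P \<and>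
          (let lam = exp P; lami = (\<lambda>i. of_real lam * \<kappa> ^ i)
           in operator_spectral_radius F N L = lam \<and>
              prob_space \<nu> \<and> space \<nu> = shift_space G \<and> sets \<nu> = sets (shift_borel G \<theta>) \<and>
              (\<forall>f\<in>C. integral\<^sup>L \<nu> (L f) = of_real lam * integral\<^sup>L \<nu> f) \<and>
              h \<in> F \<and> (\<forall>\<omega>. h \<omega> \<in> \<real>\<^sub>\<ge>\<^sub>0) \<and> L h = (\<lambda>\<omega>. of_real lam * h \<omega>) \<and>
              integral\<^sup>L \<nu> h = 1 \<and>
              (\<exists>Es. cyclic_decomposition G \<theta> Es) \<and>
              (\<forall>Es. cyclic_decomposition G \<theta> Es \<longrightarrow>
                (let \<Sigma> = (\<lambda>j. edge_union G (Es j));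
                     hi = rotated_eigenfunction p \<kappa> \<Sigma> h;
                     nui = rotated_measure p \<kappa> \<Sigma> \<nu>;
                     Pr = (\<lambda>i. hi i \<otimes>\<^sub>o nui i)
                 in (\<forall>i<p. simple_eigenvalue F L (lami i) \<and>
                            eigenfunction F L (lami i) (hi i) \<and>
                            dual_eigenvector C L (lami i) (nui i) \<and>
                            is_projection F N (Pr i)) \<and>
                    (\<forall>i<p. \<forall>k<p. i \<noteq> k \<longrightarrow> (\<forall>f\<in>F. Pr i (Pr k f) = (\<lambda>_. 0))) \<and>
                    (\<exists>R. bounded_operator F N R \<and>
                         (\<forall>f\<in>F. L f = (\<lambda>\<omega>. (\<Sum>i<p. lami i * Pr i f \<omega>) + R f \<omega>)) \<and>
                         (\<forall>i<p. \<forall>f\<in>F. Pr i (R f) = (\<lambda>_. 0) \<and> R (Pr i f) = (\<lambda>_. 0)) \<and>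
                         operator_spectral_radius F N R < lam)))))"
proof -
  have system: "contracting_system S r c \<beta>"
    by (intro contracting_system.intro; use multigraph G1 G2 G3 G4_maps G4_contraction G4_holder derivative_nonzero in \<open>unfold G_def\<close>)
  obtain B K where "potential G (r powr \<beta>) (\<lambda>\<omega>. s * log_derivative S \<omega>) B K"
    using contracting_system.log_derivative_potential[OF system G5 s] unfolding contracting_system.\<theta>_def[OF system] G_def by blast
  then interpret potential G "r powr \<beta>" "\<lambda>\<omega>. s * log_derivative S \<omega>" B K .
  obtain h where h: "cone h" "bounded_by G h 1" "\<And>\<omega>. \<omega> \<in> X \<Longrightarrow> L h \<omega> = lam * h \<omega>" "\<And>\<omega>. \<omega> \<in> X \<Longrightarrow> 0 < h \<omega>"
    using eigenfunction_exists by blast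
  obtain \<nu> where \<nu>: "eigenmeasure \<nu> lam" using eigenmeasure_exists by blast
  define hc where "hc = (\<lambda>\<omega>. if \<omega> \<in> X then complex_of_real (h \<omega> / integral\<^sup>L \<nu> h) else 0)"
  \<comment> \<open>The eigenvalue is written \<open>exp (ln lam)\<close> to match
    \<open>exp P\<close> with the pressure \<open>P = ln lam\<close>.\<close>
  have "\<exists>\<rho> K. cyclic_spectrum G (r powr \<beta>) A (exp (ln lam)) \<rho> K hc \<nu> (period G) Es"
    if Es: "cyclic_decomposition G (r powr \<beta>) Es" for Es
  proof -
    have cover: "(\<Union>i<period G. Es i) = arcs G" using Es by (simp add: cyclic_decomposition_def)
    have "\<exists>\<rho> K. cyclic_spectrum G (r powr \<beta>) A lam \<rho> K hc \<nu> (period G) Es"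
      unfolding hc_def
    proof (rule cyclic_spectrum_exists[OF h \<nu> period_pos cover])
      fix i j assume "i < period G" "j < period G" "i \<noteq> j"
      then show "Es i \<inter> Es j = {}" by (rule cyclic_decomposition_disjoint[OF Es])
    next
      fix \<omega> i assume "\<omega> \<in> X" "i < period G" "\<omega> 0 \<in> Es i"
      then show "\<omega> 1 \<in> Es (Suc i mod period G)" by (intro cyclic_decomposition_step[OF Es])
    next
      fix \<omega> \<upsilon> i n assume "\<omega> \<in> X" "\<upsilon> \<in> X" "i < period G" "\<omega> 0 \<in> Es i" "\<upsilon> 0 \<in> Es i"
      then show "\<exists>k \<eta> \<zeta>. \<eta> \<in> X \<and> \<zeta> \<in> X \<and> agree n \<omega> \<eta> \<and> agree n \<upsilon> \<zeta> \<and> (shift ^^ k) \<eta> = (shift ^^ k) \<zeta>"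
        by (intro cyclic_decomposition_common_future[OF Es])
    qed
    then show ?thesis using lam_pos by simp
  qed
  moreover have "hc \<omega> \<in> \<real>\<^sub>\<ge>\<^sub>0" for \<omega>
    using less_imp_le[OF h(4)] eigenfunction_integral_pos[OF h(1,2,4) \<nu>] by (simp add: hc_def)
  ultimately have h0: "\<And>\<omega>. hc \<omega> \<in> \<real>\<^sub>\<ge>\<^sub>0"
    and spec: "\<And>Es. cyclic_decomposition G (r powr \<beta>) Es \<Longrightarrow> \<exists>\<rho> K. cyclic_spectrum G (r powr \<beta>) A (exp (ln lam)) \<rho> K hc \<nu> (period G) Es"
    by simp_all
  \<comment> \<open>One decomposition is fixed to read off what does not refer to any, such as the
    spectral radius. \<open>\<nu>\<close> and \<open>h\<close> were chosen before it, so the last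
    clause can be proved for every decomposition with the same pair.\<close>
  obtain Es where Es: "cyclic_decomposition G (r powr \<beta>) Es" using cyclic_decomposition_exists by blast
  obtain \<rho> K' where "cyclic_spectrum G (r powr \<beta>) A (exp (ln lam)) \<rho> K' hc \<nu> (period G) Es" using spec[OF Es] by blast
  then interpret C: cyclic_spectrum G "r powr \<beta>" A "exp (ln lam)" \<rho> K' hc \<nu> "period G" Es .
  show ?thesis
    unfolding Let_def
  proof (intro exI[of _ "ln lam"] exI[of _ \<nu>] exI[of _ hc] conjI exI[where P = "cyclic_decomposition G (r powr \<beta>)", OF Es]
      C.A_bounded pressure[OF h \<nu>] C.spectral_radius_A C.\<nu>_prob space_eigenmeasure[OF \<nu>] C.\<nu>_sets ballI C.\<nu>_eig
      C.h_FH allI[OF h0] C.h_eig C.h_int, goal_cases)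
    case 4
    show ?case (is "\<forall>Es. _ \<longrightarrow> ?R Es")
    proof (intro allI impI)
      fix Es assume "cyclic_decomposition G (r powr \<beta>) Es"
      from spec[OF this] obtain \<rho> K' where "cyclic_spectrum G (r powr \<beta>) A (exp (ln lam)) \<rho> K' hc \<nu> (period G) Es" by blast
      from cyclic_spectrum.spectral_decomposition_explicit[OF this, unfolded Let_def]
      show "?R Es" .
    qed
  qed
qed

end
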